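(* Let $\mathbb{M}$ be a monster model of a complete $C$-minimal expansion of ACVF whose language contains a constant symbol $t$ with $v(t)>0$. Suppose $\mathbb{M}$ is definably complete, $\mathbb{M}$ has characteristic $0$, and either $k^\times$ has no exotic automorphisms or $\Gamma$ has no exotic automorphisms. Let $X$ be a punctured neighborhood of $0$ and $f:X\to\mathbb{M}$ a definable function. Then there are integers $m_1<m_2<\cdots$ and elements $c_1,c_2,\ldots\in\mathbb{M}$ such that for each $\ell$, $$\lim_{x\to 0}\frac{f(x)-\sum_{n=1}^{\ell}c_nx^{m_n}}{x^{m_\ell}}=0.$$
   Context: ACVF is the theory of algebraically closed non-trivially valued fields; $C$-minimal means that in every model every definable subset of the home sort is a finite boolean combination of balls and points. "Definable" means with parameters. $v$ is the valuation, $\Gamma$ the value group, $k$ the residue field. $\mathbb{M}$ is definably complete if every definable chain of balls whose radii approach $+\infty$ has non-empty intersection. "$k^\times$ has no exotic automorphisms": every definable automorphism of the multiplicative group $k^\times$ is definable in the pure ring language on $k$. "$\Gamma$ has no exotic automorphisms": the only definable automorphisms of $(\Gamma,+,\le)$ are multiplication by positive rationals. A punctured neighborhood of $0$ is a set of the form $U\setminus\{0\}$ with $U$ an open set containing $0$. *)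

theory Defs
  imports "HOL-Analysis.Abstract_Limits" "HOL-Algebra.Algebraic_Closure"
begin

unbundle cardinal_syntax

section \<open>First-order logic\<close>

text \<open>A language assigns arities to its symbols; \<open>None\<close> means that the symbol is not in the
  language, so the set of symbols may be any subset of the symbol type.\<close>

record ('f, 'r) language =
  fun_ar :: "'f \<Rightarrow> nat option"
  rel_ar :: "'r \<Rightarrow> nat option"

datatype 'f fo_term = Var nat | App 'f "'f fo_term list"

datatype ('f, 'r) fo_form =
    Equal "'f fo_term" "'f fo_term"
  | Atom 'r "'f fo_term list"
  | Falsum
  | Imp "('f, 'r) fo_form" "('f, 'r) fo_form"
  | Forall nat "('f, 'r) fo_form"

record ('f, 'r, 'a) fo_structure =
  univ :: "'a set"
  fun_int :: "'f \<Rightarrow> 'a list \<Rightarrow> 'a"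
  rel_int :: "'r \<Rightarrow> 'a list \<Rightarrow> bool"

primrec wf_term :: "('f, 'r) language \<Rightarrow> 'f fo_term \<Rightarrow> bool" where
  "wf_term L (Var i) = True"
| "wf_term L (App g ts) = (fun_ar L g = Some (length ts) \<and> list_all id (map (wf_term L) ts))"

primrec wf_form :: "('f, 'r) language \<Rightarrow> ('f, 'r) fo_form \<Rightarrow> bool" where
  "wf_form L (Equal s t) = (wf_term L s \<and> wf_term L t)"
| "wf_form L (Atom R ts) = (rel_ar L R = Some (length ts) \<and> (\<forall>s\<in>set ts. wf_term L s))"
| "wf_form L Falsum = True"
| "wf_form L (Imp p q) = (wf_form L p \<and> wf_form L q)"
| "wf_form L (Forall i p) = wf_form L p"

primrec term_vars :: "'f fo_term \<Rightarrow> nat set" where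
  "term_vars (Var i) = {i}"
| "term_vars (App g ts) = \<Union>(set (map term_vars ts))"

primrec free_vars :: "('f, 'r) fo_form \<Rightarrow> nat set" where
  "free_vars (Equal s t) = term_vars s \<union> term_vars t"
| "free_vars (Atom R ts) = (\<Union>s\<in>set ts. term_vars s)"
| "free_vars Falsum = {}"
| "free_vars (Imp p q) = free_vars p \<union> free_vars q"
| "free_vars (Forall i p) = free_vars p - {i}"

primrec eval_term :: "('f, 'r, 'a) fo_structure \<Rightarrow> (nat \<Rightarrow> 'a) \<Rightarrow> 'f fo_term \<Rightarrow> 'a" where
  "eval_term N e (Var i) = e i"
| "eval_term N e (App g ts) = fun_int N g (map (eval_term N e) ts)"

primrec sat :: "('f, 'r, 'a) fo_structure \<Rightarrow> ('f, 'r) fo_form \<Rightarrow> (nat \<Rightarrow> 'a) \<Rightarrow> bool" where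
  "sat N (Equal s t) = (\<lambda>e. eval_term N e s = eval_term N e t)"
| "sat N (Atom R ts) = (\<lambda>e. rel_int N R (map (eval_term N e) ts))"
| "sat N Falsum = (\<lambda>e. False)"
| "sat N (Imp p q) = (\<lambda>e. sat N p e \<longrightarrow> sat N q e)"
| "sat N (Forall i p) = (\<lambda>e. \<forall>a\<in>univ N. sat N p (e(i := a)))"

definition is_structure :: "('f, 'r) language \<Rightarrow> ('f, 'r, 'a) fo_structure \<Rightarrow> bool" where
  "is_structure L N \<longleftrightarrow> univ N \<noteq> {} \<and>
     (\<forall>g xs. fun_ar L g = Some (length xs) \<and> set xs \<subseteq> univ N \<longrightarrow> fun_int N g xs \<in> univ N)"

definition sentence :: "('f, 'r) language \<Rightarrow> ('f, 'r) fo_form \<Rightarrow> bool" where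
  "sentence L p \<longleftrightarrow> wf_form L p \<and> free_vars p = {}"

definition true_in :: "('f, 'r, 'a) fo_structure \<Rightarrow> ('f, 'r) fo_form \<Rightarrow> bool" where
  "true_in N p \<longleftrightarrow> (\<forall>e. range e \<subseteq> univ N \<longrightarrow> sat N p e)"

definition is_model ::
  "('f, 'r) language \<Rightarrow> ('f, 'r) fo_form set \<Rightarrow> ('f, 'r, 'a) fo_structure \<Rightarrow> bool" where
  "is_model L T N \<longleftrightarrow> is_structure L N \<and> (\<forall>p\<in>T. true_in N p)"

text \<open>HOL cannot quantify over models of all types at once. The type argument below fixes the type
  in which the carriers of models live. Below it is always the type of the elements of a
  monster model, which has more than \<open>|L| + \<aleph>\<^sub>0\<close> elements; so by Loewenheim-Skolem nothing is lost
  by considering only these models.\<close>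

definition complete_theory ::
  "'a itself \<Rightarrow> ('f, 'r) language \<Rightarrow> ('f, 'r) fo_form set \<Rightarrow> bool" where
  "complete_theory ty L T \<longleftrightarrow>
     (\<forall>p\<in>T. sentence L p) \<and>
     (\<exists>N :: ('f, 'r, 'a) fo_structure. is_model L T N) \<and>
     (\<forall>p. sentence L p \<longrightarrow>
        (\<forall>N :: ('f, 'r, 'a) fo_structure. is_model L T N \<longrightarrow> true_in N p) \<or>
        (\<forall>N :: ('f, 'r, 'a) fo_structure. is_model L T N \<longrightarrow> true_in N (Imp p Falsum)))"

text \<open>\<open>with_params xs e\<close> assigns the tuple \<open>xs\<close> to the first variables; the remaining variables are
  parameter slots, filled by \<open>e\<close>.\<close>

definition with_params :: "'a list \<Rightarrow> (nat \<Rightarrow> 'a) \<Rightarrow> nat \<Rightarrow> 'a" where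
  "with_params xs e = (\<lambda>i. if i < length xs then xs ! i else e i)"

definition definable ::
  "('f, 'r) language \<Rightarrow> ('f, 'r, 'a) fo_structure \<Rightarrow> nat \<Rightarrow> 'a list set \<Rightarrow> bool" where
  "definable L N n S \<longleftrightarrow> (\<exists>p e. wf_form L p \<and> range e \<subseteq> univ N \<and>
     S = {xs. length xs = n \<and> set xs \<subseteq> univ N \<and> sat N p (with_params xs e)})"

definition definable_family ::
  "('f, 'r) language \<Rightarrow> ('f, 'r, 'a) fo_structure \<Rightarrow> 'a set set \<Rightarrow> bool" where
  "definable_family L N F \<longleftrightarrow> (\<exists>n S D. definable L N n S \<and> definable L N (Suc n) D \<and>
     F = (\<lambda>s. {x. x # s \<in> D}) ` S)"

subsection \<open>Monster models\<close>

text \<open>In a partial type, each formula comes with its own assignment of parameters from \<open>A\<close>.\<close>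

definition saturated ::
  "'k rel \<Rightarrow> ('f, 'r) language \<Rightarrow> ('f, 'r, 'a) fo_structure \<Rightarrow> bool" where
  "saturated \<kappa> L N \<longleftrightarrow> (\<forall>A n. \<forall>P :: (('f, 'r) fo_form \<times> (nat \<Rightarrow> 'a)) set.
     A \<subseteq> univ N \<and> |A| <o \<kappa> \<and>
     (\<forall>(p, e)\<in>P. wf_form L p \<and> (\<forall>i\<in>free_vars p - {..<n}. e i \<in> A)) \<and>
     (\<forall>P0. P0 \<subseteq> P \<and> finite P0 \<longrightarrow>
        (\<exists>xs. length xs = n \<and> set xs \<subseteq> univ N \<and> (\<forall>(p, e)\<in>P0. sat N p (with_params xs e)))) \<longrightarrow>
     (\<exists>xs. length xs = n \<and> set xs \<subseteq> univ N \<and> (\<forall>(p, e)\<in>P. sat N p (with_params xs e))))"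

definition partial_elementary ::
  "('f, 'r) language \<Rightarrow> ('f, 'r, 'a) fo_structure \<Rightarrow> 'a set \<Rightarrow> ('a \<Rightarrow> 'a) \<Rightarrow> bool" where
  "partial_elementary L N A h \<longleftrightarrow> h ` A \<subseteq> univ N \<and>
     (\<forall>p e. wf_form L p \<and> (\<forall>i\<in>free_vars p. e i \<in> A) \<longrightarrow> sat N p e = sat N p (h \<circ> e))"

definition automorphism ::
  "('f, 'r) language \<Rightarrow> ('f, 'r, 'a) fo_structure \<Rightarrow> ('a \<Rightarrow> 'a) \<Rightarrow> bool" where
  "automorphism L N \<sigma> \<longleftrightarrow> bij_betw \<sigma> (univ N) (univ N) \<and>
     (\<forall>g xs. fun_ar L g = Some (length xs) \<and> set xs \<subseteq> univ N \<longrightarrow>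
        \<sigma> (fun_int N g xs) = fun_int N g (map \<sigma> xs)) \<and>
     (\<forall>R xs. rel_ar L R = Some (length xs) \<and> set xs \<subseteq> univ N \<longrightarrow>
        rel_int N R xs = rel_int N R (map \<sigma> xs))"

definition strongly_homogeneous ::
  "'k rel \<Rightarrow> ('f, 'r) language \<Rightarrow> ('f, 'r, 'a) fo_structure \<Rightarrow> bool" where
  "strongly_homogeneous \<kappa> L N \<longleftrightarrow>
     (\<forall>A h. A \<subseteq> univ N \<and> |A| <o \<kappa> \<and> partial_elementary L N A h \<longrightarrow>
        (\<exists>\<sigma>. automorphism L N \<sigma> \<and> (\<forall>x\<in>A. \<sigma> x = h x)))"

text \<open>There are \<open>|L| + \<aleph>\<^sub>0\<close> formulas, so \<open>\<kappa> > |L| + \<aleph>\<^sub>0\<close>.\<close>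

definition monster_model :: "'k rel \<Rightarrow> ('f, 'r) language \<Rightarrow> ('f, 'r) fo_form set \<Rightarrow>
    ('f, 'r, 'a) fo_structure \<Rightarrow> bool" where
  "monster_model \<kappa> L T N \<longleftrightarrow> is_model L T N \<and>
     Card_order \<kappa> \<and> |{p. wf_form L p}| <o \<kappa> \<and> saturated \<kappa> L N \<and> strongly_homogeneous \<kappa> L N"

subsection \<open>The pure ring language\<close>

datatype ring_sym = RZero | ROne | RNeg | RAdd | RMul

primrec ring_arity :: "ring_sym \<Rightarrow> nat" where
  "ring_arity RZero = 0"
| "ring_arity ROne = 0"
| "ring_arity RNeg = 1"
| "ring_arity RAdd = 2"
| "ring_arity RMul = 2"

definition ring_language :: "(ring_sym, unit) language" where
  "ring_language = \<lparr>fun_ar = (\<lambda>s. Some (ring_arity s)), rel_ar = (\<lambda>_. None)\<rparr>"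

primrec ring_fun :: "('a, 'm) ring_scheme \<Rightarrow> ring_sym \<Rightarrow> 'a list \<Rightarrow> 'a" where
  "ring_fun R RZero xs = \<zero>\<^bsub>R\<^esub>"
| "ring_fun R ROne xs = \<one>\<^bsub>R\<^esub>"
| "ring_fun R RNeg xs = \<ominus>\<^bsub>R\<^esub> (xs ! 0)"
| "ring_fun R RAdd xs = xs ! 0 \<oplus>\<^bsub>R\<^esub> xs ! 1"
| "ring_fun R RMul xs = xs ! 0 \<otimes>\<^bsub>R\<^esub> xs ! 1"

definition ring_structure :: "('a, 'm) ring_scheme \<Rightarrow> (ring_sym, unit, 'a) fo_structure" where
  "ring_structure R = \<lparr>univ = carrier R, fun_int = ring_fun R, rel_int = (\<lambda>_ _. False)\<rparr>"

section \<open>Expansions of ACVF\<close>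

text \<open>ACVF is taken in the one-sorted language of rings with a binary relation \<open>Div\<close>, where
  \<open>Div x y\<close> means \<open>v(x) \<le> v(y)\<close>. An expansion has additional symbols, specified by a
  language \<open>E\<close>.\<close>

datatype 'f vf_fun = Ring ring_sym | FunE 'f

datatype 'r vf_rel = Div | RelE 'r

definition vf_language :: "('f, 'r) language \<Rightarrow> ('f vf_fun, 'r vf_rel) language" where
  "vf_language E =
     \<lparr>fun_ar = (\<lambda>s. case s of Ring r \<Rightarrow> Some (ring_arity r) | FunE g \<Rightarrow> fun_ar E g),
      rel_ar = (\<lambda>s. case s of Div \<Rightarrow> Some 2 | RelE R \<Rightarrow> rel_ar E R)\<rparr>"

type_synonym ('f, 'r, 'a) vf_structure = "('f vf_fun, 'r vf_rel, 'a) fo_structure"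

definition vfield :: "('f, 'r, 'a) vf_structure \<Rightarrow> 'a ring" where
  "vfield N = \<lparr>carrier = univ N,
     monoid.mult = (\<lambda>x y. fun_int N (Ring RMul) [x, y]), one = fun_int N (Ring ROne) [],
     zero = fun_int N (Ring RZero) [], add = (\<lambda>x y. fun_int N (Ring RAdd) [x, y])\<rparr>"

text \<open>\<open>v(x) \<le> v(y)\<close> and \<open>v(x) < v(y)\<close>, with \<open>v(0) = +\<infinity>\<close>.\<close>

definition vle :: "('f, 'r, 'a) vf_structure \<Rightarrow> 'a \<Rightarrow> 'a \<Rightarrow> bool" where
  "vle N x y \<longleftrightarrow> rel_int N Div [x, y]"

definition vless :: "('f, 'r, 'a) vf_structure \<Rightarrow> 'a \<Rightarrow> 'a \<Rightarrow> bool" where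
  "vless N x y \<longleftrightarrow> vle N x y \<and> \<not> vle N y x"

definition val_ring :: "('f, 'r, 'a) vf_structure \<Rightarrow> 'a ring" where
  "val_ring N = (vfield N)\<lparr>carrier := {x \<in> univ N. vle N \<one>\<^bsub>vfield N\<^esub> x}\<rparr>"

definition max_ideal :: "('f, 'r, 'a) vf_structure \<Rightarrow> 'a set" where
  "max_ideal N = {x \<in> univ N. vless N \<one>\<^bsub>vfield N\<^esub> x}"

definition acvf :: "('f, 'r, 'a) vf_structure \<Rightarrow> bool" where
  "acvf N \<longleftrightarrow>
     algebraically_closed (vfield N) \<and>
     (\<forall>x\<in>univ N. fun_int N (Ring RNeg) [x] = \<ominus>\<^bsub>vfield N\<^esub> x) \<and>
     subring (carrier (val_ring N)) (vfield N) \<and>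
     (\<forall>x\<in>univ N - {\<zero>\<^bsub>vfield N\<^esub>}.
        x \<in> carrier (val_ring N) \<or> inv\<^bsub>vfield N\<^esub> x \<in> carrier (val_ring N)) \<and>
     carrier (val_ring N) \<noteq> univ N \<and>
     (\<forall>x\<in>univ N. \<forall>y\<in>univ N.
        vle N x y \<longleftrightarrow> (\<exists>z\<in>carrier (val_ring N). y = x \<otimes>\<^bsub>vfield N\<^esub> z))"

text \<open>The residue field \<open>k\<close> with the residue map, and the value group \<open>\<Gamma> = K\<^sup>\<times>/O\<^sup>\<times>\<close> with the
  valuation on \<open>K\<^sup>\<times>\<close>. The group operation of \<open>\<Gamma>\<close> is written multiplicatively.\<close>

definition residue_field :: "('f, 'r, 'a) vf_structure \<Rightarrow> 'a set ring" where
  "residue_field N = val_ring N Quot max_ideal N"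

definition res :: "('f, 'r, 'a) vf_structure \<Rightarrow> 'a \<Rightarrow> 'a set" where
  "res N x = max_ideal N +>\<^bsub>val_ring N\<^esub> x"

definition value_group :: "('f, 'r, 'a) vf_structure \<Rightarrow> 'a set monoid" where
  "value_group N = units_of (vfield N) Mod Units (val_ring N)"

definition val :: "('f, 'r, 'a) vf_structure \<Rightarrow> 'a \<Rightarrow> 'a set" where
  "val N x = Units (val_ring N) #>\<^bsub>units_of (vfield N)\<^esub> x"

definition value_le :: "('f, 'r, 'a) vf_structure \<Rightarrow> 'a set \<Rightarrow> 'a set \<Rightarrow> bool" where
  "value_le N \<gamma> \<delta> \<longleftrightarrow> (\<exists>x\<in>\<gamma>. \<exists>y\<in>\<delta>. vle N x y)"

subsection \<open>Balls and C-minimality\<close>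

text \<open>Radii in \<open>\<Gamma>\<close> are represented as \<open>v(r)\<close> with \<open>r \<noteq> 0\<close>.\<close>

definition closed_ball :: "('f, 'r, 'a) vf_structure \<Rightarrow> 'a \<Rightarrow> 'a \<Rightarrow> 'a set" where
  "closed_ball N a r = {x \<in> univ N. vle N r (x \<ominus>\<^bsub>vfield N\<^esub> a)}"

definition open_ball :: "('f, 'r, 'a) vf_structure \<Rightarrow> 'a \<Rightarrow> 'a \<Rightarrow> 'a set" where
  "open_ball N a r = {x \<in> univ N. vless N r (x \<ominus>\<^bsub>vfield N\<^esub> a)}"

definition ball_of_radius :: "('f, 'r, 'a) vf_structure \<Rightarrow> 'a \<Rightarrow> 'a set \<Rightarrow> bool" where
  "ball_of_radius N r B \<longleftrightarrow> r \<in> univ N - {\<zero>\<^bsub>vfield N\<^esub>} \<and>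
     (\<exists>a\<in>univ N. B = closed_ball N a r \<or> B = open_ball N a r)"

definition is_ball :: "('f, 'r, 'a) vf_structure \<Rightarrow> 'a set \<Rightarrow> bool" where
  "is_ball N B \<longleftrightarrow> (\<exists>r. ball_of_radius N r B)"

inductive_set bool_combs :: "'a set \<Rightarrow> 'a set set \<Rightarrow> 'a set set" for U G where
  base: "A \<in> G \<Longrightarrow> A \<in> bool_combs U G"
| empty: "{} \<in> bool_combs U G"
| compl: "A \<in> bool_combs U G \<Longrightarrow> U - A \<in> bool_combs U G"
| union: "A \<in> bool_combs U G \<Longrightarrow> B \<in> bool_combs U G \<Longrightarrow> A \<union> B \<in> bool_combs U G"

definition C_minimal_expansion ::
  "'a itself \<Rightarrow> ('f, 'r) language \<Rightarrow> ('f vf_fun, 'r vf_rel) fo_form set \<Rightarrow> bool" where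
  "C_minimal_expansion ty E T \<longleftrightarrow>
     (\<forall>N :: ('f, 'r, 'a) vf_structure. is_model (vf_language E) T N \<longrightarrow>
        acvf N \<and>
        (\<forall>S \<subseteq> univ N. definable (vf_language E) N 1 {[x] |x. x \<in> S} \<longrightarrow>
           S \<in> bool_combs (univ N) ({B. is_ball N B} \<union> {{a} |a. a \<in> univ N})))"

definition definably_complete ::
  "('f, 'r) language \<Rightarrow> ('f, 'r, 'a) vf_structure \<Rightarrow> bool" where
  "definably_complete E N \<longleftrightarrow> (\<forall>F.
     definable_family (vf_language E) N F \<and> (\<forall>B\<in>F. is_ball N B) \<and>
     (\<forall>A\<in>F. \<forall>B\<in>F. A \<subseteq> B \<or> B \<subseteq> A) \<and>
     (\<forall>r\<in>univ N - {\<zero>\<^bsub>vfield N\<^esub>}. \<exists>B\<in>F. \<exists>s. ball_of_radius N s B \<and> vle N r s) \<longrightarrow>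
     \<Inter>F \<noteq> {})"

subsection \<open>Exotic automorphisms\<close>

text \<open>A relation on the imaginary sorts \<open>k\<close> and \<open>\<Gamma>\<close> is definable iff its preimage in the field is.\<close>

definition residue_no_exotic :: "('f, 'r) language \<Rightarrow> ('f, 'r, 'a) vf_structure \<Rightarrow> bool" where
  "residue_no_exotic E N \<longleftrightarrow>
     (\<forall>\<alpha> \<in> iso (units_of (residue_field N)) (units_of (residue_field N)).
        definable (vf_language E) N 2
          {[x, y] |x y. x \<in> Units (val_ring N) \<and> y \<in> Units (val_ring N) \<and> \<alpha> (res N x) = res N y} \<longrightarrow>
        definable ring_language (ring_structure (residue_field N)) 2
          {[a, \<alpha> a] |a. a \<in> Units (residue_field N)})"

text \<open>\<open>\<alpha>\<close> is multiplication by \<open>p/q\<close> iff \<open>q \<alpha>(\<gamma>) = p \<gamma>\<close>, as \<open>\<Gamma>\<close> is divisible and torsion-free.\<close>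

definition value_group_no_exotic :: "('f, 'r) language \<Rightarrow> ('f, 'r, 'a) vf_structure \<Rightarrow> bool" where
  "value_group_no_exotic E N \<longleftrightarrow>
     (\<forall>\<alpha> \<in> iso (value_group N) (value_group N).
        (\<forall>\<gamma>\<in>carrier (value_group N). \<forall>\<delta>\<in>carrier (value_group N).
           value_le N \<gamma> \<delta> \<longleftrightarrow> value_le N (\<alpha> \<gamma>) (\<alpha> \<delta>)) \<and>
        definable (vf_language E) N 2
          {[x, y] |x y. x \<in> Units (vfield N) \<and> y \<in> Units (vfield N) \<and> \<alpha> (val N x) = val N y} \<longrightarrow>
        (\<exists>(p :: nat) (q :: nat). p > 0 \<and> q > 0 \<and>
           (\<forall>\<gamma>\<in>carrier (value_group N).
              \<alpha> \<gamma> [^]\<^bsub>value_group N\<^esub> q = \<gamma> [^]\<^bsub>value_group N\<^esub> p)))"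

subsection \<open>Topology and definable functions\<close>

definition val_topology :: "('f, 'r, 'a) vf_structure \<Rightarrow> 'a topology" where
  "val_topology N = topology_generated_by {B. is_ball N B}"

definition punctured_nbhd_0 :: "('f, 'r, 'a) vf_structure \<Rightarrow> 'a set \<Rightarrow> bool" where
  "punctured_nbhd_0 N D \<longleftrightarrow>
     (\<exists>W. openin (val_topology N) W \<and> \<zero>\<^bsub>vfield N\<^esub> \<in> W \<and> D = W - {\<zero>\<^bsub>vfield N\<^esub>})"

definition definable_fun ::
  "('f, 'r) language \<Rightarrow> ('f, 'r, 'a) fo_structure \<Rightarrow> 'a set \<Rightarrow> ('a \<Rightarrow> 'a) \<Rightarrow> bool" where
  "definable_fun L N D f \<longleftrightarrow> D \<subseteq> univ N \<and> f ` D \<subseteq> univ N \<and> definable L N 2 {[x, f x] |x. x \<in> D}"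

definition char_0 :: "('a, 'm) ring_scheme \<Rightarrow> bool" where
  "char_0 R \<longleftrightarrow> (\<forall>n::nat. n > 0 \<longrightarrow> [n] \<cdot>\<^bsub>R\<^esub> \<one>\<^bsub>R\<^esub> \<noteq> \<zero>\<^bsub>R\<^esub>)"

end

theory Submission
  imports Defs "HOL-Decision_Procs.Algebra_Aux"
begin

text \<open>
  Near \<open>0\<close> every definable condition on \<open>x\<close> is eventually true or eventually false, and a definable
  condition on units is constant off finitely many residue classes. Together with saturation this
  shows, for a definable \<open>f\<close> that does not vanish near \<open>0\<close>, that \<open>f (b x) / f x\<close> tends to a nonzero
  limit \<open>s b\<close> as \<open>x \<rightarrow> 0\<close>, and \<open>s\<close> is a definable endomorphism of \<open>K\<^sup>\<times>\<close>. Such an endomorphism is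
  trivial as soon as it induces the trivial map on \<open>\<Gamma>\<close> or on \<open>k\<^sup>\<times>\<close>. So \<open>s\<^sup>q = b\<^sup>p\<close> for some
  \<open>p\<close> and \<open>q > 0\<close>: for \<open>\<Gamma>\<close> this is the hypothesis, and for \<open>k\<close> a definable multiplicative map in a pure
  algebraically closed field is algebraic over the identity by back and forth, hence a rational power
  by independence of characters. Roots of unity, in characteristic \<open>0\<close>, force \<open>s b = b\<^sup>m\<close> with an
  integer \<open>m\<close>. Then \<open>f x / x\<^sup>m\<close> has a constant leading term near \<open>0\<close> and, by definable completeness, a
  limit \<open>c\<close>. Subtract \<open>c x\<^sup>m\<close> and repeat.
\<close>

section \<open>Definable predicates on assignments\<close>

text \<open>The obstacle throughout is uniformity. C-minimality speaks of one definable set at a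
  time, so at first the radius from which on \<open>f\<close> behaves well at u x depends on the
  unit u. Saturation bounds countably many radii at once; the units that are good for the common
  radius form a definable subgroup meeting infinitely many residue classes, and such a subgroup is
  everything. The second ingredient is that k and \<Gamma> do not interact: no definable map on a
  final segment of \<Gamma> attains all leading terms of one value and then leaves that value,
  because the endpoints of its fibres would embed an infinite part of k into \<Gamma>, where an
  interval can be cut in two. Hence a leading term that depends only on v(x) is constant near 0.
  That an endomorphism s with a nonzero limit is trivial is a translation argument: s(b x) = s(b)
  s(x) has the same limit as s(x). The sorts k and \<Gamma> are formed only where the hypotheses on
  them are used; before that they appear through the relations \<open>\<approx>\<close> and
  \<open>\<asymp>\<close> on the field.\<close>

primrec ren_term :: "(nat \<Rightarrow> nat) \<Rightarrow> 'f fo_term \<Rightarrow> 'f fo_term" where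
  "ren_term \<rho> (Var i) = Var (\<rho> i)"
| "ren_term \<rho> (App g ts) = App g (map (ren_term \<rho>) ts)"

text \<open>Bound variables are renamed together with free ones; for an injective map nothing is
  captured, so no fresh names are required.\<close>

primrec ren_form :: "(nat \<Rightarrow> nat) \<Rightarrow> ('f, 'r) fo_form \<Rightarrow> ('f, 'r) fo_form" where
  "ren_form \<rho> (Equal s t) = Equal (ren_term \<rho> s) (ren_term \<rho> t)"
| "ren_form \<rho> (Atom R ts) = Atom R (map (ren_term \<rho>) ts)"
| "ren_form \<rho> Falsum = Falsum"
| "ren_form \<rho> (Imp p q) = Imp (ren_form \<rho> p) (ren_form \<rho> q)"
| "ren_form \<rho> (Forall i p) = Forall (\<rho> i) (ren_form \<rho> p)"

lemma wf_term_ren: "wf_term L t \<Longrightarrow> wf_term L (ren_term \<rho> t)"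
  by (induction t) (auto simp: list_all_iff)

lemma wf_form_ren: "wf_form L p \<Longrightarrow> wf_form L (ren_form \<rho> p)"
  by (induction p) (auto simp: wf_term_ren)

lemma eval_term_ren: "eval_term N e (ren_term \<rho> t) = eval_term N (e \<circ> \<rho>) t"
  by (induction t) (auto intro!: arg_cong[where f = "fun_int N _"])

lemma sat_ren: "inj \<rho> \<Longrightarrow> sat N (ren_form \<rho> p) e = sat N p (e \<circ> \<rho>)"
proof (induction p arbitrary: e)
  case (Forall i p)
  \<comment> \<open>Injectivity enters here: updating position \<open>\<rho> i\<close> must not
    disturb the value read at any other \<open>\<rho> j\<close>.\<close>
  have "e(\<rho> i := a) \<circ> \<rho> = (e \<circ> \<rho>)(i := a)" for a
    using Forall.prems by (auto simp: inj_eq)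
  then show ?case by (simp only: ren_form.simps sat.simps Forall.IH[OF Forall.prems])
qed (simp_all add: eval_term_ren comp_def)

text \<open>Even positions hold the variables of a predicate, odd positions hold parameters.\<close>

definition merge :: "(nat \<Rightarrow> 'a) \<Rightarrow> (nat \<Rightarrow> 'a) \<Rightarrow> nat \<Rightarrow> 'a" where
  "merge e q i = (if even i then e (i div 2) else q (i div 2))"

text \<open>A predicate on infinite assignments has no arity, so connectives, quantifiers and
  substitutions need no bookkeeping of tuple lengths. A formula sees finitely many positions, hence
  this is the usual definability with parameters.\<close>

definition dfpred ::
  "('f, 'r) language \<Rightarrow> ('f, 'r, 'a) fo_structure \<Rightarrow> ((nat \<Rightarrow> 'a) \<Rightarrow> bool) \<Rightarrow> bool" where
  "dfpred L N P \<longleftrightarrow> (\<exists>p q. wf_form L p \<and> range q \<subseteq> univ N \<and>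
     (\<forall>e. range e \<subseteq> univ N \<longrightarrow> P e = sat N p (merge e q)))"

section \<open>Closure of definable predicates under connectives, renaming and quantifiers\<close>

lemma dfpredI:
  assumes "wf_form L p" "range q \<subseteq> univ N" "inj \<tau>"
    "\<And>e. range e \<subseteq> univ N \<Longrightarrow> P e = sat N p (merge e q \<circ> \<tau>)"
  shows "dfpred L N P"
  unfolding dfpred_def
  using assms by (intro exI[of _ "ren_form \<tau> p"] exI[of _ q]) (auto simp: wf_form_ren sat_ren)

lemma dfpred_cong:
  assumes "dfpred L N P" "\<And>e. range e \<subseteq> univ N \<Longrightarrow> P e = Q e"
  shows "dfpred L N Q"
proof -
  obtain p q where "wf_form L p" "range q \<subseteq> univ N"
    "\<And>e. range e \<subseteq> univ N \<Longrightarrow> P e = sat N p (merge e q)"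
    using assms(1) unfolding dfpred_def by blast
  then show ?thesis unfolding dfpred_def
    using assms(2) by (intro exI[of _ p] exI[of _ q]) auto
qed

lemma dfpred_not:
  assumes "dfpred L N P"
  shows "dfpred L N (\<lambda>e. \<not> P e)"
proof -
  obtain p q where "wf_form L p" "range q \<subseteq> univ N"
    "\<And>e. range e \<subseteq> univ N \<Longrightarrow> P e = sat N p (merge e q)"
    using assms unfolding dfpred_def by blast
  then show ?thesis unfolding dfpred_def
    by (intro exI[of _ "Imp p Falsum"] exI[of _ q]) auto
qed

lemma div2_even_odd: "even i \<Longrightarrow> even j \<Longrightarrow> i div 2 = j div 2 \<Longrightarrow> i = j"
  "odd i \<Longrightarrow> odd j \<Longrightarrow> i div 2 = j div 2 \<Longrightarrow> i = j" for i j :: nat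
  by (auto elim!: evenE oddE)

lemma dfpred_conj:
  assumes "dfpred L N P" "dfpred L N Q"
  shows "dfpred L N (\<lambda>e. P e \<and> Q e)"
proof -
  obtain p q where p: "wf_form L p" "range q \<subseteq> univ N"
    "\<And>e. range e \<subseteq> univ N \<Longrightarrow> P e = sat N p (merge e q)"
    using assms(1) unfolding dfpred_def by blast
  obtain p' q' where p': "wf_form L p'" "range q' \<subseteq> univ N"
    "\<And>e. range e \<subseteq> univ N \<Longrightarrow> Q e = sat N p' (merge e q')"
    using assms(2) unfolding dfpred_def by blast
  \<comment> \<open>The two parameter assignments are interleaved by a second \<open>merge\<close>;
    \<open>\<tau>\<close> and \<open>\<tau>'\<close> send the j-th parameter slot to the slots
    numbered 2j and 2j + 1 and fix the variable slots.\<close>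
  define \<tau> \<tau>' :: "nat \<Rightarrow> nat" where
    "\<tau> i = (if even i then i else 2 * (2 * (i div 2)) + 1)" and
    "\<tau>' i = (if even i then i else 2 * (2 * (i div 2) + 1) + 1)" for i
  have inj: "inj \<tau>" "inj \<tau>'"
    by (rule inj_on_inverseI[where g = "\<lambda>j. if even j then j else 2 * (j div 2 div 2) + 1"];
        simp add: \<tau>_def \<tau>'_def)+
  have e: "merge e (merge q q') \<circ> \<tau> = merge e q" "merge e (merge q q') \<circ> \<tau>' = merge e q'" for e
    by (auto simp: merge_def \<tau>_def \<tau>'_def fun_eq_iff elim!: oddE)
  define r where "r = Imp (Imp (ren_form \<tau> p) (Imp (ren_form \<tau>' p') Falsum)) Falsum"
  have "wf_form L r" by (simp add: r_def wf_form_ren p p')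
  moreover have "range (merge q q') \<subseteq> univ N" using p p' by (auto simp: merge_def)
  ultimately show ?thesis unfolding dfpred_def
    by (intro exI[of _ r] exI[of _ "merge q q'"]) (auto simp: r_def sat_ren inj e p p')
qed

lemma dfpred_reindex:
  assumes "dfpred L N P" "inj \<rho>"
  shows "dfpred L N (\<lambda>e. P (\<lambda>i. e (\<rho> i)))"
proof -
  obtain p q where p: "wf_form L p" "range q \<subseteq> univ N"
    "\<And>e. range e \<subseteq> univ N \<Longrightarrow> P e = sat N p (merge e q)"
    using assms(1) unfolding dfpred_def by blast
  define \<tau> where "\<tau> i = (if even i then 2 * \<rho> (i div 2) else i)" for i
  have "inj \<tau>"
  proof (rule injI)
    fix i j assume "\<tau> i = \<tau> j"
    moreover from this have "even i = even j" unfolding \<tau>_def by (auto split: if_splits)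
    ultimately show "i = j"
      using assms(2) unfolding \<tau>_def by (auto simp: inj_eq intro: div2_even_odd split: if_splits)
  qed
  moreover have "P (\<lambda>i. e (\<rho> i)) = sat N p (merge e q \<circ> \<tau>)" if "range e \<subseteq> univ N" for e
  proof -
    have "merge (\<lambda>i. e (\<rho> i)) q = merge e q \<circ> \<tau>" by (auto simp: merge_def \<tau>_def fun_eq_iff)
    then show ?thesis using p(3)[of "\<lambda>i. e (\<rho> i)"] that by auto
  qed
  ultimately show ?thesis using p by (intro dfpredI[of L p q N \<tau>])
qed

lemma range_case_nat: "range (case_nat a q) \<subseteq> S \<longleftrightarrow> a \<in> S \<and> range q \<subseteq> S"
proof -
  have "(\<forall>i. case_nat a q i \<in> S) \<longleftrightarrow> a \<in> S \<and> (\<forall>i. q i \<in> S)"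
    by (auto split: nat.split dest: spec[of _ 0] spec[of _ "Suc _"])
  then show ?thesis by (simp add: image_subset_iff)
qed

text \<open>Turns the first variable into the first parameter.\<close>

definition var_to_param :: "nat \<Rightarrow> nat" where
  "var_to_param i = (if i = 0 then 1 else if even i then i - 2 else i + 2)"

lemma inj_var_to_param: "inj var_to_param"
  by (rule inj_on_inverseI[where g = "\<lambda>j. if j = 1 then 0 else if even j then j + 2 else j - 2"])
    (auto simp: var_to_param_def elim!: evenE; presburger)

text \<open>The second equation serves quantifiers: position 1, the first parameter slot, acts as
  the bound variable and overwrites whatever dummy \<open>b\<close> stood there.\<close>

lemma merge_var_to_param:
  "merge e (case_nat a q) \<circ> var_to_param = merge (case_nat a e) q"
  "(merge e (case_nat b q))(1 := a) \<circ> var_to_param = merge (case_nat a e) q"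
proof -
  have a: "(i - 2) div 2 = j \<and> i div 2 = Suc j" if "i \<noteq> 0" "even i" "j = i div 2 - 1" for i j :: nat
    using that by presburger
  have b: "even (i - 2)" if "even i" for i :: nat using that by presburger
  have c: "i \<noteq> 0" if "odd i" for i :: nat using that by presburger
  show "merge e (case_nat a q) \<circ> var_to_param = merge (case_nat a e) q"
    "(merge e (case_nat b q))(1 := a) \<circ> var_to_param = merge (case_nat a e) q"
    using a[OF _ _ refl] b c by (auto simp: merge_def var_to_param_def fun_eq_iff split: nat.split)
qed

lemma dfpred_param:
  assumes "dfpred L N P" "a \<in> univ N"
  shows "dfpred L N (\<lambda>e. P (case_nat a e))"
proof -
  obtain p q where p: "wf_form L p" "range q \<subseteq> univ N"
    "\<And>e. range e \<subseteq> univ N \<Longrightarrow> P e = sat N p (merge e q)"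
    using assms(1) unfolding dfpred_def by blast
  show ?thesis
  proof (rule dfpredI[OF p(1) _ inj_var_to_param])
    show "range (case_nat a q) \<subseteq> univ N" using p(2) assms(2) by (simp add: range_case_nat)
    show "P (case_nat a e) = sat N p (merge e (case_nat a q) \<circ> var_to_param)" if "range e \<subseteq> univ N" for e
      unfolding merge_var_to_param using that assms(2) by (intro p(3)) (simp add: range_case_nat)
  qed
qed

text \<open>The bound variable must sit at a fixed position of the formula, but every even position
  belongs to a variable of the resulting predicate. It therefore moves to parameter slot 1, which
  needs some value \<open>a\<close> for the part of the assignment outside the quantifier.\<close>

lemma dfpred_all:
  assumes "dfpred L N (\<lambda>e. Q (e 0) (\<lambda>i. e (Suc i)))" "univ N \<noteq> {}"
  shows "dfpred L N (\<lambda>e. \<forall>x\<in>univ N. Q x e)"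
proof -
  obtain p q where p: "wf_form L p" "range q \<subseteq> univ N"
    "\<And>e. range e \<subseteq> univ N \<Longrightarrow> Q (e 0) (\<lambda>i. e (Suc i)) = sat N p (merge e q)"
    using assms(1) unfolding dfpred_def by blast
  obtain a where a: "a \<in> univ N" using assms(2) by blast
  show ?thesis unfolding dfpred_def
  proof (intro exI conjI allI impI)
    show "wf_form L (Forall 1 (ren_form var_to_param p))" using p by (simp add: wf_form_ren)
    show "range (case_nat a q) \<subseteq> univ N" using p(2) a by (simp add: range_case_nat)
    show "(\<forall>x\<in>univ N. Q x e) = sat N (Forall 1 (ren_form var_to_param p)) (merge e (case_nat a q))"
      if "range e \<subseteq> univ N" for e
    proof -
      have "Q x e = sat N p (merge (case_nat x e) q)" if "x \<in> univ N" for x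
        using p(3)[of "case_nat x e"] that \<open>range e \<subseteq> _\<close> by (simp add: range_case_nat)
      then show ?thesis by (simp add: sat_ren inj_var_to_param merge_var_to_param del: One_nat_def)
    qed
  qed
qed

section \<open>Passage between predicates on assignments and definable sets of tuples\<close>

lemma definable_imp_dfpred:
  assumes "definable L N n S"
  shows "dfpred L N (\<lambda>e. map e [0..<n] \<in> S)"
proof -
  obtain p q where p: "wf_form L p" "range q \<subseteq> univ N"
    "S = {xs. length xs = n \<and> set xs \<subseteq> univ N \<and> sat N p (with_params xs q)}"
    using assms unfolding definable_def by blast
  \<comment> \<open>Parameters keep their number, so the first \<open>n\<close> parameter slots are
    simply never read.\<close>
  define \<tau> where "\<tau> i = (if i < n then 2 * i else 2 * i + 1)" for i :: nat
  have "with_params (map e [0..<n]) q = merge e q \<circ> \<tau>" for e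
    by (auto simp: with_params_def merge_def \<tau>_def fun_eq_iff)
  moreover have "inj \<tau>" by (rule inj_on_inverseI[where g = "\<lambda>j. j div 2"]) (simp add: \<tau>_def)
  ultimately show ?thesis
    by (intro dfpredI[where \<tau> = \<tau>, OF p(1,2)]) (auto simp: p(3) image_subset_iff)
qed

text \<open>Only the first \<open>n\<close> variables stay free; the others are frozen at
  \<open>u\<close> and join the parameters, which are shifted by \<open>n\<close> to make room for
  the tuple.\<close>

lemma dfpred_with_params:
  assumes "dfpred L N P" "u \<in> univ N"
  obtains p q where "wf_form L p" "range q \<subseteq> univ N"
    "\<And>xs. length xs = n \<Longrightarrow> set xs \<subseteq> univ N \<Longrightarrow>
       P (\<lambda>i. if i < n then xs ! i else u) = sat N p (with_params xs q)"
proof -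
  obtain p q where p: "wf_form L p" "range q \<subseteq> univ N"
    "\<And>e. range e \<subseteq> univ N \<Longrightarrow> P e = sat N p (merge e q)"
    using assms(1) unfolding dfpred_def by blast
  define \<tau> where "\<tau> j = (if even j \<and> j < 2 * n then j div 2 else j + n)" for j :: nat
  have inj: "inj \<tau>"
    by (rule inj_on_inverseI[where g = "\<lambda>k. if k < n then 2 * k else k - n"]) (auto simp: \<tau>_def)
  define q' where "q' k = merge (\<lambda>_. u) q (k - n)" for k
  have "with_params xs q' \<circ> \<tau> = merge (\<lambda>i. if i < n then xs ! i else u) q" if "length xs = n" for xs
    using that by (auto simp: with_params_def merge_def \<tau>_def q'_def fun_eq_iff)
  moreover have "range (\<lambda>i. if i < n then xs ! i else u) \<subseteq> univ N"
    if "length xs = n" "set xs \<subseteq> univ N" for xs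
    using that assms(2) by (auto simp: set_conv_nth)
  moreover have "range q' \<subseteq> univ N" using assms(2) p(2) by (auto simp: q'_def merge_def)
  ultimately show ?thesis
    using p inj by (intro that[of "ren_form \<tau> p" q']) (simp_all add: wf_form_ren sat_ren)
qed

lemma dfpred_imp_definable:
  assumes "dfpred L N P" "u \<in> univ N"
  shows "definable L N n {xs. length xs = n \<and> set xs \<subseteq> univ N \<and> P (\<lambda>i. if i < n then xs ! i else u)}"
proof -
  obtain p q where pq: "wf_form L p" "range q \<subseteq> univ N"
    "\<And>xs. length xs = n \<Longrightarrow> set xs \<subseteq> univ N \<Longrightarrow>
       P (\<lambda>i. if i < n then xs ! i else u) = sat N p (with_params xs q)"
    using dfpred_with_params[OF assms] by blast
  show ?thesis unfolding definable_def
    by (intro exI[of _ p] exI[of _ q]) (use pq in auto)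
qed

text \<open>Countably many conditions carry countably many parameters, even though each brings its
  own assignment, and \<open>\<kappa>\<close> exceeds the number of formulas, which is
  infinite.\<close>

lemma monster_countable_saturation:
  assumes M: "monster_model \<kappa> L T N"
    and P: "\<And>n. dfpred L N (\<lambda>e. P n (e 0))"
    and fin: "\<And>n :: nat. \<exists>x\<in>univ N. \<forall>i<n. P i x"
  shows "\<exists>x\<in>univ N. \<forall>i. P i x"
proof -
  obtain u where u: "u \<in> univ N" using fin[of 0] by blast
  have "\<exists>p q. wf_form L p \<and> range q \<subseteq> univ N \<and> (\<forall>x\<in>univ N. P n x = sat N p (with_params [x] q))" for n
  proof -
    obtain p q where "wf_form L p" "range q \<subseteq> univ N"
      and pq: "\<And>xs. length xs = 1 \<Longrightarrow> set xs \<subseteq> univ N \<Longrightarrow>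
       P n ((\<lambda>i. if i < 1 then xs ! i else u) 0) = sat N p (with_params xs q)"
      using dfpred_with_params[OF P u, of 1 n] by blast
    then show ?thesis using pq[of "[_]"] by (intro exI[of _ p] exI[of _ q]) auto
  qed
  then obtain p q where pq: "\<And>n. wf_form L (p n)" "\<And>n. range (q n) \<subseteq> univ N"
    "\<And>n x. x \<in> univ N \<Longrightarrow> P n x = sat N (p n) (with_params [x] (q n))" by metis
  define A where "A = (\<Union>n. range (q n))"
  have "|A| \<le>o |UNIV :: nat set|"
    unfolding A_def by (intro card_of_UNION_ordLeq_infinite) (auto simp: card_of_image card_of_mono1)
  also have "|UNIV :: nat set| \<le>o |{r. wf_form L r}|"
    by (rule card_of_ordLeqI[of "\<lambda>i. Equal (Var i) (Var i)"]) (auto intro: inj_onI)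
  also have "|{r. wf_form L r}| <o \<kappa>" using M by (simp add: monster_model_def)
  finally have A: "|A| <o \<kappa>" .
  define F where "F = range (\<lambda>n. (p n, q n))"
  have "\<exists>xs. length xs = 1 \<and> set xs \<subseteq> univ N \<and> (\<forall>(r, e)\<in>F. sat N r (with_params xs e))"
  proof -
    have "saturated \<kappa> L N" using M by (simp add: monster_model_def)
    moreover have "A \<subseteq> univ N" using pq(2) by (auto simp: A_def)
    moreover have "\<forall>(r, e)\<in>F. wf_form L r \<and> (\<forall>i\<in>free_vars r - {..<1}. e i \<in> A)"
    proof -
      have "q n i \<in> A" for n i unfolding A_def by blast
      then show ?thesis using pq(1) by (auto simp: F_def)
    qed
    moreover have "\<exists>xs. length xs = 1 \<and> set xs \<subseteq> univ N \<and> (\<forall>(r, e)\<in>F0. sat N r (with_params xs e))"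
      if F0: "F0 \<subseteq> F" "finite F0" for F0
    proof -
      obtain I where I: "finite I" "F0 = (\<lambda>n. (p n, q n)) ` I"
        
        using finite_subset_image[OF F0(2), of "\<lambda>n. (p n, q n)" UNIV] F0(1) unfolding F_def by auto
      obtain m where "\<forall>i\<in>I. i < m" using I(1) using finite_nat_set_iff_bounded[of I] by auto
      moreover obtain x where "x \<in> univ N" "\<forall>i<m. P i x" using fin by blast
      ultimately show ?thesis using pq by (intro exI[of _ "[x]"]) (auto simp: I(2))
    qed
    ultimately show ?thesis
      using A unfolding saturated_def by (elim allE[of _ A] allE[of _ 1] allE[of _ F]) blast
  qed
  then obtain x where "x \<in> univ N" "\<forall>(r, e)\<in>F. sat N r (with_params [x] e)"
    by (auto simp: length_Suc_conv)
  then show ?thesis using pq by (auto simp: F_def intro!: bexI[of _ x])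
qed

section \<open>Calculus of definable predicates\<close>

text \<open>Quantifiers follow de Bruijn's convention: in a premise the bound variable is \<open>e 0\<close> and the
  assignment outside of the quantifier is \<open>\<lambda>i. e (Suc i)\<close>.\<close>

named_theorems df

text \<open>From here on formulas disappear: only closure properties of the class of definable
  predicates are used, and the rules collected in \<open>df\<close> prove definability by structural
  introduction.\<close>

locale definability =
  fixes U :: "'a set" and Df :: "((nat \<Rightarrow> 'a) \<Rightarrow> bool) \<Rightarrow> bool"
  assumes U_nonempty: "U \<noteq> {}"
    and Df_cong: "\<And>P Q. Df P \<Longrightarrow> (\<And>e. range e \<subseteq> U \<Longrightarrow> P e = Q e) \<Longrightarrow> Df Q"
    and Df_not [df]: "\<And>P. Df P \<Longrightarrow> Df (\<lambda>e. \<not> P e)"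
    and Df_conj [df]: "\<And>P Q. Df P \<Longrightarrow> Df Q \<Longrightarrow> Df (\<lambda>e. P e \<and> Q e)"
    and Df_all [df]: "\<And>Q. Df (\<lambda>e. Q (e 0) (\<lambda>i. e (Suc i))) \<Longrightarrow> Df (\<lambda>e. \<forall>x\<in>U. Q x e)"
    and Df_reindex: "\<And>P \<rho>. Df P \<Longrightarrow> inj \<rho> \<Longrightarrow> Df (\<lambda>e. P (\<lambda>i. e (\<rho> i)))"
    and Df_param: "\<And>P a. Df P \<Longrightarrow> a \<in> U \<Longrightarrow> Df (\<lambda>e. P (case_nat a e))"
    and Df_eq_var: "Df (\<lambda>e. e 0 = e 1)"
begin

lemma Df_disj [df]:
  assumes "Df P" "Df Q"
  shows "Df (\<lambda>e. P e \<or> Q e)"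
proof -
  have "Df (\<lambda>e. \<not> (\<not> P e \<and> \<not> Q e))" by (intro Df_not Df_conj assms)
  then show ?thesis by simp
qed

lemma Df_imp [df]:
  assumes "Df P" "Df Q"
  shows "Df (\<lambda>e. P e \<longrightarrow> Q e)"
proof -
  have "Df (\<lambda>e. \<not> (P e \<and> \<not> Q e))" by (intro Df_not Df_conj assms)
  then show ?thesis by simp
qed

lemma Df_iff [df]:
  assumes "Df P" "Df Q"
  shows "Df (\<lambda>e. P e = Q e)"
proof -
  have "Df (\<lambda>e. (P e \<longrightarrow> Q e) \<and> (Q e \<longrightarrow> P e))" by (intro Df_imp Df_conj assms)
  then show ?thesis by (simp add: iff_conv_conj_imp)
qed

lemma Df_ex [df]:
  assumes "Df (\<lambda>e. Q (e 0) (\<lambda>i. e (Suc i)))"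
  shows "Df (\<lambda>e. \<exists>x\<in>U. Q x e)"
proof -
  have "Df (\<lambda>e. \<not> (\<forall>x\<in>U. \<not> Q x e))" by (intro Df_not Df_all assms)
  then show ?thesis by simp
qed

lemma Df_triv [df]: "Df (\<lambda>e. b)"
proof -
  have "Df (\<lambda>e. e 0 = e 1 \<longrightarrow> e 0 = e 1)" by (intro Df_imp Df_eq_var)
  then have "Df (\<lambda>e. True)" by simp
  moreover from Df_not[OF this] have "Df (\<lambda>e. False)" by simp
  ultimately show ?thesis by (cases b) simp_all
qed

text \<open>The graph has the value in position 0 and the arguments shifted by one, the same form in
  which a bound variable appears in the premise of a quantifier rule.\<close>

definition Dt :: "((nat \<Rightarrow> 'a) \<Rightarrow> 'a) \<Rightarrow> bool" where
  "Dt t \<longleftrightarrow> (\<forall>e. range e \<subseteq> U \<longrightarrow> t e \<in> U) \<and> Df (\<lambda>e. e 0 = t (\<lambda>i. e (Suc i)))"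

lemma Dt_closed: "Dt t \<Longrightarrow> range e \<subseteq> U \<Longrightarrow> t e \<in> U"
  by (simp add: Dt_def)

lemma Dt_var [df]: "Dt (\<lambda>e. e n)"
proof -
  have "inj (\<lambda>i. if i = 0 then 0 else n + i)" by (auto simp: inj_def)
  from Df_reindex[OF Df_eq_var this] show ?thesis by (auto simp: Dt_def)
qed

lemma inj_swap01: "inj (\<lambda>i :: nat. if i = 0 then 1 else if i = 1 then 0 else i)"
  by (auto simp: inj_def)

lemma Df_swap: "Df (\<lambda>e. P (e 0) (e 1)) \<Longrightarrow> Df (\<lambda>e. P (e 1) (e 0))"
  using Df_reindex[OF _ inj_swap01, of "\<lambda>e. P (e 0) (e 1)"] by simp

lemma Dt_const [df]: "a \<in> U \<Longrightarrow> Dt (\<lambda>e. a)"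
  using Df_param[OF Df_swap[OF Df_eq_var, of], of a] by (simp add: Dt_def)

lemma Dt_shift: "Dt t \<Longrightarrow> Dt (\<lambda>e. t (\<lambda>i. e (Suc i)))"
proof -
  assume t: "Dt t"
  have "inj (\<lambda>i. if i = 0 then 0 else Suc i)" by (auto simp: inj_def)
  from Df_reindex[OF _ this, of "\<lambda>e. e 0 = t (\<lambda>i. e (Suc i))"] t show ?thesis
    by (auto simp: Dt_def image_subset_iff)
qed

lemma Dt_eq_shift: "Dt t \<Longrightarrow> Df (\<lambda>e. e 0 = t (\<lambda>i. e (Suc i)))"
  by (simp add: Dt_def)

text \<open>Substitution is eliminated by quantifying over the values: some x = s and some y = t
  satisfy P(x, y). The inner binder takes position 0, so the two arguments arrive swapped.\<close>

lemma Df_comp2: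
  assumes "Df (\<lambda>e. P (e 0) (e 1))" "Dt s" "Dt t"
  shows "Df (\<lambda>e. P (s e) (t e))"
proof -
  have "Df (\<lambda>e. \<exists>x\<in>U. x = s e \<and> (\<exists>y\<in>U. y = t e \<and> P x y))"
    using Df_swap[OF assms(1)]
    by (intro Df_ex Df_conj assms Dt_eq_shift Dt_shift) simp
  then show ?thesis by (rule Df_cong) (use assms(2,3) in \<open>auto dest: Dt_closed\<close>)
qed

lemma Df_comp3:
  assumes "Df (\<lambda>e. P (e 0) (e 1) (e 2))" "Dt s" "Dt t" "Dt u"
  shows "Df (\<lambda>e. P (s e) (t e) (u e))"
proof -
  have "inj (\<lambda>i :: nat. if i = 0 then 2 else if i = 2 then 0 else i)" by (auto simp: inj_def)
  from Df_reindex[OF assms(1) this] have "Df (\<lambda>e. P (e 2) (e 1) (e 0))" by simp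
  then have "Df (\<lambda>e. \<exists>x\<in>U. x = s e \<and> (\<exists>y\<in>U. y = t e \<and> (\<exists>z\<in>U. z = u e \<and> P x y z)))"
    by (intro Df_ex Df_conj assms Dt_eq_shift Dt_shift) (simp add: numeral_2_eq_2)
  then show ?thesis by (rule Df_cong) (use assms(2-) in \<open>auto dest: Dt_closed\<close>)
qed

lemma Df_eq [df]: "Dt s \<Longrightarrow> Dt t \<Longrightarrow> Df (\<lambda>e. s e = t e)"
  by (rule Df_comp2[OF Df_eq_var])

definition deffun :: "('a \<Rightarrow> 'a) \<Rightarrow> bool" where
  "deffun g \<longleftrightarrow> g \<in> U \<rightarrow> U \<and> Df (\<lambda>e. e 0 = g (e 1))"

definition deffun2 :: "('a \<Rightarrow> 'a \<Rightarrow> 'a) \<Rightarrow> bool" where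
  "deffun2 g \<longleftrightarrow> (\<forall>x\<in>U. \<forall>y\<in>U. g x y \<in> U) \<and> Df (\<lambda>e. e 0 = g (e 1) (e 2))"

lemma Dt_fun1: "deffun g \<Longrightarrow> Dt s \<Longrightarrow> Dt (\<lambda>e. g (s e))"
  using Df_comp2[of "\<lambda>x y. x = g y" "\<lambda>e. e 0" "\<lambda>e. s (\<lambda>i. e (Suc i))"] Dt_shift[of s] Dt_var[of 0]
  by (auto simp: deffun_def Dt_def)

lemma Dt_fun2: "deffun2 g \<Longrightarrow> Dt s \<Longrightarrow> Dt t \<Longrightarrow> Dt (\<lambda>e. g (s e) (t e))"
  using Df_comp3[of "\<lambda>x y z. x = g y z" "\<lambda>e. e 0" "\<lambda>e. s (\<lambda>i. e (Suc i))" "\<lambda>e. t (\<lambda>i. e (Suc i))"]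
    Dt_shift[of s] Dt_shift[of t] Dt_var[of 0]
  by (auto simp: deffun2_def Dt_def)

lemma deffunI: "(\<And>x. x \<in> U \<Longrightarrow> g x \<in> U) \<Longrightarrow> Dt (\<lambda>e. g (e 0)) \<Longrightarrow> deffun g"
  by (auto simp: deffun_def Dt_def)

lemma deffun_closed: "deffun g \<Longrightarrow> x \<in> U \<Longrightarrow> g x \<in> U"
  by (auto simp: deffun_def)

end

section \<open>Valued fields\<close>

text \<open>\<open>x \<preceq> y\<close> stands for v(x) \<le> v(y), so \<open>\<zero>\<close> is
  the largest element, and large means close to \<open>\<zero>\<close>. Values are represented by
  field elements up to \<open>\<asymp>\<close>, and radii by nonzero elements.\<close>

locale valued_field = field R for R :: "('a, 'm) ring_scheme" (structure) +
  fixes le :: "'a \<Rightarrow> 'a \<Rightarrow> bool" (infix "\<preceq>" 50)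
  assumes le_carrier: "x \<preceq> y \<Longrightarrow> x \<in> carrier R \<and> y \<in> carrier R"
    and le_total: "x \<in> carrier R \<Longrightarrow> y \<in> carrier R \<Longrightarrow> x \<preceq> y \<or> y \<preceq> x"
    and le_trans [trans]: "x \<preceq> y \<Longrightarrow> y \<preceq> z \<Longrightarrow> x \<preceq> z"
    and le_mult: "x \<preceq> y \<Longrightarrow> z \<in> carrier R \<Longrightarrow> x \<otimes> z \<preceq> y \<otimes> z"
    and le_zero: "x \<in> carrier R \<Longrightarrow> x \<preceq> \<zero>"
    and zero_le: "\<zero> \<preceq> x \<Longrightarrow> x = \<zero>"
    and le_add: "z \<preceq> x \<Longrightarrow> z \<preceq> y \<Longrightarrow> z \<preceq> x \<oplus> y"
begin

definition lt (infix "\<prec>" 50) where "x \<prec> y \<longleftrightarrow> x \<preceq> y \<and> \<not> y \<preceq> x"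

definition eqv (infix "\<asymp>" 50) where "x \<asymp> y \<longleftrightarrow> x \<preceq> y \<and> y \<preceq> x"

abbreviation "K \<equiv> carrier R"

definition Kx where "Kx = carrier R - {\<zero>}"

definition vring where "vring = {x. \<one> \<preceq> x}"

definition vunits where "vunits = {x. x \<asymp> \<one>}"

text \<open>\<open>x \<doteq> y\<close> means that \<open>x\<close> and \<open>y\<close> have the same leading term; \<open>x \<approx> y\<close> means that they
  have the same residue.\<close>

definition rveq (infix "\<doteq>" 50) where "x \<doteq> y \<longleftrightarrow> y \<in> carrier R \<and> x \<prec> x \<ominus> y"

definition req (infix "\<approx>" 50) where "x \<approx> y \<longleftrightarrow> x \<in> carrier R \<and> y \<in> carrier R \<and> \<one> \<prec> x \<ominus> y"

lemma KxI [intro]: "x \<in> K \<Longrightarrow> x \<noteq> \<zero> \<Longrightarrow> x \<in> Kx" by (simp add: Kx_def)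
lemma Kx_iff: "x \<in> Kx \<longleftrightarrow> x \<in> K \<and> x \<noteq> \<zero>" by (simp add: Kx_def)
lemma zero_notin_Kx [simp]: "\<zero> \<notin> Kx" by (simp add: Kx_def)
lemma one_Kx [simp]: "\<one> \<in> Kx" by (simp add: Kx_def)
lemma Kx_mult [simp]: "x \<in> Kx \<Longrightarrow> y \<in> Kx \<Longrightarrow> x \<otimes> y \<in> Kx" by (simp add: Kx_def integral_iff)
lemma inv_Kx [simp]: "z \<in> Kx \<Longrightarrow> inv z \<in> Kx" by (simp add: Kx_def nonzero_imp_inverse_nonzero)
lemma Kx_div [simp]: "x \<in> Kx \<Longrightarrow> y \<in> Kx \<Longrightarrow> x \<oslash> y \<in> Kx"
  using Kx_mult[of x "inv y"] inv_Kx[of y] by (simp add: Kx_iff m_div_def)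
lemma KxD [dest]: "x \<in> Kx \<Longrightarrow> x \<in> K" by (simp add: Kx_def)
lemma Kx_K [simp]: "x \<in> Kx \<Longrightarrow> x \<in> K" by (simp add: Kx_def)
lemma Kx_nz [simp]: "x \<in> Kx \<Longrightarrow> x \<noteq> \<zero>" by (simp add: Kx_def)
lemma div_closed [simp]: "x \<in> K \<Longrightarrow> y \<in> K \<Longrightarrow> x \<oslash> y \<in> K" by (simp add: m_div_def)

lemma le_K: "x \<preceq> y \<Longrightarrow> x \<in> K" "x \<preceq> y \<Longrightarrow> y \<in> K" using le_carrier by auto
lemma lt_K: "x \<prec> y \<Longrightarrow> x \<in> K" "x \<prec> y \<Longrightarrow> y \<in> K" using le_carrier by (auto simp: lt_def)
lemma eqv_K: "x \<asymp> y \<Longrightarrow> x \<in> K" "x \<asymp> y \<Longrightarrow> y \<in> K" using le_carrier by (auto simp: eqv_def)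
lemma le_refl [simp]: "x \<in> K \<Longrightarrow> x \<preceq> x" using le_total by blast
lemma eqv_refl [simp]: "x \<in> K \<Longrightarrow> x \<asymp> x" by (simp add: eqv_def)
lemma lt_irrefl [simp]: "\<not> x \<prec> x" by (simp add: lt_def)
lemma lt_imp_le: "x \<prec> y \<Longrightarrow> x \<preceq> y" by (simp add: lt_def)
lemma eqv_sym: "x \<asymp> y \<Longrightarrow> y \<asymp> x" by (simp add: eqv_def)
lemma eqv_trans [trans]: "x \<asymp> y \<Longrightarrow> y \<asymp> z \<Longrightarrow> x \<asymp> z" using le_trans by (auto simp: eqv_def)
lemma eqv_le: "x \<asymp> y \<Longrightarrow> x \<preceq> y" "x \<asymp> y \<Longrightarrow> y \<preceq> x" by (simp_all add: eqv_def)
lemma lt_trans [trans]: "x \<prec> y \<Longrightarrow> y \<prec> z \<Longrightarrow> x \<prec> z" using le_trans unfolding lt_def by blast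
lemma lt_le_trans [trans]: "x \<prec> y \<Longrightarrow> y \<preceq> z \<Longrightarrow> x \<prec> z" using le_trans unfolding lt_def by blast
lemma le_lt_trans [trans]: "x \<preceq> y \<Longrightarrow> y \<prec> z \<Longrightarrow> x \<prec> z" using le_trans unfolding lt_def by blast
lemma not_le: "x \<in> K \<Longrightarrow> y \<in> K \<Longrightarrow> \<not> x \<preceq> y \<longleftrightarrow> y \<prec> x" using le_total by (auto simp: lt_def)
lemma not_lt: "x \<in> K \<Longrightarrow> y \<in> K \<Longrightarrow> \<not> x \<prec> y \<longleftrightarrow> y \<preceq> x" using le_total by (auto simp: lt_def)
lemma lt_not_le: "x \<prec> y \<Longrightarrow> \<not> y \<preceq> x" by (auto simp: lt_def)
lemma lt_not_eqv: "x \<prec> y \<Longrightarrow> \<not> x \<asymp> y" "x \<prec> y \<Longrightarrow> \<not> y \<asymp> x" by (auto simp: lt_def eqv_def)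
lemma not_eqv: "x \<in> K \<Longrightarrow> y \<in> K \<Longrightarrow> \<not> x \<asymp> y \<longleftrightarrow> x \<prec> y \<or> y \<prec> x"
  using le_total by (auto simp: lt_def eqv_def)
lemma eqv_lt_trans [trans]: "x \<asymp> y \<Longrightarrow> y \<prec> z \<Longrightarrow> x \<prec> z" using le_lt_trans eqv_le by blast
lemma lt_eqv_trans [trans]: "x \<prec> y \<Longrightarrow> y \<asymp> z \<Longrightarrow> x \<prec> z" using lt_le_trans eqv_le by blast
lemma eqv_le_trans [trans]: "x \<asymp> y \<Longrightarrow> y \<preceq> z \<Longrightarrow> x \<preceq> z" using le_trans eqv_le by blast
lemma le_eqv_trans [trans]: "x \<preceq> y \<Longrightarrow> y \<asymp> z \<Longrightarrow> x \<preceq> z" using le_trans eqv_le by blast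
lemma lt_nz: "x \<prec> y \<Longrightarrow> x \<in> Kx"
  unfolding Kx_iff using le_zero[of y] lt_K[of x y] by (auto simp: lt_def)
lemma eqv_Kx: "x \<asymp> y \<Longrightarrow> x \<in> Kx \<longleftrightarrow> y \<in> Kx" 
  unfolding Kx_iff using zero_le[of x] zero_le[of y] eqv_K[of x y] by (auto simp: eqv_def)
lemma lt_zero: "x \<in> Kx \<Longrightarrow> x \<prec> \<zero>"
  using zero_le[of x] le_zero[of x] by (auto simp: lt_def)

lemma le_Kx: "x \<preceq> y \<Longrightarrow> y \<in> Kx \<Longrightarrow> x \<in> Kx"
  using zero_le[of y] le_K[of x y] by (metis KxI Kx_nz)

lemma mult_div_cancel [simp]: "x \<in> K \<Longrightarrow> z \<in> Kx \<Longrightarrow> x \<otimes> z \<oslash> z = x"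
  by (simp add: m_div_def m_assoc)

lemma div_mult_cancel [simp]: "x \<in> K \<Longrightarrow> z \<in> Kx \<Longrightarrow> x \<oslash> z \<otimes> z = x"
  by (simp add: m_div_def m_assoc)

lemma div_Kx_eq: "z \<in> Kx \<Longrightarrow> x \<oslash> z = x \<otimes> inv z" by (simp add: m_div_def)

lemma le_mult_iff: "z \<in> Kx \<Longrightarrow> x \<in> K \<Longrightarrow> y \<in> K \<Longrightarrow> x \<otimes> z \<preceq> y \<otimes> z \<longleftrightarrow> x \<preceq> y"
  using le_mult[of x y z] le_mult[of "x \<otimes> z" "y \<otimes> z" "inv z"]
  by (auto simp: m_assoc)

lemma lt_mult_iff: "z \<in> Kx \<Longrightarrow> x \<in> K \<Longrightarrow> y \<in> K \<Longrightarrow> x \<otimes> z \<prec> y \<otimes> z \<longleftrightarrow> x \<prec> y"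
  by (simp add: lt_def le_mult_iff)

lemma eqv_mult_iff: "z \<in> Kx \<Longrightarrow> x \<in> K \<Longrightarrow> y \<in> K \<Longrightarrow> x \<otimes> z \<asymp> y \<otimes> z \<longleftrightarrow> x \<asymp> y"
  by (simp add: eqv_def le_mult_iff)

lemma le_mult2: "x \<preceq> y \<Longrightarrow> x' \<preceq> y' \<Longrightarrow> x \<otimes> x' \<preceq> y \<otimes> y'"
proof -
  assume a: "x \<preceq> y" "x' \<preceq> y'"
  have "x \<otimes> x' \<preceq> y \<otimes> x'" using a le_K by (intro le_mult) auto
  also have "y \<otimes> x' = x' \<otimes> y" using a le_K by (intro m_comm) auto
  also have "x' \<otimes> y \<preceq> y' \<otimes> y" using a le_K by (intro le_mult) auto
  also have "y' \<otimes> y = y \<otimes> y'" using a le_K by (intro m_comm) auto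
  finally show ?thesis .
qed

lemma eqv_mult2: "x \<asymp> y \<Longrightarrow> x' \<asymp> y' \<Longrightarrow> x \<otimes> x' \<asymp> y \<otimes> y'"
  by (simp add: eqv_def le_mult2)

lemma lt_mult2: "x \<prec> y \<Longrightarrow> x' \<preceq> y' \<Longrightarrow> x' \<in> Kx \<Longrightarrow> x \<otimes> x' \<prec> y \<otimes> y'"
proof -
  assume a: "x \<prec> y" "x' \<preceq> y'" "x' \<in> Kx"
  have "x \<otimes> x' \<prec> y \<otimes> x'" using a lt_K by (subst lt_mult_iff) auto
  also have "y \<otimes> x' \<preceq> y \<otimes> y'" using a lt_K by (intro le_mult2) auto
  finally show ?thesis .
qed

lemma le_div_iff: "z \<in> Kx \<Longrightarrow> x \<in> K \<Longrightarrow> y \<in> K \<Longrightarrow> x \<preceq> y \<oslash> z \<longleftrightarrow> x \<otimes> z \<preceq> y"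
  using le_mult_iff[of z x "y \<oslash> z"] by (simp add: div_mult_cancel)
lemma div_le_iff: "z \<in> Kx \<Longrightarrow> x \<in> K \<Longrightarrow> y \<in> K \<Longrightarrow> y \<oslash> z \<preceq> x \<longleftrightarrow> y \<preceq> x \<otimes> z"
  using le_mult_iff[of z "y \<oslash> z" x] by (simp add: div_mult_cancel)
lemma lt_div_iff: "z \<in> Kx \<Longrightarrow> x \<in> K \<Longrightarrow> y \<in> K \<Longrightarrow> x \<prec> y \<oslash> z \<longleftrightarrow> x \<otimes> z \<prec> y"
  by (simp add: lt_def le_div_iff div_le_iff)
lemma div_lt_iff: "z \<in> Kx \<Longrightarrow> x \<in> K \<Longrightarrow> y \<in> K \<Longrightarrow> y \<oslash> z \<prec> x \<longleftrightarrow> y \<prec> x \<otimes> z"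
  by (simp add: lt_def le_div_iff div_le_iff)
lemma eqv_div_iff: "z \<in> Kx \<Longrightarrow> x \<in> K \<Longrightarrow> y \<in> K \<Longrightarrow> x \<asymp> y \<oslash> z \<longleftrightarrow> x \<otimes> z \<asymp> y"
  by (simp add: eqv_def le_div_iff div_le_iff)

lemma eqv_div2: "x \<asymp> y \<Longrightarrow> x' \<asymp> y' \<Longrightarrow> x' \<in> Kx \<Longrightarrow> x \<oslash> x' \<asymp> y \<oslash> y'"
proof -
  assume a: "x \<asymp> y" "x' \<asymp> y'" "x' \<in> Kx"
  then have b: "x \<in> K" "y \<in> K" "y' \<in> Kx" using eqv_K eqv_Kx by auto
  have "x \<oslash> x' \<otimes> y' \<asymp> x \<oslash> x' \<otimes> x'" using a b by (intro eqv_mult2) (auto simp: eqv_sym)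
  then have "x \<oslash> x' \<otimes> y' \<asymp> y" using a b eqv_trans[of _ x y] by (simp add: div_mult_cancel)
  then show ?thesis using a b by (simp add: eqv_div_iff)
qed

text \<open>The square of -1 is \<open>\<one>\<close>, while squaring an element of nonzero value
  moves it further away from the value of \<open>\<one>\<close>.\<close>

lemma minus_one_eqv: "\<ominus> \<one> \<asymp> \<one>"
proof -
  have sq: "\<ominus> \<one> \<otimes> \<ominus> \<one> = \<one>" by algebra
  consider "\<ominus> \<one> \<prec> \<one>" | "\<one> \<prec> \<ominus> \<one>" | "\<ominus> \<one> \<asymp> \<one>" using not_eqv[of "\<ominus> \<one>" "\<one>"] by auto
  then show ?thesis
  proof cases
    case 1
    then have "\<ominus> \<one> \<otimes> \<ominus> \<one> \<prec> \<one> \<otimes> \<one>" using lt_nz[OF 1] by (intro lt_mult2) (auto simp: lt_imp_le)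
    then show ?thesis using sq by simp
  next
    case 2
    then have "\<one> \<otimes> \<one> \<prec> \<ominus> \<one> \<otimes> \<ominus> \<one>" by (intro lt_mult2) (auto simp: lt_imp_le)
    then show ?thesis using sq by simp
  qed
qed

lemma minus_eqv: "x \<in> K \<Longrightarrow> \<ominus> x \<asymp> x"
  using eqv_mult2[OF minus_one_eqv, of x x] by (simp add: l_minus)

lemma le_minus_iff [simp]: "x \<in> K \<Longrightarrow> z \<preceq> \<ominus> x \<longleftrightarrow> z \<preceq> x"
  using eqv_le[OF minus_eqv, of x] le_trans[of z "\<ominus> x" x] le_trans[of z x "\<ominus> x"] by auto

lemma le_diff: "z \<preceq> x \<Longrightarrow> z \<preceq> y \<Longrightarrow> z \<preceq> x \<ominus> y"
  using le_add[of z x "\<ominus> y"] le_K[of z y] by (simp add: a_minus_def)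

lemma lt_add: "z \<prec> x \<Longrightarrow> z \<prec> y \<Longrightarrow> z \<prec> x \<oplus> y"
proof -
  assume a: "z \<prec> x" "z \<prec> y"
  show ?thesis
  proof (cases "x \<preceq> y")
    case True
    then have "x \<preceq> x \<oplus> y" using le_K by (intro le_add) auto
    with a(1) show ?thesis by (rule lt_le_trans)
  next
    case False
    then have "y \<preceq> x" using a lt_K le_total by blast
    then have "y \<preceq> x \<oplus> y" using le_K by (intro le_add) auto
    with a(2) show ?thesis by (rule lt_le_trans)
  qed
qed

lemma lt_minus_iff [simp]: "x \<in> K \<Longrightarrow> z \<prec> \<ominus> x \<longleftrightarrow> z \<prec> x"
  using minus_eqv[of x] lt_eqv_trans[of z "\<ominus> x" x] lt_eqv_trans[of z x "\<ominus> x"] eqv_sym by auto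

lemma diff_swap_eqv: "x \<in> K \<Longrightarrow> y \<in> K \<Longrightarrow> x \<ominus> y \<asymp> y \<ominus> x"
proof -
  assume a: "x \<in> K" "y \<in> K"
  then have "x \<ominus> y = \<ominus> (y \<ominus> x)" by algebra
  then show ?thesis using a minus_eqv[of "y \<ominus> x"] by simp
qed

lemma le_diff_swap: "x \<in> K \<Longrightarrow> y \<in> K \<Longrightarrow> z \<preceq> x \<ominus> y \<longleftrightarrow> z \<preceq> y \<ominus> x"
  
  using le_eqv_trans[OF _ diff_swap_eqv, of z x y] le_eqv_trans[OF _ diff_swap_eqv, of z y x] by auto

lemma lt_diff_swap: "x \<in> K \<Longrightarrow> y \<in> K \<Longrightarrow> z \<prec> x \<ominus> y \<longleftrightarrow> z \<prec> y \<ominus> x"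
  using lt_eqv_trans[OF _ diff_swap_eqv, of z x y] lt_eqv_trans[OF _ diff_swap_eqv, of z y x] by auto

lemma diff_split: "x \<in> K \<Longrightarrow> y \<in> K \<Longrightarrow> w \<in> K \<Longrightarrow> x \<ominus> w = (x \<ominus> y) \<oplus> (y \<ominus> w)"
  by algebra

lemma le_diff_trans: "z \<preceq> x \<ominus> y \<Longrightarrow> z \<preceq> y \<ominus> w \<Longrightarrow> x \<in> K \<Longrightarrow> y \<in> K \<Longrightarrow> w \<in> K \<Longrightarrow> z \<preceq> x \<ominus> w"
  using le_add[of z "x \<ominus> y" "y \<ominus> w"] diff_split[of x y w] by simp

lemma lt_diff_trans: "z \<prec> x \<ominus> y \<Longrightarrow> z \<prec> y \<ominus> w \<Longrightarrow> x \<in> K \<Longrightarrow> y \<in> K \<Longrightarrow> w \<in> K \<Longrightarrow> z \<prec> x \<ominus> w"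
  using lt_add[of z "x \<ominus> y" "y \<ominus> w"] diff_split[of x y w] by simp

text \<open>The isosceles property of ultrametrics: a larger value of the difference would, by
  adding \<open>y\<close> back, give \<open>x\<close> a value above its own.\<close>

lemma dominant_diff: assumes "x \<prec> y" shows "x \<ominus> y \<asymp> x"
proof -
  have k: "x \<in> K" "y \<in> K" using assms lt_K by auto
  have a: "x \<preceq> x \<ominus> y" using assms k by (intro le_diff) (auto simp: lt_imp_le)
  have "x = (x \<ominus> y) \<oplus> y" using k by algebra
  then have "\<not> x \<prec> x \<ominus> y" using lt_add[of x "x \<ominus> y" y] assms by auto
  then show ?thesis using a k by (auto simp: eqv_def not_lt)
qed

lemma dominant_diff': "x \<prec> y \<Longrightarrow> y \<ominus> x \<asymp> x"
  using eqv_trans[OF diff_swap_eqv dominant_diff, of y x] lt_K by auto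

lemma diff_self [simp]: "x \<in> K \<Longrightarrow> x \<ominus> x = \<zero>" by algebra

lemma diff_zero_iff: "x \<in> K \<Longrightarrow> y \<in> K \<Longrightarrow> x \<ominus> y = \<zero> \<longleftrightarrow> x = y"
  using r_right_minus_eq by blast

lemma diff_eqv_replace:
  assumes "x \<in> K" "y \<in> K" "a \<in> K" "x \<ominus> a \<prec> x \<ominus> y" shows "y \<ominus> a \<asymp> x \<ominus> a"
proof -
  have "y \<ominus> a = (x \<ominus> a) \<ominus> (x \<ominus> y)" using assms(1-3) by algebra
  then show ?thesis using dominant_diff[OF assms(4)] by simp
qed

subsection \<open>Leading terms and residues\<close>

lemma rveq_K: "x \<doteq> y \<Longrightarrow> x \<in> Kx" "x \<doteq> y \<Longrightarrow> y \<in> Kx"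
proof -
  assume a: "x \<doteq> y"
  show x: "x \<in> Kx" using a lt_nz by (auto simp: rveq_def)
  have "y \<noteq> \<zero>" using a x by (auto simp: rveq_def a_minus_def)
  then show "y \<in> Kx" using a by (auto simp: rveq_def)
qed

lemma rveq_eqv: "x \<doteq> y \<Longrightarrow> y \<asymp> x"
proof -
  assume a: "x \<doteq> y"
  then have k: "x \<in> K" "y \<in> K" using rveq_K by auto
  have "y = x \<ominus> (x \<ominus> y)" using k by algebra
  then show ?thesis using dominant_diff[of x "x \<ominus> y"] a by (simp add: rveq_def)
qed

lemma rveq_refl [simp]: "x \<in> Kx \<Longrightarrow> x \<doteq> x" by (simp add: rveq_def lt_zero)

lemma rveq_sym: "x \<doteq> y \<Longrightarrow> y \<doteq> x"
  using rveq_eqv[of x y] rveq_K[of x y] eqv_lt_trans[of y x "x \<ominus> y"] lt_diff_swap[of x y y]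
  by (simp add: rveq_def)

lemma rveq_trans [trans]: "x \<doteq> y \<Longrightarrow> y \<doteq> z \<Longrightarrow> x \<doteq> z"
proof -
  assume a: "x \<doteq> y" "y \<doteq> z"
  then have k: "x \<in> K" "y \<in> K" "z \<in> K" using rveq_K by auto
  have "x \<prec> y \<ominus> z" using a rveq_eqv eqv_sym eqv_lt_trans by (meson rveq_def)
  then show ?thesis using a k lt_diff_trans by (auto simp: rveq_def)
qed

lemma rveq_mult: assumes "x \<doteq> y" "z \<in> Kx" shows "x \<otimes> z \<doteq> y \<otimes> z"
proof -
  have k: "x \<in> K" "y \<in> K" "z \<in> K" using rveq_K assms by auto
  then have "x \<otimes> z \<ominus> y \<otimes> z = (x \<ominus> y) \<otimes> z" by algebra
  then show ?thesis using assms k by (simp add: rveq_def lt_mult_iff)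
qed

lemma rveq_mult2: "x \<doteq> y \<Longrightarrow> x' \<doteq> y' \<Longrightarrow> x \<otimes> x' \<doteq> y \<otimes> y'"
proof -
  assume a: "x \<doteq> y" "x' \<doteq> y'"
  have "x \<otimes> x' \<doteq> y \<otimes> x'" using a rveq_K by (intro rveq_mult) auto
  also have "y \<otimes> x' = x' \<otimes> y" using a rveq_K by (intro m_comm) auto
  also have "x' \<otimes> y \<doteq> y' \<otimes> y" using a rveq_K by (intro rveq_mult) auto
  also have "y' \<otimes> y = y \<otimes> y'" using a rveq_K by (intro m_comm) auto
  finally show ?thesis .
qed

lemma rveq_mult_iff: "z \<in> Kx \<Longrightarrow> x \<in> K \<Longrightarrow> y \<in> K \<Longrightarrow> x \<otimes> z \<doteq> y \<otimes> z \<longleftrightarrow> x \<doteq> y"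
  using rveq_mult[of x y z] rveq_mult[of "x \<otimes> z" "y \<otimes> z" "inv z"] by (auto simp: m_assoc)

lemma rveq_div_iff: "z \<in> Kx \<Longrightarrow> x \<in> K \<Longrightarrow> y \<in> K \<Longrightarrow> x \<oslash> z \<doteq> y \<longleftrightarrow> x \<doteq> y \<otimes> z"
  using rveq_mult_iff[of z "x \<oslash> z" y] by (simp add: div_mult_cancel)

lemma rveq_div2: assumes "x \<doteq> y" "x' \<doteq> y'" shows "x \<oslash> x' \<doteq> y \<oslash> y'"
proof -
  have k: "x \<in> Kx" "y \<in> Kx" "x' \<in> Kx" "y' \<in> Kx" using assms rveq_K by auto
  have "x \<otimes> y' \<doteq> y \<otimes> x'" using rveq_mult2[OF assms(1) rveq_sym[OF assms(2)]] .
  moreover have "y \<oslash> y' \<otimes> x' = y \<otimes> x' \<oslash> y'" using k by (simp add: m_div_def m_ac)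
  ultimately show ?thesis
    using k rveq_sym[of "y \<otimes> x' \<oslash> y'" x] rveq_div_iff[of y' "y \<otimes> x'" x]
      rveq_sym[of "x \<otimes> y'" "y \<otimes> x'"] by (simp add: rveq_div_iff)
qed

text \<open>A unit has the value of \<open>\<one>\<close>, so comparing the difference with
  \<open>x\<close> or with \<open>\<one>\<close> is the same; statements on leading terms and on
  residues are exchanged by this.\<close>

lemma req_rveq: "x \<in> vunits \<Longrightarrow> x \<approx> y \<longleftrightarrow> x \<doteq> y"
proof -
  assume "x \<in> vunits"
  then have "x \<asymp> \<one>" "x \<in> K" by (auto simp: vunits_def eqv_K)
  then show ?thesis unfolding req_def rveq_def using eqv_lt_trans eqv_sym by blast
qed

lemma req_refl [simp]: "x \<in> K \<Longrightarrow> x \<approx> x" by (simp add: req_def lt_zero)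
lemma req_sym: "x \<approx> y \<Longrightarrow> y \<approx> x" using lt_diff_swap by (auto simp: req_def)
lemma req_trans [trans]: "x \<approx> y \<Longrightarrow> y \<approx> z \<Longrightarrow> x \<approx> z" using lt_diff_trans by (auto simp: req_def)

lemma vring_K [simp]: "x \<in> vring \<Longrightarrow> x \<in> K" using le_K by (auto simp: vring_def)
lemma vunits_K [simp]: "x \<in> vunits \<Longrightarrow> x \<in> K" using eqv_K by (auto simp: vunits_def)
lemma vunits_Kx [simp]: "x \<in> vunits \<Longrightarrow> x \<in> Kx" using eqv_Kx[of x "\<one>"] by (auto simp: vunits_def)
lemma vunits_vring [simp]: "x \<in> vunits \<Longrightarrow> x \<in> vring" using eqv_le by (auto simp: vunits_def vring_def)
lemma one_vunits [simp]: "\<one> \<in> vunits" by (simp add: vunits_def)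
lemma zero_vring [simp]: "\<zero> \<in> vring" by (simp add: vring_def le_zero)
lemma vunits_mult [simp]: "x \<in> vunits \<Longrightarrow> y \<in> vunits \<Longrightarrow> x \<otimes> y \<in> vunits"
  using eqv_mult2[of x "\<one>" y "\<one>"] by (simp add: vunits_def)
lemma vring_mult [simp]: "x \<in> vring \<Longrightarrow> y \<in> vring \<Longrightarrow> x \<otimes> y \<in> vring"
  using le_mult2[of "\<one>" x "\<one>" y] by (simp add: vring_def)
lemma vring_add [simp]: "x \<in> vring \<Longrightarrow> y \<in> vring \<Longrightarrow> x \<oplus> y \<in> vring"
  by (simp add: vring_def le_add)
lemma vring_diff [simp]: "x \<in> vring \<Longrightarrow> y \<in> vring \<Longrightarrow> x \<ominus> y \<in> vring"
  by (simp add: vring_def le_diff)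
lemma vring_minus [simp]: "x \<in> vring \<Longrightarrow> \<ominus> x \<in> vring"
  by (simp add: vring_def le_K)
lemma vunits_div [simp]: "x \<in> vunits \<Longrightarrow> y \<in> vunits \<Longrightarrow> x \<oslash> y \<in> vunits"
  using eqv_div2[of x "\<one>" y "\<one>"] by (auto simp: vunits_def m_div_def)
lemma vunits_inv [simp]: "x \<in> vunits \<Longrightarrow> inv x \<in> vunits"
  using vunits_div[of "\<one>" x] by (simp add: m_div_def)

lemma eqv_unit_mult: "x \<in> K \<Longrightarrow> u \<in> vunits \<Longrightarrow> u \<otimes> x \<asymp> x"
  using eqv_mult2[of u "\<one>" x x] by (simp add: vunits_def)

lemma eqv_unit_obtain: assumes "x \<asymp> y" "y \<in> Kx" obtains u where "u \<in> vunits" "x = u \<otimes> y"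
proof (rule that[of "x \<oslash> y"])
  have x: "x \<in> K" using assms eqv_K by auto
  then show "x = x \<oslash> y \<otimes> y" using assms by (simp add: div_mult_cancel)
  have "\<one> \<asymp> x \<oslash> y" using assms x eqv_sym[OF assms(1)] by (simp add: eqv_div_iff)
  then show "x \<oslash> y \<in> vunits" by (auto simp: vunits_def intro: eqv_sym)
qed

lemma vring_not_unit: "x \<in> vring \<Longrightarrow> x \<notin> vunits \<longleftrightarrow> x \<approx> \<zero>"
  by (auto simp: vring_def vunits_def req_def a_minus_def eqv_def lt_def le_K)

lemma req_mult: "x \<approx> y \<Longrightarrow> z \<in> vring \<Longrightarrow> x \<otimes> z \<approx> y \<otimes> z"
proof -
  assume a: "x \<approx> y" "z \<in> vring"
  then have k: "x \<in> K" "y \<in> K" "z \<in> K" by (auto simp: req_def)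
  then have "x \<otimes> z \<ominus> y \<otimes> z = (x \<ominus> y) \<otimes> z" by algebra
  moreover have "\<one> \<otimes> \<one> \<prec> (x \<ominus> y) \<otimes> z" using a by (intro lt_mult2) (auto simp: req_def vring_def)
  ultimately show ?thesis using k by (simp add: req_def)
qed

lemma req_mult2: "x \<approx> y \<Longrightarrow> x' \<approx> y' \<Longrightarrow> x' \<in> vring \<Longrightarrow> y \<in> vring \<Longrightarrow> x \<otimes> x' \<approx> y \<otimes> y'"
proof -
  assume a: "x \<approx> y" "x' \<approx> y'" "x' \<in> vring" "y \<in> vring"
  then have k: "y' \<in> K" by (simp add: req_def)
  have "x \<otimes> x' \<approx> y \<otimes> x'" using a by (intro req_mult) auto
  also have "y \<otimes> x' = x' \<otimes> y" using a by (intro m_comm) auto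
  also have "x' \<otimes> y \<approx> y' \<otimes> y" using a by (intro req_mult) auto
  also have "y' \<otimes> y = y \<otimes> y'" using a k by (intro m_comm) auto
  finally show ?thesis .
qed

lemma req_unit: "x \<approx> y \<Longrightarrow> x \<in> vunits \<Longrightarrow> y \<in> vunits"
  using req_rveq[of x y] rveq_eqv[of x y] eqv_trans by (auto simp: vunits_def)

lemma finite_le_max: "finite Q \<Longrightarrow> Q \<noteq> {} \<Longrightarrow> Q \<subseteq> K \<Longrightarrow> \<exists>m\<in>Q. \<forall>q\<in>Q. q \<preceq> m"
proof (induction Q rule: finite_ne_induct)
  case (insert x F)
  then obtain m where m: "m \<in> F" "\<forall>q\<in>F. q \<preceq> m" by auto
  show ?case
  proof (cases "x \<preceq> m")
    case False
    then have "m \<preceq> x" using le_total[of x m] insert m by auto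
    then show ?thesis using m le_trans insert.prems by (intro bexI[of _ x]) auto
  qed (use m insert.prems in auto)
qed auto

lemma finite_le_min: "finite Q \<Longrightarrow> Q \<noteq> {} \<Longrightarrow> Q \<subseteq> K \<Longrightarrow> \<exists>m\<in>Q. \<forall>q\<in>Q. m \<preceq> q"
proof (induction Q rule: finite_ne_induct)
  case (insert x F)
  then obtain m where m: "m \<in> F" "\<forall>q\<in>F. m \<preceq> q" by auto
  show ?case
  proof (cases "m \<preceq> x")
    case False
    then have "x \<preceq> m" using le_total[of x m] insert m by auto
    then show ?thesis using m le_trans insert.prems by (intro bexI[of _ x]) auto
  qed (use m insert.prems in auto)
qed auto

end

section \<open>Definably complete C-minimal fields\<close>

text \<open>The common shape of the cell arguments: \<open>r Q x y\<close> says that the finite data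
  \<open>Q\<close> do not tell \<open>x\<close> and \<open>y\<close> apart. Enlarging
  \<open>Q\<close> only makes this harder, so the data of the generators can be united along a
  boolean combination.\<close>

lemma bool_combs_agree:
  assumes "S \<in> bool_combs U G" "D \<subseteq> U"
    and base: "\<And>A. A \<in> G \<Longrightarrow> \<exists>Q. finite Q \<and> Q \<subseteq> V \<and> (\<forall>x\<in>D. \<forall>y\<in>D. r Q x y \<longrightarrow> (x \<in> A) = (y \<in> A))"
    and r: "\<And>Q Q' x y. r (Q \<union> Q') x y \<Longrightarrow> r Q x y \<and> r Q' x y"
  shows "\<exists>Q. finite Q \<and> Q \<subseteq> V \<and> (\<forall>x\<in>D. \<forall>y\<in>D. r Q x y \<longrightarrow> (x \<in> S) = (y \<in> S))"
  using assms(1)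
proof (induction rule: bool_combs.induct)
  case empty
  then show ?case by (intro exI[of _ "{}"]) auto
next
  case (compl A)
  then obtain Q where "finite Q" "Q \<subseteq> V" "\<forall>x\<in>D. \<forall>y\<in>D. r Q x y \<longrightarrow> (x \<in> A) = (y \<in> A)" by blast
  then show ?case using assms(2) by (intro exI[of _ Q]) blast
next
  case (union A B)
  then obtain Q Q' where Q: "finite Q" "Q \<subseteq> V" "finite Q'" "Q' \<subseteq> V"
    and e: "\<forall>x\<in>D. \<forall>y\<in>D. r Q x y \<longrightarrow> (x \<in> A) = (y \<in> A)"
    "\<forall>x\<in>D. \<forall>y\<in>D. r Q' x y \<longrightarrow> (x \<in> B) = (y \<in> B)" by blast
  have "(x \<in> A \<union> B) = (y \<in> A \<union> B)" if "x \<in> D" "y \<in> D" "r (Q \<union> Q') x y" for x y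
    using r[OF that(3)] e that by simp
  then show ?case using Q by (intro exI[of _ "Q \<union> Q'"]) simp
qed (rule base)

text \<open>What the analysis takes from the monster model, apart from the hypothesis on
  automorphisms. Saturation is wanted for countably many conditions in one variable, algebraic
  closedness as roots of monic polynomials. In \<open>completeness\<close>, \<open>S y c\<close>
  codes a closed ball with centre \<open>y\<close> and radius \<open>c\<close>, and nestedness is
  expressed by the distance of the centres.\<close>

locale cmin_field = valued_field R le + definability "carrier R" Df
  for R :: "('a, 'm) ring_scheme" (structure) and le (infix "\<preceq>" 50) and Df +
  assumes Df_le_var: "Df (\<lambda>e. e 0 \<preceq> e 1)"
    and Df_add_var: "Df (\<lambda>e. e 0 = e 1 \<oplus> e 2)"
    and Df_mult_var: "Df (\<lambda>e. e 0 = e 1 \<otimes> e 2)"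
    and nontriv: "\<exists>t\<in>carrier R. \<one> \<prec> t \<and> t \<noteq> \<zero>"
    and root: "\<And>p. set p \<subseteq> carrier R \<Longrightarrow> p \<noteq> [] \<Longrightarrow> \<exists>x\<in>carrier R. eval (\<one> # p) x = \<zero>"
    and char0: "\<And>n :: nat. n > 0 \<Longrightarrow> [n] \<cdot> \<one> \<noteq> \<zero>"
    and cmin: "\<And>P. Df (\<lambda>e. P (e 0)) \<Longrightarrow> {x \<in> carrier R. P x} \<in> bool_combs (carrier R)
      ({B. \<exists>a\<in>carrier R. \<exists>r\<in>carrier R - {\<zero>}. B = {x. r \<preceq> x \<ominus> a \<and> x \<in> carrier R} \<or>
          B = {x. r \<prec> x \<ominus> a \<and> x \<in> carrier R}} \<union> {{a} |a. a \<in> carrier R})"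
    and saturation: "\<And>P :: nat \<Rightarrow> 'a \<Rightarrow> bool. (\<And>n. Df (\<lambda>e. P n (e 0))) \<Longrightarrow>
      (\<And>n. \<exists>x\<in>carrier R. \<forall>i<n. P i x) \<Longrightarrow> \<exists>x\<in>carrier R. \<forall>i. P i x"
    and completeness: "\<And>S. Df (\<lambda>e. S (e 0) (e 1)) \<Longrightarrow>
      (\<And>y c. S y c \<Longrightarrow> y \<in> carrier R \<and> c \<in> carrier R \<and> c \<noteq> \<zero>) \<Longrightarrow>
      (\<And>y c y' c'. S y c \<Longrightarrow> S y' c' \<Longrightarrow> c \<preceq> y \<ominus> y' \<or> c' \<preceq> y \<ominus> y') \<Longrightarrow>
      (\<And>r. r \<in> carrier R \<Longrightarrow> r \<noteq> \<zero> \<Longrightarrow> \<exists>y c. S y c \<and> r \<preceq> c) \<Longrightarrow>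
      \<exists>x\<in>carrier R. \<forall>y c. S y c \<longrightarrow> c \<preceq> x \<ominus> y"
begin

lemma Df_le [df]: "Dt s \<Longrightarrow> Dt t \<Longrightarrow> Df (\<lambda>e. s e \<preceq> t e)"
  by (rule Df_comp2[OF Df_le_var])

lemma Df_lt [df]: "Dt s \<Longrightarrow> Dt t \<Longrightarrow> Df (\<lambda>e. s e \<prec> t e)"
  unfolding lt_def by (intro df)

lemma Df_eqv [df]: "Dt s \<Longrightarrow> Dt t \<Longrightarrow> Df (\<lambda>e. s e \<asymp> t e)"
  unfolding eqv_def by (intro df)

lemma Dt_add [df]: "Dt s \<Longrightarrow> Dt t \<Longrightarrow> Dt (\<lambda>e. s e \<oplus> t e)"
  by (rule Dt_fun2[where g = "\<lambda>x y. x \<oplus> y"]) (simp_all add: deffun2_def Df_add_var[simplified])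

lemma Dt_mult [df]: "Dt s \<Longrightarrow> Dt t \<Longrightarrow> Dt (\<lambda>e. s e \<otimes> t e)"
  by (rule Dt_fun2[where g = "\<lambda>x y. x \<otimes> y"]) (simp_all add: deffun2_def Df_mult_var[simplified])

lemma add_eq_zero_iff: "x \<in> K \<Longrightarrow> y \<in> K \<Longrightarrow> x = \<ominus> y \<longleftrightarrow> x \<oplus> y = \<zero>"
  using minus_equality l_neg by blast

lemma Dt_neg [df]: "Dt s \<Longrightarrow> Dt (\<lambda>e. \<ominus> s e)"
proof (rule Dt_fun1[where g = "\<lambda>x. \<ominus> x"])
  have "Df (\<lambda>e. e 0 \<oplus> e 1 = \<zero>)" by (intro df) simp
  then have "Df (\<lambda>e. e 0 = \<ominus> e 1)"
    by (rule Df_cong) (simp add: add_eq_zero_iff image_subset_iff)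
  then show "deffun (\<lambda>x. \<ominus> x)" by (simp add: deffun_def)
qed

lemma Dt_diff [df]: "Dt s \<Longrightarrow> Dt t \<Longrightarrow> Dt (\<lambda>e. s e \<ominus> t e)"
  unfolding a_minus_def by (intro df)

text \<open>Division is total with value \<open>\<zero>\<close> at divisor \<open>\<zero>\<close>,
  hence the separate case in the graph.\<close>

lemma div_eq_iff: "x \<in> K \<Longrightarrow> y \<in> K \<Longrightarrow> z \<in> K \<Longrightarrow>
    z = x \<oslash> y \<longleftrightarrow> y = \<zero> \<and> z = \<zero> \<or> y \<noteq> \<zero> \<and> z \<otimes> y = x"
proof (cases "y = \<zero>")
  case False
  assume k: "x \<in> K" "y \<in> K" "z \<in> K"
  then have y: "y \<in> Kx" using False by auto
  have "z = x \<oslash> y \<longleftrightarrow> z \<otimes> y = x"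
    using mult_div_cancel[OF k(3) y] div_mult_cancel[OF k(1) y] by metis
  then show ?thesis using False by simp
qed (simp add: m_div_def)

lemma Dt_div [df]: "Dt s \<Longrightarrow> Dt t \<Longrightarrow> Dt (\<lambda>e. s e \<oslash> t e)"
proof (rule Dt_fun2[where g = "\<lambda>x y. x \<oslash> y"])
  have "Df (\<lambda>e. e 2 = \<zero> \<and> e 0 = \<zero> \<or> e 2 \<noteq> \<zero> \<and> e 0 \<otimes> e 2 = e 1)" by (intro df) simp_all
  then have "Df (\<lambda>e. e 0 = e 1 \<oslash> e 2)"
    by (rule Df_cong) (subst div_eq_iff, simp_all add: image_subset_iff)
  then show "deffun2 (\<lambda>x y. x \<oslash> y)" by (simp add: deffun2_def)
qed

lemma Dt_nat_pow [df]: "Dt s \<Longrightarrow> Dt (\<lambda>e. s e [^] (n :: nat))"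
  by (induction n) (auto intro: df simp: nat_pow_0 nat_pow_Suc)

lemma Dt_if:
  assumes "Df P" "Dt s" "Dt t"
  shows "Dt (\<lambda>e. if P e then s e else t e)"
proof -
  have "inj Suc" by simp
  from Df_reindex[OF assms(1) this] assms(2,3)
  have "Df (\<lambda>e. P (\<lambda>i. e (Suc i)) \<and> e 0 = s (\<lambda>i. e (Suc i)) \<or> \<not> P (\<lambda>i. e (Suc i)) \<and> e 0 = t (\<lambda>i. e (Suc i)))"
    by (intro Df_disj Df_conj Df_not) (simp_all add: Dt_def)
  then have "Df (\<lambda>e. e 0 = (if P (\<lambda>i. e (Suc i)) then s (\<lambda>i. e (Suc i)) else t (\<lambda>i. e (Suc i))))"
    by (rule Df_cong) auto
  then show ?thesis using assms(2,3) by (simp add: Dt_def)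
qed

lemma Df_rveq [df]: "Dt s \<Longrightarrow> Dt t \<Longrightarrow> Df (\<lambda>e. s e \<doteq> t e)"
proof -
  assume a: "Dt s" "Dt t"
  then have "Df (\<lambda>e. s e \<prec> s e \<ominus> t e)" by (intro df)
  then show ?thesis by (rule Df_cong) (use a in \<open>auto simp: rveq_def Dt_def\<close>)
qed

lemma Df_req [df]: "Dt s \<Longrightarrow> Dt t \<Longrightarrow> Df (\<lambda>e. s e \<approx> t e)"
proof -
  assume a: "Dt s" "Dt t"
  then have "Df (\<lambda>e. \<one> \<prec> s e \<ominus> t e)" by (intro df) simp
  then show ?thesis by (rule Df_cong) (use a in \<open>auto simp: req_def Dt_def\<close>)
qed

lemma Df_Kx [df]: "Dt s \<Longrightarrow> Df (\<lambda>e. s e \<in> Kx)"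
proof -
  assume a: "Dt s"
  then have "Df (\<lambda>e. s e \<noteq> \<zero>)" by (intro df) simp_all
  then show ?thesis by (rule Df_cong) (simp add: Kx_def Dt_closed[OF a] del: Kx_K Kx_nz)
qed

lemma Df_vunits [df]: "Dt s \<Longrightarrow> Df (\<lambda>e. s e \<in> vunits)"
  unfolding vunits_def mem_Collect_eq by (intro df) simp_all

lemma Df_vring [df]: "Dt s \<Longrightarrow> Df (\<lambda>e. s e \<in> vring)"
  unfolding vring_def mem_Collect_eq by (intro df) simp_all

lemma Df_all_sub:
  assumes "A \<subseteq> K" "\<And>s. Dt s \<Longrightarrow> Df (\<lambda>e. s e \<in> A)" "Df (\<lambda>e. Q (e 0) (\<lambda>i. e (Suc i)))"
  shows "Df (\<lambda>e. \<forall>x\<in>A. Q x e)" "Df (\<lambda>e. \<exists>x\<in>A. Q x e)"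
proof -
  have "Df (\<lambda>e. \<forall>x\<in>K. x \<in> A \<longrightarrow> Q x e)" "Df (\<lambda>e. \<exists>x\<in>K. x \<in> A \<and> Q x e)"
    by (intro df assms)+
  moreover have "(\<forall>x\<in>K. x \<in> A \<longrightarrow> Q x e) = (\<forall>x\<in>A. Q x e)" "(\<exists>x\<in>K. x \<in> A \<and> Q x e) = (\<exists>x\<in>A. Q x e)" for e
    using assms(1) by blast+
  ultimately show "Df (\<lambda>e. \<forall>x\<in>A. Q x e)" "Df (\<lambda>e. \<exists>x\<in>A. Q x e)" by simp_all
qed

lemma Kx_sub: "Kx \<subseteq> K" and vunits_sub: "vunits \<subseteq> K" and vring_sub: "vring \<subseteq> K" by auto

lemmas Df_quant [df] = Df_all_sub[OF Kx_sub Df_Kx] Df_all_sub[OF vunits_sub Df_vunits]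
  Df_all_sub[OF vring_sub Df_vring]

subsection \<open>Consequences of algebraic closedness\<close>

lemma eval_Cons: "eval (a # q) x = a \<otimes> x [^] length q \<oplus> eval q x"
  by simp

lemma eval_replicate_append: "set q \<subseteq> K \<Longrightarrow> x \<in> K \<Longrightarrow> eval (replicate n \<zero> @ q) x = eval q x"
  by (induction n) (auto simp: eval_in_carrier)

lemma nth_root: assumes "a \<in> K" "n > 0" obtains x where "x \<in> K" "x [^] (n :: nat) = a"
proof -
  obtain x where x: "x \<in> K" "eval (\<one> # replicate (n - 1) \<zero> @ [\<ominus> a]) x = \<zero>"
    using root[of "replicate (n - 1) \<zero> @ [\<ominus> a]"] assms by (auto simp: subset_iff)
  have "eval (replicate (n - 1) \<zero> @ [\<ominus> a]) x = \<ominus> a"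
    using x(1) assms by (subst eval_replicate_append) auto
  then have "x [^] n \<oplus> \<ominus> a = \<zero>"
    using x assms by (simp only: eval_Cons) (simp add: length_replicate)
  then have "x [^] n = a" using x(1) assms by (simp add: diff_zero_iff flip: a_minus_def)
  with x(1) show ?thesis by (rule that)
qed

lemma sqrt_obtain: assumes "a \<in> K" obtains x where "x \<in> K" "x \<otimes> x = a"
  using nth_root[OF assms, of 2] by (auto simp: numeral_2_eq_2)

text \<open>The value group is divisible: a square root of \<open>x \<otimes> y\<close> has the mean
  of the two values. For \<open>y = \<zero>\<close> there is no mean, and multiplication by an
  element of positive value takes its place.\<close>

lemma dense: assumes "x \<prec> y" obtains z where "z \<in> Kx" "x \<prec> z" "z \<prec> y"
proof (cases "y = \<zero>")
  case True
  obtain t where t: "t \<in> Kx" "\<one> \<prec> t" using nontriv by auto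
  have x: "x \<in> Kx" using assms lt_nz by blast
  have "\<one> \<otimes> x \<prec> t \<otimes> x" using t x by (subst lt_mult_iff) auto
  then show ?thesis using that[of "t \<otimes> x"] x t True lt_zero by auto
next
  case False
  have k: "x \<in> Kx" "y \<in> Kx" using assms lt_nz lt_K False by blast+
  obtain z where z: "z \<in> K" "z \<otimes> z = x \<otimes> y" using sqrt_obtain[of "x \<otimes> y"] k by auto
  have zx: "z \<in> Kx" using z k integral_iff[of x y] by (metis KxI Kx_K Kx_nz l_null zero_closed)
  have "x \<prec> z"
  proof (rule ccontr)
    assume "\<not> x \<prec> z"
    then have a: "z \<preceq> x" using not_lt k z by auto
    have "z \<otimes> z \<preceq> x \<otimes> x" by (rule le_mult2[OF a a])
    also have "x \<otimes> x \<prec> y \<otimes> x" using assms k by (subst lt_mult_iff) auto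
    finally show False using z k m_comm[of x y] by auto
  qed
  moreover have "z \<prec> y"
  proof (rule ccontr)
    assume "\<not> z \<prec> y"
    then have a: "y \<preceq> z" using not_lt k z by auto
    have "x \<otimes> y \<prec> y \<otimes> y" using assms k by (subst lt_mult_iff) auto
    also have "y \<otimes> y \<preceq> z \<otimes> z" by (rule le_mult2[OF a a])
    finally show False using z by auto
  qed
  ultimately show ?thesis using that zx by blast
qed

lemma below_exists: assumes "x \<in> Kx" obtains z where "z \<in> Kx" "z \<prec> x"
proof -
  obtain t where t: "t \<in> Kx" "\<one> \<prec> t" using nontriv by auto
  have "x \<oslash> t \<prec> x" using assms t lt_mult_iff[of x "\<one>" t] by (subst div_lt_iff) (auto simp: m_comm)
  then show ?thesis using that[of "x \<oslash> t"] assms t by auto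
qed

lemma above_exists: assumes "x \<in> Kx" obtains z where "z \<in> Kx" "x \<prec> z"
  using dense[OF lt_zero[OF assms]] by blast

text \<open>When v(x) < 0, the power \<open>x [^] length q\<close> has a smaller value than every
  monomial of \<open>q\<close>, as the coefficients are integral. This is what makes the valuation
  ring integrally closed.\<close>

lemma eval_lt_pow: "set q \<subseteq> vring \<Longrightarrow> x \<prec> \<one> \<Longrightarrow> x [^] length q \<prec> eval q x"
proof (induction q)
  case Nil
  then show ?case by (simp add: lt_zero)
next
  case (Cons a q)
  have x: "x \<in> Kx" "x \<in> K" using Cons lt_nz lt_K by auto
  have a: "a \<in> vring" using Cons by simp
  have px: "x [^] n \<in> Kx" for n :: nat using x by (induction n) auto
  have lt: "x [^] length (a # q) \<prec> x [^] length q"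
    using lt_mult_iff[OF px, of x "\<one>" "length q"] Cons.prems x by (simp add: m_comm)
  have "\<one> \<otimes> x [^] length q \<preceq> a \<otimes> x [^] length q" using a x by (intro le_mult) (auto simp: vring_def)
  then have "x [^] length (a # q) \<prec> a \<otimes> x [^] length q" using lt lt_le_trans x by simp
  moreover have "x [^] length (a # q) \<prec> eval q x" using Cons lt lt_trans by auto
  ultimately show ?case unfolding eval_Cons by (rule lt_add)
qed

lemma root_vring:
  assumes "set p \<subseteq> vring" "x \<in> K" "eval (\<one> # p) x = \<zero>"
  shows "x \<in> vring"
proof (rule ccontr)
  assume "x \<notin> vring"
  then have x: "x \<prec> \<one>" using assms not_le[of "\<one>" x] by (auto simp: vring_def)
  have p: "set p \<subseteq> K" using assms by auto
  have "x [^] length p \<prec> eval p x" using eval_lt_pow assms x by blast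
  moreover have "x [^] length p \<oplus> eval p x = \<zero>" using assms by (simp add: eval_Cons)
  then have "x [^] length p = \<ominus> eval p x"
    using add_eq_zero_iff[of "x [^] length p" "eval p x"] assms eval_in_carrier[OF p] by simp
  then have "x [^] length p \<asymp> eval p x" using minus_eqv eval_in_carrier[OF p assms(2)] by simp
  ultimately show False using lt_not_eqv by blast
qed

lemma vunits_pow [simp]: "u \<in> vunits \<Longrightarrow> u [^] (n :: nat) \<in> vunits"
  by (induction n) auto

lemma vring_pow [simp]: "u \<in> vring \<Longrightarrow> u [^] (n :: nat) \<in> vring"
  by (induction n) (simp_all add: vring_def[THEN eqset_imp_iff, of "\<one>"])

lemma Kx_pow [simp]: "u \<in> Kx \<Longrightarrow> u [^] (n :: nat) \<in> Kx"
  by (induction n) auto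

lemma req_one_pow: "u \<approx> \<one> \<Longrightarrow> u [^] (n :: nat) \<approx> \<one>"
proof (induction n)
  case (Suc n)
  have "u \<in> vring" using Suc.prems req_unit[OF req_sym] by auto
  then have "u [^] n \<otimes> u \<approx> \<one> \<otimes> \<one>" using Suc by (intro req_mult2) auto
  then show ?case by simp
qed simp

text \<open>Two of the \<open>card A + 1\<close> first powers of \<open>u\<close> fall into one
  class. The difference of their exponents depends on \<open>u\<close>, but it divides the
  factorial, which is one exponent for all \<open>u\<close>.\<close>

lemma finite_order:
  assumes A: "finite A" and u: "u \<in> vunits" and pow: "\<And>i. \<exists>a\<in>A. u [^] (i :: nat) \<approx> a"
  shows "u [^] (fact (card A) :: nat) \<approx> \<one>"
proof -
  define g where "g i = (SOME a. a \<in> A \<and> u [^] i \<approx> a)" for i :: nat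
  have g: "g i \<in> A \<and> u [^] i \<approx> g i" for i
    unfolding g_def by (rule someI_ex) (use pow in blast)
  have "\<not> inj_on g {..card A}"
    using card_inj_on_le[of g "{..card A}" A] A g by auto
  then obtain i j where "i \<in> {..card A}" "j \<in> {..card A}" "i \<noteq> j" "g i = g j"
    by (auto simp: inj_on_def)
  then obtain i j where ij: "i < j" "j \<le> card A" "g i = g j"
    by (metis atMost_iff linorder_neqE_nat)
  then have "u [^] j \<approx> u [^] i" using g[of i] g[of j] req_sym req_trans by metis
  moreover have "u [^] j = u [^] (j - i) \<otimes> u [^] i" using u ij by (simp add: nat_pow_mult)
  ultimately have "u [^] (j - i) \<otimes> u [^] i \<otimes> inv (u [^] i) \<approx> u [^] i \<otimes> inv (u [^] i)"
    using req_mult[of "u [^] j" "u [^] i" "inv (u [^] i)"] u by simp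
  then have d: "u [^] (j - i) \<approx> \<one>" using u vunits_Kx[OF vunits_pow[OF u, of i]] by (simp add: m_assoc)
  have "(j - i) dvd fact (card A)" using ij by (intro dvd_fact) auto
  then obtain k :: nat where "fact (card A) = (j - i) * k" by blast
  then show ?thesis using req_one_pow[OF d, of k] u by (simp add: nat_pow_pow)
qed

text \<open>With finitely many residues, one exponent N would bring every unit to residue 1. A root
  x of X^(N+1) - X - 1 satisfies (x^N - 1) x = 1, so x is a unit; but then x^N - 1 has positive
  value, a contradiction.\<close>

lemma residue_infinite:
  assumes "finite A" "A \<subseteq> vring"
  shows "\<exists>u\<in>vunits. \<forall>a\<in>A. \<not> u \<approx> a"
proof (rule ccontr)
  assume "\<not> ?thesis"
  then have A: "\<exists>a\<in>A. u \<approx> a" if "u \<in> vunits" for u using that by blast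
  define N where "N = (fact (card A) :: nat)"
  have N: "N > 0" by (simp add: N_def)
  have one: "u [^] N \<approx> \<one>" if u: "u \<in> vunits" for u
    unfolding N_def by (rule finite_order[OF assms(1) u]) (use A vunits_pow[OF u] in blast)
  define p where "p = replicate (N - 1) \<zero> @ [\<ominus> \<one>, \<ominus> \<one>]"
  have p: "set p \<subseteq> vring" by (auto simp: p_def vring_def le_zero)
  moreover have "p \<noteq> []" by (simp add: p_def)
  ultimately obtain x where x: "x \<in> K" "eval (\<one> # p) x = \<zero>"
    using root[of p] vring_sub by blast
  have xv: "x \<in> vring" using root_vring p x by blast
  have "eval p x = \<ominus> x \<oplus> \<ominus> \<one>" unfolding p_def using x(1)
    by (subst eval_replicate_append) (auto simp: l_minus)
  moreover have "length p = Suc N" using N by (simp add: p_def)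
  ultimately have "x [^] N \<otimes> x \<oplus> (\<ominus> x \<oplus> \<ominus> \<one>) = \<zero>"
    using x by (simp only: eval_Cons) simp
  moreover have "(x [^] N \<ominus> \<one>) \<otimes> x \<ominus> \<one> = x [^] N \<otimes> x \<oplus> (\<ominus> x \<oplus> \<ominus> \<one>)"
    if "x [^] N \<in> K" using x(1) that by algebra
  ultimately have e: "(x [^] N \<ominus> \<one>) \<otimes> x = \<one>" using x(1) by (simp add: diff_zero_iff)
  have v: "\<one> \<preceq> x [^] N \<ominus> \<one>" "\<one> \<preceq> x" using xv by (auto simp: vring_def intro!: le_diff)
      (use vring_pow[OF xv, of N] in \<open>simp add: vring_def\<close>)
  have "x \<in> vunits"
  proof (rule ccontr)
    assume "x \<notin> vunits"
    then have "\<one> \<prec> x" using v x(1) by (auto simp: vunits_def eqv_def lt_def)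
    then have "\<one> \<otimes> \<one> \<prec> x \<otimes> (x [^] N \<ominus> \<one>)"
      using v(1) by (intro lt_mult2) auto
    then show False using e x(1) by (simp add: m_comm)
  qed
  then have "\<one> \<prec> x [^] N \<ominus> \<one>" using one by (auto simp: req_def)
  then have "\<one> \<otimes> \<one> \<prec> (x [^] N \<ominus> \<one>) \<otimes> x"
    using v(2) by (intro lt_mult2) auto
  then show False using e by simp
qed

lemma residue_sequence:
  obtains w :: "nat \<Rightarrow> 'a" where "\<And>n. w n \<in> vunits" "\<And>i j. i \<noteq> j \<Longrightarrow> \<not> w i \<approx> w j"
proof -
  have "\<exists>w :: nat \<Rightarrow> 'a. \<forall>n. w n \<in> vunits \<and> (\<forall>i<n. \<not> w n \<approx> w i)"
  proof (rule dependent_wellorder_choice)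
    fix n and w :: "nat \<Rightarrow> 'a"
    assume "\<And>y. y < n \<Longrightarrow> w y \<in> vunits \<and> (\<forall>i<y. \<not> w y \<approx> w i)"
    then show "\<exists>r. r \<in> vunits \<and> (\<forall>i<n. \<not> r \<approx> w i)"
      using residue_infinite[of "w ` {..<n}"] by force
  qed auto
  then obtain w :: "nat \<Rightarrow> 'a" where w: "\<And>n. w n \<in> vunits" "\<And>n i. i < n \<Longrightarrow> \<not> w n \<approx> w i" by blast
  then have "\<not> w i \<approx> w j" if "i \<noteq> j" for i j using that req_sym by (cases i j rule: linorder_cases) blast+
  with w(1) show ?thesis by (rule that)
qed

subsection \<open>Definable sets in one variable\<close>

lemma eqv_cong:
  assumes "x \<asymp> y"
  shows "r \<preceq> x \<longleftrightarrow> r \<preceq> y" "x \<preceq> r \<longleftrightarrow> y \<preceq> r" "r \<prec> x \<longleftrightarrow> r \<prec> y" "x \<prec> r \<longleftrightarrow> y \<prec> r"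
    "x \<asymp> r \<longleftrightarrow> y \<asymp> r" "r \<asymp> x \<longleftrightarrow> r \<asymp> y"
proof -
  note a = assms eqv_sym[OF assms]
  show le: "r \<preceq> x \<longleftrightarrow> r \<preceq> y" "x \<preceq> r \<longleftrightarrow> y \<preceq> r" for r
    using le_eqv_trans[OF _ a(1)] le_eqv_trans[OF _ a(2)] eqv_le_trans[OF a(1)] eqv_le_trans[OF a(2)]
    by blast+
  then show "r \<prec> x \<longleftrightarrow> r \<prec> y" "x \<prec> r \<longleftrightarrow> y \<prec> r" "x \<asymp> r \<longleftrightarrow> y \<asymp> r" "r \<asymp> x \<longleftrightarrow> r \<asymp> y"
    by (simp_all add: lt_def eqv_def)
qed

definition Df1 :: "('a \<Rightarrow> bool) \<Rightarrow> bool" where "Df1 P \<longleftrightarrow> Df (\<lambda>e. P (e 0))"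

text \<open>The relation says that \<open>Q\<close> does not separate \<open>x\<close> from
  \<open>y\<close>. Strictness also excludes the values in \<open>Q\<close> themselves, so
  \<open>sep Q x x\<close> fails exactly at the exceptional values.\<close>

definition sep where "sep Q x y \<longleftrightarrow> (\<forall>q\<in>Q. (q \<prec> x \<and> q \<prec> y) \<or> (x \<prec> q \<and> y \<prec> q))"

text \<open>If v(x) differs from v(a), then v(x - a) is the smaller of the two. So when
  \<open>x\<close> and \<open>y\<close> lie on the same side of v(a) and v(r), the condition on x -
  a is either a condition on \<open>x\<close> alone or a comparison of \<open>a\<close> with
  \<open>r\<close>.\<close>

lemma sep_ball:
  assumes "a \<in> K" "r \<in> Kx" "x \<in> Kx" "y \<in> Kx" "sep (insert r ({a} \<inter> Kx)) x y"
  shows "(r \<preceq> x \<ominus> a \<longleftrightarrow> r \<preceq> y \<ominus> a) \<and> (r \<prec> x \<ominus> a \<longleftrightarrow> r \<prec> y \<ominus> a) \<and> x \<noteq> a \<and> y \<noteq> a"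
proof -
  have r: "(r \<preceq> x \<longleftrightarrow> r \<preceq> y) \<and> (r \<prec> x \<longleftrightarrow> r \<prec> y)"
  proof -
    have "(r \<prec> x \<and> r \<prec> y) \<or> (x \<prec> r \<and> y \<prec> r)" using assms(5) by (simp add: sep_def)
    then show ?thesis by (auto simp: lt_def)
  qed
  consider "a = \<zero>" | "a \<in> Kx" "a \<prec> x" "a \<prec> y" | "a \<in> Kx" "x \<prec> a" "y \<prec> a"
    using assms by (auto simp: sep_def)
  then show ?thesis
  proof cases
    case 1
    have "x \<ominus> \<zero> = x" "y \<ominus> \<zero> = y" using assms(3,4) by (simp_all add: a_minus_def)
    with 1 r assms show ?thesis by auto
  next
    case 2
    show ?thesis
      using eqv_cong[OF dominant_diff'[OF 2(2)]] eqv_cong[OF dominant_diff'[OF 2(3)]] 2 by auto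
  next
    case 3
    show ?thesis
      using eqv_cong[OF dominant_diff[OF 3(2)]] eqv_cong[OF dominant_diff[OF 3(3)]] 3 r by auto
  qed
qed

text \<open>The centre \<open>a\<close> need not be integral. If v(x - a) < 0, then x - y is too
  close to \<open>\<zero>\<close> to change this value; otherwise both differences are
  units.\<close>

lemma sep_residue:
  assumes "a \<in> K" "x \<in> vring" "y \<in> vring" "\<not> x \<approx> a" "\<not> y \<approx> a"
  shows "x \<ominus> a \<asymp> y \<ominus> a"
proof -
  have k: "x \<ominus> a \<preceq> \<one>" "y \<ominus> a \<preceq> \<one>" "x \<in> K" "y \<in> K"
    using assms not_lt[of "\<one>" "x \<ominus> a"] not_lt[of "\<one>" "y \<ominus> a"] by (auto simp: req_def)
  have xy: "\<one> \<preceq> x \<ominus> y" "\<one> \<preceq> y \<ominus> x" using vring_diff assms by (auto simp: vring_def)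
  consider "x \<ominus> a \<prec> \<one>" | "y \<ominus> a \<prec> \<one>" | "x \<ominus> a \<asymp> \<one>" "y \<ominus> a \<asymp> \<one>"
    using k by (auto simp: lt_def eqv_def)
  then show ?thesis
  proof cases
    case 1
    then have "x \<ominus> a \<prec> x \<ominus> y" using xy lt_le_trans by blast
    then show ?thesis using diff_eqv_replace k assms(1) eqv_sym by blast
  next
    case 2
    then have "y \<ominus> a \<prec> y \<ominus> x" using xy lt_le_trans by blast
    then show ?thesis using diff_eqv_replace k assms(1) by blast
  next
    case 3
    then show ?thesis using eqv_trans eqv_sym by blast
  qed
qed

text \<open>C-minimality seen along the valuation: by \<open>sep_ball\<close> each centre
  contributes its value and each ball also its radius to the finite set of exceptional
  values.\<close>

lemma value_cells:
  assumes "Df1 P"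
  obtains Q where "finite Q" "Q \<subseteq> Kx" "\<And>x y. x \<in> Kx \<Longrightarrow> y \<in> Kx \<Longrightarrow> sep Q x y \<Longrightarrow> P x = P y"
proof -
  have "\<exists>Q. finite Q \<and> Q \<subseteq> Kx \<and> (\<forall>x\<in>Kx. \<forall>y\<in>Kx. sep Q x y \<longrightarrow> (x \<in> {x \<in> K. P x}) = (y \<in> {x \<in> K. P x}))"
  proof (rule bool_combs_agree[OF cmin[of P, OF assms[unfolded Df1_def]] Kx_sub])
    fix A assume "A \<in> {B. \<exists>a\<in>K. \<exists>r\<in>K - {\<zero>}. B = {x. r \<preceq> x \<ominus> a \<and> x \<in> K} \<or>
          B = {x. r \<prec> x \<ominus> a \<and> x \<in> K}} \<union> {{a} |a. a \<in> K}"
    then consider a r where "a \<in> K" "r \<in> Kx" "A = {x. r \<preceq> x \<ominus> a \<and> x \<in> K} \<or> A = {x. r \<prec> x \<ominus> a \<and> x \<in> K}"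
      | a where "a \<in> K" "A = {a}"
      unfolding Kx_def by blast
    then show "\<exists>Q. finite Q \<and> Q \<subseteq> Kx \<and> (\<forall>x\<in>Kx. \<forall>y\<in>Kx. sep Q x y \<longrightarrow> (x \<in> A) = (y \<in> A))"
    proof cases
      case (1 a r)
      have "(x \<in> A) = (y \<in> A)" if "x \<in> Kx" "y \<in> Kx" "sep (insert r ({a} \<inter> Kx)) x y" for x y
        using sep_ball[OF 1(1,2) that] 1(3) that by auto
      then show ?thesis using 1 by (intro exI[of _ "insert r ({a} \<inter> Kx)"]) auto
    next
      case (2 a)
      have "(x \<in> A) = (y \<in> A)" if "x \<in> Kx" "y \<in> Kx" "sep (insert \<one> ({a} \<inter> Kx)) x y" for x y
        using sep_ball[OF 2(1) _ that] 2 by auto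
      then show ?thesis using 2 by (intro exI[of _ "insert \<one> ({a} \<inter> Kx)"]) auto
    qed
  qed (auto simp: sep_def)
  then show ?thesis using that by auto
qed

text \<open>The trace of strong minimality of k: a ball or a point cuts the valuation ring
  nontrivially only inside the residue class of its centre.\<close>

lemma residue_cells:
  assumes "Df1 P"
  obtains Q where "finite Q" "Q \<subseteq> K"
    "\<And>x y. x \<in> vring \<Longrightarrow> y \<in> vring \<Longrightarrow> \<forall>q\<in>Q. \<not> x \<approx> q \<and> \<not> y \<approx> q \<Longrightarrow> P x = P y"
proof -
  have "\<exists>Q. finite Q \<and> Q \<subseteq> K \<and> (\<forall>x\<in>vring. \<forall>y\<in>vring. (\<forall>q\<in>Q. \<not> x \<approx> q \<and> \<not> y \<approx> q) \<longrightarrow>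
      (x \<in> {x \<in> K. P x}) = (y \<in> {x \<in> K. P x}))"
  proof (rule bool_combs_agree[OF cmin[of P, OF assms[unfolded Df1_def]] vring_sub])
    fix A assume "A \<in> {B. \<exists>a\<in>K. \<exists>r\<in>K - {\<zero>}. B = {x. r \<preceq> x \<ominus> a \<and> x \<in> K} \<or>
          B = {x. r \<prec> x \<ominus> a \<and> x \<in> K}} \<union> {{a} |a. a \<in> K}"
    then obtain a where a: "a \<in> K" "A = {a} \<or> (\<exists>r. A = {x. r \<preceq> x \<ominus> a \<and> x \<in> K} \<or> A = {x. r \<prec> x \<ominus> a \<and> x \<in> K})"
      by blast
    have agree: "(x \<in> A) = (y \<in> A)" if "x \<in> vring" "y \<in> vring" "\<not> x \<approx> a" "\<not> y \<approx> a" for x y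
      using eqv_cong[OF sep_residue[OF a(1) that]] a that by auto
    show "\<exists>Q. finite Q \<and> Q \<subseteq> K \<and> (\<forall>x\<in>vring. \<forall>y\<in>vring.
        (\<forall>q\<in>Q. \<not> x \<approx> q \<and> \<not> y \<approx> q) \<longrightarrow> (x \<in> A) = (y \<in> A))"
      by (intro exI[of _ "{a}"] conjI ballI impI agree) (use a(1) in simp_all)
  qed auto
  then obtain Q where Q: "finite Q" "Q \<subseteq> K" and agree: "\<forall>x\<in>vring. \<forall>y\<in>vring.
      (\<forall>q\<in>Q. \<not> x \<approx> q \<and> \<not> y \<approx> q) \<longrightarrow> (x \<in> {x \<in> K. P x}) = (y \<in> {x \<in> K. P x})" by blast
  show ?thesis
  proof (rule that[OF Q])
    fix x y assume "x \<in> vring" "y \<in> vring" "\<forall>q\<in>Q. \<not> x \<approx> q \<and> \<not> y \<approx> q"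
    from agree[rule_format, OF this(1,2)] this show "P x = P y" by simp
  qed
qed

lemma sep_nbhd:
  assumes "finite Q" "Q \<subseteq> Kx" "x \<in> Kx" "\<forall>q\<in>Q. \<not> q \<asymp> x"
  obtains p p' where "p \<in> Kx" "p' \<in> Kx" "p \<prec> x" "x \<prec> p'" "\<And>z. p \<prec> z \<Longrightarrow> z \<prec> p' \<Longrightarrow> sep Q x z"
proof -
  \<comment> \<open>\<open>b\<close> and \<open>b'\<close> bound the interval when \<open>Q\<close>
    has no element on that side.\<close>
  obtain b where b: "b \<in> Kx" "b \<prec> x" using below_exists[OF assms(3)] .
  obtain b' where b': "b' \<in> Kx" "x \<prec> b'" using above_exists[OF assms(3)] .
  define A B where "A = insert b {q \<in> Q. q \<prec> x}" and "B = insert b' {q \<in> Q. x \<prec> q}"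
  have "finite A" "A \<noteq> {}" "A \<subseteq> K" "finite B" "B \<noteq> {}" "B \<subseteq> K"
    using assms b b' by (auto simp: A_def B_def)
  then obtain p p' where p: "p \<in> A" "\<forall>q\<in>A. q \<preceq> p" "p' \<in> B" "\<forall>q\<in>B. p' \<preceq> q"
    using finite_le_max[of A] finite_le_min[of B] by metis
  show ?thesis
  proof (rule that[of p p'])
    show "p \<in> Kx" "p' \<in> Kx" "p \<prec> x" "x \<prec> p'" using p b b' assms by (auto simp: A_def B_def)
    fix z assume z: "p \<prec> z" "z \<prec> p'"
    have "(q \<prec> x \<and> q \<prec> z) \<or> (x \<prec> q \<and> z \<prec> q)" if "q \<in> Q" for q
    proof -
      have "q \<prec> x \<or> x \<prec> q" using not_eqv[of q x] assms that by auto
      then show ?thesis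
        using p(2,4) z le_lt_trans lt_le_trans that unfolding A_def B_def by blast
    qed
    then show "sep Q x z" by (auto simp: sep_def)
  qed
qed

lemma locally_constant:
  assumes "Df1 P"
  obtains Q where "finite Q" "Q \<subseteq> Kx" "\<And>x. x \<in> Kx \<Longrightarrow> \<forall>q\<in>Q. \<not> q \<asymp> x \<Longrightarrow>
    \<exists>p\<in>Kx. \<exists>p'\<in>Kx. p \<prec> x \<and> x \<prec> p' \<and> (\<forall>z. p \<prec> z \<and> z \<prec> p' \<longrightarrow> P z = P x)"
proof -
  obtain Q where Q: "finite Q" "Q \<subseteq> Kx" "\<And>x y. x \<in> Kx \<Longrightarrow> y \<in> Kx \<Longrightarrow> sep Q x y \<Longrightarrow> P x = P y"
    using value_cells[OF assms] by blast
  show ?thesis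
  proof (rule that[OF Q(1,2)])
    fix x assume x: "x \<in> Kx" "\<forall>q\<in>Q. \<not> q \<asymp> x"
    obtain p p' where p: "p \<in> Kx" "p' \<in> Kx" "p \<prec> x" "x \<prec> p'" "\<And>z. p \<prec> z \<Longrightarrow> z \<prec> p' \<Longrightarrow> sep Q x z"
      using sep_nbhd[OF Q(1,2) x] by blast
    have "P z = P x" if "p \<prec> z" "z \<prec> p'" for z
      using Q(3)[OF x(1) lt_nz[OF that(2)] p(5)[OF that]] by simp
    with p show "\<exists>p\<in>Kx. \<exists>p'\<in>Kx. p \<prec> x \<and> x \<prec> p' \<and> (\<forall>z. p \<prec> z \<and> z \<prec> p' \<longrightarrow> P z = P x)"
      by blast
  qed
qed

lemma left_germ:
  assumes "Df1 P" "c \<in> Kx"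
  obtains p where "p \<in> Kx" "p \<prec> c" "\<And>x y. p \<prec> x \<Longrightarrow> x \<prec> c \<Longrightarrow> p \<prec> y \<Longrightarrow> y \<prec> c \<Longrightarrow> P x = P y"
proof -
  obtain Q where Q: "finite Q" "Q \<subseteq> Kx" "\<And>x y. x \<in> Kx \<Longrightarrow> y \<in> Kx \<Longrightarrow> sep Q x y \<Longrightarrow> P x = P y"
    using value_cells[OF assms(1)] by blast
  obtain b where b: "b \<in> Kx" "b \<prec> c" using below_exists[OF assms(2)] .
  define A where "A = insert b {q \<in> Q. q \<prec> c}"
  have "finite A" "A \<noteq> {}" "A \<subseteq> K" using Q b by (auto simp: A_def)
  then obtain p where p: "p \<in> A" "\<forall>q\<in>A. q \<preceq> p" using finite_le_max[of A] by metis
  show ?thesis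
  proof (rule that[of p])
    show "p \<in> Kx" "p \<prec> c" using p b Q by (auto simp: A_def)
    fix x y assume xy: "p \<prec> x" "x \<prec> c" "p \<prec> y" "y \<prec> c"
    have "(q \<prec> x \<and> q \<prec> y) \<or> (x \<prec> q \<and> y \<prec> q)" if "q \<in> Q" for q
    proof (cases "q \<prec> c")
      case True
      then show ?thesis using p(2) xy le_lt_trans that unfolding A_def by blast
    next
      case False
      then have "c \<preceq> q" using not_lt that Q(2) assms(2) by auto
      then show ?thesis using xy lt_le_trans by blast
    qed
    then have "sep Q x y" by (auto simp: sep_def)
    then show "P x = P y" using Q(3) xy lt_nz by blast
  qed
qed

text \<open>O-minimality of \<Gamma> for initial segments; it replaces suprema, which \<Gamma> need
  not have in general. Membership is constant between the largest exceptional value \<open>c\<close>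
  inside and the smallest one \<open>d\<close> outside, so the cut falls right after
  \<open>c\<close> or right before \<open>d\<close>.\<close>

lemma cut_endpoint:
  assumes "Df1 A" and down: "\<And>x y. A x \<Longrightarrow> y \<preceq> x \<Longrightarrow> x \<in> Kx \<Longrightarrow> A y"
  shows "(\<forall>x\<in>Kx. A x) \<or> (\<forall>x\<in>Kx. \<not> A x) \<or> (\<exists>c\<in>Kx. (\<forall>x\<in>Kx. A x \<longleftrightarrow> x \<preceq> c) \<or> (\<forall>x\<in>Kx. A x \<longleftrightarrow> x \<prec> c))"
proof (cases "(\<forall>x\<in>Kx. A x) \<or> (\<forall>x\<in>Kx. \<not> A x)")
  case False
  then obtain a n where an: "a \<in> Kx" "A a" "n \<in> Kx" "\<not> A n" by blast
  obtain Q where Q: "finite Q" "Q \<subseteq> Kx" "\<And>x y. x \<in> Kx \<Longrightarrow> y \<in> Kx \<Longrightarrow> sep Q x y \<Longrightarrow> A x = A y"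
    using value_cells[OF assms(1)] by blast
  \<comment> \<open>The known member \<open>a\<close> and nonmember \<open>n\<close> keep both sets
    nonempty.\<close>
  define V W where "V = insert a {q \<in> Q. A q}" and "W = insert n {q \<in> Q. \<not> A q}"
  have "finite V" "V \<noteq> {}" "V \<subseteq> K" "finite W" "W \<noteq> {}" "W \<subseteq> K"
    using Q an by (auto simp: V_def W_def)
  then obtain c d where c: "c \<in> V" "\<forall>q\<in>V. q \<preceq> c" and d: "d \<in> W" "\<forall>q\<in>W. d \<preceq> q"
    using finite_le_max[of V] finite_le_min[of W] by metis
  have cd: "c \<in> Kx" "d \<in> Kx" "A c" "\<not> A d" using c d Q an by (auto simp: V_def W_def)
  have const: "A x = A y" if "c \<prec> x" "x \<prec> d" "c \<prec> y" "y \<prec> d" for x y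
  proof -
    have "(q \<prec> x \<and> q \<prec> y) \<or> (x \<prec> q \<and> y \<prec> q)" if "q \<in> Q" for q
      using c(2) d(2) \<open>c \<prec> x\<close> \<open>x \<prec> d\<close> \<open>c \<prec> y\<close> \<open>y \<prec> d\<close> le_lt_trans lt_le_trans that
      unfolding V_def W_def by blast
    then have "sep Q x y" by (auto simp: sep_def)
    then show ?thesis using Q(3) that lt_nz by blast
  qed
  have up: "\<not> A x" if "d \<preceq> x" "x \<in> Kx" for x using down[of x d] that cd by blast
  have dn: "A x" if "x \<preceq> c" for x using down[of c x] that cd by blast
  show ?thesis
  proof (cases "\<exists>z. c \<prec> z \<and> z \<prec> d \<and> A z")
    case True
    then obtain z where z: "c \<prec> z" "z \<prec> d" "A z" by blast
    have "A x \<longleftrightarrow> x \<prec> d" if "x \<in> Kx" for x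
    proof
      assume "A x" then show "x \<prec> d" using up[of x] not_le[of d x] that cd by blast
    next
      assume "x \<prec> d"
      show "A x"
      proof (cases "x \<preceq> c")
        case False
        then have "c \<prec> x" using not_le that cd by auto
        then show ?thesis using const z \<open>x \<prec> d\<close> by blast
      qed (rule dn)
    qed
    then show ?thesis using cd(2) by blast
  next
    case False
    have "A x \<longleftrightarrow> x \<preceq> c" if "x \<in> Kx" for x
      using dn[of x] False up[of x] not_le[of x c] not_le[of d x] that cd by blast
    then show ?thesis using cd(1) by blast
  qed
qed blast

end

context cmin_field
begin

subsection \<open>Germs at zero\<close>

text \<open>Truth on a punctured ball around \<open>\<zero>\<close>. On definable properties this
  behaves like a complete type: \<open>ev\<close> commutes with negation by
  \<open>ev_dichotomy\<close>.\<close>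

definition ev :: "('a \<Rightarrow> bool) \<Rightarrow> bool" where
  "ev P \<longleftrightarrow> (\<exists>d\<in>Kx. \<forall>x\<in>Kx. d \<preceq> x \<longrightarrow> P x)"

lemma evI: "d \<in> Kx \<Longrightarrow> (\<And>x. x \<in> Kx \<Longrightarrow> d \<preceq> x \<Longrightarrow> P x) \<Longrightarrow> ev P"
  by (auto simp: ev_def)

lemma ev_mono: assumes "ev P" "\<And>x. x \<in> Kx \<Longrightarrow> P x \<Longrightarrow> Q x" shows "ev Q"
  using assms unfolding ev_def by blast

lemma ev_conj: assumes "ev P" "ev Q" shows "ev (\<lambda>x. P x \<and> Q x)"
proof -
  obtain d where d: "d \<in> Kx" "\<forall>x\<in>Kx. d \<preceq> x \<longrightarrow> P x" using assms(1) unfolding ev_def by blast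
  obtain d' where d': "d' \<in> Kx" "\<forall>x\<in>Kx. d' \<preceq> x \<longrightarrow> Q x" using assms(2) unfolding ev_def by blast
  consider "d \<preceq> d'" | "d' \<preceq> d" using le_total d d' by blast
  then show ?thesis
  proof cases
    case 1
    show ?thesis by (rule evI[OF d'(1)]) (use d d' 1 le_trans in blast)
  next
    case 2
    show ?thesis by (rule evI[OF d(1)]) (use d d' 2 le_trans in blast)
  qed
qed

lemma ev_mono2:
  assumes "ev P" "ev Q" "\<And>x. x \<in> Kx \<Longrightarrow> P x \<Longrightarrow> Q x \<Longrightarrow> S x" shows "ev S"
  by (rule ev_mono[OF ev_conj[OF assms(1,2)]]) (use assms(3) in blast)

lemma ev_True [simp]: "ev (\<lambda>x. True)"
  by (rule evI[OF one_Kx]) simp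

lemma ev_above: "b \<in> Kx \<Longrightarrow> ev (\<lambda>x. b \<preceq> x)"
  by (rule evI)

lemma ev_gt: assumes "b \<in> Kx" shows "ev (\<lambda>x. b \<prec> x)"
proof -
  obtain z where "z \<in> Kx" "b \<prec> z" using above_exists[OF assms] .
  then show ?thesis by (intro evI[of z]) (auto intro: lt_le_trans)
qed

lemma ev_ex: assumes "ev P" obtains x where "x \<in> Kx" "P x"
  using assms unfolding ev_def by (metis le_refl Kx_K)

lemma ev_False [simp]: "\<not> ev (\<lambda>x. False)"
  using ev_ex by blast

lemma ev_scale:
  assumes "ev P" "b \<in> Kx"
  shows "ev (\<lambda>x. P (b \<otimes> x))"
proof -
  obtain d where d: "d \<in> Kx" "\<forall>x\<in>Kx. d \<preceq> x \<longrightarrow> P x" using assms(1) unfolding ev_def by blast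
  show ?thesis
  proof (rule evI[of "d \<oslash> b"])
    fix x assume x: "x \<in> Kx" "d \<oslash> b \<preceq> x"
    then have "d \<preceq> b \<otimes> x" using d(1) assms(2) by (simp add: div_le_iff m_comm)
    then show "P (b \<otimes> x)" using d x assms(2) by simp
  qed (use d assms in simp)
qed

lemma ev_finite: "finite A \<Longrightarrow> (\<And>a. a \<in> A \<Longrightarrow> ev (P a)) \<Longrightarrow> ev (\<lambda>x. \<forall>a\<in>A. P a x)"
proof (induction A rule: finite_induct)
  case (insert a A)
  then have "ev (P a)" "ev (\<lambda>x. \<forall>a\<in>A. P a x)" by blast+
  then show ?case by (rule ev_mono2) blast
qed simp

text \<open>Beyond the finitely many exceptional values there is a single cell.\<close>

lemma ev_dichotomy: assumes "Df1 P" shows "ev P \<or> ev (\<lambda>x. \<not> P x)"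
proof -
  obtain Q where Q: "finite Q" "Q \<subseteq> Kx" "\<And>x y. x \<in> Kx \<Longrightarrow> y \<in> Kx \<Longrightarrow> sep Q x y \<Longrightarrow> P x = P y"
    using value_cells[OF assms] by blast
  have "ev (\<lambda>x. \<forall>q\<in>Q. q \<prec> x)" using Q(1,2) by (intro ev_finite ev_gt) blast+
  then obtain d where d: "d \<in> Kx" "\<forall>x\<in>Kx. d \<preceq> x \<longrightarrow> (\<forall>q\<in>Q. q \<prec> x)" unfolding ev_def by blast
  have agree: "P x = P d" if "x \<in> Kx" "d \<preceq> x" for x
    by (rule Q(3)) (use d that in \<open>auto simp: sep_def\<close>)
  show ?thesis
  proof (cases "P d")
    case True
    have "ev P" by (rule evI[OF d(1)]) (use agree True in blast)
    then show ?thesis ..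
  next
    case False
    have "ev (\<lambda>x. \<not> P x)" by (rule evI[OF d(1)]) (use agree False in blast)
    then show ?thesis ..
  qed
qed

lemma ev_not_iff: assumes "Df1 P" shows "\<not> ev P \<longleftrightarrow> ev (\<lambda>x. \<not> P x)"
proof
  assume "ev (\<lambda>x. \<not> P x)"
  then show "\<not> ev P" using ev_mono2[of "\<lambda>x. \<not> P x" P "\<lambda>x. False"] by auto
qed (use ev_dichotomy[OF assms] in blast)

lemma Df_ev [df]: assumes "Df (\<lambda>e. Q (e 0) (\<lambda>i. e (Suc i)))" shows "Df (\<lambda>e. ev (\<lambda>x. Q x e))"
proof -
  have "inj (\<lambda>i. if i = 0 then 0 else Suc i)" by (auto simp: inj_def)
  from Df_reindex[OF assms this] have q: "Df (\<lambda>e. Q (e 0) (\<lambda>i. e (Suc (Suc i))))" by simp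
  show ?thesis unfolding ev_def by (intro Df_quant Df_imp Df_le Dt_var q)
qed

text \<open>By saturation \<Gamma> has uncountable cofinality. Radii chosen for each member of a
  sequence thus have a common refinement, the source of all uniformity below.\<close>

lemma countable_bound:
  assumes "\<And>n :: nat. q n \<in> Kx"
  shows "\<exists>d\<in>Kx. \<forall>n. q n \<preceq> d"
proof -
  have "\<exists>x\<in>K. \<forall>n. x \<in> Kx \<and> q n \<preceq> x"
  proof (rule saturation)
    show "Df (\<lambda>e. e 0 \<in> Kx \<and> q n \<preceq> e 0)" for n using assms[of n] by (intro df) auto
    show "\<exists>x\<in>K. \<forall>i<n. x \<in> Kx \<and> q i \<preceq> x" for n
    proof -
      have "\<exists>m\<in>q ` {..n}. \<forall>y\<in>q ` {..n}. y \<preceq> m" by (rule finite_le_max) (use assms in auto)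
      then obtain m where "\<forall>i\<le>n. q i \<preceq> q m" by auto
      then show ?thesis using assms by (intro bexI[of _ "q m"]) auto
    qed
  qed
  then show ?thesis by auto
qed

subsection \<open>Uniformity over residue classes\<close>

text \<open>A countable witness for the infinitude of k; countable so that
  \<open>countable_bound\<close> applies to radii chosen along it.\<close>

definition res_seq :: "(nat \<Rightarrow> 'a) \<Rightarrow> bool" where
  "res_seq w \<longleftrightarrow> (\<forall>n. w n \<in> vunits) \<and> (\<forall>i j. i \<noteq> j \<longrightarrow> \<not> w i \<approx> w j)"

lemma res_seq_exists: obtains w where "res_seq w"
  using residue_sequence unfolding res_seq_def by metis

lemma res_seq_units: "res_seq w \<Longrightarrow> w n \<in> vunits"
  by (simp add: res_seq_def)

lemma res_seq_avoid: assumes "res_seq w" "finite Q" shows "finite {n. \<exists>q\<in>Q. w n \<approx> q}"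
proof -
  have "finite {n. w n \<approx> q}" for q
  proof (cases "\<exists>m. w m \<approx> q")
    case True
    then obtain m where "w m \<approx> q" by blast
    then have "{n. w n \<approx> q} \<subseteq> {m}"
      using assms(1) req_sym req_trans unfolding res_seq_def by blast
    then show ?thesis using finite_subset by blast
  qed simp
  moreover have "{n. \<exists>q\<in>Q. w n \<approx> q} = (\<Union>q\<in>Q. {n. w n \<approx> q})" by blast
  ultimately show ?thesis using assms(2) by simp
qed

lemma cofinite_residues:
  assumes "Df1 P" "res_seq w" "infinite {n. P (w n)}"
  obtains Q where "finite Q" "Q \<subseteq> K" "\<And>x. x \<in> vring \<Longrightarrow> \<forall>q\<in>Q. \<not> x \<approx> q \<Longrightarrow> P x"
proof -
  obtain Q where Q: "finite Q" "Q \<subseteq> K"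
    "\<And>x y. x \<in> vring \<Longrightarrow> y \<in> vring \<Longrightarrow> \<forall>q\<in>Q. \<not> x \<approx> q \<and> \<not> y \<approx> q \<Longrightarrow> P x = P y"
    using residue_cells[OF assms(1)] by blast
  have "\<not> {n. P (w n)} \<subseteq> {n. \<exists>q\<in>Q. w n \<approx> q}"
    using assms(3) res_seq_avoid[OF assms(2) Q(1)] finite_subset by blast
  then obtain n where n: "P (w n)" "\<forall>q\<in>Q. \<not> w n \<approx> q" by blast
  show ?thesis
  proof (rule that[OF Q(1,2)])
    fix x assume "x \<in> vring" "\<forall>q\<in>Q. \<not> x \<approx> q"
    then show "P x" using Q(3)[of x "w n"] n res_seq_units[OF assms(2)] by auto
  qed
qed

lemma residue_dichotomy:
  assumes "Df1 P" "res_seq w" "infinite {n. P (w n)}" "res_seq w'" "infinite {n. \<not> P (w' n)}"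
  shows False
proof -
  obtain Q where Q: "finite Q" "Q \<subseteq> K" "\<And>x. x \<in> vring \<Longrightarrow> \<forall>q\<in>Q. \<not> x \<approx> q \<Longrightarrow> P x"
    using cofinite_residues[OF assms(1-3)] by blast
  have "{n. \<not> P (w' n)} \<subseteq> {n. \<exists>q\<in>Q. w' n \<approx> q}"
    using Q(3) vunits_vring[OF res_seq_units[OF assms(4)]] by blast
  then show False using res_seq_avoid[OF assms(4) Q(1)] assms(5) finite_subset by blast
qed

text \<open>A subgroup that contains almost all classes contains every \<open>u\<close>: choose
  \<open>w n\<close> such that neither it nor its product with \<open>u\<close> falls into an
  exceptional class; then \<open>u\<close> is a quotient of two members of \<open>H\<close>.\<close>

lemma unit_subgroup_full:
  assumes "Df1 H" "res_seq w" "infinite {n. H (w n)}"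
    and mult: "\<And>u v. u \<in> vunits \<Longrightarrow> v \<in> vunits \<Longrightarrow> H u \<Longrightarrow> H v \<Longrightarrow> H (u \<otimes> v)"
    and inverse: "\<And>u. u \<in> vunits \<Longrightarrow> H u \<Longrightarrow> H (inv u)"
    and u: "u \<in> vunits"
  shows "H u"
proof -
  obtain Q where Q: "finite Q" "Q \<subseteq> K" "\<And>x. x \<in> vring \<Longrightarrow> \<forall>q\<in>Q. \<not> x \<approx> q \<Longrightarrow> H x"
    using cofinite_residues[OF assms(1-3)] by blast
  have "finite {n. \<exists>q\<in>Q \<union> (\<lambda>q. q \<otimes> inv u) ` Q. w n \<approx> q}"
    using Q(1) by (intro res_seq_avoid[OF assms(2)]) blast
  then obtain n where n: "\<forall>q\<in>Q \<union> (\<lambda>q. q \<otimes> inv u) ` Q. \<not> w n \<approx> q"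
    using ex_new_if_finite[OF infinite_UNIV_nat, of "{n. \<exists>q\<in>Q \<union> (\<lambda>q. q \<otimes> inv u) ` Q. w n \<approx> q}"] by auto
  have w: "w n \<in> vunits" by (rule res_seq_units[OF assms(2)])
  have "\<not> w n \<otimes> u \<approx> q" if "q \<in> Q" for q
  proof
    assume "w n \<otimes> u \<approx> q"
    then have "w n \<otimes> u \<otimes> inv u \<approx> q \<otimes> inv u" using u by (intro req_mult) auto
    then have "w n \<approx> q \<otimes> inv u" using u w by (simp add: m_assoc)
    then show False using n that by blast
  qed
  then have "H (w n \<otimes> u)" using u w by (intro Q(3)) auto
  moreover have "H (inv (w n))" using n w by (intro inverse Q(3)) auto
  ultimately have "H (inv (w n) \<otimes> (w n \<otimes> u))"
    using mult[of "inv (w n)" "w n \<otimes> u"] u w by simp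
  moreover have "inv (w n) \<otimes> (w n \<otimes> u) = u" using u w by (simp flip: m_assoc)
  ultimately show ?thesis by simp
qed

text \<open>The quantifiers are exchanged in two moves: \<open>countable_bound\<close> gives one
  \<open>d\<close> for a sequence of units with distinct residues, and the units that are good for
  this \<open>d\<close> form a definable group.\<close>

lemma uniform_units:
  assumes "\<And>d. d \<in> Kx \<Longrightarrow> Df1 (S d)"
    and mono: "\<And>d d' u. S d u \<Longrightarrow> d \<preceq> d' \<Longrightarrow> d' \<in> Kx \<Longrightarrow> S d' u"
    and ex: "\<And>u. u \<in> vunits \<Longrightarrow> \<exists>d\<in>Kx. S d u"
    and mult: "\<And>d u v. d \<in> Kx \<Longrightarrow> u \<in> vunits \<Longrightarrow> v \<in> vunits \<Longrightarrow> S d u \<Longrightarrow> S d v \<Longrightarrow> S d (u \<otimes> v)"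
    and inverse: "\<And>d u. d \<in> Kx \<Longrightarrow> u \<in> vunits \<Longrightarrow> S d u \<Longrightarrow> S d (inv u)"
  shows "\<exists>d\<in>Kx. \<forall>u\<in>vunits. S d u"
proof -
  obtain w where w: "res_seq w" by (rule res_seq_exists)
  then have "\<forall>n. \<exists>d\<in>Kx. S d (w n)" using ex res_seq_units by blast
  then obtain q where q: "\<And>n. q n \<in> Kx" "\<And>n. S (q n) (w n)" by metis
  obtain d where d: "d \<in> Kx" "\<forall>n. q n \<preceq> d" using countable_bound[of q] q(1) by blast
  then have "S d (w n)" for n using mono q by blast
  then have "infinite {n. S d (w n)}" by simp
  then have "S d u" if "u \<in> vunits" for u
    using unit_subgroup_full[OF assms(1)[OF d(1)] w] mult[OF d(1)] inverse[OF d(1)] that by blast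
  then show ?thesis using d(1) by blast
qed

lemma inv_div: "x \<in> Kx \<Longrightarrow> y \<in> Kx \<Longrightarrow> \<one> \<oslash> (x \<oslash> y) = y \<oslash> x"
  by (simp add: div_Kx_eq nonzero_inverse_mult_distrib nonzero_imp_inverse_nonzero
      nonzero_inverse_inverse_eq m_comm)

lemma unit_cancel: "u \<in> vunits \<Longrightarrow> x \<in> K \<Longrightarrow> u \<otimes> (inv u \<otimes> x) = x"
  by (simp flip: m_assoc)

text \<open>Replacing x by x / u turns \<open>P u\<close> into \<open>P'\<close> at the inverse of
  \<open>u\<close>. Off finitely many residue classes \<open>P\<close> and \<open>P'\<close> are
  constant, hence blind to inversion; since they exclude each other, neither holds at a generic
  \<open>u\<close>. So \<open>H\<close> holds on almost all classes and, being a group,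
  everywhere.\<close>

lemma value_invariant:
  assumes f: "deffun f"
  shows "\<exists>d\<in>Kx. \<forall>u\<in>vunits. \<forall>x\<in>Kx. d \<preceq> x \<longrightarrow> f (u \<otimes> x) \<asymp> f x"
proof -
  have fK: "f x \<in> K" if "x \<in> K" for x using deffun_closed[OF f that] .
  define H P P' where "H u \<longleftrightarrow> ev (\<lambda>x. f (u \<otimes> x) \<asymp> f x)" and "P u \<longleftrightarrow> ev (\<lambda>x. f x \<prec> f (u \<otimes> x))"
    and "P' u \<longleftrightarrow> ev (\<lambda>x. f (u \<otimes> x) \<prec> f x)" for u
  have df1: "Df1 H" "Df1 P" "Df1 P'"
    unfolding H_def P_def P'_def Df1_def by (intro df Dt_fun1[OF f])+
  have tri: "H u \<or> P u \<or> P' u" if "u \<in> vunits" for u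
  proof -
    have "Df1 (\<lambda>x. f x \<prec> f (u \<otimes> x))" "Df1 (\<lambda>x. f (u \<otimes> x) \<prec> f x)"
      unfolding Df1_def using that by (intro df Dt_fun1[OF f]; simp)+
    then consider "P u" | "P' u" | "ev (\<lambda>x. \<not> f x \<prec> f (u \<otimes> x))" "ev (\<lambda>x. \<not> f (u \<otimes> x) \<prec> f x)"
      using ev_dichotomy unfolding P_def P'_def by blast
    then show ?thesis
    proof cases
      case 3
      then have "H u" unfolding H_def
        by (rule ev_mono2) (use that fK in \<open>auto simp: not_lt eqv_def\<close>)
      then show ?thesis by blast
    qed auto
  qed
  have excl: "\<not> (P u \<and> P' u)" for u
  proof
    assume "P u \<and> P' u"
    then have "ev (\<lambda>x. f x \<prec> f (u \<otimes> x) \<and> f (u \<otimes> x) \<prec> f x)"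
      unfolding P_def P'_def by (intro ev_conj) auto
    then show False using lt_trans lt_irrefl by (blast elim: ev_ex)
  qed
  have PP: "P' (inv u)" if "u \<in> vunits" "P u" for u
    unfolding P'_def using ev_scale[OF that(2)[unfolded P_def] vunits_Kx[OF vunits_inv[OF that(1)]]]
    by (rule ev_mono) (use that(1) in \<open>simp add: unit_cancel\<close>)
  have P'P: "P (inv u)" if "u \<in> vunits" "P' u" for u
    unfolding P_def using ev_scale[OF that(2)[unfolded P'_def] vunits_Kx[OF vunits_inv[OF that(1)]]]
    by (rule ev_mono) (use that(1) in \<open>simp add: unit_cancel\<close>)
  obtain w where w: "res_seq w" by (rule res_seq_exists)
  obtain Q where Q: "finite Q" "Q \<subseteq> K"
    "\<And>x y. x \<in> vring \<Longrightarrow> y \<in> vring \<Longrightarrow> \<forall>q\<in>Q. \<not> x \<approx> q \<and> \<not> y \<approx> q \<Longrightarrow> P x = P y"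
    using residue_cells[OF df1(2)] by blast
  obtain Q' where Q': "finite Q'" "Q' \<subseteq> K"
    "\<And>x y. x \<in> vring \<Longrightarrow> y \<in> vring \<Longrightarrow> \<forall>q\<in>Q'. \<not> x \<approx> q \<and> \<not> y \<approx> q \<Longrightarrow> P' x = P' y"
    using residue_cells[OF df1(3)] by blast
  \<comment> \<open>Besides the exceptional classes their inverses are avoided, so that
    \<open>w n\<close> and its inverse are both generic.\<close>
  define B where "B = (Q \<union> Q') \<union> (\<lambda>q. inv q) ` ((Q \<union> Q') \<inter> vunits)"
  have "H (w n)" if n: "\<forall>q\<in>B. \<not> w n \<approx> q" for n
  proof -
    have wn: "w n \<in> vunits" by (rule res_seq_units[OF w])
    have "\<not> inv (w n) \<approx> q" if "q \<in> Q \<union> Q'" for q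
    proof
      assume a: "inv (w n) \<approx> q"
      then have q: "q \<in> vunits" using req_unit wn by auto
      have "inv (w n) \<otimes> (w n \<otimes> inv q) \<approx> q \<otimes> (w n \<otimes> inv q)" using a wn q by (intro req_mult) auto
      moreover have "inv (w n) \<otimes> (w n \<otimes> inv q) = inv q" "q \<otimes> (w n \<otimes> inv q) = w n"
        using wn q m_lcomm[of q "w n" "inv q"] by (simp_all flip: m_assoc)
      ultimately have "w n \<approx> inv q" using req_sym by simp
      then show False using n that q unfolding B_def by blast
    qed
    then have avoid: "\<forall>q\<in>Q. \<not> w n \<approx> q \<and> \<not> inv (w n) \<approx> q" "\<forall>q\<in>Q'. \<not> w n \<approx> q \<and> \<not> inv (w n) \<approx> q"
      using n unfolding B_def by blast+
    have "P (w n) = P (inv (w n))" by (rule Q(3)[OF _ _ avoid(1)]) (use wn in auto)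
    moreover have "P' (w n) = P' (inv (w n))" by (rule Q'(3)[OF _ _ avoid(2)]) (use wn in auto)
    ultimately show ?thesis using tri[OF wn] PP[OF wn] P'P[OF wn] excl by blast
  qed
  then have "- {n. \<exists>q\<in>B. w n \<approx> q} \<subseteq> {n. H (w n)}" by blast
  moreover have "finite {n. \<exists>q\<in>B. w n \<approx> q}"
    using Q(1) Q'(1) unfolding B_def by (intro res_seq_avoid[OF w]) blast
  ultimately have inf: "infinite {n. H (w n)}" using finite_subset by (metis finite_compl infinite_UNIV_nat)
  have Hu: "H u" if "u \<in> vunits" for u
  proof (rule unit_subgroup_full[OF df1(1) w inf _ _ that])
    fix u v assume uv: "u \<in> vunits" "v \<in> vunits" "H u" "H v"
    show "H (u \<otimes> v)" unfolding H_def
      using ev_scale[OF uv(3)[unfolded H_def] vunits_Kx[OF uv(2)]] uv(4)[unfolded H_def]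
      by (rule ev_mono2) (use uv in \<open>simp add: m_assoc, blast intro: eqv_trans\<close>)
  next
    fix u assume u: "u \<in> vunits" "H u"
    show "H (inv u)" unfolding H_def
      using ev_scale[OF u(2)[unfolded H_def] vunits_Kx[OF vunits_inv[OF u(1)]]]
      by (rule ev_mono) (use u(1) in \<open>simp add: unit_cancel eqv_sym\<close>)
  qed
  \<comment> \<open>Multiplication by a unit preserves the condition d \<preceq> x; therefore the
    units that are good for one \<open>d\<close> are closed under products and inverses.\<close>
  show ?thesis
  proof (rule uniform_units)
    show "Df1 (\<lambda>u. \<forall>x\<in>Kx. d \<preceq> x \<longrightarrow> f (u \<otimes> x) \<asymp> f x)" if "d \<in> Kx" for d
      unfolding Df1_def by (intro df Dt_fun1[OF f]) (use that in auto)
    show "\<forall>x\<in>Kx. d' \<preceq> x \<longrightarrow> f (u \<otimes> x) \<asymp> f x" if "\<forall>x\<in>Kx. d \<preceq> x \<longrightarrow> f (u \<otimes> x) \<asymp> f x" "d \<preceq> d'" for d d' u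
      using that le_trans by blast
    show "\<exists>d\<in>Kx. \<forall>x\<in>Kx. d \<preceq> x \<longrightarrow> f (u \<otimes> x) \<asymp> f x" if "u \<in> vunits" for u
      using Hu[OF that] unfolding H_def ev_def .
  next
    fix d u v assume a: "d \<in> Kx" "u \<in> vunits" "v \<in> vunits"
      "\<forall>x\<in>Kx. d \<preceq> x \<longrightarrow> f (u \<otimes> x) \<asymp> f x" "\<forall>x\<in>Kx. d \<preceq> x \<longrightarrow> f (v \<otimes> x) \<asymp> f x"
    show "\<forall>x\<in>Kx. d \<preceq> x \<longrightarrow> f (u \<otimes> v \<otimes> x) \<asymp> f x"
    proof (intro ballI impI)
      fix x assume x: "x \<in> Kx" "d \<preceq> x"
      then have "d \<preceq> v \<otimes> x" using eqv_cong(1)[OF eqv_unit_mult, of x v] a(3) by auto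
      then have "f (u \<otimes> (v \<otimes> x)) \<asymp> f (v \<otimes> x)" "f (v \<otimes> x) \<asymp> f x" using a x by auto
      then show "f (u \<otimes> v \<otimes> x) \<asymp> f x" using a x eqv_trans by (simp add: m_assoc)
    qed
  next
    fix d u assume a: "d \<in> Kx" "u \<in> vunits" "\<forall>x\<in>Kx. d \<preceq> x \<longrightarrow> f (u \<otimes> x) \<asymp> f x"
    show "\<forall>x\<in>Kx. d \<preceq> x \<longrightarrow> f (inv u \<otimes> x) \<asymp> f x"
    proof (intro ballI impI)
      fix x assume x: "x \<in> Kx" "d \<preceq> x"
      then have "d \<preceq> inv u \<otimes> x" using eqv_cong(1)[OF eqv_unit_mult, of x "inv u"] a(2) by auto
      then have "f (u \<otimes> (inv u \<otimes> x)) \<asymp> f (inv u \<otimes> x)" using a x by auto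
      then show "f (inv u \<otimes> x) \<asymp> f x" using a x eqv_sym by (simp add: unit_cancel)
    qed
  qed
qed

text \<open>Otherwise every class is left eventually. Saturation gives a \<open>d\<close> from which
  on \<open>h\<close> avoids infinitely many classes, hence all but finitely many of them; those few
  are left eventually too, and \<open>h\<close> has no residue to take.\<close>

lemma residue_constant:
  assumes h: "deffun h" and "ev (\<lambda>x. h x \<in> vring)"
  shows "\<exists>c\<in>vring. ev (\<lambda>x. h x \<approx> c)"
proof (rule ccontr)
  assume no: "\<not> ?thesis"
  have hK: "h x \<in> K" if "x \<in> K" for x using deffun_closed[OF h that] .
  have ne: "\<exists>d\<in>Kx. \<forall>x\<in>Kx. d \<preceq> x \<longrightarrow> \<not> h x \<approx> c" if "c \<in> vring" for c
  proof -
    have "Df1 (\<lambda>x. h x \<approx> c)" unfolding Df1_def using that by (intro df Dt_fun1[OF h]) simp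
    then show ?thesis using ev_not_iff no that unfolding ev_def by blast
  qed
  obtain w where w: "res_seq w" by (rule res_seq_exists)
  then have "\<forall>n. \<exists>d\<in>Kx. \<forall>x\<in>Kx. d \<preceq> x \<longrightarrow> \<not> h x \<approx> w n" using ne res_seq_units vunits_vring by blast
  then obtain q where q: "\<And>n. q n \<in> Kx" "\<And>n x. x \<in> Kx \<Longrightarrow> q n \<preceq> x \<Longrightarrow> \<not> h x \<approx> w n" by metis
  obtain d where d: "d \<in> Kx" "\<forall>n. q n \<preceq> d" using countable_bound[of q] q(1) by blast
  define P where "P c \<longleftrightarrow> (\<forall>x\<in>Kx. d \<preceq> x \<longrightarrow> \<not> h x \<approx> c)" for c
  have "P (w n)" for n unfolding P_def using q(2) d(2) le_trans by blast
  then have inf: "infinite {n. P (w n)}" by simp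
  have "Df1 P" unfolding Df1_def P_def by (intro df Dt_fun1[OF h]) (use d(1) in auto)
  then obtain Q where Q: "finite Q" "Q \<subseteq> K" "\<And>x. x \<in> vring \<Longrightarrow> \<forall>q\<in>Q. \<not> x \<approx> q \<Longrightarrow> P x"
    using cofinite_residues[OF _ w inf] by blast
  have "ev (\<lambda>x. \<forall>q\<in>Q \<inter> vring. \<not> h x \<approx> q)"
    using Q(1) ne unfolding ev_def[symmetric] by (intro ev_finite) blast+
  then have "ev (\<lambda>x. d \<preceq> x \<and> h x \<in> vring \<and> (\<forall>q\<in>Q \<inter> vring. \<not> h x \<approx> q))"
    by (intro ev_conj assms(2) ev_above d(1))
  then obtain x where x: "x \<in> Kx" "d \<preceq> x" "h x \<in> vring" "\<forall>q\<in>Q \<inter> vring. \<not> h x \<approx> q"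
    using ev_ex by blast
  have "\<not> h x \<approx> q" if "q \<in> Q" for q
  proof (cases "q \<in> vring")
    case False
    then have "q \<prec> \<one>" using Q(2) that not_le[of "\<one>" q] by (auto simp: vring_def)
    show ?thesis
    proof
      assume a: "h x \<approx> q"
      have "q \<in> K" "h x \<in> K" using Q(2) that hK x(1) by auto
      then have "q = h x \<ominus> (h x \<ominus> q)" by algebra
      moreover have "\<one> \<preceq> h x \<ominus> (h x \<ominus> q)" 
        by (rule le_diff) (use a x(3) in \<open>auto simp: req_def vring_def lt_imp_le\<close>)
      ultimately show False using False by (simp add: vring_def)
    qed
  qed (use x that in blast)
  then have "P (h x)" using Q(3) x(3) by blast
  then show False using x hK unfolding P_def by auto
qed

text \<open>The ratio f(u x) / f(x) is a unit by \<open>value_invariant\<close>, so its residue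
  settles by \<open>residue_constant\<close>. The identity f(u v x) / f(x) = f(u v x) / f(v x) * f(v
  x) / f(x) makes the good \<open>u\<close> a group, and \<open>uniform_units\<close> removes the
  dependence on \<open>u\<close>.\<close>

lemma ratio_invariant:
  assumes f: "deffun f" and nz: "ev (\<lambda>x. f x \<noteq> \<zero>)"
  obtains d where "d \<in> Kx" "\<And>x. x \<in> Kx \<Longrightarrow> d \<preceq> x \<Longrightarrow> f x \<in> Kx"
    "\<And>u x. u \<in> vunits \<Longrightarrow> x \<in> Kx \<Longrightarrow> d \<preceq> x \<Longrightarrow> f (u \<otimes> x) \<oslash> f x \<in> vunits"
    "\<And>u x x'. u \<in> vunits \<Longrightarrow> x \<in> Kx \<Longrightarrow> x' \<in> Kx \<Longrightarrow> d \<preceq> x \<Longrightarrow> d \<preceq> x' \<Longrightarrow>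
       f (u \<otimes> x) \<oslash> f x \<approx> f (u \<otimes> x') \<oslash> f x'"
proof -
  have fK: "f x \<in> K" if "x \<in> K" for x using deffun_closed[OF f that] .
  have "ev (\<lambda>x. \<forall>u\<in>vunits. f (u \<otimes> x) \<asymp> f x)"
    using value_invariant[OF f] unfolding ev_def by blast
  from ev_conj[OF this nz] obtain d0 where d0: "d0 \<in> Kx"
    "\<And>x. x \<in> Kx \<Longrightarrow> d0 \<preceq> x \<Longrightarrow> (\<forall>u\<in>vunits. f (u \<otimes> x) \<asymp> f x) \<and> f x \<noteq> \<zero>"
    unfolding ev_def by blast
  have fx: "f x \<in> Kx" if "x \<in> Kx" "d0 \<preceq> x" for x using d0(2)[OF that] fK that by auto
  have unit: "f (u \<otimes> x) \<oslash> f x \<in> vunits" if "u \<in> vunits" "x \<in> Kx" "d0 \<preceq> x" for u x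
  proof -
    have "\<one> \<asymp> f (u \<otimes> x) \<oslash> f x"
      using fx[OF that(2,3)] d0(2)[OF that(2,3)] that fK eqv_sym by (simp add: eqv_div_iff)
    then show ?thesis by (auto simp: vunits_def intro: eqv_sym)
  qed
  have le_unit: "d \<preceq> u \<otimes> x" if "d \<preceq> x" "u \<in> vunits" for d u x
    using eqv_cong(1)[OF eqv_unit_mult, of x u] that le_K by auto
  \<comment> \<open>The fixed bound \<open>d0\<close> is repeated inside \<open>S\<close> so that
    \<open>f\<close> does not vanish at the points considered, whatever \<open>d\<close> is.\<close>
  define S where "S d u \<longleftrightarrow> (\<forall>x\<in>Kx. \<forall>x'\<in>Kx. d \<preceq> x \<and> d0 \<preceq> x \<and> d \<preceq> x' \<and> d0 \<preceq> x' \<longrightarrow>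
    f (u \<otimes> x) \<oslash> f x \<approx> f (u \<otimes> x') \<oslash> f x')" for d u
  have "\<exists>d\<in>Kx. \<forall>u\<in>vunits. S d u"
  proof (rule uniform_units)
    show "Df1 (S d)" if "d \<in> Kx" for d
      unfolding Df1_def S_def by (intro df Dt_fun1[OF f]) (use that d0(1) in auto)
    show "S d' u" if "S d u" "d \<preceq> d'" for d d' u
      using that le_trans unfolding S_def by blast
  next
    fix u assume u: "u \<in> vunits"
    have "deffun (\<lambda>x. f (u \<otimes> x) \<oslash> f x)"
      using u fK by (intro deffunI div_closed df Dt_fun1[OF f]) auto
    moreover have "ev (\<lambda>x. f (u \<otimes> x) \<oslash> f x \<in> vring)"
      using unit[OF u] by (intro evI[OF d0(1)]) auto
    ultimately obtain c where "ev (\<lambda>x. f (u \<otimes> x) \<oslash> f x \<approx> c)"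
      using residue_constant by blast
    then show "\<exists>d\<in>Kx. S d u" unfolding ev_def S_def using req_sym req_trans by blast
  next
    fix d u v assume a: "d \<in> Kx" "u \<in> vunits" "v \<in> vunits" "S d u" "S d v"
    show "S d (u \<otimes> v)" unfolding S_def
    proof (intro ballI impI)
      fix x x' assume x: "x \<in> Kx" "x' \<in> Kx" and le: "d \<preceq> x \<and> d0 \<preceq> x \<and> d \<preceq> x' \<and> d0 \<preceq> x'"
      have e: "f (u \<otimes> v \<otimes> x) \<oslash> f x = f (u \<otimes> (v \<otimes> x)) \<oslash> f (v \<otimes> x) \<otimes> (f (v \<otimes> x) \<oslash> f x)"
        if "x \<in> Kx" "d0 \<preceq> x" for x
      proof -
        have k: "f (v \<otimes> x) \<in> Kx" "f x \<in> Kx" "f (u \<otimes> (v \<otimes> x)) \<in> K"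
          using fx[OF that] fx[of "v \<otimes> x"] le_unit[OF that(2) a(3)] a that fK by auto
        then have "f (u \<otimes> (v \<otimes> x)) \<oslash> f (v \<otimes> x) \<otimes> (f (v \<otimes> x) \<oslash> f x)
          = f (u \<otimes> (v \<otimes> x)) \<otimes> (inv f (v \<otimes> x) \<otimes> f (v \<otimes> x)) \<otimes> inv f x"
          unfolding div_Kx_eq[OF k(1)] div_Kx_eq[OF k(2)] by (simp add: m_assoc del: l_inv)
        then show ?thesis using k a that by (simp add: m_assoc div_Kx_eq)
      qed
      have r: "f (u \<otimes> (v \<otimes> x)) \<oslash> f (v \<otimes> x) \<approx> f (u \<otimes> (v \<otimes> x')) \<oslash> f (v \<otimes> x')"
        "f (v \<otimes> x) \<oslash> f x \<approx> f (v \<otimes> x') \<oslash> f x'"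
        using a x le le_unit unfolding S_def by auto
      have "d0 \<preceq> v \<otimes> x'" using le le_unit a(3) by blast
      then show "f (u \<otimes> v \<otimes> x) \<oslash> f x \<approx> f (u \<otimes> v \<otimes> x') \<oslash> f x'"
        unfolding e[OF x(1) conjunct1[OF conjunct2[OF le]]] e[OF x(2) conjunct2[OF conjunct2[OF conjunct2[OF le]]]]
        using req_mult2[OF r] unit[of v x] unit[of u "v \<otimes> x'"] a x le by simp
    qed
  next
    fix d u assume a: "d \<in> Kx" "u \<in> vunits" "S d u"
    show "S d (inv u)" unfolding S_def
    proof (intro ballI impI)
      fix x x' assume x: "x \<in> Kx" "x' \<in> Kx" and le: "d \<preceq> x \<and> d0 \<preceq> x \<and> d \<preceq> x' \<and> d0 \<preceq> x'"
      define y y' where "y = inv u \<otimes> x" and "y' = inv u \<otimes> x'"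
      have y: "y \<in> Kx" "y' \<in> Kx" "d \<preceq> y \<and> d0 \<preceq> y \<and> d \<preceq> y' \<and> d0 \<preceq> y'"
        using x le le_unit[of _ _ "inv u"] a(2) by (auto simp: y_def y'_def)
      have uy: "u \<otimes> y = x" "u \<otimes> y' = x'" using x a by (auto simp: y_def y'_def unit_cancel)
      have k: "f x \<in> Kx" "f x' \<in> Kx" "f y \<in> Kx" "f y' \<in> Kx" using fx x y le by auto
      have "f x \<oslash> f y \<approx> f x' \<oslash> f y'" using a(3) y uy unfolding S_def by fastforce
      moreover have "f x \<oslash> f y \<in> vunits" using unit[OF a(2) y(1)] y uy by simp
      ultimately have "f x \<oslash> f y \<doteq> f x' \<oslash> f y'" by (simp add: req_rveq)
      from rveq_div2[OF rveq_refl[OF one_Kx] this] have "\<one> \<oslash> (f x \<oslash> f y) \<doteq> \<one> \<oslash> (f x' \<oslash> f y')" .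
      moreover have "\<one> \<oslash> (f x \<oslash> f y) = f y \<oslash> f x" "\<one> \<oslash> (f x' \<oslash> f y') = f y' \<oslash> f x'"
        using k inv_div by simp_all
      moreover have "f y \<oslash> f x \<in> vunits" using unit[of "inv u" x] a x le by (simp add: y_def)
      ultimately show "f (inv u \<otimes> x) \<oslash> f x \<approx> f (inv u \<otimes> x') \<oslash> f x'"
        by (simp add: req_rveq flip: y_def y'_def)
    qed
  qed
  then obtain d where d: "d \<in> Kx" "\<forall>u\<in>vunits. S d u" by blast
  from ev_conj[OF ev_above[OF d(1)] ev_above[OF d0(1)]] obtain b where
    b: "b \<in> Kx" "\<And>x. x \<in> Kx \<Longrightarrow> b \<preceq> x \<Longrightarrow> d \<preceq> x \<and> d0 \<preceq> x" unfolding ev_def by blast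
  show ?thesis
    by (rule that[OF b(1)]) (use b d fx unit in \<open>auto simp: S_def\<close>)
qed

end

context cmin_field
begin

lemma dense_ex: "x \<prec> y \<Longrightarrow> \<exists>z\<in>Kx. x \<prec> z \<and> z \<prec> y"
  by (rule dense[of x y]) blast+

lemma ev_exD: "ev P \<Longrightarrow> \<exists>x\<in>Kx. P x"
  by (rule ev_ex[of P]) blast+

subsection \<open>Leading terms depending only on the valuation\<close>

lemma interval_sequence:
  assumes "a \<prec> b"
  obtains s :: "nat \<Rightarrow> 'a" where "\<And>n. s n \<in> Kx" "\<And>n. a \<prec> s n" "\<And>n. s n \<prec> b" "\<And>i j. i \<noteq> j \<Longrightarrow> \<not> s i \<asymp> s j"
proof -
  have "\<exists>s :: nat \<Rightarrow> 'a. \<forall>n. (s n \<in> Kx \<and> a \<prec> s n \<and> s n \<prec> b) \<and> s (Suc n) \<prec> s n"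
  proof (rule dependent_nat_choice)
    show "\<exists>x. x \<in> Kx \<and> a \<prec> x \<and> x \<prec> b" using dense_ex[OF assms] by blast
    show "\<exists>y. (y \<in> Kx \<and> a \<prec> y \<and> y \<prec> b) \<and> y \<prec> x" if "x \<in> Kx \<and> a \<prec> x \<and> x \<prec> b" for x
    proof -
      have "a \<prec> x" using that by simp
      then obtain y where "y \<in> Kx" "a \<prec> y" "y \<prec> x" using dense_ex by blast
      then show ?thesis using that lt_trans[of y x b] by auto
    qed
  qed
  then obtain s :: "nat \<Rightarrow> 'a" where s: "\<And>n. s n \<in> Kx" "\<And>n. a \<prec> s n" "\<And>n. s n \<prec> b" "\<And>n. s (Suc n) \<prec> s n"
    by blast
  have lt: "s j \<prec> s i" if "i < j" for i j using that
  proof (induction j)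
    case (Suc j)
    then show ?case using s(4)[of j] lt_trans[of "s (Suc j)" "s j" "s i"] by (auto simp: less_Suc_eq)
  qed simp
  have "\<not> s i \<asymp> s j" if "i \<noteq> j" for i j
    using that lt[of i j] lt[of j i] lt_not_eqv(1)[of "s i" "s j"] lt_not_eqv(2)[of "s j" "s i"]
      lt_not_eqv(1)[of "s j" "s i"] lt_not_eqv(2)[of "s i" "s j"]
    by (cases i j rule: linorder_cases) auto
  with s(1-3) show ?thesis by (rule that)
qed

lemma max_exists: "a \<in> K \<Longrightarrow> b \<in> K \<Longrightarrow> \<exists>m. a \<preceq> m \<and> b \<preceq> m \<and> (m = a \<or> m = b)"
  using le_total[of a b] le_refl by blast

lemma min_exists: "a \<in> K \<Longrightarrow> b \<in> K \<Longrightarrow> \<exists>m. m \<preceq> a \<and> m \<preceq> b \<and> (m = a \<or> m = b)"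
  using le_total[of a b] le_refl by blast

text \<open>Orthogonality of k and \<Gamma>. Up to leading terms \<open>g\<close> is a function of
  v(x). Its fibre over a residue c is a set of values, nonempty by \<open>full\<close> and bounded
  by \<open>away\<close>. For each of the two kinds of endpoint, attained or not, the upper endpoint
  determines c, so there are infinitely many endpoints. Hence they fill an interval, and cutting
  that interval at one point splits k into two infinite definable parts.\<close>

lemma residue_map_to_values_aux:
  assumes g: "deffun g" and d: "d \<in> Kx"
    and inv: "\<And>x u. x \<in> Kx \<Longrightarrow> d \<preceq> x \<Longrightarrow> u \<in> vunits \<Longrightarrow> g (u \<otimes> x) \<doteq> g x"
    and y0: "y0 \<in> Kx"
    and full: "\<And>y. y \<asymp> y0 \<Longrightarrow> \<exists>x\<in>Kx. d \<preceq> x \<and> g x \<doteq> y"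
    and away: "ev (\<lambda>x. \<not> g x \<asymp> y0)"
  shows False
proof -
  have gK: "g x \<in> K" if "x \<in> K" for x using deffun_closed[OF g that] .
  \<comment> \<open>\<open>Z c\<close> is the fibre over the residue of \<open>c\<close> and
    \<open>A c\<close> its downward closure; \<open>Ep1\<close> and \<open>Ep2\<close> say that
    \<open>e\<close> is the upper endpoint, attained or not.\<close>
  define Z where "Z c x \<longleftrightarrow> x \<in> Kx \<and> d \<preceq> x \<and> g x \<doteq> c \<otimes> y0" for c x
  define A where "A c x \<longleftrightarrow> (\<exists>z\<in>Kx. Z c z \<and> x \<preceq> z)" for c x
  define Ep1 Ep2 where "Ep1 c e \<longleftrightarrow> (\<forall>x\<in>Kx. A c x \<longleftrightarrow> x \<preceq> e)" and "Ep2 c e \<longleftrightarrow> (\<forall>x\<in>Kx. A c x \<longleftrightarrow> x \<prec> e)" for c e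
  define Ep where "Ep c e \<longleftrightarrow> Ep1 c e \<or> Ep2 c e" for c e
  have "Df (\<lambda>e. Z (e 0) (e 1))" unfolding Z_def by (intro df Dt_fun1[OF g]) (use d y0 in auto)
  note dfZ = Df_comp2[OF this]
  have "Df (\<lambda>e. A (e 0) (e 1))" unfolding A_def by (intro df dfZ)
  note dfA = Df_comp2[OF this]
  have "Df (\<lambda>e. Ep (e 0) (e 1))" unfolding Ep_def Ep1_def Ep2_def by (intro df dfA)
  note dfEp = Df_comp2[OF this]
  have Z_eqv: "Z c x'" if "Z c x" "x' \<asymp> x" for c x x'
  proof -
    note xx' = \<open>x' \<asymp> x\<close> and x = \<open>Z c x\<close>
    obtain u where u: "u \<in> vunits" "x' = u \<otimes> x"
      using eqv_unit_obtain[OF xx'] x unfolding Z_def by blast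
    then have "g x' \<doteq> g x" using inv that unfolding Z_def by blast
    then show ?thesis
      using that u rveq_trans eqv_cong(1)[OF that(2), of d] unfolding Z_def by auto
  qed
  have Z_inj: "c \<approx> c'" if "Z c x" "Z c' x" "c \<in> vunits" "c' \<in> vunits" for c c' x
  proof -
    have "c \<otimes> y0 \<doteq> c' \<otimes> y0" using that rveq_sym rveq_trans unfolding Z_def by blast
    then show ?thesis using that y0 by (simp add: rveq_mult_iff req_rveq)
  qed
  have Z_cong: "Z c' x" if "Z c x" "c \<approx> c'" "c \<in> vunits" for c c' x
  proof -
    have "c \<otimes> y0 \<doteq> c' \<otimes> y0" using that y0 by (intro rveq_mult) (simp_all add: req_rveq)
    then show ?thesis using that rveq_trans unfolding Z_def by blast
  qed
  obtain D where D: "D \<in> Kx" "\<forall>x\<in>Kx. D \<preceq> x \<longrightarrow> \<not> g x \<asymp> y0" using away unfolding ev_def by blast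
  have bound: "x \<prec> D" if "Z c x" "c \<in> vunits" for c x
  proof -
    have "g x \<asymp> y0" using that y0 eqv_trans eqv_sym rveq_eqv eqv_unit_mult unfolding Z_def by (meson Kx_K)
    then show ?thesis using D that not_le[of D x] unfolding Z_def by auto
  qed
  have Zex: "\<exists>x. Z c x" if "c \<in> vunits" for c
    using full[of "c \<otimes> y0"] eqv_unit_mult[of y0 c] that y0 unfolding Z_def by auto
  have Ep_ex: "\<exists>e\<in>Kx. Ep c e" if c: "c \<in> vunits" for c
  proof -
    have "Df1 (A c)" unfolding Df1_def by (intro dfA df) (use c in simp_all)
    moreover have "A c y" if "A c x" "y \<preceq> x" for x y using that le_trans unfolding A_def by blast
    moreover have "\<not> A c D" using bound c lt_not_le unfolding A_def by blast
    moreover obtain z where "Z c z" using Zex c by blast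
    then have "z \<in> Kx" "A c z" unfolding A_def Z_def by auto
    ultimately show ?thesis using cut_endpoint[of "A c"] D(1) unfolding Ep_def Ep1_def Ep2_def by blast
  qed
  have unique': False if h: "Ep c e" "Ep c e'" "e \<prec> e'" for c e e'
  proof -
    obtain z where z: "z \<in> Kx" "e \<prec> z" "z \<prec> e'" using dense[OF h(3)] .
    have "(A c z \<longleftrightarrow> z \<preceq> e) \<or> (A c z \<longleftrightarrow> z \<prec> e)" "(A c z \<longleftrightarrow> z \<preceq> e') \<or> (A c z \<longleftrightarrow> z \<prec> e')"
      using h(1,2) z(1) unfolding Ep_def Ep1_def Ep2_def by blast+
    then show False using lt_not_le[OF z(2)] lt_imp_le[of z e] lt_imp_le[OF z(3)] z(3) by blast
  qed
  have unique: "e \<asymp> e'" if "Ep c e" "Ep c e'" "e \<in> Kx" "e' \<in> Kx" for c e e'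
    using unique' that not_eqv[of e e'] by auto
  have A_cong: "A c x \<longleftrightarrow> A c' x" if "c \<approx> c'" "c \<in> vunits" "c' \<in> vunits" for c c' x
    unfolding A_def using that Z_cong req_sym by blast
  have Ep_cong: "Ep c' e" if "Ep c e" "c \<approx> c'" "c \<in> vunits" "c' \<in> vunits" for c c' e
    using that(1) unfolding Ep_def Ep1_def Ep2_def A_cong[OF that(2-4)] .
  have Ep1_Z: "Z c e" if "Ep1 c e" "e \<in> Kx" for c e
  proof -
    have "A c e" using that unfolding Ep1_def by simp
    then obtain z where z: "Z c z" "e \<preceq> z" unfolding A_def by blast
    then have "z \<in> Kx" "A c z" unfolding A_def Z_def by auto
    then have "z \<preceq> e" using that unfolding Ep1_def by blast
    then show ?thesis using Z_eqv z by (simp add: eqv_def)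
  qed
  have Ep1_inj: "c \<approx> c'" if "Ep1 c e" "Ep1 c' e'" "e \<asymp> e'" "e \<in> Kx" "e' \<in> Kx" "c \<in> vunits" "c' \<in> vunits" for c c' e e'
    using Z_inj Z_eqv[OF Ep1_Z[OF that(2,5)] that(3)] Ep1_Z[OF that(1,4)] that by blast
  \<comment> \<open>An endpoint that is not attained is approached by the fibre, so by
    \<open>left_germ\<close> the fibre contains a whole interval ending there. Two residues with the
    same such endpoint would have overlapping fibres.\<close>
  have Ep2_Z: "\<exists>p\<in>Kx. p \<prec> e \<and> (\<forall>x. p \<prec> x \<and> x \<prec> e \<longrightarrow> Z c x)" if h: "Ep2 c e" "e \<in> Kx" "c \<in> vunits" for c e
  proof -
    have "Df1 (Z c)" unfolding Df1_def by (intro dfZ df) (use that in simp_all)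
    then obtain p where p: "p \<in> Kx" "p \<prec> e" "\<And>x y. p \<prec> x \<Longrightarrow> x \<prec> e \<Longrightarrow> p \<prec> y \<Longrightarrow> y \<prec> e \<Longrightarrow> Z c x = Z c y"
      using left_germ[OF _ h(2)] by blast
    obtain x where x: "x \<in> Kx" "p \<prec> x" "x \<prec> e" using dense[OF p(2)] .
    then have "A c x" using that unfolding Ep2_def by blast
    then obtain z where z: "Z c z" "x \<preceq> z" unfolding A_def by blast
    then have "z \<in> Kx" "A c z" unfolding A_def Z_def by auto
    then have "z \<prec> e" using that unfolding Ep2_def by blast
    moreover have "p \<prec> z" using x z lt_le_trans by blast
    ultimately have "Z c y" if "p \<prec> y" "y \<prec> e" for y using p(3)[of z y] z that by simp
    then show ?thesis using p by blast
  qed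
  have Ep2_inj: "c \<approx> c'" if h: "Ep2 c e" "Ep2 c' e'" "e \<asymp> e'" "e \<in> Kx" "e' \<in> Kx" "c \<in> vunits" "c' \<in> vunits" for c c' e e'
  proof -
    obtain p where p: "p \<in> Kx" "p \<prec> e" "\<And>x. p \<prec> x \<Longrightarrow> x \<prec> e \<Longrightarrow> Z c x" using Ep2_Z[OF h(1,4,6)] by blast
    obtain p' where p': "p' \<in> Kx" "p' \<prec> e'" "\<And>x. p' \<prec> x \<Longrightarrow> x \<prec> e' \<Longrightarrow> Z c' x" using Ep2_Z[OF h(2,5,7)] by blast
    obtain m where m: "p \<preceq> m" "p' \<preceq> m" "m = p \<or> m = p'" using max_exists[of p p'] p(1) p'(1) by blast
    have "m \<prec> e" using m(3) p(2) lt_eqv_trans[OF p'(2) eqv_sym[OF h(3)]] by blast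
    then obtain z where z: "m \<prec> z" "z \<prec> e" using dense_ex by blast
    have "Z c z" by (rule p(3)[OF le_lt_trans[OF m(1) z(1)] z(2)])
    moreover have "Z c' z" by (rule p'(3)[OF le_lt_trans[OF m(2) z(1)] lt_eqv_trans[OF z(2) h(3)]])
    ultimately show ?thesis using Z_inj that by blast
  qed
  obtain w where w: "res_seq w" by (rule res_seq_exists)
  have wu: "w i \<in> vunits" for i by (rule res_seq_units[OF w])
  have "\<forall>i. \<exists>e\<in>Kx. Ep (w i) e" using Ep_ex wu by blast
  then obtain e where e: "\<And>i. e i \<in> Kx" "\<And>i. Ep (w i) (e i)" by metis
  have "infinite {i. Ep1 (w i) (e i)} \<or> infinite {i. Ep2 (w i) (e i)}"
  proof (rule ccontr)
    assume "\<not> ?thesis"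
    then have "finite ({i. Ep1 (w i) (e i)} \<union> {i. Ep2 (w i) (e i)})" by blast
    moreover have "{i. Ep1 (w i) (e i)} \<union> {i. Ep2 (w i) (e i)} = UNIV" using e(2) unfolding Ep_def by blast
    ultimately show False by simp
  qed
  then obtain I where I: "infinite I" "(\<forall>i\<in>I. Ep1 (w i) (e i)) \<or> (\<forall>i\<in>I. Ep2 (w i) (e i))" by blast
  have dist: "i = j" if "i \<in> I" "j \<in> I" "e i \<asymp> e j" for i j
  proof -
    have "w i \<approx> w j" using I(2) Ep1_inj Ep2_inj that e(1) wu by blast
    then show ?thesis using w unfolding res_seq_def by blast
  qed
  \<comment> \<open>\<open>T\<close> is the definable set of all endpoints. The \<open>e i\<close>
    with i in \<open>I\<close> have different values, so one of them is not exceptional and has a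
    neighbourhood consisting of endpoints.\<close>
  define T where "T x \<longleftrightarrow> (\<exists>c\<in>vunits. Ep c x)" for x
  have "Df1 T" unfolding Df1_def T_def by (intro df dfEp)
  from locally_constant[OF this] obtain Q where Q: "finite Q" "Q \<subseteq> Kx"
    "\<And>x. x \<in> Kx \<Longrightarrow> \<forall>q\<in>Q. \<not> q \<asymp> x \<Longrightarrow> \<exists>p\<in>Kx. \<exists>p'\<in>Kx. p \<prec> x \<and> x \<prec> p' \<and>
       (\<forall>z. p \<prec> z \<and> z \<prec> p' \<longrightarrow> T z = T x)"
    by blast
  have "finite {i \<in> I. \<exists>q\<in>Q. q \<asymp> e i}"
  proof -
    have "finite {i \<in> I. q \<asymp> e i}" for q
    proof (cases "\<exists>i\<in>I. q \<asymp> e i")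
      case True
      then obtain i where i: "i \<in> I" "q \<asymp> e i" by blast
      then have "{i \<in> I. q \<asymp> e i} \<subseteq> {i}" using dist eqv_sym eqv_trans by blast
      then show ?thesis by (rule finite_subset) simp
    next
      case False
      then have "{i \<in> I. q \<asymp> e i} = {}" by blast
      then show ?thesis by (simp only: finite.emptyI)
    qed
    moreover have "{i \<in> I. \<exists>q\<in>Q. q \<asymp> e i} = (\<Union>q\<in>Q. {i \<in> I. q \<asymp> e i})" by blast
    ultimately show ?thesis using Q(1) by simp
  qed
  then have "\<not> I \<subseteq> {i \<in> I. \<exists>q\<in>Q. q \<asymp> e i}" using I(1) finite_subset by blast
  then obtain k where k: "\<forall>q\<in>Q. \<not> q \<asymp> e k" by blast
  obtain p p' where p: "p \<prec> e k" "e k \<prec> p'"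
    "\<forall>z. p \<prec> z \<and> z \<prec> p' \<longrightarrow> T z = T (e k)"
    using Q(3)[OF e(1) k] by blast
  have Tk: "T (e k)" using e(2)[of k] wu unfolding T_def by blast
  have T: "\<exists>c\<in>vunits. Ep c z" if "p \<prec> z" "z \<prec> p'" for z
    using p(3)[rule_format, of z] that Tk unfolding T_def by simp
  \<comment> \<open>Every interval near \<open>e k\<close> contains endpoints of infinitely many
    distinct residues, since one residue has only one endpoint.\<close>
  have seq: "\<exists>c s. res_seq c \<and> (\<forall>n. s n \<in> Kx \<and> a \<prec> s n \<and> s n \<prec> b \<and> Ep (c n) (s n))"
    if ab: "a \<prec> b" "p \<preceq> a" "b \<preceq> p'" for a b
  proof -
    obtain s :: "nat \<Rightarrow> 'a" where s: "\<And>n. s n \<in> Kx" "\<And>n. a \<prec> s n" "\<And>n. s n \<prec> b" "\<And>i j. i \<noteq> j \<Longrightarrow> \<not> s i \<asymp> s j"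
      using interval_sequence[OF ab(1)] by blast
    have "p \<prec> s n" "s n \<prec> p'" for n
      by (rule le_lt_trans[OF ab(2) s(2)], rule lt_le_trans[OF s(3) ab(3)])
    then have "\<forall>n. \<exists>c\<in>vunits. Ep c (s n)" using T by blast
    then obtain c where c: "\<And>n. c n \<in> vunits" "\<And>n. Ep (c n) (s n)" by metis
    have "\<not> c i \<approx> c j" if "i \<noteq> j" for i j
    proof
      assume "c i \<approx> c j"
      then have "Ep (c j) (s i)" using Ep_cong c by blast
      then show False using unique c(2) s(1,4) that by blast
    qed
    then have "res_seq c" using c(1) unfolding res_seq_def by blast
    then show ?thesis using s c by blast
  qed
  obtain c s where c: "res_seq c" "\<And>n. s n \<in> Kx" "\<And>n. s n \<prec> e k" "\<And>n. Ep (c n) (s n)"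
    using seq[OF p(1) le_refl[OF lt_K(1)[OF p(1)]] lt_imp_le[OF p(2)]] by blast
  obtain c' s' where c': "res_seq c'" "\<And>n. s' n \<in> Kx" "\<And>n. e k \<prec> s' n" "\<And>n. Ep (c' n) (s' n)"
    using seq[OF p(2) lt_imp_le[OF p(1)] le_refl[OF lt_K(2)[OF p(2)]]] by blast
  \<comment> \<open>Residues whose endpoint lies below \<open>e k\<close>: infinitely many do and
    infinitely many do not.\<close>
  define W where "W c \<longleftrightarrow> (\<exists>x\<in>Kx. Ep c x \<and> x \<prec> e k)" for c
  have "Df1 W" unfolding Df1_def W_def by (intro df dfEp) (use e(1) in simp_all)
  moreover have "W (c n)" for n unfolding W_def using c by blast
  then have "infinite {n. W (c n)}" by simp
  moreover have "\<not> W (c' n)" for n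
  proof
    assume "W (c' n)"
    then obtain x where "x \<in> Kx" "Ep (c' n) x" "x \<prec> e k" unfolding W_def by blast
    then show False using unique'[of "c' n" x "s' n"] c'(4)[of n] lt_trans[OF _ c'(3)[of n], of x] by blast
  qed
  then have "infinite {n. \<not> W (c' n)}" by simp
  ultimately show False using residue_dichotomy c(1) c'(1) by blast
qed

text \<open>If the value of \<open>g\<close> stabilises, \<open>residue_constant\<close> settles the
  leading term. If not, \<open>g\<close> leaves every value; the set of its leading terms is
  definable, so off finitely many values it contains all or no leading terms of a value, and the
  first alternative is excluded by \<open>residue_map_to_values_aux\<close>.\<close>

lemma leading_term_constant:
  assumes g: "deffun g" and d: "d \<in> Kx"
    and inv: "\<And>x u. x \<in> Kx \<Longrightarrow> d \<preceq> x \<Longrightarrow> u \<in> vunits \<Longrightarrow> g (u \<otimes> x) \<doteq> g x"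
  shows "\<exists>c\<in>Kx. ev (\<lambda>x. g x \<doteq> c)"
proof (rule ccontr)
  assume no: "\<not> ?thesis"
  have gK: "g x \<in> K" if "x \<in> K" for x using deffun_closed[OF g that] .
  have gx: "g x \<in> Kx" if "x \<in> Kx" "d \<preceq> x" for x
    using rveq_K(2)[OF inv[OF that one_vunits]] .
  have away: "ev (\<lambda>x. \<not> g x \<asymp> y)" if y: "y \<in> Kx" for y
  proof (rule ccontr)
    have "Df1 (\<lambda>x. g x \<asymp> y)" unfolding Df1_def by (intro df Dt_fun1[OF g]) (use y in simp_all)
    moreover assume "\<not> ev (\<lambda>x. \<not> g x \<asymp> y)"
    ultimately have e: "ev (\<lambda>x. g x \<asymp> y)" using ev_dichotomy by blast
    have unit: "g x \<oslash> y \<in> vunits" if "g x \<asymp> y" for x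
    proof -
      have "\<one> \<asymp> g x \<oslash> y" using that y eqv_K eqv_sym by (simp add: eqv_div_iff)
      then show ?thesis by (auto simp: vunits_def intro: eqv_sym)
    qed
    have "deffun (\<lambda>x. g x \<oslash> y)" using y gK by (intro deffunI df Dt_fun1[OF g]) auto
    moreover have "ev (\<lambda>x. g x \<oslash> y \<in> vring)" using e by (rule ev_mono) (use unit in auto)
    ultimately obtain c where c: "c \<in> vring" "ev (\<lambda>x. g x \<oslash> y \<approx> c)" using residue_constant by blast
    have cy: "ev (\<lambda>x. c \<in> Kx \<and> g x \<doteq> c \<otimes> y)" using e c(2)
    proof (rule ev_mono2)
      fix x assume x: "x \<in> Kx" "g x \<asymp> y" "g x \<oslash> y \<approx> c"
      then have "g x \<oslash> y \<doteq> c" using unit by (simp add: req_rveq)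
      moreover from this have "c \<in> Kx" by (rule rveq_K)
      ultimately show "c \<in> Kx \<and> g x \<doteq> c \<otimes> y" using x y c(1) gK by (simp add: rveq_div_iff)
    qed
    from ev_exD[OF this] have "c \<in> Kx" by blast
    moreover have "ev (\<lambda>x. g x \<doteq> c \<otimes> y)" using cy by (rule ev_mono) blast
    ultimately show False using no y by auto
  qed
  define Y where "Y y \<longleftrightarrow> (\<exists>x\<in>Kx. d \<preceq> x \<and> g x \<doteq> y)" for y
  have "Df1 Y" unfolding Df1_def Y_def by (intro df Dt_fun1[OF g]) (use d in simp_all)
  then obtain Q where Q: "finite Q" "Q \<subseteq> Kx" "\<And>x y. x \<in> Kx \<Longrightarrow> y \<in> Kx \<Longrightarrow> sep Q x y \<Longrightarrow> Y x = Y y"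
    using value_cells by blast
  have evQ: "ev (\<lambda>x. \<forall>q\<in>Q. \<not> g x \<asymp> q)" using Q(1,2) away by (intro ev_finite) blast+
  from ev_exD[OF ev_conj[OF this ev_above[OF d]]] obtain x0 where x0: "x0 \<in> Kx" "\<forall>q\<in>Q. \<not> g x0 \<asymp> q" "d \<preceq> x0"
    by blast
  have Y0: "Y (g x0)" "g x0 \<in> Kx" using x0 gx unfolding Y_def by auto
  have "Y y" if "y \<asymp> g x0" for y
  proof -
    have "sep Q (g x0) y" unfolding sep_def
    proof
      fix q assume q: "q \<in> Q"
      then have "q \<prec> g x0 \<or> g x0 \<prec> q" using x0(2) not_eqv[of "g x0" q] Q(2) Y0(2) by auto
      then show "q \<prec> g x0 \<and> q \<prec> y \<or> g x0 \<prec> q \<and> y \<prec> q" using eqv_cong[OF that] by blast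
    qed
    then show ?thesis using Q(3)[of "g x0" y] Y0 eqv_Kx[OF that] by simp
  qed
  then show False
    using residue_map_to_values_aux[OF g d inv Y0(2)] away[OF Y0(2)] unfolding Y_def by blast
qed

text \<open>Passing from x to u x multiplies f(b x) and f(x) by ratios with the same residue, by
  \<open>ratio_invariant\<close> at b x and at x. So the leading term of f(b x) / f(x) depends only
  on v(x).\<close>

lemma shift_ratio:
  assumes f: "deffun f" and nz: "ev (\<lambda>x. f x \<noteq> \<zero>)" and b: "b \<in> Kx"
  shows "\<exists>c\<in>Kx. ev (\<lambda>x. f (b \<otimes> x) \<oslash> f x \<doteq> c)"
proof -
  have fK: "f x \<in> K" if "x \<in> K" for x using deffun_closed[OF f that] .
  obtain d where d: "d \<in> Kx" "\<And>x. x \<in> Kx \<Longrightarrow> d \<preceq> x \<Longrightarrow> f x \<in> Kx"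
    "\<And>u x. u \<in> vunits \<Longrightarrow> x \<in> Kx \<Longrightarrow> d \<preceq> x \<Longrightarrow> f (u \<otimes> x) \<oslash> f x \<in> vunits"
    "\<And>u x x'. u \<in> vunits \<Longrightarrow> x \<in> Kx \<Longrightarrow> x' \<in> Kx \<Longrightarrow> d \<preceq> x \<Longrightarrow> d \<preceq> x' \<Longrightarrow>
       f (u \<otimes> x) \<oslash> f x \<approx> f (u \<otimes> x') \<oslash> f x'"
    using ratio_invariant[OF f nz] by blast
  from ev_conj[OF ev_above[OF d(1)] ev_scale[OF ev_above[OF d(1)] b]]
  obtain d' where d': "d' \<in> Kx" "\<And>x. x \<in> Kx \<Longrightarrow> d' \<preceq> x \<Longrightarrow> d \<preceq> x \<and> d \<preceq> b \<otimes> x"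
    unfolding ev_def by blast
  show ?thesis
  proof (rule leading_term_constant)
    show "deffun (\<lambda>x. f (b \<otimes> x) \<oslash> f x)" using b fK by (intro deffunI df Dt_fun1[OF f]) auto
    show "d' \<in> Kx" by fact
  next
    fix x u assume x: "x \<in> Kx" "d' \<preceq> x" "u \<in> vunits"
    note dx = d'(2)[OF x(1,2)]
    define \<rho> \<sigma> where "\<rho> = f (u \<otimes> (b \<otimes> x)) \<oslash> f (b \<otimes> x)" and "\<sigma> = f (u \<otimes> x) \<oslash> f x"
    have k: "f x \<in> Kx" "f (b \<otimes> x) \<in> Kx" "\<rho> \<in> vunits" "\<sigma> \<in> vunits"
      using d dx x b by (auto simp: \<rho>_def \<sigma>_def)
    have "\<rho> \<approx> \<sigma>" unfolding \<rho>_def \<sigma>_def using d(4) x dx b by simp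
    then have "\<rho> \<otimes> f (b \<otimes> x) \<doteq> \<sigma> \<otimes> f (b \<otimes> x)" using k by (intro rveq_mult) (auto simp: req_rveq)
    from rveq_div2[OF this rveq_refl, of "\<sigma> \<otimes> f x"]
    have r: "(\<rho> \<otimes> f (b \<otimes> x)) \<oslash> (\<sigma> \<otimes> f x) \<doteq> (\<sigma> \<otimes> f (b \<otimes> x)) \<oslash> (\<sigma> \<otimes> f x)" using k by simp
    have e1: "\<rho> \<otimes> f (b \<otimes> x) = f (b \<otimes> (u \<otimes> x))" "\<sigma> \<otimes> f x = f (u \<otimes> x)"
      using k x b fK m_lcomm[of b u x] div_mult_cancel[OF fK, of "u \<otimes> (b \<otimes> x)" "f (b \<otimes> x)"]
        div_mult_cancel[OF fK, of "u \<otimes> x" "f x"] unfolding \<rho>_def \<sigma>_def by auto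
    have e2: "(\<sigma> \<otimes> f (b \<otimes> x)) \<oslash> (\<sigma> \<otimes> f x) = f (b \<otimes> x) \<oslash> f x" using k by simp
    show "f (b \<otimes> (u \<otimes> x)) \<oslash> f (u \<otimes> x) \<doteq> f (b \<otimes> x) \<oslash> f x"
      using r unfolding e2 unfolding e1 .
  qed
qed

text \<open>A connectedness argument in \<Gamma>. Shifts by the powers of one \<open>t\<close> put
  infinitely many values into the class of a point, and all but finitely many of those values have
  an interval around them inside the class. Thus classes are open near \<open>\<zero>\<close>, and a
  stretch of one class cannot end anywhere.\<close>

lemma eventual_class:
  assumes E: "Df (\<lambda>e. E (e 0) (e 1))"
    and refl: "\<And>x. x \<in> Kx \<Longrightarrow> E x x"
    and sym: "\<And>x y. x \<in> Kx \<Longrightarrow> y \<in> Kx \<Longrightarrow> E x y \<Longrightarrow> E y x"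
    and trans: "\<And>x y z. x \<in> Kx \<Longrightarrow> y \<in> Kx \<Longrightarrow> z \<in> Kx \<Longrightarrow> E x y \<Longrightarrow> E y z \<Longrightarrow> E x z"
    and shift: "\<And>b. b \<in> Kx \<Longrightarrow> ev (\<lambda>x. E (b \<otimes> x) x)"
  shows "\<exists>x\<in>Kx. ev (\<lambda>y. E y x)"
proof (rule ccontr)
  assume no: "\<not> ?thesis"
  note dfE = Df_comp2[OF E]
  have df1E: "Df1 (\<lambda>z. E z x)" if "x \<in> K" for x unfolding Df1_def by (intro dfE df that)
  obtain t where t: "t \<in> Kx" "\<one> \<prec> t" using nontriv by blast
  have "\<forall>n :: nat. \<exists>q\<in>Kx. \<forall>x\<in>Kx. q \<preceq> x \<longrightarrow> E (t [^] n \<otimes> x) x"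
    using shift[OF Kx_pow[OF t(1)]] unfolding ev_def by blast
  then obtain q :: "nat \<Rightarrow> 'a" where q: "\<And>n. q n \<in> Kx" "\<And>n x. x \<in> Kx \<Longrightarrow> q n \<preceq> x \<Longrightarrow> E (t [^] n \<otimes> x) x"
    by metis
  obtain d where d: "d \<in> Kx" "\<forall>n. q n \<preceq> d" using countable_bound[of q] q(1) by blast
  have tE: "E (t [^] n \<otimes> x) x" if "x \<in> Kx" "d \<preceq> x" for n :: nat and x
    using q(2) d(2) that le_trans by blast
  have tlt: "t [^] i \<otimes> x \<prec> t [^] j \<otimes> x" if "i < j" "x \<in> Kx" for i j :: nat and x using that(1)
  proof (induction j)
    case (Suc j)
    have "\<one> \<otimes> (t [^] j \<otimes> x) \<prec> t \<otimes> (t [^] j \<otimes> x)" using t that by (subst lt_mult_iff) auto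
    then have "t [^] j \<otimes> x \<prec> t [^] Suc j \<otimes> x" using t that by (simp add: m_ac)
    then show ?case using Suc lt_trans less_Suc_eq by blast
  qed simp
  \<comment> \<open>For x near \<open>\<zero>\<close> all points \<open>t [^] n \<otimes> x\<close>
    are equivalent to \<open>x\<close> and have pairwise different values; one of them avoids the
    finitely many exceptional values of the class of \<open>x\<close>.\<close>
  have interval: "\<exists>y\<in>Kx. x \<preceq> y \<and> (\<exists>p\<in>Kx. \<exists>p'\<in>Kx. p \<prec> y \<and> y \<prec> p' \<and> (\<forall>z\<in>Kx. p \<prec> z \<longrightarrow> z \<prec> p' \<longrightarrow> E z x))"
    if x: "x \<in> Kx" "d \<preceq> x" for x
  proof -
    have xK: "x \<in> K" using x(1) by simp
    obtain Q where Q: "finite Q" "Q \<subseteq> Kx" "\<And>y. y \<in> Kx \<Longrightarrow> \<forall>q\<in>Q. \<not> q \<asymp> y \<Longrightarrow> \<exists>p\<in>Kx. \<exists>p'\<in>Kx. p \<prec> y \<and> y \<prec> p' \<and>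
       (\<forall>z. p \<prec> z \<and> z \<prec> p' \<longrightarrow> E z x = E y x)"
      using locally_constant[OF df1E[OF xK]] by blast
    have "finite {n :: nat. q \<asymp> t [^] n \<otimes> x}" for q
    proof (cases "\<exists>n :: nat. q \<asymp> t [^] n \<otimes> x")
      case True
      then obtain n :: nat where n: "q \<asymp> t [^] n \<otimes> x" by blast
      have "m = n" if "q \<asymp> t [^] m \<otimes> x" for m :: nat
        using eqv_trans[OF eqv_sym[OF n] that] tlt[of m n x] tlt[of n m x] x(1)
          lt_not_eqv(1)[of "t [^] n \<otimes> x" "t [^] m \<otimes> x"] lt_not_eqv(2)[of "t [^] m \<otimes> x" "t [^] n \<otimes> x"]
        by (cases m n rule: linorder_cases) auto
      then have "{n. q \<asymp> t [^] n \<otimes> x} \<subseteq> {n}" by blast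
      then show ?thesis by (rule finite_subset) simp
    qed simp
    then have "finite (\<Union>q\<in>Q. {n :: nat. q \<asymp> t [^] n \<otimes> x})" using Q(1) by simp
    from ex_new_if_finite[OF infinite_UNIV_nat this]
    obtain n where "n \<notin> (\<Union>q\<in>Q. {n :: nat. q \<asymp> t [^] n \<otimes> x})" by blast
    then have n: "\<forall>q\<in>Q. \<not> q \<asymp> t [^] n \<otimes> x" by blast
    define y where "y = t [^] n \<otimes> x"
    have y: "y \<in> Kx" "E y x" using t x tE unfolding y_def by auto
    have "x \<preceq> y" using tlt[of 0 n x] x unfolding y_def by (cases "n = 0") (auto simp: lt_imp_le)
    obtain p p' where "p \<in> Kx" "p' \<in> Kx" "p \<prec> y" "y \<prec> p'" "\<forall>z. p \<prec> z \<and> z \<prec> p' \<longrightarrow> E z x = E y x"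
      using Q(3)[OF y(1)] n unfolding y_def by blast
    then show ?thesis using y \<open>x \<preceq> y\<close> by blast
  qed
  \<comment> \<open>\<open>N y\<close> says that the class of \<open>y\<close> contains an open
    interval of values around \<open>y\<close>. It holds arbitrarily close to
    \<open>\<zero>\<close>, hence eventually.\<close>
  define N where "N y \<longleftrightarrow> (\<exists>p\<in>Kx. \<exists>p'\<in>Kx. p \<prec> y \<and> y \<prec> p' \<and> (\<forall>z\<in>Kx. p \<prec> z \<longrightarrow> z \<prec> p' \<longrightarrow> E z y))" for y
  have "Df1 N" unfolding Df1_def N_def by (intro df dfE)
  moreover have "\<not> ev (\<lambda>y. \<not> N y)"
  proof
    assume "ev (\<lambda>y. \<not> N y)"
    from ev_conj[OF this ev_above[OF d(1)]] obtain b where b: "b \<in> Kx" "\<forall>x\<in>Kx. b \<preceq> x \<longrightarrow> \<not> N x \<and> d \<preceq> x"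
      unfolding ev_def by blast
    then obtain y p p' where y: "y \<in> Kx" "b \<preceq> y" "p \<in> Kx" "p' \<in> Kx" "p \<prec> y" "y \<prec> p'"
      "\<forall>z\<in>Kx. p \<prec> z \<longrightarrow> z \<prec> p' \<longrightarrow> E z b" using interval[of b] by auto
    then have "E b y" using sym b(1) by blast
    then have "\<forall>z\<in>Kx. p \<prec> z \<longrightarrow> z \<prec> p' \<longrightarrow> E z y" using y trans b(1) by blast
    then have "N y" unfolding N_def using y by blast
    then show False using b y by blast
  qed
  ultimately have "ev N" using ev_dichotomy by blast
  then obtain D where D: "D \<in> Kx" "\<And>x. x \<in> Kx \<Longrightarrow> D \<preceq> x \<Longrightarrow> N x" unfolding ev_def by blast
  \<comment> \<open>The supremum argument: \<open>J\<close> collects how far a stretch starting at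
    \<open>D\<close> stays in the class of \<open>D\<close>. Both kinds of endpoint \<open>c\<close>
    contradict openness of the class at \<open>c\<close>.\<close>
  define J where "J y \<longleftrightarrow> (\<forall>z\<in>Kx. D \<preceq> z \<longrightarrow> z \<preceq> y \<longrightarrow> E z D)" for y
  have "Df1 J" unfolding Df1_def J_def by (intro df dfE) (use D in simp_all)
  moreover have "J y" if "J x" "y \<preceq> x" for x y using that le_trans unfolding J_def by blast
  moreover have JD: "J D"
  proof -
    obtain p p' where "p \<prec> D" "D \<prec> p'" "\<forall>z\<in>Kx. p \<prec> z \<longrightarrow> z \<prec> p' \<longrightarrow> E z D"
      using D(2)[OF D(1)] D(1) unfolding N_def by auto
    then show ?thesis unfolding J_def using lt_le_trans le_lt_trans by blast
  qed
  moreover have "\<not> (\<forall>x\<in>Kx. J x)"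
  proof
    assume a: "\<forall>x\<in>Kx. J x"
    have "ev (\<lambda>y. E y D)" by (rule evI[OF D(1)]) (use a in \<open>auto simp: J_def\<close>)
    then show False using no D(1) by blast
  qed
  ultimately obtain c where c: "c \<in> Kx" "(\<forall>x\<in>Kx. J x \<longleftrightarrow> x \<preceq> c) \<or> (\<forall>x\<in>Kx. J x \<longleftrightarrow> x \<prec> c)"
    using cut_endpoint[of J] D(1) by blast
  have Dc: "D \<preceq> c" using c(2) JD D(1) lt_imp_le by blast
  obtain p p' where p: "p \<in> Kx" "p' \<in> Kx" "p \<prec> c" "c \<prec> p'" "\<And>z. z \<in> Kx \<Longrightarrow> p \<prec> z \<Longrightarrow> z \<prec> p' \<Longrightarrow> E z c"
    using D(2)[OF c(1) Dc] unfolding N_def by blast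
  show False
  proof (cases "J c")
    case True
    obtain z where z: "z \<in> Kx" "c \<prec> z" "z \<prec> p'" using dense[OF p(4)] .
    have "J z" unfolding J_def
    proof (intro ballI impI)
      fix y assume y: "y \<in> Kx" "D \<preceq> y" "y \<preceq> z"
      show "E y D"
      proof (cases "y \<preceq> c")
        case False
        then have cy: "c \<prec> y" using not_le[of y c] y c(1) by auto
        have "E y c" by (rule p(5)[OF y(1) lt_trans[OF p(3) cy] le_lt_trans[OF y(3) z(3)]])
        moreover have "E c D" using True Dc c(1) unfolding J_def by auto
        ultimately show ?thesis using trans y c(1) D(1) by blast
      qed (use True y in \<open>auto simp: J_def\<close>)
    qed
    then show False using c(2) z(1) lt_not_le[OF z(2)] lt_imp_le[of z c] by blast
  next
    case False
    then have "\<forall>x\<in>Kx. J x \<longleftrightarrow> x \<prec> c" using c(2) c(1) le_refl[OF Kx_K[OF c(1)]] by blast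
    then have Jc: "J x \<longleftrightarrow> x \<prec> c" if "x \<in> Kx" for x using that by blast
    have "D \<prec> c" using Jc JD D(1) by blast
    obtain m where m: "p \<preceq> m" "D \<preceq> m" "m = p \<or> m = D" using max_exists[of p D] p(1) D(1) by blast
    then have "m \<prec> c" using p(3) \<open>D \<prec> c\<close> by blast
    then obtain z where z: "z \<in> Kx" "m \<prec> z" "z \<prec> c" using dense_ex by blast
    have "E z c" by (rule p(5)[OF z(1) le_lt_trans[OF m(1) z(2)] lt_trans[OF z(3) p(4)]])
    moreover have "E z D"
      using Jc[OF z(1)] z(1,3) lt_imp_le[OF le_lt_trans[OF m(2) z(2)]] unfolding J_def by auto
    ultimately have cD: "E c D" using sym trans c(1) z(1) D(1) by blast
    have "J c" unfolding J_def
    proof (intro ballI impI)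
      fix y assume y: "y \<in> Kx" "D \<preceq> y" "y \<preceq> c"
      show "E y D"
      proof (cases "y \<prec> c")
        case True
        then show ?thesis using Jc[OF y(1)] y unfolding J_def by auto
      next
        case False
        then have cy: "c \<preceq> y" using not_lt[of y c] y c(1) by auto
        have "E y c" by (rule p(5)[OF y(1) lt_le_trans[OF p(3) cy] le_lt_trans[OF y(3) p(4)]])
        then show ?thesis using cD trans y(1) c(1) D(1) by blast
      qed
    qed
    then show False using False by blast
  qed
qed

subsection \<open>Limits of definable functions\<close>

lemma shift_eqv:
  assumes f: "deffun f" and nz: "ev (\<lambda>x. f x \<noteq> \<zero>)" and b: "b \<in> Kx"
  shows "\<exists>c\<in>Kx. ev (\<lambda>x. f (b \<otimes> x) \<asymp> c \<otimes> f x)"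
proof -
  have fK: "f x \<in> K" if "x \<in> K" for x using deffun_closed[OF f that] .
  obtain c where c: "c \<in> Kx" "ev (\<lambda>x. f (b \<otimes> x) \<oslash> f x \<doteq> c)" using shift_ratio[OF assms] by blast
  have "ev (\<lambda>x. f (b \<otimes> x) \<asymp> c \<otimes> f x)" using c(2) nz
  proof (rule ev_mono2)
    fix x assume x: "x \<in> Kx" "f (b \<otimes> x) \<oslash> f x \<doteq> c" "f x \<noteq> \<zero>"
    then have "c \<asymp> f (b \<otimes> x) \<oslash> f x" "f x \<in> Kx" using rveq_eqv fK by auto
    then show "f (b \<otimes> x) \<asymp> c \<otimes> f x" using x(1) b c(1) fK by (simp add: eqv_div_iff eqv_sym)
  qed
  with c(1) show ?thesis by blast
qed

lemma eventual_value:
  assumes f: "deffun f" and nz: "ev (\<lambda>x. f x \<noteq> \<zero>)"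
    and shift: "\<And>b. b \<in> Kx \<Longrightarrow> ev (\<lambda>x. f (b \<otimes> x) \<asymp> f x)"
  shows "\<exists>c\<in>Kx. ev (\<lambda>x. f x \<asymp> c)"
proof -
  have fK: "f x \<in> K" if "x \<in> K" for x using deffun_closed[OF f that] .
  have "\<exists>x\<in>Kx. ev (\<lambda>y. f y \<asymp> f x)"
  proof (rule eventual_class)
    show "Df (\<lambda>e. f (e 0) \<asymp> f (e 1))" by (intro df Dt_fun1[OF f])
    show "f x \<asymp> f x" if "x \<in> Kx" for x using fK that by simp
    show "f y \<asymp> f x" if "f x \<asymp> f y" for x y using that by (rule eqv_sym)
    show "f x \<asymp> f z" if "f x \<asymp> f y" "f y \<asymp> f z" for x y z using that by (rule eqv_trans)
  qed (rule shift)
  then obtain x0 where x0: "x0 \<in> Kx" "ev (\<lambda>y. f y \<asymp> f x0)" by blast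
  from ev_exD[OF ev_conj[OF this(2) nz]] obtain x where x: "x \<in> Kx" "f x \<asymp> f x0" "f x \<noteq> \<zero>" by blast
  then have "f x0 \<in> Kx" using eqv_Kx[OF x(2)] fK[of x] by blast
  then show ?thesis using x0 by blast
qed

text \<open>The eventual lower bounds of v(f) form a cut. If it has an endpoint \<open>c\<close>,
  then f(x) and f(b x) \<asymp> a f(x) have the same cut, so \<open>a\<close> has value 0, for every
  b; \<open>eventual_value\<close> then makes v(f) constant. The two cases with an endpoint differ
  in whether it belongs to the cut.\<close>

lemma value_trichotomy:
  assumes f: "deffun f" and nz: "ev (\<lambda>x. f x \<noteq> \<zero>)"
  shows "(\<forall>y\<in>Kx. ev (\<lambda>x. y \<preceq> f x)) \<or> (\<forall>y\<in>Kx. ev (\<lambda>x. f x \<prec> y)) \<or> (\<exists>c\<in>Kx. ev (\<lambda>x. f x \<asymp> c))"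
proof -
  have fK: "f x \<in> K" if "x \<in> K" for x using deffun_closed[OF f that] .
  define A where "A y \<longleftrightarrow> ev (\<lambda>x. y \<preceq> f x)" for y
  have nA: "ev (\<lambda>x. f x \<prec> y)" if "\<not> A y" "y \<in> Kx" for y
  proof -
    have "Df1 (\<lambda>x. y \<preceq> f x)" unfolding Df1_def by (intro df Dt_fun1[OF f]) (use that in simp_all)
    then have "ev (\<lambda>x. \<not> y \<preceq> f x)" using ev_not_iff that unfolding A_def by blast
    then show ?thesis by (rule ev_mono) (use that fK not_le in auto)
  qed
  have "Df1 A" unfolding Df1_def A_def by (intro df Dt_fun1[OF f])
  moreover have "A y" if "A x" "y \<preceq> x" for x y
    using that(1) unfolding A_def by (rule ev_mono) (use that(2) le_trans in blast)
  ultimately consider "\<forall>x\<in>Kx. A x" | "\<forall>x\<in>Kx. \<not> A x"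
    | c where "c \<in> Kx" "\<forall>x\<in>Kx. A x \<longleftrightarrow> x \<preceq> c" | c where "c \<in> Kx" "\<forall>x\<in>Kx. A x \<longleftrightarrow> x \<prec> c"
    using cut_endpoint[of A] by blast
  then show ?thesis
  proof cases
    case 1
    then show ?thesis unfolding A_def by blast
  next
    case 2
    then show ?thesis using nA by blast
  next
    case (3 c)
    have lo: "ev (\<lambda>x. c \<preceq> f x)" using 3 unfolding A_def by simp
    have hi: "ev (\<lambda>x. f x \<prec> y)" if "c \<prec> y" "y \<in> Kx" for y using nA 3 that lt_not_le by blast
    have "ev (\<lambda>x. f (b \<otimes> x) \<asymp> f x)" if b: "b \<in> Kx" for b
    proof -
      obtain a where a: "a \<in> Kx" "ev (\<lambda>x. f (b \<otimes> x) \<asymp> a \<otimes> f x)" using shift_eqv[OF f nz b] by blast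
      have "\<not> \<one> \<prec> a"
      proof
        assume "\<one> \<prec> a"
        then have "c \<prec> a \<otimes> c" using lt_mult_iff[of c "\<one>" a] a 3 by simp
        then have "ev (\<lambda>x. f (b \<otimes> x) \<prec> a \<otimes> c)" using ev_scale[OF hi b] a 3 by simp
        from ev_exD[OF ev_conj[OF ev_conj[OF this lo] a(2)]] obtain x where x: "x \<in> Kx" "f (b \<otimes> x) \<prec> a \<otimes> c" "c \<preceq> f x" "f (b \<otimes> x) \<asymp> a \<otimes> f x"
          by blast
        have "a \<otimes> c \<preceq> a \<otimes> f x" using x(3) a by (intro le_mult2) auto
        then show False using x(2,4) eqv_cong(4) lt_not_le by blast
      qed
      moreover have "\<not> a \<prec> \<one>"
      proof
        assume "a \<prec> \<one>"
        then have "c \<prec> c \<oslash> a" using lt_mult_iff[of c a "\<one>"] a 3 by (simp add: lt_div_iff m_comm)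
        then have "ev (\<lambda>x. f x \<prec> c \<oslash> a)" using hi a 3 by simp
        from ev_exD[OF ev_conj[OF ev_conj[OF this ev_scale[OF lo b]] a(2)]] obtain x where x: "x \<in> Kx" "f x \<prec> c \<oslash> a" "c \<preceq> f (b \<otimes> x)" "f (b \<otimes> x) \<asymp> a \<otimes> f x"
          by blast
        have "a \<otimes> f x \<prec> c" using x a 3 fK by (simp add: lt_div_iff m_comm)
        then show False using x(3,4) eqv_cong(1) lt_not_le by blast
      qed
      ultimately have "a \<asymp> \<one>" using not_eqv[of a "\<one>"] a by auto
      then have "a \<in> vunits" by (simp add: vunits_def)
      then show ?thesis using a(2) by (elim ev_mono) (use eqv_unit_mult fK eqv_trans in blast)
    qed
    then show ?thesis using eventual_value[OF f nz] by blast
  next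
    case (4 c)
    have hi: "ev (\<lambda>x. f x \<prec> c)" using nA[of c] 4 by simp
    have lo: "ev (\<lambda>x. y \<preceq> f x)" if "y \<prec> c" for y using 4 that lt_nz unfolding A_def by blast
    have "ev (\<lambda>x. f (b \<otimes> x) \<asymp> f x)" if b: "b \<in> Kx" for b
    proof -
      obtain a where a: "a \<in> Kx" "ev (\<lambda>x. f (b \<otimes> x) \<asymp> a \<otimes> f x)" using shift_eqv[OF f nz b] by blast
      have "\<not> \<one> \<prec> a"
      proof
        assume "\<one> \<prec> a"
        then have "c \<oslash> a \<prec> c" using lt_mult_iff[of c "\<one>" a] a 4 by (simp add: div_lt_iff m_comm)
        from ev_exD[OF ev_conj[OF ev_conj[OF lo[OF this] ev_scale[OF hi b]] a(2)]] obtain x where x: "x \<in> Kx" "c \<oslash> a \<preceq> f x" "f (b \<otimes> x) \<prec> c" "f (b \<otimes> x) \<asymp> a \<otimes> f x"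
          by blast
        have "c \<preceq> a \<otimes> f x" using x a 4 fK by (simp add: div_le_iff m_comm)
        then show False using x(3,4) eqv_cong(4) lt_not_le by blast
      qed
      moreover have "\<not> a \<prec> \<one>"
      proof
        assume "a \<prec> \<one>"
        then have "a \<otimes> c \<prec> c" using lt_mult_iff[of c a "\<one>"] a 4 by simp
        from ev_exD[OF ev_conj[OF ev_conj[OF ev_scale[OF lo[OF this] b] hi] a(2)]] obtain x where x: "x \<in> Kx" "a \<otimes> c \<preceq> f (b \<otimes> x)" "f x \<prec> c" "f (b \<otimes> x) \<asymp> a \<otimes> f x"
          by blast
        have "a \<otimes> f x \<prec> a \<otimes> c" using x a 4 fK lt_mult_iff[of a "f x" c] by (simp add: m_comm)
        then show False using x(2,4) eqv_cong(1) lt_not_le by blast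
      qed
      ultimately have "a \<asymp> \<one>" using not_eqv[of a "\<one>"] a by auto
      then have "a \<in> vunits" by (simp add: vunits_def)
      then show ?thesis using a(2) by (elim ev_mono) (use eqv_unit_mult fK eqv_trans in blast)
    qed
    then show ?thesis using eventual_value[OF f nz] by blast
  qed
qed

definition lim :: "('a \<Rightarrow> 'a) \<Rightarrow> 'a \<Rightarrow> bool" where
  "lim \<phi> y \<longleftrightarrow> y \<in> K \<and> (\<forall>\<epsilon>\<in>Kx. ev (\<lambda>x. \<epsilon> \<preceq> \<phi> x \<ominus> y))"

text \<open>\<open>R c\<close> says that \<phi> eventually stays in a closed ball of radius
  \<open>c\<close>. If all radii occur, definable completeness provides the limit. A smallest radius
  is improved by correcting the centre by a residue; and an infimum of radii occurs itself, since
  \<open>eventual_class\<close> puts \<phi> eventually into one ball of that radius.\<close>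

lemma limit_exists:
  assumes \<phi>: "deffun \<phi>"
  shows "(\<forall>y\<in>Kx. ev (\<lambda>x. \<phi> x \<prec> y)) \<or> (\<exists>y. lim \<phi> y)"
proof (rule ccontr)
  assume "\<not> ?thesis"
  then have ninf: "\<not> (\<forall>y\<in>Kx. ev (\<lambda>x. \<phi> x \<prec> y))" and nlim: "\<not> lim \<phi> y" for y by blast+
  have \<phi>K: "\<phi> x \<in> K" if "x \<in> K" for x using deffun_closed[OF \<phi> that] .
  \<comment> \<open>Under the assumption to be refuted, \<phi> - y tends neither to
    \<open>\<zero>\<close> nor to infinity, so only the third case of the trichotomy
    remains.\<close>
  have const: "\<exists>c\<in>Kx. ev (\<lambda>x. \<phi> x \<ominus> y \<asymp> c)" if y: "y \<in> K" for y
  proof -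
    have def: "deffun (\<lambda>x. \<phi> x \<ominus> y)" using y \<phi>K by (intro deffunI df Dt_fun1[OF \<phi>]) auto
    have "Df1 (\<lambda>x. \<phi> x \<ominus> y \<noteq> \<zero>)" unfolding Df1_def by (intro df Dt_fun1[OF \<phi>]) (use y in simp_all)
    moreover have "\<not> ev (\<lambda>x. \<not> \<phi> x \<ominus> y \<noteq> \<zero>)"
    proof
      assume "ev (\<lambda>x. \<not> \<phi> x \<ominus> y \<noteq> \<zero>)"
      then have "lim \<phi> y" unfolding lim_def using y
        by (intro conjI ballI) (auto elim!: ev_mono simp: le_zero)
      then show False using nlim by blast
    qed
    ultimately have nz: "ev (\<lambda>x. \<phi> x \<ominus> y \<noteq> \<zero>)" using ev_dichotomy by blast
    have "\<not> (\<forall>z\<in>Kx. ev (\<lambda>x. z \<preceq> \<phi> x \<ominus> y))" using nlim[of y] y unfolding lim_def by blast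
    moreover have "\<not> (\<forall>z\<in>Kx. ev (\<lambda>x. \<phi> x \<ominus> y \<prec> z))"
    proof
      assume a: "\<forall>z\<in>Kx. ev (\<lambda>x. \<phi> x \<ominus> y \<prec> z)"
      have "ev (\<lambda>x. \<phi> x \<prec> z)" if z: "z \<in> Kx" for z
      proof -
        obtain m where m: "m \<in> Kx" "m \<preceq> z" "m \<preceq> y"
          using min_exists[of z y] z y le_Kx by blast
        have "ev (\<lambda>x. \<phi> x \<ominus> y \<prec> m)" using a m(1) by blast
        then show ?thesis
        proof (rule ev_mono)
          fix x assume x: "x \<in> Kx" "\<phi> x \<ominus> y \<prec> m"
          have "\<phi> x \<in> K" using \<phi>K x by simp
          then have e: "\<phi> x = \<phi> x \<ominus> y \<ominus> \<ominus> y" using y by algebra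
          have "\<phi> x \<ominus> y \<prec> \<ominus> y" using lt_le_trans[OF x(2) m(3)] y by simp
          from dominant_diff[OF this] have "\<phi> x \<asymp> \<phi> x \<ominus> y" using e by simp
          then show "\<phi> x \<prec> z" by (rule eqv_lt_trans) (rule lt_le_trans[OF x(2) m(2)])
        qed
      qed
      then show False using ninf by blast
    qed
    ultimately show ?thesis using value_trichotomy[OF def nz] by blast
  qed
  define R where "R c \<longleftrightarrow> (\<exists>y\<in>K. ev (\<lambda>x. c \<preceq> \<phi> x \<ominus> y))" for c
  have R_const: "R c" if "ev (\<lambda>x. \<phi> x \<ominus> y \<asymp> c)" "y \<in> K" for c y
    unfolding R_def using that by (intro bexI[of _ y]) (auto elim!: ev_mono simp: eqv_def)
  have "Df1 R" unfolding Df1_def R_def by (intro df Dt_fun1[OF \<phi>])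
  moreover have "R y" if "R x" "y \<preceq> x" for x y
  proof -
    obtain z where z: "z \<in> K" "ev (\<lambda>w. x \<preceq> \<phi> w \<ominus> z)" using \<open>R x\<close> unfolding R_def by blast
    have "ev (\<lambda>w. y \<preceq> \<phi> w \<ominus> z)" using z(2) by (rule ev_mono) (rule le_trans[OF that(2)])
    then show ?thesis using z(1) unfolding R_def by blast
  qed
  moreover have "\<exists>c\<in>Kx. R c" using const[of \<zero>] R_const by blast
  ultimately consider "\<forall>x\<in>Kx. R x" | c where "c \<in> Kx" "\<forall>x\<in>Kx. R x \<longleftrightarrow> x \<preceq> c"
    | c where "c \<in> Kx" "\<forall>x\<in>Kx. R x \<longleftrightarrow> x \<prec> c"
    using cut_endpoint[of R] by blast
  then show False
  proof cases
    case 1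
    define S where "S y c \<longleftrightarrow> y \<in> K \<and> c \<in> Kx \<and> ev (\<lambda>x. c \<preceq> \<phi> x \<ominus> y)" for y c
    have "\<exists>x\<in>K. \<forall>y c. S y c \<longrightarrow> c \<preceq> x \<ominus> y"
    proof (rule completeness)
      have "Df (\<lambda>e. e 1 \<in> Kx \<and> ev (\<lambda>x. e 1 \<preceq> \<phi> x \<ominus> e 0))" by (intro df Dt_fun1[OF \<phi>])
      then show "Df (\<lambda>e. S (e 0) (e 1))" unfolding S_def by (rule Df_cong) auto
    next
      fix y c y' c' assume a: "S y c" "S y' c'"
      from ev_conj[of "\<lambda>x. c \<preceq> \<phi> x \<ominus> y" "\<lambda>x. c' \<preceq> \<phi> x \<ominus> y'"] a
      obtain x where x: "x \<in> Kx" "c \<preceq> \<phi> x \<ominus> y" "c' \<preceq> \<phi> x \<ominus> y'" unfolding S_def by (blast dest: ev_exD)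
      have k: "y \<in> K" "y' \<in> K" "\<phi> x \<in> K" "c \<in> K" "c' \<in> K" using a x \<phi>K unfolding S_def by auto
      have s: "c \<preceq> y \<ominus> \<phi> x" using x k le_diff_swap by blast
      consider "c \<preceq> c'" | "c' \<preceq> c" using le_total k by blast
      then show "c \<preceq> y \<ominus> y' \<or> c' \<preceq> y \<ominus> y'"
      proof cases
        case 1
        show ?thesis using le_diff_trans[OF s le_trans[OF 1 x(3)]] k by blast
      next
        case 2
        show ?thesis using le_diff_trans[OF le_trans[OF 2 s] x(3)] k by blast
      qed
    next
      fix r assume "r \<in> K" "r \<noteq> \<zero>"
      then have r: "r \<in> Kx" by blast
      then obtain y where "y \<in> K" "ev (\<lambda>x. r \<preceq> \<phi> x \<ominus> y)" using 1 unfolding R_def by blast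
      then have "S y r" "r \<preceq> r" unfolding S_def using r by auto
      then show "\<exists>y c. S y c \<and> r \<preceq> c" by blast
    qed (auto simp: S_def)
    then obtain z where z: "z \<in> K" "\<And>y c. S y c \<Longrightarrow> c \<preceq> z \<ominus> y" by blast
    have "lim \<phi> z" unfolding lim_def
    proof (intro conjI ballI z(1))
      fix \<epsilon> assume e: "\<epsilon> \<in> Kx"
      then obtain y where y: "y \<in> K" "ev (\<lambda>x. \<epsilon> \<preceq> \<phi> x \<ominus> y)" using 1 unfolding R_def by blast
      then have "\<epsilon> \<preceq> y \<ominus> z" using z(2)[of y \<epsilon>] e z(1) le_diff_swap unfolding S_def by blast
      then have yz: "\<epsilon> \<preceq> y \<ominus> z" .
      show "ev (\<lambda>x. \<epsilon> \<preceq> \<phi> x \<ominus> z)" using y(2)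
        by (rule ev_mono) (rule le_diff_trans[OF _ yz \<phi>K y(1) z(1)], simp_all)
    qed
    then show False using nlim by blast
  next
    case (2 c)
    then have "R c" by simp
    then obtain y where y: "y \<in> K" "ev (\<lambda>x. c \<preceq> \<phi> x \<ominus> y)" unfolding R_def by blast
    have "deffun (\<lambda>x. (\<phi> x \<ominus> y) \<oslash> c)" using y(1) \<phi>K 2(1) by (intro deffunI df Dt_fun1[OF \<phi>]) auto
    moreover have "ev (\<lambda>x. (\<phi> x \<ominus> y) \<oslash> c \<in> vring)" using y(2)
      by (rule ev_mono) (use y(1) \<phi>K 2(1) in \<open>simp add: vring_def le_div_iff\<close>)
    ultimately obtain a where a: "a \<in> vring" "ev (\<lambda>x. (\<phi> x \<ominus> y) \<oslash> c \<approx> a)" using residue_constant by blast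
    \<comment> \<open>\<open>a\<close> represents the residue of (\<phi> - y) / c; adding a c to the
      centre makes the difference strictly smaller than the supposedly smallest radius.\<close>
    define y' where "y' = y \<oplus> a \<otimes> c"
    have y': "y' \<in> K" using y a 2(1) by (simp add: y'_def)
    have gt: "ev (\<lambda>x. c \<prec> \<phi> x \<ominus> y')" using a(2)
    proof (rule ev_mono)
      fix x assume x: "x \<in> Kx" "(\<phi> x \<ominus> y) \<oslash> c \<approx> a"
      have k: "\<phi> x \<in> K" "c \<in> K" "a \<in> K" using \<phi>K x 2(1) a by auto
      have "((\<phi> x \<ominus> y) \<oslash> c \<ominus> a) \<otimes> c = (\<phi> x \<ominus> y) \<oslash> c \<otimes> c \<ominus> a \<otimes> c"
        using k y(1) div_closed[of "\<phi> x \<ominus> y" c] by algebra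
      also have "(\<phi> x \<ominus> y) \<oslash> c \<otimes> c = \<phi> x \<ominus> y" using k y(1) 2(1) by simp
      also have "\<phi> x \<ominus> y \<ominus> a \<otimes> c = \<phi> x \<ominus> y'" unfolding y'_def using k y(1) by algebra
      finally have e: "((\<phi> x \<ominus> y) \<oslash> c \<ominus> a) \<otimes> c = \<phi> x \<ominus> y'" .
      have "\<one> \<otimes> c \<prec> ((\<phi> x \<ominus> y) \<oslash> c \<ominus> a) \<otimes> c" using x(2) k y(1) 2(1)
        by (subst lt_mult_iff) (auto simp: req_def)
      then show "c \<prec> \<phi> x \<ominus> y'" using k unfolding e by simp
    qed
    obtain c' where c': "c' \<in> Kx" "ev (\<lambda>x. \<phi> x \<ominus> y' \<asymp> c')" using const[OF y'] by blast
    from ev_exD[OF ev_conj[OF gt c'(2)]] obtain x where "c \<prec> \<phi> x \<ominus> y'" "\<phi> x \<ominus> y' \<asymp> c'" by blast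
    then have "c \<prec> c'" by (rule lt_eqv_trans)
    moreover have "c' \<preceq> c" using R_const[OF c'(2) y'] 2(2) c'(1) by blast
    ultimately show False using lt_not_le by blast
  next
    case (3 c)
    have "\<exists>x\<in>Kx. ev (\<lambda>y. c \<preceq> \<phi> y \<ominus> \<phi> x)"
    proof (rule eventual_class)
      show "Df (\<lambda>e. c \<preceq> \<phi> (e 0) \<ominus> \<phi> (e 1))" by (intro df Dt_fun1[OF \<phi>]) (use 3 in simp_all)
      show "c \<preceq> \<phi> x \<ominus> \<phi> x" if "x \<in> Kx" for x using that \<phi>K 3(1) by (simp add: le_zero)
      show "c \<preceq> \<phi> y \<ominus> \<phi> x" if "x \<in> Kx" "y \<in> Kx" "c \<preceq> \<phi> x \<ominus> \<phi> y" for x y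
        using that \<phi>K le_diff_swap[of "\<phi> x" "\<phi> y" c] by simp
      show "c \<preceq> \<phi> x \<ominus> \<phi> z" if "x \<in> Kx" "y \<in> Kx" "z \<in> Kx" "c \<preceq> \<phi> x \<ominus> \<phi> y" "c \<preceq> \<phi> y \<ominus> \<phi> z" for x y z
        using le_diff_trans[OF that(4,5)] that \<phi>K by simp
    next
      fix b assume b: "b \<in> Kx"
      \<comment> \<open>For each coarser radius \<open>r\<close>, the points \<phi>(b x) and
        \<phi>(x) eventually lie in one ball; the trichotomy for their difference then gives the
        bound \<open>c\<close> itself.\<close>
      have near: "ev (\<lambda>x. r \<preceq> \<phi> (b \<otimes> x) \<ominus> \<phi> x)" if r: "r \<prec> c" for r
      proof -
        obtain y where y: "y \<in> K" "ev (\<lambda>x. r \<preceq> \<phi> x \<ominus> y)" using r 3 lt_nz unfolding R_def by blast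
        from ev_scale[OF y(2) b] y(2) show ?thesis
        proof (rule ev_mono2)
          fix x assume x: "x \<in> Kx" "r \<preceq> \<phi> (b \<otimes> x) \<ominus> y" "r \<preceq> \<phi> x \<ominus> y"
          then have "r \<preceq> y \<ominus> \<phi> x" using \<phi>K y(1) le_diff_swap[of y "\<phi> x" r] by simp
          then show "r \<preceq> \<phi> (b \<otimes> x) \<ominus> \<phi> x"
            using x b \<phi>K y(1) le_diff_trans[of r "\<phi> (b \<otimes> x)" y "\<phi> x"] by simp
        qed
      qed
      define h where "h x = \<phi> (b \<otimes> x) \<ominus> \<phi> x" for x
      have h: "deffun h" unfolding h_def using b \<phi>K by (intro deffunI df Dt_fun1[OF \<phi>]) auto
      have hK: "h x \<in> K" if "x \<in> K" for x using deffun_closed[OF h that] .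
      have "Df1 (\<lambda>x. h x \<noteq> \<zero>)" unfolding Df1_def by (intro df Dt_fun1[OF h]) simp
      then consider "ev (\<lambda>x. h x \<noteq> \<zero>)" | "ev (\<lambda>x. \<not> h x \<noteq> \<zero>)" using ev_dichotomy by blast
      then have "ev (\<lambda>x. c \<preceq> h x)"
      proof cases
        case 1
        consider "\<forall>y\<in>Kx. ev (\<lambda>x. y \<preceq> h x)" | "\<forall>y\<in>Kx. ev (\<lambda>x. h x \<prec> y)" | a where "a \<in> Kx" "ev (\<lambda>x. h x \<asymp> a)"
          using value_trichotomy[OF h 1] by blast
        then show ?thesis
        proof cases
          case 1
          then show ?thesis using 3(1) by blast
        next
          case 2
          obtain r where r: "r \<in> Kx" "r \<prec> c" using below_exists[OF 3(1)] .
          from ev_exD[OF ev_conj[OF near[OF r(2)] 2[rule_format, OF r(1)]]] show ?thesis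
            using lt_not_le unfolding h_def by blast
        next
          case (3 a)
          have "c \<preceq> a"
          proof (rule ccontr)
            assume "\<not> c \<preceq> a"
            then have "a \<prec> c" using not_le 3(1) \<open>c \<in> Kx\<close> by auto
            then obtain r where r: "r \<in> Kx" "a \<prec> r" "r \<prec> c" using dense_ex by blast
            from ev_exD[OF ev_conj[OF near[OF r(3)] 3(2)]] obtain x where "r \<preceq> h x" "h x \<asymp> a"
              unfolding h_def by blast
            then have "r \<preceq> a" by (rule le_eqv_trans)
            then show False using lt_not_le[OF r(2)] by blast
          qed
          show ?thesis using 3(2) by (rule ev_mono) (rule le_eqv_trans[OF \<open>c \<preceq> a\<close> eqv_sym])
        qed
      next
        case 2
        then show ?thesis by (rule ev_mono) (use 3(1) le_zero in auto)
      qed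
      then show "ev (\<lambda>x. c \<preceq> \<phi> (b \<otimes> x) \<ominus> \<phi> x)" unfolding h_def .
    qed
    then have "R c" unfolding R_def using \<phi>K by auto
    then show False using 3 by auto
  qed
qed

end

context cmin_field
begin

subsection \<open>Integer powers and definable endomorphisms of the multiplicative group\<close>

text \<open>The value \<open>\<one>\<close> outside \<open>Kx\<close> makes \<open>pw m\<close> a
  total definable function that is never \<open>\<zero>\<close>, which saves side
  conditions.\<close>

definition pw :: "int \<Rightarrow> 'a \<Rightarrow> 'a" where
  "pw m x = (if x \<in> Kx then x [^] m else \<one>)"

lemma Units_Kx: "Units R = Kx"
  by (simp add: field_Units Kx_def)

lemma pw_units_of: "x \<in> Kx \<Longrightarrow> pw m x = x [^]\<^bsub>units_of R\<^esub> m"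
proof -
  assume x: "x \<in> Kx"
  then have u: "x \<in> Units R" by (simp add: Units_Kx)
  have n: "x [^]\<^bsub>units_of R\<^esub> n = x [^] n" for n :: nat by (rule units_of_pow[OF u])
  have "inv\<^bsub>units_of R\<^esub> (x [^] nat (- m)) = inv (x [^] nat (- m))"
    by (rule units_of_inv) (use x in \<open>simp add: Units_Kx\<close>)
  then show ?thesis using x unfolding pw_def int_pow_def2[of R] int_pow_def2[of "units_of R"] n
    by (cases "m < 0") simp_all
qed

lemma pw_closed [simp]: "pw m x \<in> Kx"
proof (cases "x \<in> Kx")
  case True
  interpret G: comm_group "units_of R" by (rule units_comm_group)
  have "x [^]\<^bsub>units_of R\<^esub> m \<in> carrier (units_of R)"
    by (rule G.int_pow_closed) (simp add: units_of_carrier Units_Kx True)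
  then show ?thesis using True by (simp add: pw_units_of units_of_carrier Units_Kx)
qed (simp add: pw_def)

lemma pw_K [simp]: "pw m x \<in> K" by simp

lemma pw_0 [simp]: "pw 0 x = \<one>"
  by (simp add: pw_def int_pow_def2)

lemma pw_nat: "x \<in> Kx \<Longrightarrow> pw (int n) x = x [^] n"
  by (simp add: pw_def int_pow_int)

lemma pw_1: "x \<in> Kx \<Longrightarrow> pw 1 x = x"
  using pw_nat[of x 1] by simp

lemma pw_add: "x \<in> Kx \<Longrightarrow> pw (m + n) x = pw m x \<otimes> pw n x"
proof -
  assume x: "x \<in> Kx"
  interpret G: comm_group "units_of R" by (rule units_comm_group)
  show ?thesis using G.int_pow_mult[of x m n] x
    by (simp add: pw_units_of units_of_carrier Units_Kx units_of_mult)
qed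

lemma pw_mult: "x \<in> Kx \<Longrightarrow> y \<in> Kx \<Longrightarrow> pw m (x \<otimes> y) = pw m x \<otimes> pw m y"
proof -
  assume x: "x \<in> Kx" "y \<in> Kx"
  interpret G: comm_group "units_of R" by (rule units_comm_group)
  show ?thesis using G.int_pow_mult_distrib[of x y m] G.m_comm[of x y] x
    by (simp add: pw_units_of units_of_carrier Units_Kx units_of_mult)
qed

lemma pw_pw: "x \<in> Kx \<Longrightarrow> pw n (pw m x) = pw (m * n) x"
proof -
  assume x: "x \<in> Kx"
  interpret G: comm_group "units_of R" by (rule units_comm_group)
  have "pw n (pw m x) = (x [^]\<^bsub>units_of R\<^esub> m) [^]\<^bsub>units_of R\<^esub> n"
    by (subst pw_units_of[OF pw_closed]) (simp only: pw_units_of[OF x])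
  then show ?thesis using G.int_pow_pow[of x m n] x
    by (simp add: pw_units_of[OF x] units_of_carrier Units_Kx)
qed

lemma pw_one: "pw m \<one> = \<one>"
proof -
  interpret G: comm_group "units_of R" by (rule units_comm_group)
  show ?thesis using G.int_pow_one[of m] by (simp add: pw_units_of units_of_one)
qed

lemma pw_minus: "x \<in> Kx \<Longrightarrow> pw m x \<otimes> pw (- m) x = \<one>"
  using pw_add[of x m "- m"] by simp

lemma pw_minus_div: "x \<in> Kx \<Longrightarrow> pw (- m) x = \<one> \<oslash> pw m x"
proof -
  assume x: "x \<in> Kx"
  have "pw (- m) x = pw (- m) x \<otimes> pw m x \<oslash> pw m x" by simp
  then show ?thesis using pw_minus[OF x, of m] by (simp add: m_comm)
qed

lemma deffun_pw: "deffun (pw m)"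
proof (cases "m \<ge> 0")
  case True
  have "pw m = (\<lambda>x. if x \<in> Kx then x [^] nat m else \<one>)"
    using True pw_nat[of _ "nat m"] by (auto simp: pw_def)
  moreover have "deffun \<dots>" by (intro deffunI Dt_if df) auto
  ultimately show ?thesis by simp
next
  case False
  have "pw m = (\<lambda>x. if x \<in> Kx then \<one> \<oslash> x [^] nat (- m) else \<one>)"
    using False pw_minus_div[of _ "- m"] pw_nat[of _ "nat (- m)"] by (auto simp: pw_def)
  moreover have "deffun \<dots>" by (intro deffunI Dt_if df) auto
  ultimately show ?thesis by simp
qed

text \<open>The conditions concern \<open>Kx\<close> only; at \<open>\<zero>\<close> the value is an
  arbitrary element of the field, so that \<open>s\<close> is total.\<close>

definition dhom :: "('a \<Rightarrow> 'a) \<Rightarrow> bool" where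
  "dhom s \<longleftrightarrow> deffun s \<and> (\<forall>a\<in>Kx. s a \<in> Kx) \<and> (\<forall>a\<in>Kx. \<forall>b\<in>Kx. s (a \<otimes> b) = s a \<otimes> s b)"

lemma dhomD:
  assumes "dhom s"
  shows "deffun s" "a \<in> Kx \<Longrightarrow> s a \<in> Kx" "a \<in> Kx \<Longrightarrow> b \<in> Kx \<Longrightarrow> s (a \<otimes> b) = s a \<otimes> s b"
  using assms by (auto simp: dhom_def)

lemma dhom_one: assumes "dhom s" shows "s \<one> = \<one>"
proof -
  have "s \<one> \<otimes> s \<one> = s \<one>" using dhomD(3)[OF assms, of \<one> \<one>] by simp
  then show ?thesis using dhomD(2)[OF assms one_Kx] m_lcancel[of "s \<one>" "s \<one>" \<one>] by simp
qed

lemma dhom_pw: "dhom (pw m)"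
  by (simp add: dhom_def deffun_pw pw_mult)

lemma dhom_mult: assumes "dhom s" "dhom r" shows "dhom (\<lambda>x. s x \<otimes> r x)"
  unfolding dhom_def
proof (intro conjI ballI)
  show "deffun (\<lambda>x. s x \<otimes> r x)"
    using deffun_closed[OF dhomD(1)[OF assms(1)]] deffun_closed[OF dhomD(1)[OF assms(2)]]
    by (intro deffunI df Dt_fun1[OF dhomD(1)[OF assms(1)]] Dt_fun1[OF dhomD(1)[OF assms(2)]]) simp
  fix a assume a: "a \<in> Kx"
  show "s a \<otimes> r a \<in> Kx" using dhomD(2)[OF assms(1) a] dhomD(2)[OF assms(2) a] by simp
  fix b assume b: "b \<in> Kx"
  note k = dhomD(2)[OF assms(1) a] dhomD(2)[OF assms(2) a] dhomD(2)[OF assms(1) b] dhomD(2)[OF assms(2) b]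
  show "s (a \<otimes> b) \<otimes> r (a \<otimes> b) = s a \<otimes> r a \<otimes> (s b \<otimes> r b)"
    using dhomD(3)[OF assms(1) a b] dhomD(3)[OF assms(2) a b] k by (simp add: m_ac)
qed

lemma dhom_pw_comp: assumes "dhom s" shows "dhom (\<lambda>x. pw m (s x))"
  unfolding dhom_def
proof (intro conjI ballI)
  show "deffun (\<lambda>x. pw m (s x))"
    by (intro deffunI df Dt_fun1[OF deffun_pw] Dt_fun1[OF dhomD(1)[OF assms]]) simp
  fix a assume a: "a \<in> Kx"
  show "pw m (s a) \<in> Kx" by simp
  fix b assume b: "b \<in> Kx"
  show "pw m (s (a \<otimes> b)) = pw m (s a) \<otimes> pw m (s b)"
    using dhomD(2)[OF assms a] dhomD(2)[OF assms b] dhomD(3)[OF assms a b] by (simp add: pw_mult)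
qed

lemma dhom_pw_apply: assumes "dhom s" "x \<in> Kx" shows "s (pw m x) = pw m (s x)"
proof -
  note s = dhomD[OF assms(1)]
  have nat: "s (pw (int n) x) = pw (int n) (s x)" for n
  proof (induction n)
    case 0
    then show ?case by (simp add: dhom_one[OF assms(1)])
  next
    case (Suc n)
    have "pw (int (Suc n)) y = pw (int n) y \<otimes> y" if "y \<in> Kx" for y
      using pw_add[OF that, of "int n" 1] pw_1[OF that] by (simp add: add.commute)
    then show ?case using Suc s assms(2) by simp
  qed
  show ?thesis
  proof (cases m rule: int_cases2)
    case (nonneg n)
    then show ?thesis using nat by simp
  next
    case (nonpos n)
    have "pw (int n) x \<otimes> pw m x = \<one>" using pw_minus[OF assms(2), of "int n"] nonpos by simp
    then have "pw (int n) (s x) \<otimes> s (pw m x) = \<one>"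
      using s(3)[of "pw (int n) x" "pw m x"] nat dhom_one[OF assms(1)] by simp
    then have "pw (int n) (s x) \<otimes> s (pw m x) = pw (int n) (s x) \<otimes> pw m (s x)"
      using pw_minus[OF s(2)[OF assms(2)], of "int n"] nonpos by simp
    then show ?thesis using m_lcancel[of "pw (int n) (s x)" "s (pw m x)" "pw m (s x)"] s(2)[of "pw m x"]
      by simp
  qed
qed

subsection \<open>Calculus of limits\<close>

lemma lim_K: "lim \<phi> y \<Longrightarrow> y \<in> K" by (simp add: lim_def)

lemma limD: "lim \<phi> y \<Longrightarrow> \<epsilon> \<in> Kx \<Longrightarrow> ev (\<lambda>x. \<epsilon> \<preceq> \<phi> x \<ominus> y)" by (simp add: lim_def)

lemma limI: "y \<in> K \<Longrightarrow> (\<And>\<epsilon>. \<epsilon> \<in> Kx \<Longrightarrow> ev (\<lambda>x. \<epsilon> \<preceq> \<phi> x \<ominus> y)) \<Longrightarrow> lim \<phi> y" by (simp add: lim_def)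

lemma lim_cong: assumes "lim \<phi> y" "ev (\<lambda>x. \<phi> x = \<psi> x)" shows "lim \<psi> y"
proof (rule limI[OF lim_K[OF assms(1)]])
  fix \<epsilon> assume "\<epsilon> \<in> Kx"
  from limD[OF assms(1) this] assms(2) show "ev (\<lambda>x. \<epsilon> \<preceq> \<psi> x \<ominus> y)" by (rule ev_mono2) simp
qed

lemma lim_scale: assumes "lim \<phi> y" "b \<in> Kx" shows "lim (\<lambda>x. \<phi> (b \<otimes> x)) y"
  by (rule limI[OF lim_K[OF assms(1)]]) (rule ev_scale[OF limD[OF assms(1)] assms(2)])

lemma ev_K: "deffun \<phi> \<Longrightarrow> ev (\<lambda>x. \<phi> x \<in> K)"
  by (rule ev_mono[OF ev_True]) (use deffun_closed in auto)

lemma lim_unique: assumes "ev (\<lambda>x. \<phi> x \<in> K)" "lim \<phi> y" "lim \<phi> z" shows "y = z"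
proof (rule ccontr)
  assume "y \<noteq> z"
  then have "y \<ominus> z \<in> Kx" using lim_K assms diff_zero_iff by blast
  then obtain e where e: "e \<in> Kx" "y \<ominus> z \<prec> e" by (rule above_exists)
  from ev_exD[OF ev_conj[OF ev_conj[OF limD[OF assms(2) e(1)] limD[OF assms(3) e(1)]] assms(1)]]
  obtain x where x: "e \<preceq> \<phi> x \<ominus> y" "e \<preceq> \<phi> x \<ominus> z" "\<phi> x \<in> K" by blast
  have "e \<preceq> y \<ominus> \<phi> x" using x lim_K[OF assms(2)] le_diff_swap by simp
  then have "e \<preceq> y \<ominus> z" by (rule le_diff_trans) (use x lim_K[OF assms(2)] lim_K[OF assms(3)] in auto)
  then show False using e(2) lt_not_le by blast
qed

lemma lim_mult:
  assumes "ev (\<lambda>x. \<phi> x \<in> K)" "ev (\<lambda>x. \<psi> x \<in> K)" "lim \<phi> y" "lim \<psi> z"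
  shows "lim (\<lambda>x. \<phi> x \<otimes> \<psi> x) (y \<otimes> z)"
proof (rule limI)
  have k: "y \<in> K" "z \<in> K" using assms lim_K by auto
  then show "y \<otimes> z \<in> K" by simp
  fix \<epsilon> assume e: "\<epsilon> \<in> Kx"
  \<comment> \<open>\<open>m\<close> bounds v(\<psi>) from below near \<open>\<zero>\<close>;
    \<open>\<delta>\<close> makes y (\<psi> - z) small, with an arbitrary choice when y is
    \<open>\<zero>\<close>.\<close>
  obtain m where m: "m \<preceq> \<one>" "m \<preceq> z" using min_exists[of \<one> z] k by auto
  have mx: "m \<in> Kx" using le_Kx m by auto
  define \<delta> where "\<delta> = (if y = \<zero> then \<one> else \<epsilon> \<oslash> y)"
  have d: "\<delta> \<in> Kx" "\<epsilon> \<preceq> y \<otimes> \<delta>"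
  proof -
    show "\<delta> \<in> Kx" unfolding \<delta>_def using e k KxI[of y] by simp
    then show "\<epsilon> \<preceq> y \<otimes> \<delta>"
    proof (cases "y = \<zero>")
      case False
      then have "\<epsilon> \<oslash> y \<otimes> y = \<epsilon>" using e k by (intro div_mult_cancel) auto
      then show ?thesis using False e k by (simp add: \<delta>_def m_comm)
    qed (use e \<open>\<delta> \<in> Kx\<close> in \<open>simp add: le_zero\<close>)
  qed
  have "ev (\<lambda>x. \<epsilon> \<oslash> m \<preceq> \<phi> x \<ominus> y)" using e mx by (intro limD[OF assms(3)]) auto
  from ev_conj[OF ev_conj[OF this limD[OF assms(4) one_Kx]] ev_conj[OF limD[OF assms(4) d(1)] ev_conj[OF assms(1,2)]]]
  show "ev (\<lambda>x. \<epsilon> \<preceq> \<phi> x \<otimes> \<psi> x \<ominus> y \<otimes> z)"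
  proof (rule ev_mono)
    fix x assume x: "(\<epsilon> \<oslash> m \<preceq> \<phi> x \<ominus> y \<and> \<one> \<preceq> \<psi> x \<ominus> z) \<and> \<delta> \<preceq> \<psi> x \<ominus> z \<and> \<phi> x \<in> K \<and> \<psi> x \<in> K"
    then have K: "\<phi> x \<in> K" "\<psi> x \<in> K" by auto
    have "\<psi> x = (\<psi> x \<ominus> z) \<oplus> z" using K k by algebra
    moreover have "m \<preceq> (\<psi> x \<ominus> z) \<oplus> z" by (rule le_add) (use x m le_trans in blast)+
    ultimately have "m \<preceq> \<psi> x" by simp
    then have "\<epsilon> \<oslash> m \<otimes> m \<preceq> (\<phi> x \<ominus> y) \<otimes> \<psi> x" using x by (intro le_mult2) auto
    then have a: "\<epsilon> \<preceq> (\<phi> x \<ominus> y) \<otimes> \<psi> x" using e mx by simp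
    have "y \<otimes> \<delta> \<preceq> y \<otimes> (\<psi> x \<ominus> z)" using x k by (intro le_mult2) auto
    then have b: "\<epsilon> \<preceq> y \<otimes> (\<psi> x \<ominus> z)" using d(2) le_trans by blast
    have "\<phi> x \<otimes> \<psi> x \<ominus> y \<otimes> z = (\<phi> x \<ominus> y) \<otimes> \<psi> x \<oplus> y \<otimes> (\<psi> x \<ominus> z)" using K k by algebra
    then show "\<epsilon> \<preceq> \<phi> x \<otimes> \<psi> x \<ominus> y \<otimes> z" using le_add[OF a b] by simp
  qed
qed

lemma lim_const: "c \<in> K \<Longrightarrow> lim (\<lambda>x. c) c"
  by (rule limI) (auto simp: le_zero intro: ev_mono[OF ev_True])

text \<open>A stable value excludes both escape to infinity and the limit
  \<open>\<zero>\<close>.\<close>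

lemma limit_nonzero:
  assumes \<phi>: "deffun \<phi>" and c: "c \<in> Kx" "ev (\<lambda>x. \<phi> x \<asymp> c)"
  obtains y where "y \<in> Kx" "lim \<phi> y"
proof -
  have "\<not> (\<forall>y\<in>Kx. ev (\<lambda>x. \<phi> x \<prec> y))"
  proof
    assume "\<forall>y\<in>Kx. ev (\<lambda>x. \<phi> x \<prec> y)"
    from ev_exD[OF ev_conj[OF bspec[OF this c(1)] c(2)]] show False using lt_not_eqv by blast
  qed
  then obtain y where y: "lim \<phi> y" using limit_exists[OF \<phi>] by blast
  have "y \<noteq> \<zero>"
  proof
    assume y0: "y = \<zero>"
    obtain e where e: "e \<in> Kx" "c \<prec> e" using above_exists[OF c(1)] .
    from ev_exD[OF ev_conj[OF limD[OF y e(1)] c(2)]] obtain x where x: "x \<in> Kx" "e \<preceq> \<phi> x \<ominus> y" "\<phi> x \<asymp> c" by blast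
    have "\<phi> x \<ominus> y = \<phi> x" using y0 eqv_K[OF x(3)] by (simp add: a_minus_def)
    then have "e \<preceq> c" using x le_eqv_trans by simp
    then show False using e(2) lt_not_le by blast
  qed
  then show ?thesis using that[OF _ y] lim_K[OF y] by blast
qed

text \<open>Translation by \<open>b\<close> does not change a limit at \<open>\<zero>\<close>, but
  it multiplies \<open>s\<close> by \<open>s b\<close>; a nonzero limit can be cancelled.\<close>

lemma dhom_trivial:
  assumes s: "dhom s" and c: "c \<in> Kx" "ev (\<lambda>x. s x \<asymp> c)" and b: "b \<in> Kx"
  shows "s b = \<one>"
proof -
  note h = dhomD[OF s]
  obtain y where y: "y \<in> Kx" "lim s y" using limit_nonzero[OF h(1) c] .
  have K: "ev (\<lambda>x. s x \<in> K)" by (rule ev_K[OF h(1)])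
  have sb: "s b \<in> Kx" by (rule h(2)[OF b])
  have "lim (\<lambda>x. s (b \<otimes> x)) y" by (rule lim_scale[OF y(2) b])
  then have l: "lim (\<lambda>x. s b \<otimes> s x) y" by (rule lim_cong) (rule evI[OF one_Kx], use h(3) b in auto)
  have "ev (\<lambda>x. s b \<in> K)" by (rule evI[OF one_Kx]) (use sb in auto)
  then have "lim (\<lambda>x. s b \<otimes> s x) (s b \<otimes> y)" using sb y K by (intro lim_mult lim_const) auto
  moreover have "ev (\<lambda>x. s b \<otimes> s x \<in> K)" using K by (rule ev_mono) (use sb in auto)
  ultimately have "s b \<otimes> y = y" using lim_unique[of "\<lambda>x. s b \<otimes> s x", OF _ _ l] by blast
  then have "s b \<otimes> y = \<one> \<otimes> y" using y by simp
  then show ?thesis using m_rcancel[of y "s b" \<one>] y sb by simp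
qed

text \<open>An endomorphism with residue 1 on all units has a leading term that depends on v(x)
  only; \<open>leading_term_constant\<close> makes it constant near \<open>\<zero>\<close>, which
  gives a stable value.\<close>

lemma dhom_residue_trivial:
  assumes s: "dhom s" and "\<And>u. u \<in> vunits \<Longrightarrow> s u \<approx> \<one>" and b: "b \<in> Kx"
  shows "s b = \<one>"
proof -
  note h = dhomD[OF s]
  have "\<exists>c\<in>Kx. ev (\<lambda>x. s x \<doteq> c)"
  proof (rule leading_term_constant[OF h(1) one_Kx])
    fix x u assume x: "x \<in> Kx" "u \<in> vunits"
    have "s u \<in> vunits" using req_unit[OF req_sym[OF assms(2)[OF x(2)]]] by simp
    then have "s u \<doteq> \<one>" using assms(2)[OF x(2)] by (simp add: req_rveq)
    from rveq_mult[OF this h(2)[OF x(1)]] show "s (u \<otimes> x) \<doteq> s x" using h x by simp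
  qed
  then obtain c where c: "c \<in> Kx" "ev (\<lambda>x. s x \<doteq> c)" by blast
  have "ev (\<lambda>x. s x \<asymp> c)" using c(2) by (rule ev_mono) (rule eqv_sym[OF rveq_eqv])
  then show ?thesis using dhom_trivial[OF s c(1) _ b] by blast
qed

lemma dhom_unit_valued_trivial:
  assumes s: "dhom s" and "\<And>x. x \<in> Kx \<Longrightarrow> s x \<asymp> \<one>" and b: "b \<in> Kx"
  shows "s b = \<one>"
  by (rule dhom_trivial[OF s one_Kx evI[OF one_Kx] b]) (use assms(2) in blast)

text \<open>\<open>value_invariant\<close> compares s(u d) with s(d), and for a homomorphism this
  comparison is about \<open>s u\<close> alone.\<close>

lemma dhom_units: assumes s: "dhom s" and u: "u \<in> vunits" shows "s u \<in> vunits"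
proof -
  note h = dhomD[OF s]
  obtain d where d: "d \<in> Kx" "\<forall>u\<in>vunits. \<forall>x\<in>Kx. d \<preceq> x \<longrightarrow> s (u \<otimes> x) \<asymp> s x"
    using value_invariant[OF h(1)] by blast
  then have "s (u \<otimes> d) \<asymp> s d" using u by simp
  then have "s u \<otimes> s d \<asymp> \<one> \<otimes> s d" using h u d by simp
  then show ?thesis using eqv_mult_iff[of "s d" "s u" \<one>] h u d by (simp add: vunits_def)
qed

subsection \<open>Roots of unity force integral exponents\<close>

lemma eval_ones: "x \<in> K \<Longrightarrow> (x \<ominus> \<one>) \<otimes> eval (replicate n \<one>) x = x [^] n \<ominus> \<one>"
proof (induction n)
  case 0
  then show ?case by (simp add: a_minus_def r_neg)
next
  case (Suc n)
  define E where "E = eval (replicate n \<one>) x"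
  have E: "E \<in> K" unfolding E_def using Suc by (intro eval_in_carrier) auto
  have p: "x [^] n \<in> K" using Suc by simp
  have "(x \<ominus> \<one>) \<otimes> eval (replicate (Suc n) \<one>) x = (x \<ominus> \<one>) \<otimes> (x [^] n \<oplus> E)"
    using Suc by (simp add: E_def)
  also have "\<dots> = (x [^] n \<otimes> x \<ominus> x [^] n) \<oplus> (x \<ominus> \<one>) \<otimes> E"
    using Suc.prems p E by algebra
  also have "\<dots> = (x [^] n \<otimes> x \<ominus> x [^] n) \<oplus> (x [^] n \<ominus> \<one>)" using Suc by (simp add: E_def)
  also have "\<dots> = x [^] n \<otimes> x \<ominus> \<one>" using Suc.prems p by algebra
  finally show ?case by simp
qed

lemma eval_ones_one: "eval (replicate n \<one>) \<one> = [n] \<cdot> \<one>"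
  by (induction n) (simp_all add: a_comm)

text \<open>A root of 1 + X + ... + X^(n-1). It differs from \<open>\<one>\<close> because the value
  of this polynomial there is n, nonzero in characteristic 0.\<close>

lemma root_of_unity: assumes "n > 1" obtains z where "z \<in> Kx" "z [^] (n :: nat) = \<one>" "z \<noteq> \<one>"
proof -
  obtain k where k: "n = Suc (Suc k)" using assms less_iff_Suc_add by (metis One_nat_def add_Suc add_Suc_right plus_1_eq_Suc)
  obtain z where z: "z \<in> K" "eval (\<one> # replicate (Suc k) \<one>) z = \<zero>"
    using root[of "replicate (Suc k) \<one>"] by (auto simp: subset_iff)
  then have e: "eval (replicate n \<one>) z = \<zero>" using k by simp
  have n1: "z \<noteq> \<one>" using e eval_ones_one[of n] char0[of n] k by auto
  have "z [^] n \<ominus> \<one> = \<zero>" using eval_ones[OF z(1), of n] e z(1) by simp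
  then have p: "z [^] n = \<one>" using z(1) by (simp add: diff_zero_iff)
  have "z \<noteq> \<zero>" using p k z(1) by auto
  then show ?thesis using that z(1) p n1 by blast
qed

lemma pw_one_eqv: assumes "x \<in> Kx" "x [^] (n :: nat) = \<one>" "n > 0" shows "x \<asymp> \<one>"
proof -
  have gt: "\<one> \<prec> y [^] n" if "\<one> \<prec> y" "n > 0" for y and n :: nat using that(2)
  proof (induction n)
    case (Suc n)
    have yK: "y \<in> K" using that lt_K by blast
    show ?case
    proof (cases "n = 0")
      case False
      then have "\<one> \<otimes> \<one> \<prec> y [^] n \<otimes> y" using Suc that(1) by (intro lt_mult2) (auto intro: lt_imp_le)
      then show ?thesis by simp
    qed (use that(1) yK in simp)
  qed simp
  have lt: "y [^] n \<prec> \<one>" if "y \<prec> \<one>" "n > 0" for y and n :: nat using that(2)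
  proof (induction n)
    case (Suc n)
    have yK: "y \<in> Kx" using that lt_nz by blast
    show ?case
    proof (cases "n = 0")
      case False
      then have "y [^] n \<otimes> y \<prec> \<one> \<otimes> \<one>" using Suc that(1) yK by (intro lt_mult2) (auto intro: lt_imp_le)
      then show ?thesis by simp
    qed (use that(1) yK in simp)
  qed simp
  show ?thesis using not_eqv[of x \<one>] gt[of x n] lt[of x n] assms by auto
qed

text \<open>Take the least denominator n and suppose n > 1. If n and p are coprime, a nontrivial
  n-th root of unity z satisfies z^p = s(z)^n = s(z^n) = 1 = z^n, so z = 1. If l > 1 divides both,
  then s^(n/l) x^(-p/l) takes l-th roots of unity as values, which have value 0; so it is trivial
  and n was not least.\<close>

lemma dhom_integral_power:
  assumes s: "dhom s" and q: "q > 0" "\<And>x. x \<in> Kx \<Longrightarrow> pw (int q) (s x) = pw p x"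
  shows "\<exists>m. \<forall>x\<in>Kx. s x = pw m x"
proof -
  note h = dhomD[OF s]
  define P where "P q \<longleftrightarrow> q > 0 \<and> (\<exists>p. \<forall>x\<in>Kx. pw (int q) (s x) = pw p x)" for q :: nat
  have "P q" using q unfolding P_def by blast
  then obtain n where n: "P n" "\<And>k. P k \<Longrightarrow> n \<le> k" using LeastI[of P q] Least_le[of P] by blast
  then obtain p where p: "n > 0" "\<And>x. x \<in> Kx \<Longrightarrow> pw (int n) (s x) = pw p x" unfolding P_def by blast
  have "n = 1"
  proof (rule ccontr)
    assume "n \<noteq> 1"
    then have n1: "n > 1" using p(1) by simp
    have "\<not> coprime (int n) p"
    proof
      assume "coprime (int n) p"
      then obtain a b where ab: "a * int n + b * p = 1"
        using bezout_int[of "int n" p] by auto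
      obtain z where z: "z \<in> Kx" "z [^] n = \<one>" "z \<noteq> \<one>" using root_of_unity[OF n1] .
      have zn: "pw (int n) z = \<one>" using z pw_nat by simp
      have "pw p z = pw (int n) (s z)" using p(2) z by simp
      also have "\<dots> = s (pw (int n) z)" by (rule dhom_pw_apply[OF s z(1), symmetric])
      finally have zp: "pw p z = \<one>" using zn dhom_one[OF s] by simp
      have "z = pw (a * int n + b * p) z" using ab pw_1[OF z(1)] by simp
      also have "\<dots> = pw a (pw (int n) z) \<otimes> pw b (pw p z)"
        using z(1) by (simp add: pw_add pw_pw mult.commute)
      also have "\<dots> = \<one>" using zn zp pw_one by simp
      finally show False using z(3) by simp
    qed
    define l where "l = nat (gcd (int n) p)"
    have l: "int l = gcd (int n) p" by (simp add: l_def)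
    then have "int l dvd int n" "int l dvd p" by simp_all
    then obtain n' p' where n': "n = l * n'" and p': "p = int l * p'"
      by (metis dvd_def int_dvd_int_iff)
    have l1: "l > 1"
    proof -
      have "int l \<noteq> 1" using l \<open>\<not> coprime (int n) p\<close> by (simp add: coprime_iff_gcd_eq_1)
      moreover have "l \<noteq> 0" using n' p(1) by auto
      ultimately show ?thesis by simp
    qed
    define g where "g x = pw (int n') (s x) \<otimes> pw (- p') x" for x
    have g: "dhom g" unfolding g_def by (rule dhom_mult[OF dhom_pw_comp[OF s] dhom_pw])
    have "g x \<asymp> \<one>" if x: "x \<in> Kx" for x
    proof -
      have "pw (int l) (g x) = pw (int n) (s x) \<otimes> pw (- p) x"
        unfolding g_def using x h(2)[OF x] n' p' by (simp add: pw_mult pw_pw mult.commute)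
      also have "\<dots> = \<one>" using p(2)[OF x] pw_minus[OF x] by simp
      finally have "g x [^] l = \<one>" using pw_nat[OF dhomD(2)[OF g x], of l] by simp
      then show ?thesis using pw_one_eqv dhomD(2)[OF g x] l1 by auto
    qed
    then have g1: "g x = \<one>" if "x \<in> Kx" for x using dhom_unit_valued_trivial[OF g _ that] by blast
    have "pw (int n') (s x) = pw p' x" if x: "x \<in> Kx" for x
    proof -
      have "pw (int n') (s x) = pw (int n') (s x) \<otimes> (pw (- p') x \<otimes> pw p' x)"
        using pw_minus[OF x, of "- p'"] by simp
      also have "\<dots> = g x \<otimes> pw p' x" unfolding g_def by (simp add: m_assoc)
      finally show ?thesis using g1[OF x] by simp
    qed
    moreover have "n' > 0" using n' p(1) by simp
    ultimately have "n \<le> n'" using n(2) unfolding P_def by blast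
    then show False using n' l1 p(1) by simp
  qed
  then have "\<forall>x\<in>Kx. s x = pw p x" using p(2) pw_1 h(2) by simp
  then show ?thesis by blast
qed

end

context cmin_field
begin

subsection \<open>Definable endomorphisms are powers\<close>

text \<open>The hypothesis on \<Gamma> pulled back to the field, for automorphisms of \<Gamma>
  induced by a definable endomorphism of the multiplicative group, the only ones that occur.\<close>

definition gamma_hyp :: bool where
  "gamma_hyp \<longleftrightarrow> (\<forall>s. dhom s \<and> (\<forall>x\<in>Kx. \<forall>y\<in>Kx. x \<preceq> y \<longleftrightarrow> s x \<preceq> s y) \<and> (\<forall>y\<in>Kx. \<exists>x\<in>Kx. s x \<asymp> y) \<longrightarrow>
     (\<exists>(p::nat) (q::nat). p > 0 \<and> q > 0 \<and> (\<forall>x\<in>Kx. s x [^] q \<asymp> x [^] p)))"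

text \<open>The map induced on k^\<times> is only assumed to be onto with finite kernel, since that
  is what a power of an endomorphism achieves; the reduction to automorphisms of k^\<times> is made
  in \<open>residue_hypI\<close>.\<close>

definition residue_hyp :: bool where
  "residue_hyp \<longleftrightarrow> (\<forall>r. dhom r \<and> (\<forall>u\<in>vunits. u \<approx> \<one> \<longrightarrow> r u \<approx> \<one>) \<and> (\<forall>w\<in>vunits. \<exists>u\<in>vunits. r u \<approx> w) \<and>
     (\<exists>Q. finite Q \<and> (\<forall>u\<in>vunits. r u \<approx> \<one> \<longrightarrow> (\<exists>q\<in>Q. u \<approx> q))) \<longrightarrow>
     (\<exists>(i :: int) (j :: nat). j > 0 \<and> (\<forall>u\<in>vunits. r u [^] j \<approx> pw i u)))"

section \<open>Endomorphisms that tend to zero: monotone and onto on values\<close>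

lemma sqrt_between:
  assumes "\<one> \<prec> c" "c \<in> Kx"
  obtains r where "r \<in> Kx" "\<one> \<prec> r" "r \<prec> c" "r \<otimes> r = c"
proof -
  obtain r where r: "r \<in> K" "r \<otimes> r = c" using sqrt_obtain[of c] assms by auto
  have rx: "r \<in> Kx" using r assms by auto
  have "\<one> \<prec> r"
  proof (rule ccontr)
    assume "\<not> \<one> \<prec> r"
    then have "r \<preceq> \<one>" using not_lt[of \<one> r] r by auto
    then have "r \<otimes> r \<preceq> \<one> \<otimes> \<one>" by (intro le_mult2)
    then show False using r assms lt_not_le by simp
  qed
  moreover have "\<one> \<otimes> r \<prec> r \<otimes> r" using rx \<open>\<one> \<prec> r\<close> by (subst lt_mult_iff) auto
  ultimately show ?thesis using that rx r by simp
qed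

lemma sq_gt: "\<one> \<prec> z \<Longrightarrow> z \<in> Kx \<Longrightarrow> z \<prec> z \<otimes> z"
  using lt_mult_iff[of z \<one> z] by simp

lemma cut_endpointE:
  assumes "Df1 A" and "\<forall>x\<in>Kx. \<forall>y. A x \<longrightarrow> y \<preceq> x \<longrightarrow> A y" and "\<exists>x\<in>Kx. A x" "\<exists>x\<in>Kx. \<not> A x"
  shows "\<exists>c\<in>Kx. (\<forall>x\<in>Kx. A x \<longleftrightarrow> x \<preceq> c) \<or> (\<forall>x\<in>Kx. A x \<longleftrightarrow> x \<prec> c)"
proof -
  have "(\<forall>x\<in>Kx. A x) \<or> (\<forall>x\<in>Kx. \<not> A x) \<or> (\<exists>c\<in>Kx. (\<forall>x\<in>Kx. A x \<longleftrightarrow> x \<preceq> c) \<or> (\<forall>x\<in>Kx. A x \<longleftrightarrow> x \<prec> c))"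
    by (rule cut_endpoint[OF assms(1)]) (rule assms(2)[rule_format])
  then show ?thesis
    by (elim disjE) (use assms(3,4) in blast, use assms(3,4) in blast, assumption)
qed

lemma Kx_cancel: "u \<in> Kx \<Longrightarrow> x \<in> K \<Longrightarrow> u \<otimes> (inv u \<otimes> x) = x"
  by (simp add: m_assoc[symmetric])

lemma div_mult_cancel_right:
  assumes "a \<in> K" "b \<in> Kx" "c \<in> Kx"
  shows "a \<oslash> (b \<otimes> c) \<otimes> c = a \<oslash> b"
proof -
  have "a \<oslash> (b \<otimes> c) \<otimes> c \<otimes> b = a"
    using div_mult_cancel[of a "b \<otimes> c"] assms by (simp add: m_assoc m_comm)
  then show ?thesis using mult_div_cancel[of "a \<oslash> (b \<otimes> c) \<otimes> c" b] assms by simp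
qed

text \<open>A counterexample z has v(z) > 0 and v(s z) \<le> 0, and so has its square, whose value
  is twice as large. But counterexamples are bounded, as v(s) is positive near
  \<open>\<zero>\<close>, and a bounded cut closed under doubling has no endpoint.\<close>

lemma dhom_pos:
  assumes s: "dhom s" and l: "lim s \<zero>" and x: "x \<in> Kx" "\<one> \<prec> x"
  shows "\<one> \<prec> s x"
proof (rule ccontr)
  note h = dhomD[OF s]
  assume "\<not> \<one> \<prec> s x"
  then have sx: "s x \<preceq> \<one>" using not_lt[of \<one> "s x"] h(2)[OF x(1)] by auto
  obtain e where e: "e \<in> Kx" "\<one> \<prec> e" using above_exists[OF one_Kx] .
  obtain d where d: "d \<in> Kx" "\<forall>x\<in>Kx. d \<preceq> x \<longrightarrow> e \<preceq> s x \<ominus> \<zero>" using limD[OF l e(1)] unfolding ev_def by blast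
  have big: "\<one> \<prec> s x" if "x \<in> Kx" "d \<preceq> x" for x
  proof -
    have "s x \<ominus> \<zero> = s x" using h(2)[OF that(1)] by (simp add: a_minus_def)
    then show ?thesis using d(2) that lt_le_trans[OF e(2)] by auto
  qed
  define A where "A x \<longleftrightarrow> (\<exists>z\<in>Kx. \<one> \<prec> z \<and> s z \<preceq> \<one> \<and> x \<preceq> z)" for x
  have df: "Df1 A" unfolding Df1_def A_def by (intro df Dt_fun1[OF h(1)]) simp_all
  have down: "A y" if "A x" "y \<preceq> x" for x y
    using that le_trans[OF that(2)] unfolding A_def by blast
  have self: "A z" if "z \<in> Kx" "\<one> \<prec> z" "s z \<preceq> \<one>" for z using that unfolding A_def by auto
  have "\<not> A d" unfolding A_def using big lt_not_le by blast
  have down': "\<forall>x\<in>Kx. \<forall>y. A x \<longrightarrow> y \<preceq> x \<longrightarrow> A y" by (intro ballI allI impI) (rule down)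
  have exA: "\<exists>x\<in>Kx. A x" "\<exists>x\<in>Kx. \<not> A x" using self[OF x sx] x(1) \<open>\<not> A d\<close> d(1) by auto
  obtain c where c: "c \<in> Kx" "(\<forall>x\<in>Kx. A x \<longleftrightarrow> x \<preceq> c) \<or> (\<forall>x\<in>Kx. A x \<longleftrightarrow> x \<prec> c)"
    by (rule bexE[OF cut_endpointE[OF df down' exA]]) (rule that)
  have sq: "A (z \<otimes> z)" if z: "z \<in> Kx" "\<one> \<prec> z" "s z \<preceq> \<one>" for z
  proof (rule self)
    show "z \<otimes> z \<in> Kx" using z by simp
    show "\<one> \<prec> z \<otimes> z" using lt_trans[OF z(2) sq_gt] z by blast
    have "s z \<otimes> s z \<preceq> \<one> \<otimes> \<one>" using z(3) by (intro le_mult2)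
    then show "s (z \<otimes> z) \<preceq> \<one>" using h(3)[OF z(1,1)] by simp
  qed
  from c(2) show False
  proof
    assume cc: "\<forall>x\<in>Kx. A x \<longleftrightarrow> x \<preceq> c"
    then have "A c" using c(1) by simp
    then obtain z where z: "z \<in> Kx" "\<one> \<prec> z" "s z \<preceq> \<one>" "c \<preceq> z" unfolding A_def by blast
    have "z \<otimes> z \<preceq> c" using cc sq[OF z(1-3)] z(1) by simp
    then have "z \<otimes> z \<preceq> z" using z(4) by (rule le_trans)
    then show False using sq_gt[OF z(2,1)] lt_not_le by blast
  next
    assume cc: "\<forall>x\<in>Kx. A x \<longleftrightarrow> x \<prec> c"
    then have "x \<prec> c" using self[OF x sx] x(1) by simp
    then have "\<one> \<prec> c" using lt_trans[OF x(2)] by blast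
    \<comment> \<open>Half of the missing endpoint lies in the cut, and doubling a counterexample
      above it reaches the endpoint.\<close>
    then obtain r where r: "r \<in> Kx" "\<one> \<prec> r" "r \<prec> c" "r \<otimes> r = c" using sqrt_between[OF _ c(1)] by blast
    then have "A r" using cc by simp
    then obtain z where z: "z \<in> Kx" "\<one> \<prec> z" "s z \<preceq> \<one>" "r \<preceq> z" unfolding A_def by blast
    have "z \<otimes> z \<prec> c" using cc sq[OF z(1-3)] z(1) by simp
    moreover have "c \<preceq> z \<otimes> z" using le_mult2[OF z(4,4)] r(4) by simp
    ultimately show False using lt_not_le by blast
  qed
qed

lemma dhom_div: "dhom s \<Longrightarrow> x \<in> Kx \<Longrightarrow> y \<in> Kx \<Longrightarrow> s (x \<oslash> y) \<otimes> s y = s x"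
  using dhomD(3)[of s "x \<oslash> y" y] by simp

lemma dhom_strict:
  assumes s: "dhom s" and l: "lim s \<zero>" and x: "x \<in> Kx" "y \<in> Kx" "x \<prec> y"
  shows "s x \<prec> s y"
proof -
  note h = dhomD[OF s]
  have "\<one> \<prec> y \<oslash> x" using x by (simp add: lt_div_iff)
  then have "\<one> \<prec> s (y \<oslash> x)" using dhom_pos[OF s l, of "y \<oslash> x"] x by simp
  then have "\<one> \<otimes> s x \<prec> s (y \<oslash> x) \<otimes> s x" using h(2) x by (subst lt_mult_iff) auto
  then show ?thesis using dhom_div[OF s x(2,1)] h(2) x by simp
qed

lemma dhom_le_iff:
  assumes s: "dhom s" and l: "lim s \<zero>" and x: "x \<in> Kx" "y \<in> Kx"
  shows "x \<preceq> y \<longleftrightarrow> s x \<preceq> s y"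
proof
  note h = dhomD[OF s]
  assume a: "x \<preceq> y"
  show "s x \<preceq> s y"
  proof (cases "y \<preceq> x")
    case True
    then have "y \<asymp> x" using a by (simp add: eqv_def)
    then obtain u where u: "u \<in> vunits" "y = u \<otimes> x" using eqv_unit_obtain x by blast
    then have "s y = s u \<otimes> s x" using h x by simp
    then have "s y \<asymp> s x" using eqv_unit_mult[of "s x" "s u"] dhom_units[OF s u(1)] h(2) x by simp
    then show ?thesis by (simp add: eqv_def)
  next
    case False
    then have "x \<prec> y" using a by (simp add: lt_def)
    then show ?thesis using dhom_strict[OF s l x] lt_imp_le by blast
  qed
next
  assume a: "s x \<preceq> s y"
  show "x \<preceq> y"
  proof (rule ccontr)
    assume "\<not> x \<preceq> y"
    then have "y \<prec> x" using not_le[of x y] x by auto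
    then show False using dhom_strict[OF s l x(2,1)] a lt_not_le by blast
  qed
qed

text \<open>Lower bounds of v(s x) over all x of positive value can be doubled, since every such x
  is the square of another one. A bounded cut with a positive member that is closed under doubling
  has no endpoint.\<close>

lemma dhom_small:
  assumes s: "dhom s" and l: "lim s \<zero>" and e: "e \<in> Kx" "\<one> \<prec> e"
  shows "\<exists>x\<in>Kx. \<one> \<prec> x \<and> s x \<prec> e"
proof (rule ccontr)
  note h = dhomD[OF s]
  assume no: "\<not> ?thesis"
  define A where "A y \<longleftrightarrow> (\<forall>x\<in>Kx. \<one> \<prec> x \<longrightarrow> y \<preceq> s x)" for y
  have df: "Df1 A" unfolding Df1_def A_def by (intro df Dt_fun1[OF h(1)]) simp_all
  have down: "A y" if "A x" "y \<preceq> x" for x y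
    using that le_trans[OF that(2)] unfolding A_def by blast
  have Ae: "A e" unfolding A_def using no not_lt[of _ e] h(2) e by auto
  obtain x0 where x0: "x0 \<in> Kx" "\<one> \<prec> x0" using above_exists[OF one_Kx] .
  obtain b where b: "b \<in> Kx" "s x0 \<prec> b" using above_exists[OF h(2)[OF x0(1)]] .
  have nb: "\<not> A b" unfolding A_def using x0 b lt_not_le by blast
  have down': "\<forall>x\<in>Kx. \<forall>y. A x \<longrightarrow> y \<preceq> x \<longrightarrow> A y" by (intro ballI allI impI) (rule down)
  have exA: "\<exists>x\<in>Kx. A x" "\<exists>x\<in>Kx. \<not> A x" using Ae e(1) nb b(1) by auto
  obtain c where c: "c \<in> Kx" "(\<forall>x\<in>Kx. A x \<longleftrightarrow> x \<preceq> c) \<or> (\<forall>x\<in>Kx. A x \<longleftrightarrow> x \<prec> c)"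
    by (rule bexE[OF cut_endpointE[OF df down' exA]]) (rule that)
  have sq: "A (y \<otimes> y)" if y: "A y" "y \<in> Kx" for y
    unfolding A_def
  proof (intro ballI impI)
    fix x assume x: "x \<in> Kx" "\<one> \<prec> x"
    obtain r where r: "r \<in> Kx" "\<one> \<prec> r" "r \<otimes> r = x" using sqrt_between[OF x(2,1)] by blast
    have "y \<preceq> s r" using y r unfolding A_def by blast
    then have "y \<otimes> y \<preceq> s r \<otimes> s r" by (intro le_mult2)
    then show "y \<otimes> y \<preceq> s x" using h(3)[OF r(1,1)] r(3) by simp
  qed
  from c(2) show False
  proof
    assume cc: "\<forall>x\<in>Kx. A x \<longleftrightarrow> x \<preceq> c"
    then have Ac: "A c" and "e \<preceq> c" using c(1) Ae e(1) by auto
    have "\<one> \<prec> c" using lt_le_trans[OF e(2) \<open>e \<preceq> c\<close>] .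
    moreover have "c \<otimes> c \<preceq> c" using cc sq[OF Ac c(1)] c(1) by simp
    ultimately show False using sq_gt c(1) lt_not_le by blast
  next
    assume cc: "\<forall>x\<in>Kx. A x \<longleftrightarrow> x \<prec> c"
    then have "e \<prec> c" using Ae e(1) by simp
    then have "\<one> \<prec> c" using lt_trans[OF e(2)] by blast
    then obtain r where r: "r \<in> Kx" "r \<prec> c" "r \<otimes> r = c" using sqrt_between[OF _ c(1)] by blast
    have "A r" using bspec[OF cc r(1)] r(2) by blast
    then have "A c" using sq[OF _ r(1)] r(3) by blast
    then show False using bspec[OF cc c(1)] by simp
  qed
qed

text \<open>The cut of those x with v(s x) \<le> v(y) has an endpoint \<open>c\<close>. If
  \<open>s c\<close> missed the value of \<open>y\<close>, moving \<open>c\<close> by an x from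
  \<open>dhom_small\<close> with sufficiently small v(s x) would contradict the choice of the
  endpoint.\<close>

lemma dhom_value_surj:
  assumes s: "dhom s" and l: "lim s \<zero>" and y: "y \<in> Kx"
  shows "\<exists>x\<in>Kx. s x \<asymp> y"
proof -
  note h = dhomD[OF s]
  define A where "A x \<longleftrightarrow> x \<in> Kx \<longrightarrow> s x \<preceq> y" for x
  have df: "Df1 A" unfolding Df1_def A_def by (intro df Dt_fun1[OF h(1)]) (use y in simp_all)
  have down: "A x'" if "A x" "x' \<preceq> x" "x \<in> Kx" for x x'
    using that dhom_le_iff[OF s l, of x' x] le_trans[of "s x'" "s x" y] unfolding A_def by blast
  have big: "\<exists>x\<in>Kx. z \<prec> s x" if z: "z \<in> Kx" for z
  proof -
    obtain e where e: "e \<in> Kx" "z \<prec> e" using above_exists[OF z] .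
    from ev_exD[OF limD[OF l e(1)]] obtain x where x: "x \<in> Kx" "e \<preceq> s x \<ominus> \<zero>" by blast
    have "s x \<ominus> \<zero> = s x" using h(2)[OF x(1)] by (simp add: a_minus_def)
    then show ?thesis using x lt_le_trans[OF e(2)] by auto
  qed
  have nA: "\<exists>x\<in>Kx. \<not> A x" using big[OF y] lt_not_le unfolding A_def by blast
  have eA: "\<exists>x\<in>Kx. A x"
  proof -
    obtain x where x: "x \<in> Kx" "\<one> \<oslash> y \<prec> s x" using big[of "\<one> \<oslash> y"] y by auto
    have "s (\<one> \<oslash> x) \<otimes> s x = \<one>" using dhom_div[OF s one_Kx x(1)] dhom_one[OF s] by simp
    moreover have k: "s (\<one> \<oslash> x) \<in> Kx" "s x \<in> Kx" using h(2) x by simp_all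
    moreover have "\<one> \<prec> s x \<otimes> y" using x y k by (simp add: div_lt_iff)
    then have "s x \<otimes> s (\<one> \<oslash> x) \<prec> s x \<otimes> y" using calculation by (simp add: m_comm)
    then have "s (\<one> \<oslash> x) \<prec> y" using lt_mult_iff[of "s x" "s (\<one> \<oslash> x)" y] k y by (simp add: m_comm)
    then show ?thesis unfolding A_def using x(1) lt_imp_le by (intro bexI[of _ "\<one> \<oslash> x"]) auto
  qed
  have down': "\<forall>x\<in>Kx. \<forall>y. A x \<longrightarrow> y \<preceq> x \<longrightarrow> A y" by (intro ballI allI impI) (rule down)
  obtain c where c: "c \<in> Kx" "(\<forall>x\<in>Kx. A x \<longleftrightarrow> x \<preceq> c) \<or> (\<forall>x\<in>Kx. A x \<longleftrightarrow> x \<prec> c)"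
    by (rule bexE[OF cut_endpointE[OF df down' eA nA]]) (rule that)
  have sc: "s c \<in> Kx" by (rule h(2)[OF c(1)])
  from c(2) have "s c \<asymp> y"
  proof
    assume cc: "\<forall>x\<in>Kx. A x \<longleftrightarrow> x \<preceq> c"
    have "A c" using bspec[OF cc c(1)] c(1) by simp
    then have le: "s c \<preceq> y" unfolding A_def using c(1) by blast
    show ?thesis
    proof (rule ccontr)
      assume "\<not> s c \<asymp> y"
      then have "s c \<prec> y" using le by (simp add: lt_def eqv_def)
      then have "\<one> \<prec> y \<oslash> s c" using sc y by (simp add: lt_div_iff)
      then obtain x where x: "x \<in> Kx" "\<one> \<prec> x" "s x \<prec> y \<oslash> s c" using dhom_small[OF s l, of "y \<oslash> s c"] sc y by auto
      have "s x \<otimes> s c \<prec> y" using x h(2)[OF x(1)] sc y by (simp add: lt_div_iff)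
      then have "A (x \<otimes> c)" using h(3)[OF x(1) c(1)] lt_imp_le by (simp add: A_def)
      then have "x \<otimes> c \<preceq> c" using cc x(1) c(1) by simp
      moreover have "\<one> \<otimes> c \<prec> x \<otimes> c" using x c(1) by (subst lt_mult_iff) auto
      ultimately show False using lt_not_le c(1) by simp
    qed
  next
    assume cc: "\<forall>x\<in>Kx. A x \<longleftrightarrow> x \<prec> c"
    have "\<not> A c" using cc c(1) by simp
    then have "y \<prec> s c" using not_le[of "s c" y] sc y c(1) by (auto simp: A_def)
    then have "\<one> \<prec> s c \<oslash> y" using sc y by (simp add: lt_div_iff)
    then obtain x where x: "x \<in> Kx" "\<one> \<prec> x" "s x \<prec> s c \<oslash> y" using dhom_small[OF s l, of "s c \<oslash> y"] sc y by auto
    have sx: "s x \<in> Kx" by (rule h(2)[OF x(1)])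
    have "c \<oslash> x \<prec> c" using lt_mult_iff[of c \<one> x] x c(1) by (simp add: div_lt_iff m_comm)
    then have "s (c \<oslash> x) \<preceq> y" using cc x(1) c(1) by (auto simp: A_def)
    then have "s (c \<oslash> x) \<otimes> s x \<preceq> y \<otimes> s x" using sx by (intro le_mult) auto
    then have "s c \<preceq> y \<otimes> s x" using dhom_div[OF s c(1) x(1)] by simp
    moreover have "s x \<otimes> y \<prec> s c" using x sx sc y by (simp add: lt_div_iff)
    ultimately show ?thesis using lt_not_le sx y by (simp add: m_comm)
  qed
  with c(1) show ?thesis by blast
qed

text \<open>The hypothesis determines s^q only up to value; the quotient s^q x^(-p) is an
  endomorphism all of whose values are units, and such a map is trivial.\<close>

lemma gamma_power_contracting:
  assumes gamma_hyp and s: "dhom s" and l: "lim s \<zero>"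
  shows "\<exists>(q :: nat) p. q > 0 \<and> (\<forall>x\<in>Kx. pw (int q) (s x) = pw p x)"
proof -
  note h = dhomD[OF s]
  obtain p q :: nat where q: "q > 0" "\<forall>x\<in>Kx. s x [^] q \<asymp> x [^] p"
    using assms(1)[unfolded gamma_hyp_def, rule_format, of s] s dhom_le_iff[OF s l] dhom_value_surj[OF s l] by auto
  define g where "g x = pw (int q) (s x) \<otimes> pw (- int p) x" for x
  have g: "dhom g" unfolding g_def by (rule dhom_mult[OF dhom_pw_comp[OF s] dhom_pw])
  have "g x \<asymp> \<one>" if x: "x \<in> Kx" for x
  proof -
    have "pw (int q) (s x) \<asymp> pw (int p) x" using q(2) x h(2)[OF x] by (simp add: pw_nat)
    then have "pw (int q) (s x) \<otimes> pw (- int p) x \<asymp> pw (int p) x \<otimes> pw (- int p) x"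
      by (intro eqv_mult2) auto
    then show ?thesis using pw_minus[OF x] by (simp add: g_def)
  qed
  then have g1: "g x = \<one>" if "x \<in> Kx" for x using dhom_unit_valued_trivial[OF g _ that] by blast
  have "pw (int q) (s x) = pw (int p) x" if x: "x \<in> Kx" for x
  proof -
    have "pw (int q) (s x) = pw (int q) (s x) \<otimes> (pw (- int p) x \<otimes> pw (int p) x)"
      using pw_minus[OF x, of "- int p"] by simp
    also have "\<dots> = g x \<otimes> pw (int p) x" unfolding g_def by (simp add: m_assoc)
    finally show ?thesis using g1[OF x] by simp
  qed
  then show ?thesis using q(1) by blast
qed

lemma lim_or_const:
  assumes s: "dhom s"
  shows "lim s \<zero> \<or> (\<forall>y\<in>Kx. ev (\<lambda>x. s x \<prec> y)) \<or> (\<forall>x\<in>Kx. s x = \<one>)"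
proof -
  note h = dhomD[OF s]
  have nz: "ev (\<lambda>x. s x \<noteq> \<zero>)" by (rule evI[OF one_Kx]) (use h(2) in auto)
  consider "\<forall>y\<in>Kx. ev (\<lambda>x. y \<preceq> s x)" | "\<forall>y\<in>Kx. ev (\<lambda>x. s x \<prec> y)" | c where "c \<in> Kx" "ev (\<lambda>x. s x \<asymp> c)"
    using value_trichotomy[OF h(1) nz] by blast
  then show ?thesis
  proof cases
    case 1
    have "lim s \<zero>"
    proof (rule limI)
      fix e assume "e \<in> Kx"
      then have "ev (\<lambda>x. e \<preceq> s x)" using 1 by blast
      then show "ev (\<lambda>x. e \<preceq> s x \<ominus> \<zero>)" by (rule ev_mono) (use h(2) in \<open>auto simp: a_minus_def\<close>)
    qed simp
    then show ?thesis by blast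
  next
    case (3 c)
    then show ?thesis using dhom_trivial[OF s 3] by blast
  qed blast
qed

lemma gamma_power:
  assumes gamma_hyp and s: "dhom s"
  shows "\<exists>(q :: nat) p. q > 0 \<and> (\<forall>x\<in>Kx. pw (int q) (s x) = pw p x)"
proof -
  note h = dhomD[OF s]
  consider "lim s \<zero>" | "\<forall>y\<in>Kx. ev (\<lambda>x. s x \<prec> y)" | "\<forall>x\<in>Kx. s x = \<one>"
    using lim_or_const[OF s] by blast
  then show ?thesis
  proof cases
    case 1
    then show ?thesis by (rule gamma_power_contracting[OF assms])
  next
    case 2
    \<comment> \<open>When \<open>s\<close> tends to infinity, its pointwise inverse tends to
      \<open>\<zero>\<close>.\<close>
    define r where "r x = pw (- 1) (s x)" for x
    have r: "dhom r" unfolding r_def by (rule dhom_pw_comp[OF s])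
    have rs: "r x = \<one> \<oslash> s x" if "x \<in> Kx" for x
      using pw_minus_div[OF h(2)[OF that], of 1] pw_1[OF h(2)[OF that]] by (simp add: r_def)
    have "lim r \<zero>"
    proof (rule limI)
      fix e assume e: "e \<in> Kx"
      then have "ev (\<lambda>x. s x \<prec> \<one> \<oslash> e)" using 2 by simp
      then show "ev (\<lambda>x. e \<preceq> r x \<ominus> \<zero>)"
      proof (rule ev_mono)
        fix x assume x: "x \<in> Kx" "s x \<prec> \<one> \<oslash> e"
        then have "s x \<otimes> e \<prec> \<one>" using e h(2) by (simp add: lt_div_iff)
        then have "e \<preceq> r x" using e h(2)[OF x(1)] lt_imp_le unfolding rs[OF x(1)] by (simp add: le_div_iff m_comm)
        then show "e \<preceq> r x \<ominus> \<zero>" using dhomD(2)[OF r x(1)] by (simp add: a_minus_def)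
      qed
    qed simp
    then obtain q :: nat and p where q: "q > 0" "\<forall>x\<in>Kx. pw (int q) (r x) = pw p x"
      using gamma_power_contracting[OF assms(1) r] by blast
    have "pw (int q) (s x) = pw (- p) x" if x: "x \<in> Kx" for x
    proof -
      have "pw (- 1) (pw (int q) (r x)) = pw (- 1) (pw p x)" using q(2) x by simp
      then show ?thesis unfolding r_def using h(2)[OF x] x by (simp add: pw_pw)
    qed
    then show ?thesis using q(1) by blast
  next
    case 3
    then have "\<forall>x\<in>Kx. pw (int 1) (s x) = pw 0 x" using pw_1[of \<one>] by simp
    then show ?thesis by (intro exI[of _ "1::nat"] exI[of _ "0::int"]) simp
  qed
qed

section \<open>Endomorphisms on residues of units\<close>

lemma finite_residues:
  assumes "Df1 V" and w: "res_seq w" and "finite {n. V (w n)}"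
  obtains Q where "finite Q" "\<And>x. x \<in> vring \<Longrightarrow> V x \<Longrightarrow> \<exists>q\<in>Q. x \<approx> q"
proof -
  obtain Q where Q: "finite Q" "Q \<subseteq> K"
    "\<And>x y. x \<in> vring \<Longrightarrow> y \<in> vring \<Longrightarrow> \<forall>q\<in>Q. \<not> x \<approx> q \<and> \<not> y \<approx> q \<Longrightarrow> V x = V y"
    using residue_cells[OF assms(1)] by blast
  have "finite ({n. \<exists>q\<in>Q. w n \<approx> q} \<union> {n. V (w n)})" using res_seq_avoid[OF w Q(1)] assms(3) by simp
  from ex_new_if_finite[OF infinite_UNIV_nat this]
  obtain n where n: "\<forall>q\<in>Q. \<not> w n \<approx> q" "\<not> V (w n)" by blast
  have "\<exists>q\<in>Q. x \<approx> q" if "x \<in> vring" "V x" for x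
  proof (rule ccontr)
    assume "\<not> ?thesis"
    then have "V x = V (w n)" using Q(3)[of x "w n"] n(1) that(1) res_seq_units[OF w, of n] by auto
    then show False using n(2) that(2) by simp
  qed
  with Q(1) show ?thesis by (rule that)
qed

lemma dhom_inv: "dhom s \<Longrightarrow> u \<in> vunits \<Longrightarrow> s (inv u) = inv (s u)"
proof -
  assume s: "dhom s" and u: "u \<in> vunits"
  note h = dhomD[OF s]
  have su: "s u \<in> Kx" using h(2) u by simp
  have "s u \<otimes> s (inv u) = \<one>" using h(3)[of u "inv u"] u dhom_one[OF s] by simp
  also have "\<dots> = s u \<otimes> inv (s u)" using su by simp
  finally show ?thesis using m_lcancel[of "s u" "s (inv u)" "inv (s u)"] su h(2)[of "inv u"] u by simp
qed

lemma req_inv: assumes "u \<approx> v" "u \<in> vunits" shows "inv u \<approx> inv v"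
proof -
  have v: "v \<in> vunits" using req_unit[OF assms] .
  have "\<one> \<oslash> u \<doteq> \<one> \<oslash> v" using assms by (intro rveq_div2) (auto simp: req_rveq)
  then have "inv u \<doteq> inv v" using assms v by (simp add: div_Kx_eq)
  then show ?thesis using assms by (simp add: req_rveq)
qed

lemma pw_vunits: assumes "u \<in> vunits" shows "pw m u \<in> vunits"
proof (cases m rule: int_cases2)
  case (nonneg n)
  then show ?thesis using assms pw_nat[of u n] by simp
next
  case (nonpos n)
  then show ?thesis using assms pw_nat[of u n] pw_minus_div[of u "int n"] by simp
qed

text \<open>\<open>s\<close> need not respect residues. The residues of s(u) with u \<approx> \<one>
  form a definable group \<open>V\<close>. If \<open>V\<close> is infinite, it is everything; then
  infinitely many classes contain a unit with image of residue 1, so \<open>s\<close> is trivial on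
  residues. If \<open>V\<close> is finite, a power r = s^N kills it and induces an endomorphism of
  k^\<times>. Its kernel is everything or finite, and in the latter case its image is
  everything.\<close>

lemma residue_power:
  assumes rh: residue_hyp and s: "dhom s"
  shows "\<exists>(q :: nat) p. q > 0 \<and> (\<forall>x\<in>Kx. pw (int q) (s x) = pw p x)"
proof -
  note h = dhomD[OF s]
  have su: "s u \<in> vunits" if "u \<in> vunits" for u by (rule dhom_units[OF s that])
  \<comment> \<open>A power relation on residues of units suffices: the quotient of its two sides is
    trivial by \<open>dhom_residue_trivial\<close>.\<close>
  have conclude: ?thesis if q: "q > 0" "\<And>u. u \<in> vunits \<Longrightarrow> pw (int q) (s u) \<approx> pw p u" for q p
  proof -
    define g where "g x = pw (int q) (s x) \<otimes> pw (- p) x" for x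
    have g: "dhom g" unfolding g_def by (rule dhom_mult[OF dhom_pw_comp[OF s] dhom_pw])
    have "g u \<approx> \<one>" if u: "u \<in> vunits" for u
    proof -
      have "pw (int q) (s u) \<otimes> pw (- p) u \<approx> pw p u \<otimes> pw (- p) u"
        using q(2)[OF u] pw_vunits[OF u] by (intro req_mult) auto
      then show ?thesis using pw_minus[of u p] u by (simp add: g_def)
    qed
    then have g1: "g x = \<one>" if "x \<in> Kx" for x using dhom_residue_trivial[OF g _ that] by blast
    have "pw (int q) (s x) = pw p x" if x: "x \<in> Kx" for x
    proof -
      have "pw (int q) (s x) = pw (int q) (s x) \<otimes> (pw (- p) x \<otimes> pw p x)"
        using pw_minus[OF x, of "- p"] by simp
      also have "\<dots> = g x \<otimes> pw p x" unfolding g_def by (simp add: m_assoc)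
      finally show ?thesis using g1[OF x] by simp
    qed
    then show ?thesis using q(1) by blast
  qed
  obtain w where w: "res_seq w" by (rule res_seq_exists)
  have wu: "w n \<in> vunits" for n by (rule res_seq_units[OF w])
  define V where "V v \<longleftrightarrow> (\<exists>u\<in>vunits. u \<approx> \<one> \<and> s u \<approx> v)" for v
  have V: "Df1 V" unfolding Df1_def V_def by (intro df Dt_fun1[OF h(1)]) simp_all
  have Vmult: "V (a \<otimes> b)" if ab: "V a" "V b" for a b
  proof -
    obtain u v where u: "u \<in> vunits" "u \<approx> \<one>" "s u \<approx> a" "v \<in> vunits" "v \<approx> \<one>" "s v \<approx> b"
      using ab unfolding V_def by blast
    have a: "a \<in> vunits" using req_unit[OF u(3) su[OF u(1)]] .
    have "s u \<otimes> s v \<approx> a \<otimes> b" using u su a by (intro req_mult2) auto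
    then have "s (u \<otimes> v) \<approx> a \<otimes> b" using h(3) u by simp
    moreover have "u \<otimes> v \<approx> \<one> \<otimes> \<one>" using u by (intro req_mult2) auto
    ultimately show ?thesis unfolding V_def using u by (intro bexI[of _ "u \<otimes> v"]) auto
  qed
  have Vinv: "V (inv a)" if a: "V a" "a \<in> vunits" for a
  proof -
    obtain u where u: "u \<in> vunits" "u \<approx> \<one>" "s u \<approx> a" using a unfolding V_def by blast
    have "s (inv u) \<approx> inv a" using req_inv[OF u(3) su[OF u(1)]] dhom_inv[OF s u(1)] by simp
    moreover have "inv u \<approx> \<one>" using req_inv[OF u(2,1)] by simp
    ultimately show ?thesis unfolding V_def using u by (intro bexI[of _ "inv u"]) auto
  qed
  show ?thesis
  proof (cases "infinite {n. V (w n)}")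
    case True
    have Vall: "V u" if "u \<in> vunits" for u
      by (rule unit_subgroup_full[OF V w True _ _ that]) (use Vmult Vinv in blast)+
    define H where "H u \<longleftrightarrow> s u \<approx> \<one>" for u
    have H: "Df1 H" unfolding Df1_def H_def by (intro df Dt_fun1[OF h(1)]) simp_all
    have "\<exists>u. u \<in> vunits \<and> u \<approx> \<one> \<and> s u \<approx> s (w n)" for n using Vall[OF su[OF wu[of n]]] unfolding V_def by blast
    then obtain v where v: "\<And>n. v n \<in> vunits" "\<And>n. v n \<approx> \<one>" "\<And>n. s (v n) \<approx> s (w n)" by metis
    \<comment> \<open>Dividing \<open>w n\<close> by an element of residue 1 with the same image
      keeps the residue and lands in \<open>H\<close>.\<close>
    define w' where "w' n = w n \<otimes> inv (v n)" for n
    have w'w: "w' n \<approx> w n" for n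
    proof -
      have "w n \<otimes> inv (v n) \<approx> w n \<otimes> \<one>" using req_inv[OF v(2,1)] wu[of n] v(1)[of n]
        by (intro req_mult2) auto
      then show ?thesis using wu[of n] by (simp add: w'_def)
    qed
    have w'u: "w' n \<in> vunits" for n using wu v(1) by (simp add: w'_def)
    have rs: "res_seq w'" unfolding res_seq_def
      using w'u w w'w req_sym req_trans unfolding res_seq_def by metis
    have Hw': "H (w' n)" for n
    proof -
      have "s (w n) \<otimes> inv (s (v n)) \<approx> s (v n) \<otimes> inv (s (v n))"
        using req_sym[OF v(3)[of n]] su[OF v(1)[of n]] by (intro req_mult) auto
      then show ?thesis unfolding H_def w'_def
        using h(3)[of "w n" "inv (v n)"] wu[of n] v(1)[of n] dhom_inv[OF s v(1)[of n]] h(2)[of "v n"] by simp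
    qed
    then have inf: "infinite {n. H (w' n)}" by simp
    have "H u" if "u \<in> vunits" for u
    proof (rule unit_subgroup_full[OF H rs inf _ _ that])
      fix a b assume ab: "a \<in> vunits" "b \<in> vunits" "H a" "H b"
      have "s a \<otimes> s b \<approx> \<one> \<otimes> \<one>" using ab su unfolding H_def by (intro req_mult2) auto
      then show "H (a \<otimes> b)" unfolding H_def using h(3) ab by simp
    next
      fix a assume a: "a \<in> vunits" "H a"
      then show "H (inv a)" unfolding H_def using req_inv[of "s a" \<one>] su[of a] dhom_inv[OF s, of a] by simp
    qed
    then have "pw (int 1) (s u) \<approx> pw 0 u" if "u \<in> vunits" for u
      using that pw_1[of "s u"] h(2)[of u] unfolding H_def by simp
    then show ?thesis using conclude[of 1 0] by simp
  next
    case False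
    then obtain Q where Q: "finite Q" "\<And>x. x \<in> vring \<Longrightarrow> V x \<Longrightarrow> \<exists>q\<in>Q. x \<approx> q"
      using finite_residues[OF V w] by blast
    define N where "N = (fact (card Q) :: nat)"
    have N: "N > 0" by (simp add: N_def)
    have N1: "s u [^] N \<approx> \<one>" if u: "u \<in> vunits" "u \<approx> \<one>" for u
      unfolding N_def
    proof (rule finite_order[OF Q(1) su[OF u(1)]])
      fix i :: nat
      have "V (s u [^] i)"
      proof (induction i)
        case 0
        then show ?case unfolding V_def using dhom_one[OF s] by (intro bexI[of _ \<one>]) auto
      next
        case (Suc i)
        have "V (s u)" unfolding V_def using u su[OF u(1)] by auto
        then show ?case using Vmult Suc by simp
      qed
      then show "\<exists>a\<in>Q. s u [^] i \<approx> a" using Q(2) su[OF u(1)] by simp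
    qed
    define r where "r x = pw (int N) (s x)" for x
    have r: "dhom r" unfolding r_def by (rule dhom_pw_comp[OF s])
    note hr = dhomD[OF r]
    have rN: "r u = s u [^] N" if "u \<in> Kx" for u using pw_nat[OF h(2)[OF that]] by (simp add: r_def)
    have ru: "r u \<in> vunits" if "u \<in> vunits" for u by (rule dhom_units[OF r that])
    have r1: "r u \<approx> \<one>" if "u \<in> vunits" "u \<approx> \<one>" for u using N1[OF that] rN that by simp
    define H where "H u \<longleftrightarrow> r u \<approx> \<one>" for u
    have H: "Df1 H" unfolding Df1_def H_def by (intro df Dt_fun1[OF hr(1)]) simp_all
    show ?thesis
    proof (cases "infinite {n. H (w n)}")
      case True
      have "H u" if "u \<in> vunits" for u
      proof (rule unit_subgroup_full[OF H w True _ _ that])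
        fix a b assume ab: "a \<in> vunits" "b \<in> vunits" "H a" "H b"
        have "r a \<otimes> r b \<approx> \<one> \<otimes> \<one>" using ab ru unfolding H_def by (intro req_mult2) auto
        then show "H (a \<otimes> b)" unfolding H_def using hr(3) ab by simp
      next
        fix a assume a: "a \<in> vunits" "H a"
        then show "H (inv a)" unfolding H_def using req_inv[of "r a" \<one>] ru[of a] dhom_inv[OF r, of a] by simp
      qed
      then show ?thesis using conclude[of N 0] N unfolding H_def r_def by simp
    next
      case False
      then obtain Q' where Q': "finite Q'" "\<And>x. x \<in> vring \<Longrightarrow> H x \<Longrightarrow> \<exists>q\<in>Q'. x \<approx> q"
        using finite_residues[OF H w] by blast
      define W where "W v \<longleftrightarrow> (\<exists>u\<in>vunits. r u \<approx> v)" for v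
      have W: "Df1 W" unfolding Df1_def W_def by (intro df Dt_fun1[OF hr(1)]) simp_all
      have Wr: "W (r u)" if "u \<in> vunits" for u unfolding W_def using that ru[OF that] by (auto intro!: bexI[of _ u])
      \<comment> \<open>A finite image would have an infinite fibre along \<open>w\<close>, and
        quotients inside a fibre lie in the finite kernel.\<close>
      have "infinite {n. W (w n)}"
      proof
        assume "finite {n. W (w n)}"
        then obtain P where P: "finite P" "\<And>x. x \<in> vring \<Longrightarrow> W x \<Longrightarrow> \<exists>q\<in>P. x \<approx> q"
          using finite_residues[OF W w] by blast
        then have ex: "\<forall>n. \<exists>q\<in>P. r (w n) \<approx> q" using Wr[OF wu] ru[OF wu] by simp
        then obtain g where g: "\<And>n. g n \<in> P" "\<And>n. r (w n) \<approx> g n" by metis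
        have "finite (range g)" using g(1) P(1) by (meson finite_subset image_subsetI)
        then obtain k where k: "infinite {n. g n = g k}"
          using pigeonhole_infinite[OF infinite_UNIV_nat, of g] by auto
        have "\<exists>q\<in>(\<lambda>q. q \<otimes> w k) ` Q'. w n \<approx> q" if "g n = g k" for n
        proof -
          have "r (w n) \<approx> r (w k)" using g(2)[of n] g(2)[of k] that req_sym req_trans by metis
          then have "r (w n) \<otimes> inv (r (w k)) \<approx> r (w k) \<otimes> inv (r (w k))"
            using ru[OF wu[of k]] by (intro req_mult) auto
          then have "H (w n \<otimes> inv (w k))"
            unfolding H_def using hr(3)[of "w n" "inv (w k)"] wu dhom_inv[OF r wu[of k]] hr(2)[of "w k"] by simp
          then obtain q where q: "q \<in> Q'" "w n \<otimes> inv (w k) \<approx> q" using Q'(2)[of "w n \<otimes> inv (w k)"] wu by auto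
          have "w n \<otimes> inv (w k) \<otimes> w k \<approx> q \<otimes> w k" using q(2) wu by (intro req_mult) auto
          then have "w n \<approx> q \<otimes> w k" using wu by (simp add: m_assoc)
          then show ?thesis using q(1) by blast
        qed
        then have "{n. g n = g k} \<subseteq> {n. \<exists>q\<in>(\<lambda>q. q \<otimes> w k) ` Q'. w n \<approx> q}" by blast
        moreover have "finite {n. \<exists>q\<in>(\<lambda>q. q \<otimes> w k) ` Q'. w n \<approx> q}"
          by (rule res_seq_avoid[OF w]) (use Q'(1) in simp)
        ultimately show False using k finite_subset by blast
      qed
      then have Wall: "W u" if "u \<in> vunits" for u
      proof (rule unit_subgroup_full[OF W w _ _ _ that])
        fix a b assume ab: "a \<in> vunits" "b \<in> vunits" "W a" "W b"
        obtain u v where u: "u \<in> vunits" "r u \<approx> a" "v \<in> vunits" "r v \<approx> b" using ab unfolding W_def by blast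
        have "r u \<otimes> r v \<approx> a \<otimes> b" using u ru ab by (intro req_mult2) auto
        then show "W (a \<otimes> b)" unfolding W_def using hr(3) u by (intro bexI[of _ "u \<otimes> v"]) auto
      next
        fix a assume a: "a \<in> vunits" "W a"
        then obtain u where u: "u \<in> vunits" "r u \<approx> a" unfolding W_def by blast
        then show "W (inv a)" unfolding W_def
          using req_inv[OF u(2) ru[OF u(1)]] dhom_inv[OF r u(1)] by (intro bexI[of _ "inv u"]) auto
      qed
      have kernel: "\<exists>Q. finite Q \<and> (\<forall>u\<in>vunits. r u \<approx> \<one> \<longrightarrow> (\<exists>q\<in>Q. u \<approx> q))"
        using Q' unfolding H_def by (intro exI[of _ Q']) auto
      have "\<forall>w\<in>vunits. \<exists>u\<in>vunits. r u \<approx> w" using Wall unfolding W_def by blast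
      then obtain i :: int and j :: nat where j: "j > 0" "\<forall>u\<in>vunits. r u [^] j \<approx> pw i u"
        using rh r r1 kernel unfolding residue_hyp_def by blast
      have "pw (int (N * j)) (s u) \<approx> pw i u" if u: "u \<in> vunits" for u
      proof -
        have "pw (int (N * j)) (s u) = pw (int j) (r u)" unfolding r_def using h(2)[of u] u by (simp add: pw_pw)
        then show ?thesis using j(2) u pw_nat[OF hr(2)[of u]] by simp
      qed
      moreover have "N * j > 0" using N j(1) by simp
      ultimately show ?thesis using conclude by blast
    qed
  qed
qed

lemma dhom_power:
  assumes "gamma_hyp \<or> residue_hyp" and s: "dhom s"
  shows "\<exists>m. \<forall>x\<in>Kx. s x = pw m x"
proof -
  obtain q :: nat and p where "q > 0" "\<forall>x\<in>Kx. pw (int q) (s x) = pw p x"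
    using assms gamma_power residue_power by blast
  then show ?thesis using dhom_integral_power[OF s] by blast
qed

subsection \<open>Asymptotic expansions\<close>

text \<open>\<open>s b\<close> is the limit of f(b x) / f(x). It is definable in \<open>b\<close>
  because the limit relation is, and multiplicative because f(a b x) / f(x) factors through f(b
  x).\<close>

lemma shift_hom:
  assumes f: "deffun f" and nz: "ev (\<lambda>x. f x \<noteq> \<zero>)"
  obtains s where "dhom s" "\<And>b. b \<in> Kx \<Longrightarrow> lim (\<lambda>x. f (b \<otimes> x) \<oslash> f x) (s b)"
proof -
  have fK: "f x \<in> K" if "x \<in> K" for x using deffun_closed[OF f that] .
  define L where "L b y \<longleftrightarrow> lim (\<lambda>x. f (b \<otimes> x) \<oslash> f x) y" for b y
  have def: "deffun (\<lambda>x. f (b \<otimes> x) \<oslash> f x)" if "b \<in> Kx" for b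
    using that fK by (intro deffunI df Dt_fun1[OF f]) auto
  have ex: "\<exists>y\<in>Kx. L b y" if b: "b \<in> Kx" for b
  proof -
    obtain c where c: "c \<in> Kx" "ev (\<lambda>x. f (b \<otimes> x) \<oslash> f x \<doteq> c)" using shift_ratio[OF f nz b] by blast
    have "ev (\<lambda>x. f (b \<otimes> x) \<oslash> f x \<asymp> c)" using c(2) by (rule ev_mono) (rule eqv_sym[OF rveq_eqv])
    then obtain y where "y \<in> Kx" "lim (\<lambda>x. f (b \<otimes> x) \<oslash> f x) y" using limit_nonzero[OF def[OF b] c(1)] by blast
    then show ?thesis unfolding L_def by blast
  qed
  have uniq: "y = z" if "L b y" "L b z" "b \<in> Kx" for b y z
    using lim_unique[OF ev_K[OF def[OF that(3)]]] that(1,2) unfolding L_def by blast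
  define s where "s b = (if b \<in> Kx then THE y. L b y else \<one>)" for b
  have L: "L b (s b)" if "b \<in> Kx" for b
  proof -
    have "\<exists>!y. L b y" using ex[OF that] uniq[OF _ _ that] by blast
    then have "L b (THE y. L b y)" by (rule theI')
    then show ?thesis using that by (simp add: s_def)
  qed
  have sx: "s b \<in> Kx" if "b \<in> Kx" for b
    using ex[OF that] uniq[OF L[OF that] _ that] by auto
  have "Df (\<lambda>e. \<forall>\<epsilon>\<in>Kx. ev (\<lambda>x. \<epsilon> \<preceq> f (e 1 \<otimes> x) \<oslash> f x \<ominus> e 0))"
    by (intro df Dt_fun1[OF f])
  then have dL: "Df (\<lambda>e. L (e 1) (e 0))" by (rule Df_cong) (auto simp: L_def lim_def subset_eq)
  have "Df (\<lambda>e. (e 1 \<in> Kx \<and> L (e 1) (e 0)) \<or> (e 1 \<notin> Kx \<and> e 0 = \<one>))"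
    by (intro Df_disj Df_conj Df_not Df_Kx Dt_var dL Df_eq Dt_const one_closed)
  then have "Df (\<lambda>e. e 0 = s (e 1))"
    by (rule Df_cong) (use L uniq in \<open>auto simp: s_def\<close>)
  then have "deffun s" unfolding deffun_def using sx by (auto simp: s_def)
  moreover have "s (a \<otimes> b) = s a \<otimes> s b" if a: "a \<in> Kx" and b: "b \<in> Kx" for a b
  proof -
    have "lim (\<lambda>x. f (a \<otimes> (b \<otimes> x)) \<oslash> f (b \<otimes> x)) (s a)" using lim_scale[OF L[OF a, unfolded L_def] b] .
    moreover have "ev (\<lambda>x. f (a \<otimes> (b \<otimes> x)) \<oslash> f (b \<otimes> x) \<in> K)" "ev (\<lambda>x. f (b \<otimes> x) \<oslash> f x \<in> K)"
      by (rule evI[OF one_Kx], use fK a b in simp)+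
    ultimately have "lim (\<lambda>x. f (a \<otimes> (b \<otimes> x)) \<oslash> f (b \<otimes> x) \<otimes> (f (b \<otimes> x) \<oslash> f x)) (s a \<otimes> s b)"
      by (intro lim_mult L[OF b, unfolded L_def])
    then have "lim (\<lambda>x. f (a \<otimes> b \<otimes> x) \<oslash> f x) (s a \<otimes> s b)"
    proof (rule lim_cong)
      from ev_conj[OF nz ev_scale[OF nz b]]
      show "ev (\<lambda>x. f (a \<otimes> (b \<otimes> x)) \<oslash> f (b \<otimes> x) \<otimes> (f (b \<otimes> x) \<oslash> f x) = f (a \<otimes> b \<otimes> x) \<oslash> f x)"
      proof (rule ev_mono)
        fix x assume x: "x \<in> Kx" "f x \<noteq> \<zero> \<and> f (b \<otimes> x) \<noteq> \<zero>"
        have bx: "b \<otimes> x \<in> K" "a \<otimes> (b \<otimes> x) \<in> K" "x \<in> K" using x(1) a b by simp_all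
        have k: "f x \<in> Kx" "f (b \<otimes> x) \<in> Kx" "f (a \<otimes> (b \<otimes> x)) \<in> K"
          using x(2) fK[OF bx(1)] fK[OF bx(2)] fK[OF bx(3)] unfolding Kx_def by blast+
        have "f (a \<otimes> (b \<otimes> x)) \<oslash> f (b \<otimes> x) \<otimes> (f (b \<otimes> x) \<oslash> f x) =
            f (a \<otimes> (b \<otimes> x)) \<otimes> (inv f (b \<otimes> x) \<otimes> f (b \<otimes> x)) \<otimes> inv f x"
          unfolding div_Kx_eq[OF k(1)] div_Kx_eq[OF k(2)] using k by (simp add: m_assoc del: l_inv)
        then show "f (a \<otimes> (b \<otimes> x)) \<oslash> f (b \<otimes> x) \<otimes> (f (b \<otimes> x) \<oslash> f x) = f (a \<otimes> b \<otimes> x) \<oslash> f x"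
          using k a b x(1) by (simp add: m_assoc div_Kx_eq)
      qed
    qed
    then have "L (a \<otimes> b) (s a \<otimes> s b)" unfolding L_def .
    then show ?thesis using uniq[OF L[of "a \<otimes> b"]] a b by simp
  qed
  ultimately have "dhom s" unfolding dhom_def using sx by blast
  then show ?thesis using that L unfolding L_def by blast
qed

text \<open>When \<open>s\<close> is the m-th power, g = f / x^m has g(u x) / g(x) tending to 1 for
  each unit u. The residue of this ratio does not depend on x, so it is 1 for all x near
  \<open>\<zero>\<close>; then the leading term of \<open>g\<close> depends on v(x) only and is
  constant.\<close>

lemma leading_monomial:
  assumes hyp: "gamma_hyp \<or> residue_hyp" and f: "deffun f" and nz: "ev (\<lambda>x. f x \<noteq> \<zero>)"
  obtains m c where "c \<in> Kx" "lim (\<lambda>x. f x \<oslash> pw m x) c"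
proof -
  have fK: "f x \<in> K" if "x \<in> K" for x using deffun_closed[OF f that] .
  obtain s where s: "dhom s" "\<And>b. b \<in> Kx \<Longrightarrow> lim (\<lambda>x. f (b \<otimes> x) \<oslash> f x) (s b)"
    using shift_hom[OF f nz] by blast
  obtain m where m: "\<forall>x\<in>Kx. s x = pw m x" using dhom_power[OF hyp s(1)] by blast
  define g where "g x = f x \<oslash> pw m x" for x
  have g: "deffun g" unfolding g_def using fK by (intro deffunI df Dt_fun1[OF f] Dt_fun1[OF deffun_pw]) auto
  have gnz: "ev (\<lambda>x. g x \<noteq> \<zero>)" using nz
  proof (rule ev_mono)
    fix x assume "x \<in> Kx" "f x \<noteq> \<zero>"
    then have "g x \<in> Kx" unfolding g_def using fK[of x] by (intro Kx_div) auto
    then show "g x \<noteq> \<zero>" by simp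
  qed
  obtain d where d: "d \<in> Kx" "\<And>x. x \<in> Kx \<Longrightarrow> d \<preceq> x \<Longrightarrow> g x \<in> Kx"
    "\<And>u x. u \<in> vunits \<Longrightarrow> x \<in> Kx \<Longrightarrow> d \<preceq> x \<Longrightarrow> g (u \<otimes> x) \<oslash> g x \<in> vunits"
    "\<And>u x x'. u \<in> vunits \<Longrightarrow> x \<in> Kx \<Longrightarrow> x' \<in> Kx \<Longrightarrow> d \<preceq> x \<Longrightarrow> d \<preceq> x' \<Longrightarrow>
       g (u \<otimes> x) \<oslash> g x \<approx> g (u \<otimes> x') \<oslash> g x'"
    using ratio_invariant[OF g gnz] by blast
  have "g (u \<otimes> x) \<doteq> g x" if x: "x \<in> Kx" "d \<preceq> x" and u: "u \<in> vunits" for x u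
  proof -
    \<comment> \<open>An approximation of the limit within an \<open>e\<close> of positive value
      already fixes the residue, and a single point y suffices for that.\<close>
    obtain e where e: "e \<in> Kx" "\<one> \<prec> e" using above_exists[OF one_Kx] .
    have "ev (\<lambda>x. e \<preceq> f (u \<otimes> x) \<oslash> f x \<ominus> pw m u)"
      using limD[OF s(2)[of u] e(1)] m u by simp
    from ev_exD[OF ev_conj[OF ev_conj[OF this ev_above[OF d(1)]] nz]]
    obtain y where y: "y \<in> Kx" "e \<preceq> f (u \<otimes> y) \<oslash> f y \<ominus> pw m u" "d \<preceq> y" "f y \<noteq> \<zero>" by blast
    have fy: "f y \<in> Kx" "f (u \<otimes> y) \<in> K" using y fK u by auto
    have pu: "pw m u \<in> vunits" by (rule pw_vunits[OF u])
    have "f (u \<otimes> y) \<oslash> f y \<approx> pw m u" using lt_le_trans[OF e(2) y(2)] fy pu by (simp add: req_def)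
    from req_mult[OF this, of "inv (pw m u)"] have "f (u \<otimes> y) \<oslash> f y \<otimes> inv (pw m u) \<approx> \<one>" using pu by simp
    moreover have "g (u \<otimes> y) \<oslash> g y = f (u \<otimes> y) \<oslash> f y \<otimes> inv (pw m u)"
    proof -
      have gy: "g y \<in> Kx" using d(2) y by blast
      have "(f (u \<otimes> y) \<oslash> f y \<otimes> inv (pw m u)) \<otimes> g y = g (u \<otimes> y)"
        unfolding g_def using fy u y(1) pw_closed[of m u] pw_closed[of m y]
        by (simp add: pw_mult div_Kx_eq nonzero_inverse_mult_distrib m_ac Kx_cancel)
      then show ?thesis using gy fy mult_div_cancel[of "f (u \<otimes> y) \<oslash> f y \<otimes> inv (pw m u)" "g y"] pu by simp
    qed
    ultimately have "g (u \<otimes> y) \<oslash> g y \<approx> \<one>" by simp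
    then have "g (u \<otimes> x) \<oslash> g x \<approx> \<one>" using d(4)[OF u x(1) y(1) x(2) y(3)] req_trans by blast
    then have "g (u \<otimes> x) \<oslash> g x \<doteq> \<one>" using d(3)[OF u x] by (simp add: req_rveq)
    then show ?thesis using d(2)[OF x] deffun_closed[OF g] u x by (simp add: rveq_div_iff)
  qed
  then obtain c where c: "c \<in> Kx" "ev (\<lambda>x. g x \<doteq> c)" using leading_term_constant[OF g d(1)] by blast
  have "ev (\<lambda>x. g x \<asymp> c)" using c(2) by (rule ev_mono) (rule eqv_sym[OF rveq_eqv])
  then obtain y where "y \<in> Kx" "lim g y" using limit_nonzero[OF g c(1)] by blast
  then show ?thesis using that unfolding g_def by blast
qed

lemma lim_zero_iff: assumes "deffun g" shows "lim g \<zero> \<longleftrightarrow> (\<forall>\<epsilon>\<in>Kx. ev (\<lambda>x. \<epsilon> \<preceq> g x))"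
proof -
  have "ev (\<lambda>x. \<epsilon> \<preceq> g x \<ominus> \<zero>) \<longleftrightarrow> ev (\<lambda>x. \<epsilon> \<preceq> g x)" for \<epsilon>
  proof -
    have "x \<in> Kx \<Longrightarrow> g x \<ominus> \<zero> = g x" for x using deffun_closed[OF assms, of x] by (simp add: a_minus_def)
    then show ?thesis unfolding ev_def by simp
  qed
  then show ?thesis by (simp add: lim_def)
qed

text \<open>The last clause drives the recursion. If f = o(x^m0) and the leading exponent m were at
  most m0, then f / x^m would tend to \<open>\<zero>\<close> instead of the nonzero
  \<open>c\<close>. The alternative covers an \<open>f\<close> that vanishes near
  \<open>\<zero>\<close>.\<close>

lemma expansion_step:
  assumes hyp: "gamma_hyp \<or> residue_hyp" and f: "deffun f"
  shows "\<exists>m c. c \<in> K \<and> lim (\<lambda>x. (f x \<ominus> c \<otimes> pw m x) \<oslash> pw m x) \<zero> \<and>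
    (\<forall>m0. lim (\<lambda>x. f x \<oslash> pw m0 x) \<zero> \<longrightarrow> (c = \<zero> \<and> (\<forall>m. lim (\<lambda>x. f x \<oslash> pw m x) \<zero>)) \<or> m0 < m)"
proof -
  have fK: "f x \<in> K" if "x \<in> K" for x using deffun_closed[OF f that] .
  have def: "deffun (\<lambda>x. f x \<oslash> pw m x)" for m
    using fK by (intro deffunI df Dt_fun1[OF f] Dt_fun1[OF deffun_pw]) auto
  have "Df1 (\<lambda>x. f x \<noteq> \<zero>)" unfolding Df1_def by (intro df Dt_fun1[OF f]) simp
  then consider "ev (\<lambda>x. f x \<noteq> \<zero>)" | "ev (\<lambda>x. \<not> f x \<noteq> \<zero>)" using ev_dichotomy by blast
  then show ?thesis
  proof cases
    case 1
    obtain m c where c: "c \<in> Kx" "lim (\<lambda>x. f x \<oslash> pw m x) c" using leading_monomial[OF hyp f 1] by blast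
    have "lim (\<lambda>x. (f x \<ominus> c \<otimes> pw m x) \<oslash> pw m x) \<zero>"
    proof (rule limI)
      fix e assume "e \<in> Kx"
      from limD[OF c(2) this] show "ev (\<lambda>x. e \<preceq> (f x \<ominus> c \<otimes> pw m x) \<oslash> pw m x \<ominus> \<zero>)"
      proof (rule ev_mono)
        fix x assume x: "x \<in> Kx" "e \<preceq> f x \<oslash> pw m x \<ominus> c"
        have k: "f x \<in> K" "c \<in> K" "pw m x \<in> K" "inv (pw m x) \<in> K" using fK x c pw_closed[of m x] by auto
        have "(f x \<ominus> c \<otimes> pw m x) \<oslash> pw m x \<ominus> \<zero> = f x \<otimes> inv (pw m x) \<ominus> c \<otimes> (pw m x \<otimes> inv (pw m x))"
          unfolding div_Kx_eq[OF pw_closed] using k by algebra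
        also have "\<dots> = f x \<oslash> pw m x \<ominus> c" using k by (simp add: div_Kx_eq)
        finally show "e \<preceq> (f x \<ominus> c \<otimes> pw m x) \<oslash> pw m x \<ominus> \<zero>" using x(2) by simp
      qed
    qed simp
    moreover have "m0 < m" if l: "lim (\<lambda>x. f x \<oslash> pw m0 x) \<zero>" for m0
    proof (rule ccontr)
      assume "\<not> m0 < m"
      then obtain k :: nat where k: "m0 = m + int k" using zle_iff_zadd by (metis linorder_not_less)
      have "lim (\<lambda>x. f x \<oslash> pw m x) \<zero>" unfolding lim_zero_iff[OF def]
      proof
        fix e assume "e \<in> Kx"
        then have "ev (\<lambda>x. e \<preceq> f x \<oslash> pw m0 x)" using l unfolding lim_zero_iff[OF def] by blast
        then show "ev (\<lambda>x. e \<preceq> f x \<oslash> pw m x)" using ev_above[OF one_Kx]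
        proof (rule ev_mono2)
          fix x assume x: "x \<in> Kx" "e \<preceq> f x \<oslash> pw m0 x" "\<one> \<preceq> x"
          have m0: "pw m0 x = pw m x \<otimes> x [^] k" using x(1) k by (simp add: pw_add pw_nat)
          have xk: "x [^] k \<in> Kx" using x(1) by simp
          have eq: "f x \<oslash> pw m0 x \<otimes> x [^] k = f x \<oslash> pw m x"
            unfolding m0 using fK[of x] x(1) xk by (intro div_mult_cancel_right) auto
          have one_le: "\<one> \<preceq> x [^] k" using x(3) vring_pow[of x k] by (simp add: vring_def)
          have "e \<otimes> \<one> \<preceq> f x \<oslash> pw m0 x \<otimes> x [^] k" using x(2) one_le by (intro le_mult2)
          then show "e \<preceq> f x \<oslash> pw m x" unfolding eq using le_K[OF x(2)] by simp
        qed
      qed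
      then have "c = \<zero>" using lim_unique[OF ev_K[OF def] c(2)] by blast
      then show False using c(1) by simp
    qed
    ultimately show ?thesis using c(1) by blast
  next
    case 2
    have flat: "lim (\<lambda>x. f x \<oslash> pw m x) \<zero>" for m
      unfolding lim_zero_iff[OF def]
    proof
      fix e assume e: "e \<in> Kx"
      show "ev (\<lambda>x. e \<preceq> f x \<oslash> pw m x)" using 2
        by (rule ev_mono) (use e in \<open>simp add: div_Kx_eq le_zero\<close>)
    qed
    have "lim (\<lambda>x. (f x \<ominus> \<zero> \<otimes> pw 0 x) \<oslash> pw 0 x) \<zero>"
      using flat[of 0] by (rule lim_cong) (rule evI[OF one_Kx], use fK in \<open>simp add: a_minus_def\<close>)
    then show ?thesis using flat by (intro exI[of _ 0] exI[of _ \<zero>]) auto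
  qed
qed

lemma expansion_next:
  assumes hyp: "gamma_hyp \<or> residue_hyp" and f: "deffun f"
    and l: "lim (\<lambda>x. f x \<oslash> pw m0 x) \<zero>"
  shows "\<exists>m c. m0 < m \<and> c \<in> K \<and> lim (\<lambda>x. (f x \<ominus> c \<otimes> pw m x) \<oslash> pw m x) \<zero>"
proof -
  have fK: "f x \<in> K" if "x \<in> K" for x using deffun_closed[OF f that] .
  obtain m c where c: "c \<in> K" "lim (\<lambda>x. (f x \<ominus> c \<otimes> pw m x) \<oslash> pw m x) \<zero>"
    "(c = \<zero> \<and> (\<forall>m. lim (\<lambda>x. f x \<oslash> pw m x) \<zero>)) \<or> m0 < m"
    using expansion_step[OF hyp f] l by blast
  from c(3) show ?thesis
  proof
    assume "m0 < m"
    then show ?thesis using c by blast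
  next
    \<comment> \<open>A function that is o(x^m) for all m still needs infinitely many exponents; the
      next one is taken with coefficient \<open>\<zero>\<close>.\<close>
    assume a: "c = \<zero> \<and> (\<forall>m. lim (\<lambda>x. f x \<oslash> pw m x) \<zero>)"
    then have "lim (\<lambda>x. f x \<oslash> pw (m0 + 1) x) \<zero>" by blast
    then have "lim (\<lambda>x. (f x \<ominus> \<zero> \<otimes> pw (m0 + 1) x) \<oslash> pw (m0 + 1) x) \<zero>"
      by (rule lim_cong) (rule evI[OF one_Kx], use fK in \<open>simp add: a_minus_def\<close>)
    then show ?thesis by (intro exI[of _ "m0 + 1"] exI[of _ \<zero>]) auto
  qed
qed

theorem asymptotic_expansion:
  assumes hyp: "gamma_hyp \<or> residue_hyp" and f: "deffun f"
  shows "\<exists>(m :: nat \<Rightarrow> int) (c :: nat \<Rightarrow> 'a). strict_mono m \<and> (\<forall>n. c n \<in> K) \<and>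
    (\<forall>l. lim (\<lambda>x. (f x \<ominus> (\<Oplus>n\<in>{..l}. c n \<otimes> pw (m n) x)) \<oslash> pw (m l) x) \<zero>)"
proof -
  have fK: "f x \<in> K" if "x \<in> K" for x using deffun_closed[OF f that] .
  \<comment> \<open>A state consists of an exponent, a coefficient and the remainder from which this
    monomial is about to be subtracted; \<open>N\<close> links consecutive states.\<close>
  define P where "P st \<longleftrightarrow> (case st of (m, c, g) \<Rightarrow> deffun g \<and> c \<in> K \<and>
    lim (\<lambda>x. (g x \<ominus> c \<otimes> pw m x) \<oslash> pw m x) \<zero>)" for st :: "int \<times> 'a \<times> ('a \<Rightarrow> 'a)"
  define N where "N st st' \<longleftrightarrow> (case st of (m, c, g) \<Rightarrow> case st' of (m', c', g') \<Rightarrow>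
    m < m' \<and> g' = (\<lambda>x. g x \<ominus> c \<otimes> pw m x))" for st st' :: "int \<times> 'a \<times> ('a \<Rightarrow> 'a)"
  obtain m0 c0 where init: "c0 \<in> K" "lim (\<lambda>x. (f x \<ominus> c0 \<otimes> pw m0 x) \<oslash> pw m0 x) \<zero>"
    using expansion_step[OF hyp f] by blast
  have "\<exists>F. F 0 = (m0, c0, f) \<and> (\<forall>n. P (F n) \<and> N (F n) (F (Suc n)))"
  proof -
    \<comment> \<open>Dependent choice would leave the first state open; the clause for n = 0 pins
      it.\<close>
    have "\<exists>F. \<forall>n. (P (F n) \<and> (n = 0 \<longrightarrow> F n = (m0, c0, f))) \<and> N (F n) (F (Suc n))"
    proof (rule dependent_nat_choice)
      show "\<exists>st. P st \<and> ((0::nat) = 0 \<longrightarrow> st = (m0, c0, f))" using init f by (simp add: P_def)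
    next
      fix st and n :: nat
      assume "P st \<and> (n = 0 \<longrightarrow> st = (m0, c0, f))"
      then obtain m c g where st: "st = (m, c, g)" "deffun g" "c \<in> K"
        "lim (\<lambda>x. (g x \<ominus> c \<otimes> pw m x) \<oslash> pw m x) \<zero>" by (cases st) (auto simp: P_def)
      define g' where "g' x = g x \<ominus> c \<otimes> pw m x" for x
      have gK: "g x \<in> K" if "x \<in> K" for x using deffun_closed[OF st(2) that] .
      have g': "deffun g'" unfolding g'_def using st(3) gK
        by (intro deffunI df Dt_fun1[OF st(2)] Dt_fun1[OF deffun_pw]) auto
      obtain m' c' where "m < m'" "c' \<in> K" "lim (\<lambda>x. (g' x \<ominus> c' \<otimes> pw m' x) \<oslash> pw m' x) \<zero>"
        using expansion_next[OF hyp g'] st(4) unfolding g'_def by blast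
      then have "P (m', c', g') \<and> N st (m', c', g')" using g' st(1) by (simp add: P_def N_def g'_def[abs_def])
      then show "\<exists>y. (P y \<and> (Suc n = 0 \<longrightarrow> y = (m0, c0, f))) \<and> N st y" by blast
    qed
    then show ?thesis by blast
  qed
  then obtain F where F: "F 0 = (m0, c0, f)" "\<And>n. P (F n)" "\<And>n. N (F n) (F (Suc n))" by blast
  define m c g where "m n = fst (F n)" and "c n = fst (snd (F n))" and "g n = snd (snd (F n))" for n
  have Fn: "F n = (m n, c n, g n)" for n by (simp add: m_def c_def g_def)
  have c: "c n \<in> K" and l: "lim (\<lambda>x. (g n x \<ominus> c n \<otimes> pw (m n) x) \<oslash> pw (m n) x) \<zero>" for n
    using F(2)[of n] unfolding Fn by (auto simp: P_def)
  have step: "m n < m (Suc n)" "g (Suc n) = (\<lambda>x. g n x \<ominus> c n \<otimes> pw (m n) x)" for n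
    using F(3)[of n] unfolding Fn by (auto simp: N_def)
  have g0: "g 0 = f" using F(1) by (simp add: g_def)
  have sum: "(\<Oplus>n\<in>{..<l}. c n \<otimes> pw (m n) x) \<in> K" for l x
    using c by (intro finsum_closed) auto
  have g: "g l x = f x \<ominus> (\<Oplus>n\<in>{..<l}. c n \<otimes> pw (m n) x)" if x: "x \<in> Kx" for l x
  proof (induction l)
    case 0
    then show ?case using g0 fK x by (simp add: a_minus_def)
  next
    case (Suc l)
    have k: "f x \<in> K" "c l \<otimes> pw (m l) x \<in> K" "(\<Oplus>n\<in>{..<l}. c n \<otimes> pw (m n) x) \<in> K"
      using fK x c sum by auto
    have "(\<Oplus>n\<in>{..<Suc l}. c n \<otimes> pw (m n) x) = c l \<otimes> pw (m l) x \<oplus> (\<Oplus>n\<in>{..<l}. c n \<otimes> pw (m n) x)"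
      unfolding lessThan_Suc using c by (subst finsum_insert) auto
    moreover have "a \<ominus> b \<ominus> d = a \<ominus> (d \<oplus> b)" if "a \<in> K" "b \<in> K" "d \<in> K" for a b d
      using that by algebra
    note this[OF k(1,3,2)]
    ultimately show ?case using Suc step(2) by simp
  qed
  have "lim (\<lambda>x. (f x \<ominus> (\<Oplus>n\<in>{..l}. c n \<otimes> pw (m n) x)) \<oslash> pw (m l) x) \<zero>" for l
  proof (rule lim_cong[OF l[of l]], rule evI[OF one_Kx])
    fix x assume x: "x \<in> Kx"
    have "g l x \<ominus> c l \<otimes> pw (m l) x = g (Suc l) x" using step(2) by simp
    also have "\<dots> = f x \<ominus> (\<Oplus>n\<in>{..l}. c n \<otimes> pw (m n) x)" using g[OF x, of "Suc l"] by (simp add: lessThan_Suc_atMost)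
    finally show "(g l x \<ominus> c l \<otimes> pw (m l) x) \<oslash> pw (m l) x =
      (f x \<ominus> (\<Oplus>n\<in>{..l}. c n \<otimes> pw (m n) x)) \<oslash> pw (m l) x" by simp
  qed
  moreover have "strict_mono m" using step(1) by (simp add: strict_mono_Suc_iff)
  ultimately show ?thesis using c by blast
qed

end

section \<open>Definable multiplicative maps in algebraically closed fields\<close>

text \<open>Countability of the set of terms will make the elements algebraic over an assignment
  countable in number.\<close>

instance ring_sym :: countable by countable_datatype
instance fo_term :: (countable) countable by countable_datatype

abbreviation ring_term :: "ring_sym fo_term \<Rightarrow> bool" where
  "ring_term \<equiv> wf_term ring_language"

abbreviation tzero :: "ring_sym fo_term" where "tzero \<equiv> App RZero []"
abbreviation tone :: "ring_sym fo_term" where "tone \<equiv> App ROne []"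
abbreviation tneg :: "ring_sym fo_term \<Rightarrow> ring_sym fo_term" where "tneg s \<equiv> App RNeg [s]"
abbreviation tadd :: "ring_sym fo_term \<Rightarrow> ring_sym fo_term \<Rightarrow> ring_sym fo_term" where
  "tadd s t \<equiv> App RAdd [s, t]"
abbreviation tmul :: "ring_sym fo_term \<Rightarrow> ring_sym fo_term \<Rightarrow> ring_sym fo_term" where
  "tmul s t \<equiv> App RMul [s, t]"

lemma ring_term_App:
  "ring_term (App g ts) \<longleftrightarrow> length ts = ring_arity g \<and> (\<forall>t\<in>set ts. ring_term t)"
  by (auto simp: ring_language_def list_all_iff)

lemma ring_term_induct [consumes 1, case_names Var zero one neg add mul]:
  assumes "ring_term t" and var: "\<And>i. P (Var i)" and "P tzero" "P tone"
    and neg: "\<And>s. ring_term s \<Longrightarrow> P s \<Longrightarrow> P (tneg s)"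
    and add: "\<And>s t. ring_term s \<Longrightarrow> ring_term t \<Longrightarrow> P s \<Longrightarrow> P t \<Longrightarrow> P (tadd s t)"
    and mul: "\<And>s t. ring_term s \<Longrightarrow> ring_term t \<Longrightarrow> P s \<Longrightarrow> P t \<Longrightarrow> P (tmul s t)"
  shows "P t"
  using assms(1)
proof (induction t)
  case (Var i)
  show ?case by (rule var)
next
  case (App g ts)
  have l: "length ts = ring_arity g" and w: "\<And>t. t \<in> set ts \<Longrightarrow> ring_term t"
    using App.prems by (auto simp only: ring_term_App)
  have p: "P t" if "t \<in> set ts" for t using App.IH[OF that w[OF that]] .
  show ?case
  proof (cases g)
    case RZero
    then show ?thesis using l assms(3) by simp
  next
    case ROne
    then show ?thesis using l assms(4) by simp
  next
    case RNeg
    then obtain s where s: "ts = [s]" using l by (auto simp: length_Suc_conv)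
    show ?thesis unfolding RNeg s by (rule neg) (use p w s in simp_all)
  next
    case RAdd
    then obtain s t where s: "ts = [s, t]" using l by (auto simp: length_Suc_conv numeral_2_eq_2)
    show ?thesis unfolding RAdd s by (rule add) (use p w s in simp_all)
  next
    case RMul
    then obtain s t where s: "ts = [s, t]" using l by (auto simp: length_Suc_conv numeral_2_eq_2)
    show ?thesis unfolding RMul s by (rule mul) (use p w s in simp_all)
  qed
qed

lemma ring_term_intros [simp]:
  "ring_term tzero" "ring_term tone" "ring_term s \<Longrightarrow> ring_term (tneg s)"
  "ring_term s \<Longrightarrow> ring_term t \<Longrightarrow> ring_term (tadd s t)"
  "ring_term s \<Longrightarrow> ring_term t \<Longrightarrow> ring_term (tmul s t)"
  by (simp_all add: ring_language_def)

text \<open>Polynomials are lists of coefficient terms, constant coefficient first.\<close>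

fun padd :: "ring_sym fo_term list \<Rightarrow> ring_sym fo_term list \<Rightarrow> ring_sym fo_term list" where
  "padd [] qs = qs"
| "padd ps [] = ps"
| "padd (p # ps) (q # qs) = tadd p q # padd ps qs"

fun pmul :: "ring_sym fo_term list \<Rightarrow> ring_sym fo_term list \<Rightarrow> ring_sym fo_term list" where
  "pmul [] qs = []"
| "pmul (p # ps) qs = padd (map (tmul p) qs) (tzero # pmul ps qs)"

text \<open>Turns a polynomial back into one term, with the indeterminate as variable 0, so that its
  vanishing can be transferred like that of any other term.\<close>

primrec horner_term :: "ring_sym fo_term list \<Rightarrow> ring_sym fo_term" where
  "horner_term [] = tzero"
| "horner_term (t # ts) = tadd (ren_term Suc t) (tmul (Var 0) (horner_term ts))"

lemma length_padd [simp]: "length (padd ps qs) = max (length ps) (length qs)"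
  by (induction ps qs rule: padd.induct) auto

lemma padd_terms: "\<forall>p\<in>set ps. ring_term p \<Longrightarrow> \<forall>q\<in>set qs. ring_term q \<Longrightarrow> \<forall>t\<in>set (padd ps qs). ring_term t"
  by (induction ps qs rule: padd.induct) (auto simp del: wf_term.simps)

lemma pmul_terms: "\<forall>p\<in>set ps. ring_term p \<Longrightarrow> \<forall>q\<in>set qs. ring_term q \<Longrightarrow> \<forall>t\<in>set (pmul ps qs). ring_term t"
proof (induction ps)
  case (Cons p ps)
  have "\<forall>t\<in>set (map (tmul p) qs). ring_term t" using Cons.prems by (auto simp del: wf_term.simps)
  moreover have "\<forall>t\<in>set (tzero # pmul ps qs). ring_term t" using Cons by (auto simp del: wf_term.simps)
  ultimately have "\<forall>t\<in>set (padd (map (tmul p) qs) (tzero # pmul ps qs)). ring_term t"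
    by (rule padd_terms)
  then show ?case by (simp only: pmul.simps)
qed simp

lemma horner_term_wf: "\<forall>t\<in>set ts. ring_term t \<Longrightarrow> ring_term (horner_term ts)"
proof (induction ts)
  case (Cons t ts)
  then have "ring_term (ren_term Suc t)" "ring_term (horner_term ts)" by (auto intro: wf_term_ren)
  then show ?case by (simp del: wf_term.simps(2))
qed (simp add: ring_language_def)

text \<open>Uncountability provides transcendental elements over every assignment, which is all the
  saturation that the back and forth consumes.\<close>

locale big_acf = field R for R :: "('a, 'm) ring_scheme" (structure) +
  assumes root: "set p \<subseteq> carrier R \<Longrightarrow> p \<noteq> [] \<Longrightarrow> \<exists>x\<in>carrier R. eval (\<one> # p) x = \<zero>"
    and uncountable_carrier: "uncountable (carrier R)"
begin

definition env :: "(nat \<Rightarrow> 'a) \<Rightarrow> bool" where "env e \<longleftrightarrow> range e \<subseteq> carrier R"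

abbreviation tval :: "(nat \<Rightarrow> 'a) \<Rightarrow> ring_sym fo_term \<Rightarrow> 'a" where
  "tval e t \<equiv> eval_term (ring_structure R) e t"

primrec horner :: "(nat \<Rightarrow> 'a) \<Rightarrow> ring_sym fo_term list \<Rightarrow> 'a \<Rightarrow> 'a" where
  "horner e [] x = \<zero>"
| "horner e (t # ts) x = tval e t \<oplus> x \<otimes> horner e ts x"

lemma tval_simps [simp]:
  "tval e tzero = \<zero>" "tval e tone = \<one>" "tval e (tneg s) = \<ominus> tval e s"
  "tval e (tadd s t) = tval e s \<oplus> tval e t" "tval e (tmul s t) = tval e s \<otimes> tval e t"
  by (simp_all add: ring_structure_def)

lemma env_at [simp]: "env e \<Longrightarrow> e i \<in> carrier R" by (auto simp: env_def)

lemma env_Cons [simp]: "env e \<Longrightarrow> c \<in> carrier R \<Longrightarrow> env (case_nat c e)"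
  by (auto simp: env_def split: nat.splits)

lemma tval_closed [simp]: "ring_term t \<Longrightarrow> env e \<Longrightarrow> tval e t \<in> carrier R"
  by (induction t rule: ring_term_induct) (simp_all del: eval_term.simps(2))

lemma horner_closed [simp]:
  "\<forall>t\<in>set ts. ring_term t \<Longrightarrow> env e \<Longrightarrow> x \<in> carrier R \<Longrightarrow> horner e ts x \<in> carrier R"
  by (induction ts) auto

lemma tval_horner_term:
  "tval (case_nat x e) (horner_term ts) = horner e ts x"
proof (induction ts)
  case (Cons t ts)
  have "tval (case_nat x e) (ren_term Suc t) = tval e t" by (simp add: eval_term_ren comp_def)
  then show ?case unfolding horner_term.simps horner.simps tval_simps by (simp add: Cons del: eval_term.simps(2))
qed (simp add: ring_structure_def)

lemma horner_append:
  assumes "\<forall>t\<in>set ps. ring_term t" "\<forall>t\<in>set qs. ring_term t" "env e" "x \<in> carrier R"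
  shows "horner e (ps @ qs) x = horner e ps x \<oplus> x [^] length ps \<otimes> horner e qs x"
  using assms(1)
proof (induction ps)
  case (Cons p ps)
  have k: "tval e p \<in> carrier R" "horner e ps x \<in> carrier R" "horner e qs x \<in> carrier R" "x [^] length ps \<in> carrier R"
    using Cons.prems assms by auto
  have IH: "horner e (ps @ qs) x = horner e ps x \<oplus> x [^] length ps \<otimes> horner e qs x" using Cons by simp
  have "tval e p \<oplus> x \<otimes> (horner e ps x \<oplus> x [^] length ps \<otimes> horner e qs x) =
    tval e p \<oplus> x \<otimes> horner e ps x \<oplus> x [^] length ps \<otimes> x \<otimes> horner e qs x"
    using k assms(4) by algebra
  then show ?case by (simp add: IH)
qed (use assms in simp)

lemma horner_padd:
  assumes "env e" "x \<in> carrier R"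
  shows "\<forall>p\<in>set ps. ring_term p \<Longrightarrow> \<forall>q\<in>set qs. ring_term q \<Longrightarrow>
    horner e (padd ps qs) x = horner e ps x \<oplus> horner e qs x"
proof (induction ps qs rule: padd.induct)
  case (3 p ps q qs)
  have k: "tval e p \<in> carrier R" "tval e q \<in> carrier R" "horner e ps x \<in> carrier R" "horner e qs x \<in> carrier R"
    using 3 assms by auto
  have IH: "horner e (padd ps qs) x = horner e ps x \<oplus> horner e qs x" using 3 by simp
  have "(tval e p \<oplus> tval e q) \<oplus> x \<otimes> (horner e ps x \<oplus> horner e qs x) =
    (tval e p \<oplus> x \<otimes> horner e ps x) \<oplus> (tval e q \<oplus> x \<otimes> horner e qs x)"
    using k assms(2) by algebra
  then show ?case unfolding padd.simps horner.simps tval_simps IH .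
qed (use assms in simp_all)

lemma horner_map_tmul:
  assumes "env e" "x \<in> carrier R" "ring_term p" "\<forall>q\<in>set qs. ring_term q"
  shows "horner e (map (tmul p) qs) x = tval e p \<otimes> horner e qs x"
  using assms(4)
proof (induction qs)
  case (Cons q qs)
  have k: "tval e p \<in> carrier R" "tval e q \<in> carrier R" "horner e qs x \<in> carrier R"
    using Cons assms by auto
  have IH: "horner e (map (tmul p) qs) x = tval e p \<otimes> horner e qs x" using Cons by simp
  have "tval e p \<otimes> tval e q \<oplus> x \<otimes> (tval e p \<otimes> horner e qs x) = tval e p \<otimes> (tval e q \<oplus> x \<otimes> horner e qs x)"
    using k assms(2) by algebra
  then show ?case unfolding list.map horner.simps tval_simps IH .
qed (use assms in simp)

lemma horner_pmul:
  assumes "env e" "x \<in> carrier R" "\<forall>q\<in>set qs. ring_term q"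
  shows "\<forall>p\<in>set ps. ring_term p \<Longrightarrow> horner e (pmul ps qs) x = horner e ps x \<otimes> horner e qs x"
proof (induction ps)
  case (Cons p ps)
  have k: "tval e p \<in> carrier R" "horner e ps x \<in> carrier R" "horner e qs x \<in> carrier R"
    using Cons assms by auto
  have IH: "horner e (pmul ps qs) x = horner e ps x \<otimes> horner e qs x" using Cons by simp
  have w: "\<forall>t\<in>set (map (tmul p) qs). ring_term t" "\<forall>t\<in>set (tzero # pmul ps qs). ring_term t"
    using Cons.prems assms(3) pmul_terms[of ps qs] by (auto simp del: wf_term.simps)
  have wp: "ring_term p" using Cons.prems by simp
  have "tval e p \<otimes> horner e qs x \<oplus> (\<zero> \<oplus> x \<otimes> (horner e ps x \<otimes> horner e qs x)) =
    (tval e p \<oplus> x \<otimes> horner e ps x) \<otimes> horner e qs x"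
    using k assms(2) by algebra
  then show ?case
    unfolding pmul.simps horner_padd[OF assms(1,2) w] horner_map_tmul[OF assms(1,2) wp assms(3)]
    unfolding horner.simps tval_simps IH .
qed (use assms in simp)

text \<open>One coefficient list serves all assignments; this uniformity is what lets a polynomial
  relation move from one assignment to another.\<close>

lemma term_horner:
  assumes "ring_term t"
  shows "\<exists>ts. (\<forall>t\<in>set ts. ring_term t) \<and> (\<forall>e x. env e \<longrightarrow> x \<in> carrier R \<longrightarrow> tval (case_nat x e) t = horner e ts x)"
  using assms
proof (induction t rule: ring_term_induct)
  case (Var i)
  show ?case
  proof (cases i)
    case 0
    then show ?thesis by (intro exI[of _ "[tzero, tone]"]) (simp del: eval_term.simps(2) wf_term.simps(2))
  next
    case (Suc j)
    then show ?thesis by (intro exI[of _ "[Var j]"]) (simp del: eval_term.simps(2) wf_term.simps(2))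
  qed
next
  case zero
  show ?case by (intro exI[of _ "[]"]) (simp del: eval_term.simps(2) wf_term.simps(2))
next
  case one
  show ?case by (intro exI[of _ "[tone]"]) (simp del: eval_term.simps(2) wf_term.simps(2))
next
  case (neg s)
  then obtain ss where ss: "\<forall>t\<in>set ss. ring_term t" "\<forall>e x. env e \<longrightarrow> x \<in> carrier R \<longrightarrow> tval (case_nat x e) s = horner e ss x"
    by blast
  have w: "ring_term (tneg tone)" by (simp del: wf_term.simps(2))
  have "horner e (map (tmul (tneg tone)) ss) x = tval (case_nat x e) (tneg s)" if "env e" "x \<in> carrier R" for e x
    using horner_map_tmul[OF that w ss(1)] ss that by (simp add: l_minus del: eval_term.simps(2) wf_term.simps(2))
  then show ?case using ss(1) w by (intro exI[of _ "map (tmul (tneg tone)) ss"]) (auto simp del: eval_term.simps(2) wf_term.simps(2))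
next
  case (add s t)
  then obtain ss ts where ss: "\<forall>t\<in>set ss. ring_term t" "\<forall>e x. env e \<longrightarrow> x \<in> carrier R \<longrightarrow> tval (case_nat x e) s = horner e ss x"
    and ts: "\<forall>t\<in>set ts. ring_term t" "\<forall>e x. env e \<longrightarrow> x \<in> carrier R \<longrightarrow> tval (case_nat x e) t = horner e ts x"
    by blast
  then show ?case using padd_terms[OF ss(1) ts(1)] horner_padd[OF _ _ ss(1) ts(1)]
    by (intro exI[of _ "padd ss ts"]) (simp del: eval_term.simps(2) wf_term.simps(2))
next
  case (mul s t)
  then obtain ss ts where ss: "\<forall>t\<in>set ss. ring_term t" "\<forall>e x. env e \<longrightarrow> x \<in> carrier R \<longrightarrow> tval (case_nat x e) s = horner e ss x"
    and ts: "\<forall>t\<in>set ts. ring_term t" "\<forall>e x. env e \<longrightarrow> x \<in> carrier R \<longrightarrow> tval (case_nat x e) t = horner e ts x"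
    by blast
  then show ?case using pmul_terms[OF ss(1) ts(1)] horner_pmul[OF _ _ ts(1) ss(1)]
    by (intro exI[of _ "pmul ss ts"]) (simp del: eval_term.simps(2) wf_term.simps(2))
qed

subsection \<open>Roots\<close>

definition trivial :: "(nat \<Rightarrow> 'a) \<Rightarrow> ring_sym fo_term list \<Rightarrow> bool" where
  "trivial e ts \<longleftrightarrow> (\<forall>t\<in>set ts. tval e t = \<zero>)"

lemma horner_trivial: "trivial e ts \<Longrightarrow> x \<in> carrier R \<Longrightarrow> horner e ts x = \<zero>"
  by (induction ts) (auto simp: trivial_def)

lemma trivial_replicate [simp]: "trivial e (replicate n tzero)" by (auto simp: trivial_def ring_structure_def)

lemma horner_eval:
  assumes "\<forall>t\<in>set ts. ring_term t" "env e" "x \<in> carrier R"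
  shows "horner e ts x = eval (rev (map (tval e) ts)) x"
  using assms(1)
proof (induction ts)
  case (Cons t ts)
  have k: "tval e t \<in> carrier R" "horner e ts x \<in> carrier R" using Cons.prems assms(2,3) by auto
  have "eval (rev (map (tval e) ts) @ [tval e t]) x = eval (rev (map (tval e) ts)) x \<otimes> x \<oplus> tval e t"
    using Cons.prems assms by (intro eval_append_aux) auto
  moreover have IH: "horner e ts x = eval (rev (map (tval e) ts)) x" using Cons by simp
  moreover have "eval (rev (map (tval e) ts)) x \<in> carrier R" using k(2) unfolding IH .
  ultimately show ?case using k(1) assms(3) by (simp add: m_comm a_comm IH)
qed simp

text \<open>Top coefficients that vanish at \<open>e\<close> are stripped, so the resulting list,
  unlike those from division, depends on \<open>e\<close>.\<close>

lemma nontrivial_lead: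
  assumes "\<forall>t\<in>set ts. ring_term t" "env e" "\<not> trivial e ts"
  shows "\<exists>us u. (\<forall>t\<in>set (us @ [u]). ring_term t) \<and> tval e u \<noteq> \<zero> \<and> length us < length ts \<and>
    (\<forall>x\<in>carrier R. horner e ts x = horner e (us @ [u]) x)"
  using assms(1,3)
proof (induction ts rule: rev_induct)
  case (snoc t ts)
  show ?case
  proof (cases "tval e t = \<zero>")
    case True
    have "\<not> trivial e ts" "\<forall>t\<in>set ts. ring_term t" using True snoc.prems by (auto simp: trivial_def)
    from snoc.IH[OF this(2,1)] obtain us u where u: "\<forall>t\<in>set (us @ [u]). ring_term t" "tval e u \<noteq> \<zero>" "length us < length ts"
      "\<forall>x\<in>carrier R. horner e ts x = horner e (us @ [u]) x" by blast
    have "horner e (ts @ [t]) x = horner e ts x" if "x \<in> carrier R" for x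
      using horner_append[of ts "[t]" e x] snoc.prems that True assms(2) by simp
    then show ?thesis using u by (intro exI[of _ us] exI[of _ u]) simp
  next
    case False
    then show ?thesis using snoc.prems by (intro exI[of _ ts] exI[of _ t]) simp
  qed
qed (simp add: trivial_def)

lemma finite_roots:
  assumes "\<forall>t\<in>set ts. ring_term t" "env e" "\<not> trivial e ts"
  shows "finite {x \<in> carrier R. horner e ts x = \<zero>}"
proof -
  obtain us u where u: "\<forall>t\<in>set (us @ [u]). ring_term t" "tval e u \<noteq> \<zero>"
    "\<forall>x\<in>carrier R. horner e ts x = horner e (us @ [u]) x" using nontrivial_lead[OF assms] by blast
  define p where "p = rev (map (tval e) (us @ [u]))"
  have p: "p \<in> carrier (poly_ring R)" "p \<noteq> []"
    using u assms(2) unfolding univ_poly_carrier[symmetric] polynomial_def p_def by auto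
  have "horner e ts x = eval p x" if "x \<in> carrier R" for x
    using horner_eval[OF u(1) assms(2) that] u(3) assms(2) that by (simp add: p_def)
  then have "{x \<in> carrier R. horner e ts x = \<zero>} \<subseteq> {x. is_root p x}" using p(2) by (auto simp: is_root_def)
  then show ?thesis using finite_number_of_roots[OF p(1)] finite_subset by blast
qed

lemma root_exists:
  assumes "\<forall>t\<in>set (ts @ [t]). ring_term t" "env e" "ts \<noteq> []" "tval e t \<noteq> \<zero>"
  shows "\<exists>x\<in>carrier R. horner e (ts @ [t]) x = \<zero>"
proof -
  define b where "b = tval e t"
  have b: "b \<in> carrier R" "b \<noteq> \<zero>" "b \<in> Units R" using assms by (auto simp: b_def field_Units)
  define p where "p = map (\<lambda>a. inv b \<otimes> a) (rev (map (tval e) ts))"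
  have ib: "inv b \<in> carrier R" using b by simp
  have pc: "set p \<subseteq> carrier R" "p \<noteq> []" using assms ib by (auto simp: p_def)
  obtain x where x: "x \<in> carrier R" "eval (\<one> # p) x = \<zero>" using root[OF pc] by blast
  have scale: "eval (map (\<lambda>a. c \<otimes> a) q) x = c \<otimes> eval q x" if "set q \<subseteq> carrier R" "c \<in> carrier R" for c q
    using that
  proof (induction q)
    case (Cons a q)
    then have "a \<in> carrier R" "eval q x \<in> carrier R" "x [^] length q \<in> carrier R" using x(1) eval_in_carrier by auto
    then show ?case using Cons by (simp add: r_distr m_assoc)
  qed simp
  have "\<one> # p = map (\<lambda>a. inv b \<otimes> a) (rev (map (tval e) (ts @ [t])))"
    using b by (simp add: p_def b_def)
  moreover have "set (rev (map (tval e) (ts @ [t]))) \<subseteq> carrier R" using assms(1,2) by auto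
  ultimately have "inv b \<otimes> eval (rev (map (tval e) (ts @ [t]))) x = \<zero>"
    using scale[OF _ ib, of "rev (map (tval e) (ts @ [t]))"] x(2) by metis
  then have "inv b \<otimes> horner e (ts @ [t]) x = \<zero>" using horner_eval[OF assms(1,2) x(1)] by simp
  moreover have "inv b \<noteq> \<zero>" using b Units_inv_Units field_Units by blast
  ultimately have "horner e (ts @ [t]) x = \<zero>"
    using integral[OF _ ib horner_closed[OF assms(1,2) x(1)]] by blast
  then show ?thesis using x(1) by blast
qed

text \<open>Algebraic over the subring generated by the values of \<open>e\<close>: the coefficients
  are terms evaluated at \<open>e\<close>, so there are only countably many candidate
  relations.\<close>

definition alg_over :: "(nat \<Rightarrow> 'a) \<Rightarrow> 'a \<Rightarrow> bool" where
  "alg_over e x \<longleftrightarrow> (\<exists>ts. (\<forall>t\<in>set ts. ring_term t) \<and> \<not> trivial e ts \<and> horner e ts x = \<zero>)"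

lemma countable_alg_over: "env e \<Longrightarrow> countable {x \<in> carrier R. alg_over e x}"
proof -
  assume e: "env e"
  have "{x \<in> carrier R. alg_over e x} \<subseteq>
    (\<Union>ts \<in> {ts. (\<forall>t\<in>set ts. ring_term t) \<and> \<not> trivial e ts}. {x \<in> carrier R. horner e ts x = \<zero>})"
    by (auto simp: alg_over_def)
  moreover have "countable \<dots>"
    using finite_roots[OF _ e] by (intro countable_UN) (auto intro: countable_finite)
  ultimately show ?thesis using countable_subset by blast
qed

lemma transcendental_exists:
  assumes "env e" "countable A"
  shows "\<exists>x\<in>carrier R - A. \<not> alg_over e x"
proof (rule ccontr)
  assume "\<not> ?thesis"
  then have "carrier R \<subseteq> A \<union> {x \<in> carrier R. alg_over e x}" by blast
  then show False
    using countable_subset[OF _ countable_Un[OF assms(2) countable_alg_over[OF assms(1)]]] uncountable_carrier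
    by blast
qed

lemma infinite_carrier: "infinite (carrier R)"
  using uncountable_carrier uncountable_infinite by blast

text \<open>Quotient and remainder are lists of terms, the same for all assignments, so that divisions can be
  transferred from one assignment to another.\<close>

lemma pseudo_division:
  assumes g: "ring_term g" "\<forall>t\<in>set gs. ring_term t" and u: "\<forall>t\<in>set us. ring_term t"
  shows "\<exists>qs rs k. (\<forall>t\<in>set qs. ring_term t) \<and> (\<forall>t\<in>set rs. ring_term t) \<and> length rs \<le> length gs \<and>
    (qs = [] \<or> length qs + length gs \<le> length us) \<and>
    (\<forall>e x. env e \<longrightarrow> x \<in> carrier R \<longrightarrow>
      tval e g [^] (k::nat) \<otimes> horner e us x = horner e qs x \<otimes> horner e (gs @ [g]) x \<oplus> horner e rs x)"
  using u
proof (induction "length us" arbitrary: us rule: less_induct)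
  case less
  show ?case
  proof (cases "length us \<le> length gs")
    case True
    have "\<forall>t\<in>set (gs @ [g]). ring_term t" using g by auto
    then show ?thesis using True less.prems horner_closed[of "gs @ [g]"] horner_closed[OF less.prems]
      by - (rule exI[of _ "[]"], rule exI[of _ us], rule exI[of _ 0], simp)
  next
    case False
    then obtain vs v where us: "us = vs @ [v]" by (cases us rule: rev_cases) auto
    have v: "\<forall>t\<in>set vs. ring_term t" "ring_term v" using less.prems us by auto
    define k where "k = length vs - length gs"
    have k: "length vs = k + length gs" using False us by (simp add: k_def)
    define zs where "zs = replicate k tzero"
    have zs: "\<forall>t\<in>set zs. ring_term t" "length zs = k" by (auto simp: zs_def ring_language_def)
    have wv: "ring_term (tneg v)" using v(2) by (simp del: wf_term.simps(2))
    define vg where "vg = map (tmul (tneg v)) gs"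
    have vg: "\<forall>t\<in>set vg. ring_term t" using g wv unfolding vg_def by (auto simp del: wf_term.simps(2))
    define gv where "gv = map (tmul g) vs"
    have gv: "\<forall>t\<in>set gv. ring_term t" using g v unfolding gv_def by (auto simp del: wf_term.simps(2))
    have zvg: "\<forall>t\<in>set (zs @ vg). ring_term t" using zs vg by auto
    define ws where "ws = padd gv (zs @ vg)"
    have ws: "\<forall>t\<in>set ws. ring_term t" unfolding ws_def by (rule padd_terms[OF gv zvg])
    have lws: "length ws = length vs" using k zs by (simp add: ws_def gv_def vg_def)
    \<comment> \<open>One step of the division: after multiplication by the leading coefficient
      \<open>g\<close>, the top coefficient of \<open>us\<close> is cancelled by v x^k times the
      divisor, which leaves the shorter list \<open>ws\<close>.\<close>
    have id: "tval e g \<otimes> horner e us x = tval e v \<otimes> x [^] k \<otimes> horner e (gs @ [g]) x \<oplus> horner e ws x"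
      if e: "env e" and x: "x \<in> carrier R" for e x
    proof -
      have c: "tval e g \<in> carrier R" "tval e v \<in> carrier R" "horner e vs x \<in> carrier R" "horner e gs x \<in> carrier R"
        "x [^] k \<in> carrier R" "x [^] length gs \<in> carrier R" using e x g v by auto
      have 1: "horner e us x = horner e vs x \<oplus> x [^] k \<otimes> x [^] length gs \<otimes> tval e v"
        unfolding us using horner_append[OF v(1) _ e x, of "[v]"] v c x k by (simp add: nat_pow_mult)
      have 2: "horner e (gs @ [g]) x = horner e gs x \<oplus> x [^] length gs \<otimes> tval e g"
        using horner_append[OF g(2) _ e x, of "[g]"] g c x by simp
      have "horner e (zs @ vg) x = x [^] k \<otimes> horner e vg x"
        using horner_append[OF zs(1) vg e x] horner_trivial[of e zs x] horner_closed[OF vg e x] c x zs by (simp add: zs_def)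
      then have 3: "horner e ws x = tval e g \<otimes> horner e vs x \<oplus> x [^] k \<otimes> (\<ominus> tval e v \<otimes> horner e gs x)"
        unfolding ws_def horner_padd[OF e x gv zvg]
        unfolding gv_def vg_def horner_map_tmul[OF e x g(1) v(1)] horner_map_tmul[OF e x wv g(2)] tval_simps by simp
      show ?thesis unfolding 1 2 3 using c by algebra
    qed
    have "length ws < length us" using lws us by simp
    from less.hyps[OF this ws] obtain qs rs n where IH:
      "\<forall>t\<in>set qs. ring_term t" "\<forall>t\<in>set rs. ring_term t" "length rs \<le> length gs"
      "qs = [] \<or> length qs + length gs \<le> length ws"
      "\<And>e x. env e \<Longrightarrow> x \<in> carrier R \<Longrightarrow>
         tval e g [^] (n::nat) \<otimes> horner e ws x = horner e qs x \<otimes> horner e (gs @ [g]) x \<oplus> horner e rs x" by blast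
    \<comment> \<open>The quotient coefficient of this step is multiplied by g^n, the factor spent
      on dividing \<open>ws\<close>.\<close>
    define gn where "gn = ((tmul g) ^^ n) v"
    have gn: "ring_term gn" unfolding gn_def using g v by (induction n) (simp_all del: wf_term.simps(2))
    have tgn: "tval e gn = tval e g [^] n \<otimes> tval e v" if "env e" for e
      unfolding gn_def using g v that tval_closed[OF g(1) that]
      by (induction n) (simp_all add: m_ac del: eval_term.simps(2))
    have zg: "\<forall>t\<in>set (zs @ [gn]). ring_term t" using zs gn by auto
    define qs' where "qs' = padd (zs @ [gn]) qs"
    have qs': "\<forall>t\<in>set qs'. ring_term t" unfolding qs'_def by (rule padd_terms[OF zg IH(1)])
    have lqs: "length qs' + length gs \<le> length us" using IH(4) lws k us zs by (auto simp: qs'_def)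
    have "tval e g [^] Suc n \<otimes> horner e us x = horner e qs' x \<otimes> horner e (gs @ [g]) x \<oplus> horner e rs x"
      if e: "env e" and x: "x \<in> carrier R" for e x
    proof -
      have c: "tval e g \<in> carrier R" "tval e v \<in> carrier R" "horner e us x \<in> carrier R" "horner e (gs @ [g]) x \<in> carrier R"
        "horner e ws x \<in> carrier R" "horner e qs x \<in> carrier R" "horner e rs x \<in> carrier R"
        "x [^] k \<in> carrier R" "tval e g [^] n \<in> carrier R" using e x g v IH ws less.prems by auto
      have "horner e (zs @ [gn]) x = x [^] k \<otimes> tval e gn"
        using horner_append[OF zs(1) _ e x, of "[gn]"] horner_trivial[of e zs x] tval_closed[OF gn e] gn c x zs by (simp add: zs_def)
      then have q: "horner e qs' x = x [^] k \<otimes> (tval e g [^] n \<otimes> tval e v) \<oplus> horner e qs x"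
        unfolding qs'_def horner_padd[OF e x zg IH(1)] using tgn[OF e] by simp
      have "tval e g [^] Suc n \<otimes> horner e us x = tval e g [^] n \<otimes> (tval e g \<otimes> horner e us x)"
        using c by (simp add: m_assoc)
      also have "\<dots> = tval e g [^] n \<otimes> (tval e v \<otimes> x [^] k \<otimes> horner e (gs @ [g]) x) \<oplus> tval e g [^] n \<otimes> horner e ws x"
        unfolding id[OF e x] using c by algebra
      also have "\<dots> = tval e g [^] n \<otimes> (tval e v \<otimes> x [^] k \<otimes> horner e (gs @ [g]) x) \<oplus>
        (horner e qs x \<otimes> horner e (gs @ [g]) x \<oplus> horner e rs x)"
        unfolding IH(5)[OF e x] ..
      also have "\<dots> = horner e qs' x \<otimes> horner e (gs @ [g]) x \<oplus> horner e rs x"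
        unfolding q using c by algebra
      finally show ?thesis .
    qed
    then show ?thesis using qs' IH(2,3) lqs by - (rule exI[of _ qs'], rule exI[of _ rs], rule exI[of _ "Suc n"], blast)
  qed
qed

subsection \<open>Back and forth\<close>

text \<open>Equality of quantifier-free types: the map e i \<mapsto> e' i extends to an isomorphism
  of the generated subrings.\<close>

definition eqv_env :: "(nat \<Rightarrow> 'a) \<Rightarrow> (nat \<Rightarrow> 'a) \<Rightarrow> bool" where
  "eqv_env e e' \<longleftrightarrow> (\<forall>t. ring_term t \<longrightarrow> (tval e t = \<zero> \<longleftrightarrow> tval e' t = \<zero>))"

lemma eqv_env_sym: "eqv_env e e' \<Longrightarrow> eqv_env e' e" by (simp add: eqv_env_def)

lemma eqv_env_trivial: "eqv_env e e' \<Longrightarrow> \<forall>t\<in>set ts. ring_term t \<Longrightarrow> trivial e ts \<longleftrightarrow> trivial e' ts"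
  by (auto simp: eqv_env_def trivial_def)

lemma eqv_env_ren: "eqv_env e e' \<Longrightarrow> eqv_env (e \<circ> \<rho>) (e' \<circ> \<rho>)"
  unfolding eqv_env_def eval_term_ren[symmetric] using wf_term_ren by blast

lemma eqv_env_eq:
  assumes "eqv_env e e'" "ring_term s" "ring_term t" "env e" "env e'"
  shows "tval e s = tval e t \<longleftrightarrow> tval e' s = tval e' t"
proof -
  have w: "ring_term (tadd s (tneg t))" using assms by (simp del: wf_term.simps(2))
  have "tval e s = tval e t \<longleftrightarrow> tval e (tadd s (tneg t)) = \<zero>" if "env e" for e
    using r_right_minus_eq[of "tval e s" "tval e t"] assms that unfolding a_minus_def tval_simps by simp
  then show ?thesis using assms w unfolding eqv_env_def by blast
qed

lemma eqv_env_Cons: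
  assumes "env e" "env e'" "c \<in> carrier R" "d \<in> carrier R"
    "\<And>ts. \<forall>t\<in>set ts. ring_term t \<Longrightarrow> horner e ts c = \<zero> \<longleftrightarrow> horner e' ts d = \<zero>"
  shows "eqv_env (case_nat c e) (case_nat d e')"
  unfolding eqv_env_def
proof (intro allI impI)
  fix t assume "ring_term t"
  from term_horner[OF this] obtain ts where "\<forall>t\<in>set ts. ring_term t"
    "\<forall>e x. env e \<longrightarrow> x \<in> carrier R \<longrightarrow> tval (case_nat x e) t = horner e ts x" by blast
  then show "tval (case_nat c e) t = \<zero> \<longleftrightarrow> tval (case_nat d e') t = \<zero>" using assms by simp
qed

lemma transcendental_eqv:
  assumes "eqv_env e e'" "env e" "env e'" "c \<in> carrier R" "d \<in> carrier R" "\<not> alg_over e c" "\<not> alg_over e' d"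
  shows "eqv_env (case_nat c e) (case_nat d e')"
proof (rule eqv_env_Cons[OF assms(2-5)])
  fix ts assume w: "\<forall>t\<in>set ts. ring_term t"
  have "horner e ts c = \<zero> \<longleftrightarrow> trivial e ts"
    using assms(4,6) w horner_trivial[of e ts c] unfolding alg_over_def by blast
  moreover have "horner e' ts d = \<zero> \<longleftrightarrow> trivial e' ts"
    using assms(5,7) w horner_trivial[of e' ts d] unfolding alg_over_def by blast
  ultimately show "horner e ts c = \<zero> \<longleftrightarrow> horner e' ts d = \<zero>" using eqv_env_trivial[OF assms(1) w] by blast
qed

text \<open>A minimal polynomial of \<open>c\<close> over \<open>e\<close> up to a factor, kept as
  coefficient terms so that it can be evaluated over another assignment.\<close>

definition minimal :: "(nat \<Rightarrow> 'a) \<Rightarrow> 'a \<Rightarrow> ring_sym fo_term list \<Rightarrow> ring_sym fo_term \<Rightarrow> bool" where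
  "minimal e c gs g \<longleftrightarrow> (\<forall>t\<in>set gs. ring_term t) \<and> ring_term g \<and> tval e g \<noteq> \<zero> \<and> horner e (gs @ [g]) c = \<zero> \<and>
     (\<forall>us. (\<forall>t\<in>set us. ring_term t) \<longrightarrow> length us \<le> length gs \<longrightarrow> horner e us c = \<zero> \<longrightarrow> trivial e us)"

lemma minimal_exists:
  assumes "alg_over e c" "env e" "c \<in> carrier R"
  shows "\<exists>gs g. minimal e c gs g"
proof -
  define Q where "Q n \<longleftrightarrow> (\<exists>ts. length ts = n \<and> (\<forall>t\<in>set ts. ring_term t) \<and> \<not> trivial e ts \<and> horner e ts c = \<zero>)" for n
  have "\<exists>n. Q n" using assms(1) unfolding alg_over_def Q_def by blast
  then have n: "Q (LEAST n. Q n)" by (rule LeastI_ex)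
  then obtain ts where ts: "length ts = (LEAST n. Q n)" "\<forall>t\<in>set ts. ring_term t" "\<not> trivial e ts" "horner e ts c = \<zero>"
    unfolding Q_def by blast
  obtain gs g where g: "\<forall>t\<in>set (gs @ [g]). ring_term t" "tval e g \<noteq> \<zero>" "length gs < length ts"
    "horner e ts c = horner e (gs @ [g]) c" using nontrivial_lead[OF ts(2) assms(2) ts(3)] assms(3) by blast
  have "trivial e us" if "\<forall>t\<in>set us. ring_term t" "length us \<le> length gs" "horner e us c = \<zero>" for us
  proof (rule ccontr)
    assume "\<not> trivial e us"
    then have "Q (length us)" unfolding Q_def using that by blast
    then have "(LEAST n. Q n) \<le> length us" by (rule Least_le)
    then show False using that(2) g(3) ts(1) by simp
  qed
  then show ?thesis unfolding minimal_def using g ts(4) by (intro exI[of _ gs] exI[of _ g]) auto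
qed

text \<open>Division by the minimal relation leaves a remainder that vanishes at \<open>c\<close>,
  so its coefficients vanish over \<open>e\<close> and hence over \<open>e'\<close>; the power of
  the leading coefficient in front is nonzero and cancels.\<close>

lemma minimal_root_transfer:
  assumes eq: "eqv_env e e'" and e: "env e" "env e'" and c: "c \<in> carrier R" "d \<in> carrier R"
    and m: "minimal e c gs g" and d: "horner e' (gs @ [g]) d = \<zero>"
    and us: "\<forall>t\<in>set us. ring_term t" and uc: "horner e us c = \<zero>"
  shows "horner e' us d = \<zero>"
proof -
  have g: "ring_term g" "\<forall>t\<in>set gs. ring_term t" "tval e g \<noteq> \<zero>" "horner e (gs @ [g]) c = \<zero>"
    using m by (auto simp: minimal_def)
  obtain qs rs k where qr: "\<forall>t\<in>set qs. ring_term t" "\<forall>t\<in>set rs. ring_term t" "length rs \<le> length gs"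
    "\<And>e x. env e \<Longrightarrow> x \<in> carrier R \<Longrightarrow>
      tval e g [^] (k::nat) \<otimes> horner e us x = horner e qs x \<otimes> horner e (gs @ [g]) x \<oplus> horner e rs x"
    using pseudo_division[OF g(1,2) us] by blast
  have "horner e rs c = \<zero>" using qr(4)[OF e(1) c(1)] uc g qr(1,2) e c by simp
  then have "trivial e rs" using m qr(2,3) unfolding minimal_def by blast
  then have "trivial e' rs" using eqv_env_trivial[OF eq qr(2)] by blast
  then have "horner e' rs d = \<zero>" by (rule horner_trivial[OF _ c(2)])
  then have "tval e' g [^] k \<otimes> horner e' us d = \<zero>" using qr(4)[OF e(2) c(2)] d qr(1) e c by simp
  moreover have "tval e' g \<noteq> \<zero>" using eq g(1,3) unfolding eqv_env_def by blast
  then have "tval e' g [^] k \<noteq> \<zero>" using tval_closed[OF g(1) e(2)]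
    by (induction k) (simp_all add: integral_iff)
  ultimately show ?thesis
    using integral[of "tval e' g [^] k" "horner e' us d"] us g e c by auto
qed

text \<open>A shorter relation for \<open>d\<close> would divide \<open>ts @ [t]\<close> over \<open>e'\<close>, hence also over \<open>e\<close>, against the
  minimality for \<open>c\<close>.\<close>

lemma minimal_transfer:
  assumes eq: "eqv_env e e'" and e: "env e" "env e'" and c: "c \<in> carrier R" "d \<in> carrier R"
    and m: "minimal e c ts t" and d: "horner e' (ts @ [t]) d = \<zero>"
  shows "minimal e' d ts t"
proof -
  have t: "ring_term t" "\<forall>t\<in>set ts. ring_term t" "tval e t \<noteq> \<zero>" "horner e (ts @ [t]) c = \<zero>"
    using m by (auto simp: minimal_def)
  have t': "tval e' t \<noteq> \<zero>" using eq t(1,3) unfolding eqv_env_def by blast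
  have wt: "\<forall>t\<in>set (ts @ [t]). ring_term t" using t by auto
  have "alg_over e' d" unfolding alg_over_def using wt t' d by (intro exI[of _ "ts @ [t]"]) (auto simp: trivial_def)
  from minimal_exists[OF this e(2) c(2)] obtain gs g where m': "minimal e' d gs g" by blast
  have g: "ring_term g" "\<forall>t\<in>set gs. ring_term t" "tval e' g \<noteq> \<zero>" "horner e' (gs @ [g]) d = \<zero>"
    using m' by (auto simp: minimal_def)
  have "length ts \<le> length gs"
  proof (rule ccontr)
    assume less: "\<not> ?thesis"
    have g1: "tval e g \<noteq> \<zero>" using eq g(1,3) unfolding eqv_env_def by blast
    obtain qs rs k where qr: "\<forall>t\<in>set qs. ring_term t" "\<forall>t\<in>set rs. ring_term t" "length rs \<le> length gs"
      "qs = [] \<or> length qs + length gs \<le> length (ts @ [t])"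
      "\<And>e x. env e \<Longrightarrow> x \<in> carrier R \<Longrightarrow>
        tval e g [^] (k::nat) \<otimes> horner e (ts @ [t]) x = horner e qs x \<otimes> horner e (gs @ [g]) x \<oplus> horner e rs x"
      using pseudo_division[OF g(1,2) wt] by blast
    have wg: "\<forall>t\<in>set (gs @ [g]). ring_term t" using g by auto
    have "horner e' rs d = \<zero>" using qr(5)[OF e(2) c(2)] d g qr(1,2) e c by simp
    then have "trivial e' rs" using m' qr(2,3) unfolding minimal_def by blast
    then have tr: "trivial e rs" using eqv_env_trivial[OF eq qr(2)] by blast
    have fact: "tval e g [^] k \<otimes> horner e (ts @ [t]) x = horner e qs x \<otimes> horner e (gs @ [g]) x" if "x \<in> carrier R" for x
      using qr(5)[OF e(1) that] horner_trivial[OF tr that] horner_closed[OF qr(1) e(1) that] horner_closed[OF wg e(1) that] by simp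
    have "horner e (gs @ [g]) c \<noteq> \<zero>"
    proof
      assume "horner e (gs @ [g]) c = \<zero>"
      then have "trivial e (gs @ [g])" using m wg less unfolding minimal_def by auto
      then show False using g1 by (simp add: trivial_def)
    qed
    moreover have "horner e qs c \<otimes> horner e (gs @ [g]) c = \<zero>" using fact[OF c(1)] t g e by simp
    ultimately have qc: "horner e qs c = \<zero>"
      using integral[of "horner e qs c" "horner e (gs @ [g]) c"] horner_closed[OF qr(1) e(1) c(1)] horner_closed[OF wg e(1) c(1)] by blast
    have "gs \<noteq> []"
    proof
      assume "gs = []"
      then show False using g e c by simp
    qed
    then have "length qs \<le> length ts" using qr(4) less by (cases gs) auto
    \<comment> \<open>The quotient vanishes at \<open>c\<close> and is short enough to be trivial;
      then \<open>ts @ [t]\<close> vanishes on the whole field, which is infinite.\<close>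
    then have trq: "trivial e qs" using m qr(1) qc unfolding minimal_def by blast
    have "horner e (ts @ [t]) x = \<zero>" if x: "x \<in> carrier R" for x
    proof -
      have "tval e g [^] k \<noteq> \<zero>" using g1 tval_closed[OF g(1) e(1)] by (induction k) (simp_all add: integral_iff)
      moreover have "tval e g [^] k \<otimes> horner e (ts @ [t]) x = \<zero>"
        using fact[OF x] horner_trivial[OF trq x] horner_closed[OF wg e(1) x] by simp
      ultimately show ?thesis
        using integral[of "tval e g [^] k" "horner e (ts @ [t]) x"] horner_closed[OF wt e(1) x] g e by auto
    qed
    then have "{x \<in> carrier R. horner e (ts @ [t]) x = \<zero>} = carrier R" by blast
    moreover have "\<not> trivial e (ts @ [t])" using t(3) by (simp add: trivial_def)
    ultimately show False using finite_roots[OF wt e(1)] infinite_carrier by simp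
  qed
  then show ?thesis using m' t t' d unfolding minimal_def by auto
qed

text \<open>A transcendental \<open>c\<close> is matched by any transcendental d, an algebraic one
  by any root of its minimal relation read over \<open>e'\<close>.\<close>

lemma forth:
  assumes eq: "eqv_env e e'" and e: "env e" "env e'" and c: "c \<in> carrier R"
  shows "\<exists>d\<in>carrier R. eqv_env (case_nat c e) (case_nat d e')"
proof (cases "alg_over e c")
  case False
  obtain d where "d \<in> carrier R" "\<not> alg_over e' d"
    using transcendental_exists[OF e(2) countable_empty] by blast
  then show ?thesis using transcendental_eqv[OF eq e c _ False] by blast
next
  case True
  from minimal_exists[OF this e(1) c] obtain gs g where m: "minimal e c gs g" by blast
  have g: "ring_term g" "\<forall>t\<in>set gs. ring_term t" "tval e g \<noteq> \<zero>" "horner e (gs @ [g]) c = \<zero>"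
    using m by (auto simp: minimal_def)
  have g': "tval e' g \<noteq> \<zero>" using eq g(1,3) unfolding eqv_env_def by blast
  have "gs \<noteq> []"
  proof
    assume "gs = []"
    then show False using g e c by simp
  qed
  then obtain d where d: "d \<in> carrier R" "horner e' (gs @ [g]) d = \<zero>"
    using root_exists[of gs g e'] g g' e by auto
  have m': "minimal e' d gs g" by (rule minimal_transfer[OF eq e c d(1) m d(2)])
  have "eqv_env (case_nat c e) (case_nat d e')"
    by (rule eqv_env_Cons[OF e c d(1)])
      (use minimal_root_transfer[OF eq e c d(1) m d(2)]
        minimal_root_transfer[OF eqv_env_sym[OF eq] e(2,1) d(1) c m' g(4)] in blast)
  then show ?thesis using d(1) by blast
qed

lemma eqv_env_upd:
  assumes "eqv_env (case_nat c e) (case_nat d e')"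
  shows "eqv_env (e(i := c)) (e'(i := d))"
proof -
  define \<sigma> where "\<sigma> j = (if j = i then 0 else Suc j)" for j
  have "case_nat c e \<circ> \<sigma> = e(i := c)" "case_nat d e' \<circ> \<sigma> = e'(i := d)" by (auto simp: \<sigma>_def fun_eq_iff)
  then show ?thesis using eqv_env_ren[OF assms, of \<sigma>] by simp
qed

text \<open>Takes the role of quantifier elimination: the extension step in both directions carries
  quantifier-free equivalence through each quantifier.\<close>

lemma eqv_env_sat:
  assumes "wf_form ring_language p" "eqv_env e e'" "env e" "env e'"
  shows "sat (ring_structure R) p e \<longleftrightarrow> sat (ring_structure R) p e'"
  using assms
proof (induction p arbitrary: e e')
  case (Equal s t)
  then show ?case using eqv_env_eq by simp
next
  case (Atom r ts)
  then show ?case by (simp add: ring_language_def)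
next
  case (Imp p q)
  then show ?case by (metis sat.simps(4) wf_form.simps(4))
next
  case (Forall i p)
  have wf: "wf_form ring_language p" using Forall.prems by simp
  have univ: "univ (ring_structure R) = carrier R" by (simp add: ring_structure_def)
  have upd: "env (e(i := a))" if "env e" "a \<in> carrier R" for e a using that by (auto simp: env_def)
  have one: "sat (ring_structure R) (Forall i p) e'" if eq: "eqv_env e e'" and e: "env e" "env e'"
    and s: "sat (ring_structure R) (Forall i p) e" for e e'
    unfolding sat.simps univ
  proof
    fix d assume d: "d \<in> carrier R"
    obtain c where c: "c \<in> carrier R" "eqv_env (case_nat d e') (case_nat c e)"
      using forth[OF eqv_env_sym[OF eq] e(2,1) d] by blast
    have "sat (ring_structure R) p (e(i := c))" using s c(1) univ by simp
    then show "sat (ring_structure R) p (e'(i := d))"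
      using Forall.IH[OF wf eqv_env_upd[OF eqv_env_sym[OF c(2)]]] upd e c(1) d by blast
  qed
  show ?case
    using one[OF Forall.prems(2-4)] one[OF eqv_env_sym[OF Forall.prems(2)] Forall.prems(4,3)] by blast
qed simp

subsection \<open>Multiplicative maps with a definable graph\<close>

text \<open>Sums along lists, because the elimination of characters is an induction on the list of
  characters.\<close>

primrec isum :: "('i \<Rightarrow> 'a) \<Rightarrow> 'i list \<Rightarrow> 'a" where
  "isum F [] = \<zero>"
| "isum F (i # is) = F i \<oplus> isum F is"

lemma isum_closed [simp]: "(\<And>i. i \<in> set is \<Longrightarrow> F i \<in> carrier R) \<Longrightarrow> isum F is \<in> carrier R"
  by (induction "is") auto

lemma isum_cong: "(\<And>i. i \<in> set is \<Longrightarrow> F i = G i) \<Longrightarrow> isum F is = isum G is"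
  by (induction "is") auto

lemma isum_zero: "(\<And>i. i \<in> set is \<Longrightarrow> F i = \<zero>) \<Longrightarrow> isum F is = \<zero>"
  by (induction "is") auto

lemma isum_append:
  "(\<And>i. i \<in> set is \<union> set js \<Longrightarrow> F i \<in> carrier R) \<Longrightarrow> isum F (is @ js) = isum F is \<oplus> isum F js"
  by (induction "is") (auto simp: a_assoc)

lemma isum_mult:
  "(\<And>i. i \<in> set is \<Longrightarrow> F i \<in> carrier R) \<Longrightarrow> c \<in> carrier R \<Longrightarrow> isum (\<lambda>i. c \<otimes> F i) is = c \<otimes> isum F is"
  by (induction "is") (auto simp: r_distr)

lemma isum_diff:
  assumes "\<And>i. i \<in> set is \<Longrightarrow> F i \<in> carrier R" "\<And>i. i \<in> set is \<Longrightarrow> G i \<in> carrier R"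
  shows "isum (\<lambda>i. F i \<ominus> G i) is = isum F is \<ominus> isum G is"
  using assms
proof (induction "is")
  case (Cons i "is")
  then have "F i \<in> carrier R" "G i \<in> carrier R" "isum F is \<in> carrier R" "isum G is \<in> carrier R" by auto
  then have "F i \<ominus> G i \<oplus> (isum F is \<ominus> isum G is) = F i \<oplus> isum F is \<ominus> (G i \<oplus> isum G is)" by algebra
  then show ?case using Cons by simp
qed (simp add: a_minus_def)

lemma isum_product:
  assumes "\<And>i j. i \<in> set is \<Longrightarrow> j \<in> set js \<Longrightarrow> F (i, j) \<in> carrier R"
  shows "isum F (List.product is js) = isum (\<lambda>i. isum (\<lambda>j. F (i, j)) js) is"
  using assms
proof (induction "is")
  case (Cons i "is")
  have "isum F (map (Pair i) js) = isum (\<lambda>j. F (i, j)) js" by (induction js) auto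
  moreover have "isum F (map (Pair i) js @ List.product is js) = isum F (map (Pair i) js) \<oplus> isum F (List.product is js)"
    by (rule isum_append) (use Cons.prems in auto)
  ultimately show ?case using Cons by simp
qed simp

definition coefs :: "(nat \<Rightarrow> 'a) \<Rightarrow> ring_sym fo_term list \<Rightarrow> nat \<Rightarrow> 'a" where
  "coefs e ts i = (if i < length ts then tval e (ts ! i) else \<zero>)"

lemma coefs_closed [simp]: "\<forall>t\<in>set ts. ring_term t \<Longrightarrow> env e \<Longrightarrow> coefs e ts i \<in> carrier R"
  by (simp add: coefs_def)

lemma horner_isum:
  assumes "\<forall>t\<in>set ts. ring_term t" "env e" "x \<in> carrier R" "length ts \<le> n"
  shows "horner e ts x = isum (\<lambda>i. coefs e ts i \<otimes> x [^] i) [0..<n]"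
proof -
  have "horner e (take m ts) x = isum (\<lambda>i. coefs e ts i \<otimes> x [^] i) [0..<m]" for m
  proof (induction m)
    case (Suc m)
    have w: "\<forall>t\<in>set (take m ts). ring_term t" using assms(1) by (auto dest: in_set_takeD)
    have "isum (\<lambda>i. coefs e ts i \<otimes> x [^] i) [0..<Suc m] =
        isum (\<lambda>i. coefs e ts i \<otimes> x [^] i) [0..<m] \<oplus> coefs e ts m \<otimes> x [^] m"
      using isum_append[of "[0..<m]" "[m]" "\<lambda>i. coefs e ts i \<otimes> x [^] i"] assms by simp
    also have "\<dots> = horner e (take (Suc m) ts) x"
    proof (cases "m < length ts")
      case True
      then show ?thesis
        using horner_append[OF w _ assms(2,3), of "[ts ! m]"] assms Suc horner_closed[OF w assms(2,3)]
        by (simp add: take_Suc_conv_app_nth coefs_def m_comm)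
    next
      case False
      then show ?thesis using Suc assms horner_closed[OF w assms(2,3)] by (simp add: coefs_def)
    qed
    finally show ?case by simp
  qed simp
  from this[of n] show ?thesis using assms(4) by simp
qed

text \<open>Dedekind's independence of characters, for relations that hold off a countable set.\<close>

lemma characters_dependent:
  assumes \<chi>: "\<And>s x. x \<in> Units R \<Longrightarrow> \<chi> s x \<in> Units R"
    and mult: "\<And>s x y. x \<in> Units R \<Longrightarrow> y \<in> Units R \<Longrightarrow> \<chi> s (x \<otimes> y) = \<chi> s x \<otimes> \<chi> s y"
  shows "distinct l \<Longrightarrow> (\<And>s. s \<in> set l \<Longrightarrow> a s \<in> carrier R) \<Longrightarrow> \<exists>s\<in>set l. a s \<noteq> \<zero> \<Longrightarrow> countable C \<Longrightarrow>
    (\<And>x. x \<in> Units R - C \<Longrightarrow> isum (\<lambda>s. a s \<otimes> \<chi> s x) l = \<zero>) \<Longrightarrow>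
    \<exists>s\<in>set l. \<exists>s'\<in>set l. s \<noteq> s' \<and> (\<forall>x\<in>Units R. \<chi> s x = \<chi> s' x)"
proof (induction l arbitrary: a C)
  case (Cons s l)
  have \<chi>c: "\<chi> s x \<in> carrier R" if "x \<in> Units R" for s x using Units_closed[OF \<chi>[OF that]] .
  have ac: "a s \<in> carrier R" and al: "\<And>s'. s' \<in> set l \<Longrightarrow> a s' \<in> carrier R"
    by (rule Cons.prems(2), simp)+
  have off: "\<exists>x\<in>Units R. x \<notin> C'" if "countable C'" for C'
  proof (rule ccontr)
    assume "\<not> ?thesis"
    then have "carrier R \<subseteq> insert \<zero> C'" by (auto simp: field_Units)
    then show False using countable_subset[OF _ countable_insert[OF that]] uncountable_carrier by blast
  qed
  \<comment> \<open>If all later coefficients vanished, the first one would vanish too, since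
    characters have no zeros.\<close>
  have ex: "\<exists>s1\<in>set l. a s1 \<noteq> \<zero>"
  proof (rule ccontr)
    assume "\<not> ?thesis"
    then have z: "a s' = \<zero>" if "s' \<in> set l" for s' using that by blast
    obtain x where x: "x \<in> Units R" "x \<notin> C" using off[OF Cons.prems(4)] by blast
    have "isum (\<lambda>s. a s \<otimes> \<chi> s x) l = \<zero>" by (rule isum_zero) (use z \<chi>c[OF x(1)] in simp)
    then have "a s \<otimes> \<chi> s x = \<zero>" using Cons.prems(5)[of x] x ac \<chi>c[OF x(1)] by simp
    moreover have "\<chi> s x \<noteq> \<zero>" using \<chi>[OF x(1)] field_Units by blast
    ultimately have "a s = \<zero>" using integral[OF _ ac \<chi>c[OF x(1)]] by blast
    then show False using Cons.prems(3) z by auto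
  qed
  then obtain s1 where s1: "s1 \<in> set l" "a s1 \<noteq> \<zero>" by blast
  show ?case
  proof (cases "\<forall>x\<in>Units R. \<chi> s x = \<chi> s1 x")
    case True
    moreover have "s \<noteq> s1" using s1(1) Cons.prems(1) by auto
    ultimately show ?thesis using s1(1) by (metis list.set_intros)
  next
    case False
    then obtain y where y: "y \<in> Units R" "\<chi> s y \<noteq> \<chi> s1 y" by blast
    \<comment> \<open>Subtracting \<open>\<chi> s y\<close> times the relation at x from the
      relation at y x removes the character \<open>s\<close>, and y is chosen so that
      \<open>s1\<close> survives. Both x and y x must lie outside \<open>C\<close>, which enlarges
      the exceptional set.\<close>
    define b where "b s' = a s' \<otimes> (\<chi> s' y \<ominus> \<chi> s y)" for s'
    have bc: "b s' \<in> carrier R" if "s' \<in> set l" for s' using al[OF that] \<chi>c[OF y(1)] by (simp add: b_def)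
    have "\<chi> s1 y \<ominus> \<chi> s y \<noteq> \<zero>" using y \<chi>c[OF y(1)] by simp
    then have "b s1 \<noteq> \<zero>" using s1 al[OF s1(1)] \<chi>c[OF y(1)] unfolding b_def by (simp add: integral_iff)
    moreover have "countable (C \<union> (\<lambda>z. inv y \<otimes> z) ` C)" using Cons.prems(4) by simp
    moreover have "isum (\<lambda>s'. b s' \<otimes> \<chi> s' x) l = \<zero>" if x: "x \<in> Units R - (C \<union> (\<lambda>z. inv y \<otimes> z) ` C)" for x
    proof -
      have xu: "x \<in> Units R" "x \<notin> C" using x by auto
      have "y \<otimes> x \<notin> C"
      proof
        assume "y \<otimes> x \<in> C"
        moreover have "inv y \<otimes> (y \<otimes> x) = x" using y(1) xu(1) by (simp add: Units_closed m_assoc[symmetric])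
        ultimately show False using x by (metis DiffD2 UnI2 image_eqI)
      qed
      then have "isum (\<lambda>s. a s \<otimes> \<chi> s (y \<otimes> x)) (s # l) = \<zero>" using Cons.prems(5)[of "y \<otimes> x"] y(1) xu(1) by simp
      then have 1: "a s \<otimes> (\<chi> s y \<otimes> \<chi> s x) \<oplus> isum (\<lambda>s'. a s' \<otimes> (\<chi> s' y \<otimes> \<chi> s' x)) l = \<zero>"
        using mult[OF y(1) xu(1)] by simp
      have 2: "a s \<otimes> \<chi> s x \<oplus> isum (\<lambda>s'. a s' \<otimes> \<chi> s' x) l = \<zero>" using Cons.prems(5)[of x] xu by simp
      have k: "\<chi> s' x \<in> carrier R" "\<chi> s' y \<in> carrier R" for s' using \<chi>c y(1) xu(1) by auto
      define A where "A = isum (\<lambda>s'. a s' \<otimes> (\<chi> s' y \<otimes> \<chi> s' x)) l"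
      define B where "B = isum (\<lambda>s'. a s' \<otimes> \<chi> s' x) l"
      have AB: "A \<in> carrier R" "B \<in> carrier R" using al k by (auto simp: A_def B_def)
      have "isum (\<lambda>s'. b s' \<otimes> \<chi> s' x) l = isum (\<lambda>s'. a s' \<otimes> (\<chi> s' y \<otimes> \<chi> s' x) \<ominus> \<chi> s y \<otimes> (a s' \<otimes> \<chi> s' x)) l"
      proof (rule isum_cong)
        fix i assume "i \<in> set l"
        then have "a i \<in> carrier R" by (rule al)
        then show "b i \<otimes> \<chi> i x = a i \<otimes> (\<chi> i y \<otimes> \<chi> i x) \<ominus> \<chi> s y \<otimes> (a i \<otimes> \<chi> i x)"
          unfolding b_def using k[of i] k[of s] by algebra
      qed
      also have "\<dots> = A \<ominus> isum (\<lambda>s'. \<chi> s y \<otimes> (a s' \<otimes> \<chi> s' x)) l"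
        unfolding A_def by (rule isum_diff) (use al k in auto)
      also have "\<dots> = A \<ominus> \<chi> s y \<otimes> B"
        unfolding B_def by (subst isum_mult) (use al k in auto)
      also have "\<dots> = (a s \<otimes> (\<chi> s y \<otimes> \<chi> s x) \<oplus> A) \<ominus> \<chi> s y \<otimes> (a s \<otimes> \<chi> s x \<oplus> B)"
        using AB k[of s] ac by algebra
      also have "\<dots> = \<zero>" unfolding A_def B_def 1 2 using k[of s] by (simp add: a_minus_def)
      finally show ?thesis .
    qed
    ultimately have "\<exists>s\<in>set l. \<exists>s'\<in>set l. s \<noteq> s' \<and> (\<forall>x\<in>Units R. \<chi> s x = \<chi> s' x)"
      using Cons.IH[of b "C \<union> (\<lambda>z. inv y \<otimes> z) ` C"] bc s1(1) Cons.prems(1) by auto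
    then show ?thesis by auto
  qed
qed simp

text \<open>If the exponents of \<alpha> differ, cancelling common powers leaves a positive power of
  \<alpha>. If they agree, what remains is a fixed positive power of x equal to 1 for all units,
  impossible in an infinite field.\<close>

lemma power_relation:
  assumes \<alpha>: "\<And>x. x \<in> Units R \<Longrightarrow> \<alpha> x \<in> Units R"
    and eq: "\<And>x. x \<in> Units R \<Longrightarrow> x [^] i \<otimes> \<alpha> x [^] j = x [^] (i' :: nat) \<otimes> \<alpha> x [^] (j' :: nat)"
    and ne: "(j :: nat, i :: nat) \<noteq> (j', i')"
  shows "\<exists>(n :: nat) (m :: nat) (k :: nat). k > 0 \<and> (\<forall>x\<in>Units R. \<alpha> x [^] k \<otimes> x [^] n = x [^] m)"
proof -
  have lt_case: ?thesis
    if eq: "\<And>x. x \<in> Units R \<Longrightarrow> x [^] i \<otimes> \<alpha> x [^] j = x [^] (i' :: nat) \<otimes> \<alpha> x [^] (j' :: nat)" and l: "j' < j" for i i' j j' :: nat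
  proof (intro exI conjI ballI)
    show "j - j' > 0" using l by simp
    fix x assume x: "x \<in> Units R"
    have k: "x [^] i \<in> carrier R" "x [^] i' \<in> carrier R" "\<alpha> x [^] (j - j') \<in> carrier R" "\<alpha> x [^] j' \<in> carrier R" "\<alpha> x [^] j' \<in> Units R"
      using Units_closed[OF x] \<alpha>[OF x] Units_closed[OF \<alpha>[OF x]] by (auto intro: Units_pow_closed)
    have "\<alpha> x [^] j = \<alpha> x [^] (j - j') \<otimes> \<alpha> x [^] j'" using l Units_closed[OF \<alpha>[OF x]] by (simp add: nat_pow_mult)
    then have "\<alpha> x [^] j' \<otimes> (\<alpha> x [^] (j - j') \<otimes> x [^] i) = \<alpha> x [^] j' \<otimes> x [^] i'"
      using eq[OF x] k by (simp add: m_ac)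
    then show "\<alpha> x [^] (j - j') \<otimes> x [^] i = x [^] i'" using k by (simp add: Units_l_cancel)
  qed
  have False if e: "\<And>x. x \<in> Units R \<Longrightarrow> x [^] i \<otimes> \<alpha> x [^] j = x [^] i' \<otimes> \<alpha> x [^] j" and l: "i < i'" for i i' :: nat
  proof -
    have "Units R \<subseteq> {x \<in> carrier R. horner (\<lambda>_. \<one>) (tneg tone # replicate (i' - i - 1) tzero @ [tone]) x = \<zero>}"
    proof
      fix x assume x: "x \<in> Units R"
      have xc: "x \<in> carrier R" using Units_closed[OF x] .
      have env1: "env (\<lambda>_. \<one>)" by (auto simp: env_def)
      have k: "x [^] i \<in> Units R" "x [^] (i' - i) \<in> carrier R" "\<alpha> x [^] j \<in> Units R"
        using x Units_closed[OF x] \<alpha>[OF x] by (auto intro: Units_pow_closed)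
      have "x [^] i' = x [^] i \<otimes> x [^] (i' - i)" using l xc by (simp add: nat_pow_mult)
      then have "x [^] i \<otimes> (\<alpha> x [^] j \<otimes> \<one>) = x [^] i \<otimes> (\<alpha> x [^] j \<otimes> x [^] (i' - i))"
        using e[OF x] k Units_closed by (simp add: m_ac)
      then have "x [^] (i' - i) = \<one>" using k Units_closed Units_l_cancel
        by (metis m_closed one_closed)
      moreover have "x \<otimes> x [^] (i' - i - 1) = x [^] (i' - i)" using l xc nat_pow_Suc2[of x "i' - i - 1"] by (simp add: Suc_diff_Suc)
      moreover have "\<forall>t\<in>set (replicate (i' - i - 1) tzero). ring_term t" by (auto simp: ring_language_def)
      moreover from this have "horner (\<lambda>_. \<one>) (replicate (i' - i - 1) tzero @ [tone]) x = x [^] (i' - i - 1)"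
        using horner_append[of "replicate (i' - i - 1) tzero" "[tone]" "\<lambda>_. \<one>" x] horner_trivial[of "\<lambda>_. \<one>" _ x] env1 xc
        by (simp del: eval_term.simps(2) wf_term.simps(2))
      ultimately have "horner (\<lambda>_. \<one>) (tneg tone # replicate (i' - i - 1) tzero @ [tone]) x = \<zero>"
        by (simp add: l_neg del: eval_term.simps(2))
      then show "x \<in> {x \<in> carrier R. horner (\<lambda>_. \<one>) (tneg tone # replicate (i' - i - 1) tzero @ [tone]) x = \<zero>}" using xc by simp
    qed
    moreover have "finite {x \<in> carrier R. horner (\<lambda>_. \<one>) (tneg tone # replicate (i' - i - 1) tzero @ [tone]) x = \<zero>}"
      by (rule finite_roots) (auto simp: env_def trivial_def ring_term_App simp del: wf_term.simps(2) eval_term.simps(2))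
    ultimately have "finite (Units R)" using finite_subset by blast
    then show False using infinite_carrier by (simp add: field_Units)
  qed
  note eq_i = this
  show ?thesis
  proof (cases j j' rule: linorder_cases)
    case less
    then show ?thesis using lt_case[of i' j' i j] eq by metis
  next
    case greater
    then show ?thesis using lt_case[of i j i' j'] eq by metis
  next
    case equal
    then have "i < i' \<or> i' < i" using ne by auto
    then show ?thesis
    proof
      assume "i < i'"
      then show ?thesis using eq_i[of i i'] eq equal by metis
    next
      assume "i' < i"
      then show ?thesis using eq_i[of i' i] eq equal by metis
    qed
  qed
qed

lemma ring_term_Var [simp]: "ring_term (Var i)" by simp

theorem definable_multiplicative_map:
  assumes \<alpha>: "\<And>x. x \<in> Units R \<Longrightarrow> \<alpha> x \<in> Units R"
    and mult: "\<And>x y. x \<in> Units R \<Longrightarrow> y \<in> Units R \<Longrightarrow> \<alpha> (x \<otimes> y) = \<alpha> x \<otimes> \<alpha> y"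
    and def: "definable ring_language (ring_structure R) 2 {[x, \<alpha> x] |x. x \<in> Units R}"
  shows "\<exists>(n :: nat) (m :: nat) (k :: nat). k > 0 \<and> (\<forall>x\<in>Units R. \<alpha> x [^] k \<otimes> x [^] n = x [^] m)"
proof -
  have univ: "univ (ring_structure R) = carrier R" by (simp add: ring_structure_def)
  obtain p e where p: "wf_form ring_language p" and e: "env e" and graph:
    "{[x, \<alpha> x] |x. x \<in> Units R} =
      {xs. length xs = 2 \<and> set xs \<subseteq> carrier R \<and> sat (ring_structure R) p (with_params xs e)}"
    using def unfolding definable_def univ env_def by blast
  have gr: "x \<in> Units R \<and> y = \<alpha> x \<longleftrightarrow> sat (ring_structure R) p (with_params [x, y] e)"
    if "x \<in> carrier R" "y \<in> carrier R" for x y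
  proof -
    have "[x, y] \<in> {[x, \<alpha> x] |x. x \<in> Units R} \<longleftrightarrow> sat (ring_structure R) p (with_params [x, y] e)"
      unfolding graph using that by simp
    then show ?thesis by auto
  qed
  \<comment> \<open>\<open>with_params\<close> lists x first, whereas extending an assignment puts
    the latest element first; \<open>\<sigma>\<close> swaps the two.\<close>
  define \<sigma> :: "nat \<Rightarrow> nat" where "\<sigma> i = (if i = 0 then 1 else if i = 1 then 0 else i)" for i
  have wp: "with_params [x, y] (\<lambda>i. e' (i - 2)) = case_nat y (case_nat x e') \<circ> \<sigma>" for x y e'
    by (auto simp: with_params_def \<sigma>_def fun_eq_iff less_2_cases_iff nth_Cons' split: nat.splits)
  define e0 where "e0 i = e (i + 2)" for i
  have e0: "env e0" using e by (auto simp: env_def e0_def)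
  have wp0: "with_params [x, y] e = case_nat y (case_nat x e0) \<circ> \<sigma>" for x y
  proof -
    have "with_params [x, y] e = with_params [x, y] (\<lambda>i. e0 (i - 2))"
      by (auto simp: with_params_def e0_def fun_eq_iff intro!: arg_cong[of _ _ e])
    then show ?thesis using wp by simp
  qed
  have transfer: "x' \<in> Units R \<and> y' = \<alpha> x'" if "x \<in> Units R" "y = \<alpha> x"
    and c: "x \<in> carrier R" "y \<in> carrier R" "x' \<in> carrier R" "y' \<in> carrier R"
    and q: "eqv_env (case_nat y (case_nat x e0)) (case_nat y' (case_nat x' e0))" for x y x' y'
  proof -
    have "env (with_params [a, b] e)" if "a \<in> carrier R" "b \<in> carrier R" for a b
      using that e0 unfolding wp0 by (auto simp: env_def split: nat.splits)
    then have "sat (ring_structure R) p (with_params [x', y'] e)"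
      using eqv_env_sat[OF p eqv_env_ren[OF q, of \<sigma>]] gr[OF c(1,2)] that(1,2) c unfolding wp0 by blast
    then show ?thesis using gr[OF c(3,4)] by blast
  qed
  have refl: "eqv_env e0 e0" by (simp add: eqv_env_def)
  obtain x0 where x0: "x0 \<in> carrier R" "x0 \<noteq> \<zero>" "\<not> alg_over e0 x0"
    using transcendental_exists[OF e0, of "{\<zero>}"] by auto
  have x0u: "x0 \<in> Units R" using x0 by (simp add: field_Units)
  have \<alpha>0: "\<alpha> x0 \<in> carrier R" using Units_closed[OF \<alpha>[OF x0u]] .
  have ex0: "env (case_nat x0 e0)" using e0 x0(1) by simp
  \<comment> \<open>If \<alpha>(x0) were transcendental over x0, another transcendental y would
    satisfy the same formulas together with x0 and would have to be \<alpha>(x0) as well.\<close>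
  have "alg_over (case_nat x0 e0) (\<alpha> x0)"
  proof (rule ccontr)
    assume na: "\<not> ?thesis"
    obtain y where y: "y \<in> carrier R" "y \<noteq> \<alpha> x0" "\<not> alg_over (case_nat x0 e0) y"
      using transcendental_exists[OF ex0, of "{\<alpha> x0}"] by auto
    have "eqv_env (case_nat x0 e0) (case_nat x0 e0)" by (simp add: eqv_env_def)
    from transfer[OF x0u _ x0(1) \<alpha>0 x0(1) y(1) transcendental_eqv[OF this ex0 ex0 \<alpha>0 y(1) na y(3)]]
    show False using y(2) by simp
  qed
  then obtain ts where ts: "\<forall>t\<in>set ts. ring_term t" "\<not> trivial (case_nat x0 e0) ts" "horner (case_nat x0 e0) ts (\<alpha> x0) = \<zero>"
    unfolding alg_over_def by blast
  define C where "C = {x \<in> carrier R. alg_over e0 x}"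
  have C: "countable C" unfolding C_def by (rule countable_alg_over[OF e0])
  \<comment> \<open>All x transcendental over the parameters have the same type as x0, so the
    relation between x0 and \<alpha>(x0) holds for every x outside the countable set
    \<open>C\<close>.\<close>
  have vanish: "horner (case_nat x e0) ts (\<alpha> x) = \<zero>" if x: "x \<in> Units R - C" for x
  proof -
    have xc: "x \<in> carrier R" "\<not> alg_over e0 x" using x by (auto simp: C_def)
    have q: "eqv_env (case_nat x0 e0) (case_nat x e0)" by (rule transcendental_eqv[OF refl e0 e0 x0(1) xc(1) x0(3) xc(2)])
    obtain d where d: "d \<in> carrier R" "eqv_env (case_nat (\<alpha> x0) (case_nat x0 e0)) (case_nat d (case_nat x e0))"
      using forth[OF q ex0 _ \<alpha>0] e0 xc(1) by auto
    have "d = \<alpha> x" using transfer[OF x0u _ x0(1) \<alpha>0 xc(1) d] by simp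
    moreover have "tval (case_nat d (case_nat x e0)) (horner_term ts) = \<zero>"
      using d(2)[unfolded eqv_env_def, rule_format, OF horner_term_wf[OF ts(1)]] ts(3) by (simp add: tval_horner_term)
    ultimately show ?thesis unfolding tval_horner_term by simp
  qed
  have "\<forall>t\<in>set ts. \<exists>us. (\<forall>u\<in>set us. ring_term u) \<and> (\<forall>e x. env e \<longrightarrow> x \<in> carrier R \<longrightarrow> tval (case_nat x e) t = horner e us x)"
    using term_horner ts(1) by blast
  from bchoice[OF this] obtain us where us: "\<forall>t\<in>set ts. (\<forall>u\<in>set (us t). ring_term u) \<and>
    (\<forall>e x. env e \<longrightarrow> x \<in> carrier R \<longrightarrow> tval (case_nat x e) t = horner e (us t) x)" by blast
  define n where "n = Max (insert 0 ((\<lambda>t. length (us t)) ` set ts))"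
  have n: "length (us t) \<le> n" if "t \<in> set ts" for t unfolding n_def using that by (intro Max_ge) auto
  \<comment> \<open>The coefficients of the relation are polynomials in x. Expanding them gives a
    linear relation with constant coefficients \<open>a\<close> between the characters x^i
    \<alpha>(x)^j.\<close>
  define a where "a s = (case s of (j, i) \<Rightarrow> if j < length ts then coefs e0 (us (ts ! j)) i else \<zero>)" for s :: "nat \<times> nat"
  define \<chi> where "\<chi> s x = (case s of (j, i) \<Rightarrow> x [^] i \<otimes> \<alpha> x [^] j)" for s :: "nat \<times> nat" and x
  have ac: "a s \<in> carrier R" for s using bspec[OF us nth_mem] e0 by (auto simp: a_def split: prod.splits)
  have xu: "\<chi> s x \<in> Units R" if "x \<in> Units R" for s x
    using that \<alpha>[OF that] by (auto simp: \<chi>_def split: prod.splits intro!: Units_m_closed Units_pow_closed)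
  have xm: "\<chi> s (x \<otimes> y) = \<chi> s x \<otimes> \<chi> s y" if xy: "x \<in> Units R" "y \<in> Units R" for s x y
  proof -
    obtain j i where s: "s = (j, i)" by fastforce
    have k: "x \<in> carrier R" "y \<in> carrier R" "\<alpha> x \<in> carrier R" "\<alpha> y \<in> carrier R" using xy \<alpha> by auto
    then show ?thesis unfolding \<chi>_def s by (simp add: mult[OF xy] nat_pow_distrib m_ac)
  qed
  have coef: "coefs (case_nat x e0) ts j = isum (\<lambda>i. a (j, i) \<otimes> x [^] i) [0..<n]"
    if x: "x \<in> carrier R" for x j
  proof (cases "j < length ts")
    case True
    then have t: "ts ! j \<in> set ts" by simp
    then have "coefs (case_nat x e0) ts j = horner e0 (us (ts ! j)) x" using us e0 x True by (simp add: coefs_def)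
    also have "\<dots> = isum (\<lambda>i. coefs e0 (us (ts ! j)) i \<otimes> x [^] i) [0..<n]"
      using us t n[OF t] by (intro horner_isum e0 x) auto
    finally show ?thesis using True by (simp add: a_def)
  next
    case False
    then have "isum (\<lambda>i. a (j, i) \<otimes> x [^] i) [0..<n] = \<zero>" using x by (intro isum_zero) (simp add: a_def)
    then show ?thesis using False by (simp add: coefs_def)
  qed
  define l where "l = List.product [0..<length ts] [0..<n]"
  have rel: "isum (\<lambda>s. a s \<otimes> \<chi> s x) l = \<zero>" if x: "x \<in> Units R - C" for x
  proof -
    have xk: "x \<in> carrier R" "\<alpha> x \<in> carrier R" using x \<alpha> by auto
    have "isum (\<lambda>s. a s \<otimes> \<chi> s x) l = isum (\<lambda>j. isum (\<lambda>i. a (j, i) \<otimes> \<chi> (j, i) x) [0..<n]) [0..<length ts]"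
      unfolding l_def by (rule isum_product) (use ac Units_closed[OF xu, of x] x in simp)
    also have "\<dots> = isum (\<lambda>j. coefs (case_nat x e0) ts j \<otimes> \<alpha> x [^] j) [0..<length ts]"
    proof (rule isum_cong)
      fix j
      have "isum (\<lambda>i. a (j, i) \<otimes> \<chi> (j, i) x) [0..<n] = isum (\<lambda>i. \<alpha> x [^] j \<otimes> (a (j, i) \<otimes> x [^] i)) [0..<n]"
        using ac xk by (intro isum_cong) (simp add: \<chi>_def m_ac)
      also have "\<dots> = \<alpha> x [^] j \<otimes> isum (\<lambda>i. a (j, i) \<otimes> x [^] i) [0..<n]"
        using ac xk by (intro isum_mult) auto
      finally show "isum (\<lambda>i. a (j, i) \<otimes> \<chi> (j, i) x) [0..<n] = coefs (case_nat x e0) ts j \<otimes> \<alpha> x [^] j"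
        unfolding coef[OF xk(1)] using ac xk by (simp add: m_comm)
    qed
    also have "\<dots> = horner (case_nat x e0) ts (\<alpha> x)"
      using ts(1) e0 xk by (intro horner_isum[symmetric]) auto
    finally show ?thesis using vanish[OF x] by simp
  qed
  have "\<exists>s\<in>set l. a s \<noteq> \<zero>"
  proof (rule ccontr)
    assume no: "\<not> ?thesis"
    have "tval (case_nat x0 e0) (ts ! j) = \<zero>" if "j < length ts" for j
    proof -
      have "coefs (case_nat x0 e0) ts j = \<zero>" unfolding coef[OF x0(1)]
        by (rule isum_zero) (use no that x0(1) in \<open>auto simp: l_def\<close>)
      then show ?thesis using that by (simp add: coefs_def)
    qed
    then show False using ts(2) unfolding trivial_def by (metis in_set_conv_nth)
  qed
  moreover have "distinct l" unfolding l_def by (intro distinct_product) auto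
  ultimately obtain s s' where s: "s \<noteq> s'" "\<forall>x\<in>Units R. \<chi> s x = \<chi> s' x"
    using characters_dependent[of \<chi> l a C, OF xu xm] ac C rel by blast
  obtain j i j' i' where ij: "s = (j, i)" "s' = (j', i')" by fastforce
  show ?thesis
    by (rule power_relation[of \<alpha> i j i' j']) (use \<alpha> s in \<open>auto simp: ij \<chi>_def\<close>)
qed

end

section \<open>Structures for the language of valued fields\<close>

lemma dfpred_sat:
  assumes "wf_form L p" "univ N \<noteq> {}"
  shows "dfpred L N (sat N p)"
proof -
  obtain u where "u \<in> univ N" using assms(2) by blast
  then show ?thesis
    by (intro dfpredI[where p = p and q = "\<lambda>_. u" and \<tau> = "\<lambda>i. 2 * i"])
      (auto simp: assms merge_def comp_def inj_def)
qed

lemma definability_dfpred: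
  assumes "univ N \<noteq> {}"
  shows "definability (univ N) (dfpred L N)"
proof
  show "univ N \<noteq> {}" by fact
  show "dfpred L N P \<Longrightarrow> (\<And>e. range e \<subseteq> univ N \<Longrightarrow> P e = Q e) \<Longrightarrow> dfpred L N Q" for P Q
    by (rule dfpred_cong)
  show "dfpred L N P \<Longrightarrow> dfpred L N (\<lambda>e. \<not> P e)" for P by (rule dfpred_not)
  show "dfpred L N P \<Longrightarrow> dfpred L N Q \<Longrightarrow> dfpred L N (\<lambda>e. P e \<and> Q e)" for P Q by (rule dfpred_conj)
  show "dfpred L N (\<lambda>e. Q (e 0) (\<lambda>i. e (Suc i))) \<Longrightarrow> dfpred L N (\<lambda>e. \<forall>x\<in>univ N. Q x e)" for Q
    by (rule dfpred_all[OF _ assms])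
  show "dfpred L N (\<lambda>e. P (\<lambda>i. e (\<rho> i)))" if "dfpred L N P" "inj \<rho>" for P \<rho> by (rule dfpred_reindex[OF that])
  show "dfpred L N P \<Longrightarrow> a \<in> univ N \<Longrightarrow> dfpred L N (\<lambda>e. P (case_nat a e))" for P a by (rule dfpred_param)
  show "dfpred L N (\<lambda>e. e 0 = e 1)"
    by (rule dfpred_cong[OF dfpred_sat[of L "Equal (Var 0) (Var 1)" N, OF _ assms]]) auto
qed

text \<open>\<open>le\<close> is the divisibility relation cut down to the carrier, because
  \<open>vle\<close> may hold arbitrarily outside of it.\<close>

locale acvf_model = field R for R :: "'a ring" (structure) +
  fixes M :: "('f, 'r, 'a) vf_structure" and le :: "'a \<Rightarrow> 'a \<Rightarrow> bool" (infix "\<preceq>" 50)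
  assumes R: "R = vfield M" and acvf: "acvf M"
    and le: "\<And>x y. x \<preceq> y \<longleftrightarrow> x \<in> univ M \<and> y \<in> univ M \<and> vle M x y"
begin

lemma univ: "univ M = carrier R" by (simp add: R vfield_def)

lemma val_ring_carrier: "carrier (val_ring M) = {x. \<one> \<preceq> x}"
  using one_closed by (auto simp: val_ring_def le R[symmetric] univ)

lemma val_subring: "subring {x. \<one> \<preceq> x} R"
  using acvf unfolding acvf_def R[symmetric] val_ring_carrier by blast

lemma le_iff: "x \<in> carrier R \<Longrightarrow> y \<in> carrier R \<Longrightarrow> x \<preceq> y \<longleftrightarrow> (\<exists>z. \<one> \<preceq> z \<and> y = x \<otimes> z)"
  using acvf unfolding acvf_def R[symmetric] val_ring_carrier le univ by auto

lemma le_carrierD: "x \<preceq> y \<Longrightarrow> x \<in> carrier R \<and> y \<in> carrier R"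
  by (simp add: le univ)

lemma le_ex: "x \<preceq> y \<Longrightarrow> \<exists>z. \<one> \<preceq> z \<and> z \<in> carrier R \<and> y = x \<otimes> z"
  using le_iff[of x y] le_carrierD by blast

sublocale valued_field R "(\<preceq>)"
proof
  note O = subringE[OF val_subring]
  show "x \<preceq> y \<Longrightarrow> x \<in> carrier R \<and> y \<in> carrier R" for x y by (rule le_carrierD)
  show "x \<preceq> y \<or> y \<preceq> x" if xy: "x \<in> carrier R" "y \<in> carrier R" for x y
  proof (cases "x = \<zero> \<or> y = \<zero>")
    case True
    have z: "\<one> \<preceq> \<zero>" using O(2) by simp
    from True show ?thesis
    proof
      assume "x = \<zero>"
      then have "y \<preceq> x" using le_iff[OF xy(2,1)] z xy by (intro iffD2[OF le_iff[OF xy(2,1)]] exI[of _ \<zero>]) simp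
      then show ?thesis ..
    next
      assume "y = \<zero>"
      then have "x \<preceq> y" using z xy by (intro iffD2[OF le_iff[OF xy]] exI[of _ \<zero>]) simp
      then show ?thesis ..
    qed
  next
    case False
    then have u: "x \<in> Units R" "y \<in> Units R" using xy by (auto simp: field_Units)
    define z where "z = y \<otimes> inv x"
    have zc: "z \<in> carrier R" "z \<in> Units R" using u by (auto simp: z_def Units_closed)
    have "z \<noteq> \<zero>" using zc(2) field_Units by blast
    then have "\<one> \<preceq> z \<or> \<one> \<preceq> inv z"
      using acvf zc(1) unfolding acvf_def R[symmetric] val_ring_carrier univ by auto
    moreover have "y = x \<otimes> z" using u by (simp add: z_def Units_closed m_lcomm[of x y])
    moreover then have "x = y \<otimes> inv z" using u zc by (simp add: Units_closed m_assoc)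
    ultimately show ?thesis using le_iff[OF xy] le_iff[OF xy(2,1)] by blast
  qed
  show "x \<preceq> z" if xy: "x \<preceq> y" and yz: "y \<preceq> z" for x y z
  proof -
    obtain a b where a: "\<one> \<preceq> a" "a \<in> carrier R" "y = x \<otimes> a" and b: "\<one> \<preceq> b" "b \<in> carrier R" "z = y \<otimes> b"
      using le_ex[OF xy] le_ex[OF yz] by blast
    have c: "x \<in> carrier R" "z \<in> carrier R" using le_carrierD xy yz by auto
    have "z = x \<otimes> (a \<otimes> b)" using a b c by (simp add: m_assoc)
    moreover have "\<one> \<preceq> a \<otimes> b" using O(6) a(1) b(1) by blast
    ultimately show ?thesis using le_iff[OF c] by blast
  qed
  show "x \<otimes> z \<preceq> y \<otimes> z" if xy: "x \<preceq> y" and z: "z \<in> carrier R" for x y z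
  proof -
    obtain a where a: "\<one> \<preceq> a" "a \<in> carrier R" "y = x \<otimes> a" using le_ex[OF xy] by blast
    have c: "x \<in> carrier R" "y \<in> carrier R" using le_carrierD xy by auto
    have "y \<otimes> z = (x \<otimes> z) \<otimes> a" using a c z by (simp add: m_ac)
    then show ?thesis using le_iff[of "x \<otimes> z" "y \<otimes> z"] a c z by blast
  qed
  show "x \<preceq> \<zero>" if "x \<in> carrier R" for x
    using O(2) that by (intro iffD2[OF le_iff] exI[of _ \<zero>]) auto
  show "x = \<zero>" if "\<zero> \<preceq> x" for x using le_ex[OF that] by auto
  show "z \<preceq> x \<oplus> y" if zx: "z \<preceq> x" and zy: "z \<preceq> y" for x y z
  proof -
    obtain a b where a: "\<one> \<preceq> a" "a \<in> carrier R" "x = z \<otimes> a" and b: "\<one> \<preceq> b" "b \<in> carrier R" "y = z \<otimes> b"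
      using le_ex[OF zx] le_ex[OF zy] by blast
    have c: "z \<in> carrier R" "x \<in> carrier R" "y \<in> carrier R" using le_carrierD zx zy by auto
    have "x \<oplus> y = z \<otimes> (a \<oplus> b)" using a b c by (simp add: r_distr)
    moreover have "\<one> \<preceq> a \<oplus> b" using O(7) a(1) b(1) by blast
    ultimately show ?thesis using le_iff[of z "x \<oplus> y"] c by blast
  qed
qed

lemma lt_vless: "x \<in> K \<Longrightarrow> y \<in> K \<Longrightarrow> x \<prec> y \<longleftrightarrow> vless M x y"
  by (auto simp: lt_def vless_def le univ)

lemma val_ring: "val_ring M = R\<lparr>carrier := vring\<rparr>"
  unfolding vring_def val_ring_carrier[symmetric] by (simp add: val_ring_def R)

lemma max_ideal: "max_ideal M = {x \<in> vring. x \<approx> \<zero>}"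
  by (auto simp: max_ideal_def R[symmetric] univ lt_vless[symmetric] req_def vring_def a_minus_def dest: lt_imp_le)

lemma nontrivial: "\<exists>t\<in>carrier R. \<one> \<prec> t \<and> t \<noteq> \<zero>"
proof -
  have "vring \<noteq> K" using acvf unfolding acvf_def val_ring univ by simp
  then obtain x where x: "x \<in> K" "x \<notin> vring" by auto
  then have xu: "x \<in> Kx" by (auto intro: KxI simp: vring_def le_zero)
  have "x \<prec> \<one>" using x not_le[of \<one> x] by (auto simp: vring_def)
  then have "\<one> \<prec> \<one> \<oslash> x" using xu by (simp add: lt_div_iff)
  then show ?thesis using xu by (intro bexI[of _ "\<one> \<oslash> x"]) auto
qed

lemma monic_root:
  assumes p: "set p \<subseteq> carrier R" "p \<noteq> []"
  shows "\<exists>x\<in>carrier R. eval (\<one> # p) x = \<zero>"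
proof -
  interpret AC: algebraically_closed R using acvf unfolding acvf_def R[symmetric] by blast
  have P: "\<one> # p \<in> carrier (poly_ring R)"
    unfolding univ_poly_carrier[symmetric] polynomial_def using p by simp
  have "size (roots (\<one> # p)) = length p" using AC.roots_over_carrier[OF P] by (simp add: splitted_def)
  then obtain x where "x \<in># roots (\<one> # p)" using p(2) by (metis length_greater_0_conv nonempty_has_size multiset_nonemptyE)
  then have "is_root (\<one> # p) x" using roots_mem_iff_is_root[OF P] by blast
  then show ?thesis by (auto simp: is_root_def)
qed

lemma is_ball: "is_ball M B \<longleftrightarrow> (\<exists>a\<in>carrier R. \<exists>r\<in>carrier R - {\<zero>}. B = {x. r \<preceq> x \<ominus> a \<and> x \<in> carrier R} \<or>
    B = {x. r \<prec> x \<ominus> a \<and> x \<in> carrier R})"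
proof -
  have eq: "closed_ball M a r = {x. r \<preceq> x \<ominus> a \<and> x \<in> carrier R}" "open_ball M a r = {x. r \<prec> x \<ominus> a \<and> x \<in> carrier R}"
    if "a \<in> K" "r \<in> K - {\<zero>}" for a r
    using that unfolding closed_ball_def open_ball_def R[symmetric] univ by (auto simp: le univ lt_vless)
  have "is_ball M B \<longleftrightarrow> (\<exists>a\<in>K. \<exists>r\<in>K - {\<zero>}. B = closed_ball M a r \<or> B = open_ball M a r)"
    unfolding is_ball_def ball_of_radius_def R[symmetric] univ by blast
  then show ?thesis by (simp only: eq cong: bex_cong)
qed

lemma closed_ball: "a \<in> K \<Longrightarrow> r \<in> K \<Longrightarrow> closed_ball M a r = {x \<in> K. r \<preceq> x \<ominus> a}"
  unfolding closed_ball_def R[symmetric] univ by (auto simp: le univ)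

text \<open>For \<open>completeness\<close>, a definable set of pairs of centre and radius is read
  as a definable family of closed balls; a point of the intersection is within each radius of its
  centre.\<close>

lemma cmin_fieldI:
  fixes E :: "('f, 'r) language" and \<kappa> :: "'k rel"
  defines "L \<equiv> vf_language E"
  assumes cmin: "\<forall>S \<subseteq> univ M. definable L M 1 {[x] |x. x \<in> S} \<longrightarrow>
      S \<in> bool_combs (univ M) ({B. is_ball M B} \<union> {{a} |a. a \<in> univ M})"
    and monster: "monster_model \<kappa> L T M" and complete: "definably_complete E M" and char: "char_0 R"
  shows "cmin_field R (\<preceq>) (dfpred L M)"
proof -
  have ne: "univ M \<noteq> {}" using univ one_closed by blast
  interpret definability K "dfpred L M" using definability_dfpred[OF ne, of L] unfolding univ .
  show ?thesis
  proof unfold_locales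
    show le01: "dfpred L M (\<lambda>e. e 0 \<preceq> e 1)"
      by (rule dfpred_cong[OF dfpred_sat[of L "Atom Div [Var 0, Var 1]" M, OF _ ne]])
        (auto simp: L_def vf_language_def le vle_def)
    show add: "dfpred L M (\<lambda>e. e 0 = e 1 \<oplus> e 2)"
      by (rule dfpred_cong[OF dfpred_sat[of L "Equal (Var 0) (App (Ring RAdd) [Var 1, Var 2])" M, OF _ ne]])
        (auto simp: L_def vf_language_def R vfield_def)
    show "dfpred L M (\<lambda>e. e 0 = e 1 \<otimes> e 2)"
      by (rule dfpred_cong[OF dfpred_sat[of L "Equal (Var 0) (App (Ring RMul) [Var 1, Var 2])" M, OF _ ne]])
        (auto simp: L_def vf_language_def R vfield_def)
    show "\<exists>t\<in>carrier R. \<one> \<prec> t \<and> t \<noteq> \<zero>" by (rule nontrivial)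
    show "\<exists>x\<in>carrier R. eval (\<one> # p) x = \<zero>" if "set p \<subseteq> carrier R" "p \<noteq> []" for p
      by (rule monic_root[OF that])
    show "[n] \<cdot> \<one> \<noteq> \<zero>" if "n > 0" for n :: nat using char that by (simp add: char_0_def)
    show "{x \<in> carrier R. P x} \<in> bool_combs (carrier R)
      ({B. \<exists>a\<in>carrier R. \<exists>r\<in>carrier R - {\<zero>}. B = {x. r \<preceq> x \<ominus> a \<and> x \<in> carrier R} \<or>
          B = {x. r \<prec> x \<ominus> a \<and> x \<in> carrier R}} \<union> {{a} |a. a \<in> carrier R})"
      if P: "dfpred L M (\<lambda>e. P (e 0))" for P
    proof -
      have "{xs. length xs = 1 \<and> set xs \<subseteq> univ M \<and> P (if 0 < (1::nat) then xs ! 0 else \<one>)} = {[x] |x. x \<in> {x \<in> K. P x}}"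
        by (auto simp: length_Suc_conv univ)
      then have "definable L M 1 {[x] |x. x \<in> {x \<in> K. P x}}"
        using dfpred_imp_definable[OF P, of \<one> 1] univ by simp
      then show ?thesis using cmin[rule_format, of "{x \<in> K. P x}"] unfolding univ is_ball by auto
    qed
    show "\<exists>x\<in>carrier R. \<forall>i. P i x"
      if "\<And>n. dfpred L M (\<lambda>e. P n (e 0))" "\<And>n. \<exists>x\<in>carrier R. \<forall>i<n. P i x" for P :: "nat \<Rightarrow> 'a \<Rightarrow> bool"
      by (rule monster_countable_saturation[OF monster, of P, unfolded univ]) (rule that)+
    show "\<exists>x\<in>carrier R. \<forall>y c. S y c \<longrightarrow> c \<preceq> x \<ominus> y"
      if S: "dfpred L M (\<lambda>e. S (e 0) (e 1))"
        and Sc: "\<And>y c. S y c \<Longrightarrow> y \<in> carrier R \<and> c \<in> carrier R \<and> c \<noteq> \<zero>"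
        and nest: "\<And>y c y' c'. S y c \<Longrightarrow> S y' c' \<Longrightarrow> c \<preceq> y \<ominus> y' \<or> c' \<preceq> y \<ominus> y'"
        and large: "\<And>r. r \<in> carrier R \<Longrightarrow> r \<noteq> \<zero> \<Longrightarrow> \<exists>y c. S y c \<and> r \<preceq> c" for S
    proof -
      have Sc1: "y \<in> K" and Sc2: "c \<in> K" if "S y c" for y c using Sc[OF that] by auto
      define S2 where "S2 = {[y, c] |y c. S y c}"
      define D where "D = {[x, y, c] |x y c. x \<in> K \<and> y \<in> K \<and> c \<in> K \<and> c \<preceq> x \<ominus> y}"
      define F where "F = (\<lambda>s. {x. x # s \<in> D}) ` S2"
      have "{xs. length xs = 2 \<and> set xs \<subseteq> univ M \<and> S (if 0 < (2::nat) then xs ! 0 else \<one>) (if 1 < (2::nat) then xs ! 1 else \<one>)} = S2"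
        unfolding S2_def by (auto simp: length_Suc_conv univ numeral_2_eq_2 intro: Sc1 Sc2)
      then have dS: "definable L M 2 S2" using dfpred_imp_definable[OF S, of \<one> 2] univ by simp
      \<comment> \<open>Subtraction is expressed through addition, as the calculus of field terms
        becomes available only with the instance under construction.\<close>
      have "dfpred L M (\<lambda>e. \<exists>z\<in>K. e 0 = z \<oplus> e 1 \<and> e 2 \<preceq> z)"
        by (intro Df_ex Df_conj Df_comp3[OF add, of "\<lambda>e. e (Suc 0)" "\<lambda>e. e 0" "\<lambda>e. e (Suc 1)"]
            Df_comp2[OF le01, of "\<lambda>e. e (Suc 2)" "\<lambda>e. e 0"] Dt_var)
      then have "dfpred L M (\<lambda>e. e 2 \<preceq> e 0 \<ominus> e 1)"
      proof (rule Df_cong)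
        fix e :: "nat \<Rightarrow> 'a" assume e: "range e \<subseteq> K"
        then have k: "e 0 \<in> K" "e 1 \<in> K" "e 2 \<in> K" by auto
        have "e 0 = z \<oplus> e 1 \<longleftrightarrow> z = e 0 \<ominus> e 1" if "z \<in> K" for z
        proof
          assume "e 0 = z \<oplus> e 1"
          moreover have "z \<oplus> e 1 \<ominus> e 1 = z" using k that by algebra
          ultimately show "z = e 0 \<ominus> e 1" by simp
        next
          assume "z = e 0 \<ominus> e 1"
          then show "e 0 = z \<oplus> e 1" using k by (simp add: a_minus_def a_assoc l_neg)
        qed
        then show "(\<exists>z\<in>K. e 0 = z \<oplus> e 1 \<and> e 2 \<preceq> z) \<longleftrightarrow> e 2 \<preceq> e 0 \<ominus> e 1" using k by auto
      qed
      note D3 = this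
      have "{xs. length xs = 3 \<and> set xs \<subseteq> univ M \<and> (if 2 < (3::nat) then xs ! 2 else \<one>) \<preceq>
          (if 0 < (3::nat) then xs ! 0 else \<one>) \<ominus> (if 1 < (3::nat) then xs ! 1 else \<one>)} = D"
        unfolding D_def by (auto simp: length_Suc_conv univ numeral_3_eq_3 numeral_2_eq_2)
      then have dD: "definable L M (Suc 2) D" using dfpred_imp_definable[OF D3, of \<one> 3] univ by simp
      have F: "F = {closed_ball M y c |y c. S y c}"
      proof -
        have "{x. x # [y, c] \<in> D} = closed_ball M y c" if "S y c" for y c
          using Sc[OF that] unfolding D_def by (auto simp: closed_ball)
        then show ?thesis unfolding F_def S2_def by (auto simp: image_iff) blast+
      qed
      \<comment> \<open>For the coarser radius \<open>c\<close> both alternatives of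
        \<open>nest\<close> give c \<preceq> y - y', so the finer ball lies in the coarser
        one.\<close>
      have chain: "closed_ball M y' c' \<subseteq> closed_ball M y c" if s: "S y c" "S y' c'" and cc: "c \<preceq> c'" for y c y' c'
      proof -
        have k: "y \<in> K" "y' \<in> K" "c \<in> K" "c' \<in> K" using Sc s by blast+
        have d: "c \<preceq> y \<ominus> y'" using nest[OF s] le_trans[OF cc] by blast
        have "c \<preceq> x \<ominus> y" if "x \<in> K" "c' \<preceq> x \<ominus> y'" for x
        proof -
          have "c \<preceq> (x \<ominus> y') \<ominus> (y \<ominus> y')" using le_trans[OF cc that(2)] d by (rule le_diff)
          moreover have "(x \<ominus> y') \<ominus> (y \<ominus> y') = x \<ominus> y" using that(1) k by algebra
          ultimately show ?thesis by simp
        qed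
        then show ?thesis using k by (auto simp: closed_ball)
      qed
      have ball: "ball_of_radius M c (closed_ball M y c)" if "S y c" for y c
        using Sc[OF that] unfolding ball_of_radius_def R[symmetric] univ by blast
      have "definable_family L M F" unfolding definable_family_def F_def using dS dD by blast
      moreover have "\<forall>B\<in>F. is_ball M B" unfolding F is_ball_def using ball by blast
      moreover have "\<forall>A\<in>F. \<forall>B\<in>F. A \<subseteq> B \<or> B \<subseteq> A"
      proof (intro ballI)
        fix A B assume "A \<in> F" "B \<in> F"
        then obtain y c y' c' where s: "S y c" "S y' c'" "A = closed_ball M y c" "B = closed_ball M y' c'"
          unfolding F by blast
        have "c \<preceq> c' \<or> c' \<preceq> c" using Sc[OF s(1)] Sc[OF s(2)] le_total by blast
        then show "A \<subseteq> B \<or> B \<subseteq> A" using chain[OF s(1,2)] chain[OF s(2,1)] s(3,4) by blast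
      qed
      moreover have "\<forall>r\<in>univ M - {\<zero>\<^bsub>vfield M\<^esub>}. \<exists>B\<in>F. \<exists>s. ball_of_radius M s B \<and> vle M r s"
      proof
        fix r assume "r \<in> univ M - {\<zero>\<^bsub>vfield M\<^esub>}"
        then obtain y c where "S y c" "r \<preceq> c" using large[of r] unfolding R[symmetric] univ by blast
        then show "\<exists>B\<in>F. \<exists>s. ball_of_radius M s B \<and> vle M r s" unfolding F using ball le by blast
      qed
      ultimately have "\<Inter>F \<noteq> {}" using complete unfolding definably_complete_def L_def[symmetric] by blast
      then obtain x where x: "\<And>y c. S y c \<Longrightarrow> x \<in> closed_ball M y c" unfolding F by blast
      obtain y c where "S y c" using large[of \<one>] by auto
      then have "x \<in> K" using x[of y c] Sc[of y c] by (simp add: closed_ball)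
      moreover have "c \<preceq> x \<ominus> y" if "S y c" for y c using x[OF that] Sc[OF that] by (simp add: closed_ball)
      ultimately show ?thesis by blast
    qed
  qed
qed

end

locale vf_model = cmin_field R le Df + acvf_model R M le
  for R :: "'a ring" (structure) and le (infix "\<preceq>" 50) and Df and M :: "('f, 'r, 'a) vf_structure" +
  fixes E :: "('f, 'r) language"
  assumes Df_eq: "Df = dfpred (vf_language E) M"
begin

lemma definable2:
  assumes "Df (\<lambda>e. P (e 0) (e 1))"
  shows "definable (vf_language E) M 2 {[x, y] |x y. x \<in> K \<and> y \<in> K \<and> P x y}"
proof -
  have "{xs. length xs = 2 \<and> set xs \<subseteq> univ M \<and> P (if 0 < (2::nat) then xs ! 0 else \<one>) (if 1 < (2::nat) then xs ! 1 else \<one>)} =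
      {[x, y] |x y. x \<in> K \<and> y \<in> K \<and> P x y}"
    by (auto simp: length_Suc_conv univ numeral_2_eq_2)
  then show ?thesis using dfpred_imp_definable[of _ M, OF assms[unfolded Df_eq], of \<one> 2] univ by simp
qed

lemma Units_val_ring: "Units (val_ring M) = vunits"
proof -
  have "y \<in> vunits" if "x \<in> vring" "y \<in> vring" "x \<otimes> y = \<one>" for x y
  proof -
    have "\<one> \<otimes> y \<preceq> x \<otimes> y" using that by (intro le_mult) (auto simp: vring_def)
    then show ?thesis using that by (simp add: vring_def vunits_def eqv_def)
  qed
  moreover have "\<exists>x\<in>vring. x \<otimes> y = \<one> \<and> y \<otimes> x = \<one>" if "y \<in> vunits" for y
    using that by (intro bexI[of _ "inv y"]) auto
  ultimately show ?thesis by (auto simp: Units_def val_ring)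
qed

subsection \<open>The value group\<close>

lemma val_eq: "val M x = (\<lambda>u. u \<otimes> x) ` vunits"
  by (auto simp: val_def Units_val_ring r_coset_def R[symmetric] units_of_mult)

lemma val_subset: "x \<in> Kx \<Longrightarrow> y \<in> Kx \<Longrightarrow> x \<asymp> y \<Longrightarrow> val M x \<subseteq> val M y"
proof
  fix z assume a: "x \<in> Kx" "y \<in> Kx" "x \<asymp> y" "z \<in> val M x"
  then obtain u where u: "u \<in> vunits" "z = u \<otimes> x" by (auto simp: val_eq)
  have "x \<oslash> y \<asymp> \<one>" using eqv_mult_iff[of y "x \<oslash> y" \<one>] a by simp
  then have "u \<otimes> (x \<oslash> y) \<in> vunits" using u(1) by (intro vunits_mult) (auto simp: vunits_def)
  moreover have "u \<otimes> (x \<oslash> y) \<otimes> y = u \<otimes> (x \<oslash> y \<otimes> y)" using u(1) a by (intro m_assoc) auto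
  then have "z = u \<otimes> (x \<oslash> y) \<otimes> y" using u(2) a div_mult_cancel[of x y] by simp
  ultimately show "z \<in> val M y" by (auto simp: val_eq)
qed

lemma val_eq_iff: "x \<in> Kx \<Longrightarrow> y \<in> Kx \<Longrightarrow> val M x = val M y \<longleftrightarrow> x \<asymp> y"
proof
  assume a: "x \<in> Kx" "y \<in> Kx" "val M x = val M y"
  have "\<one> \<otimes> x \<in> val M x" unfolding val_eq by (rule imageI) simp
  then obtain u where "u \<in> vunits" "x = u \<otimes> y" using a by (auto simp: val_eq)
  then show "x \<asymp> y" using eqv_mult_iff[of y u \<one>] a by (simp add: vunits_def)
next
  assume "x \<in> Kx" "y \<in> Kx" "x \<asymp> y"
  then show "val M x = val M y" using val_subset[of x y] val_subset[of y x] eqv_sym[of x y] by blast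
qed

lemma carrier_value_group: "carrier (value_group M) = val M ` Kx"
  by (simp add: value_group_def carrier_FactGroup R[symmetric] units_of_carrier Units_Kx val_def)

lemma val_mult: "x \<in> Kx \<Longrightarrow> y \<in> Kx \<Longrightarrow> val M x \<otimes>\<^bsub>value_group M\<^esub> val M y = val M (x \<otimes> y)"
proof -
  assume xy: "x \<in> Kx" "y \<in> Kx"
  have "(u \<otimes> x) \<otimes> (v \<otimes> y) = (u \<otimes> v) \<otimes> (x \<otimes> y)" if "u \<in> vunits" "v \<in> vunits" for u v
    using xy that by (simp add: m_ac)
  then have "{(u \<otimes> x) \<otimes> (v \<otimes> y) |u v. u \<in> vunits \<and> v \<in> vunits} = (\<lambda>u. u \<otimes> (x \<otimes> y)) ` vunits"
  proof (intro equalityI subsetI)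
    fix z assume "z \<in> (\<lambda>u. u \<otimes> (x \<otimes> y)) ` vunits"
    then obtain u where u: "u \<in> vunits" "z = u \<otimes> (x \<otimes> y)" by blast
    then have "z = (u \<otimes> x) \<otimes> (\<one> \<otimes> y)" using xy by (simp add: m_assoc)
    then show "z \<in> {(u \<otimes> x) \<otimes> (v \<otimes> y) |u v. u \<in> vunits \<and> v \<in> vunits}" using u(1) one_vunits by blast
  qed (use vunits_mult in \<open>force\<close>)
  moreover have "val M x \<otimes>\<^bsub>value_group M\<^esub> val M y = {(u \<otimes> x) \<otimes> (v \<otimes> y) |u v. u \<in> vunits \<and> v \<in> vunits}"
    by (auto simp: value_group_def R[symmetric] set_mult_def units_of_mult val_eq)
  ultimately show ?thesis by (simp add: val_eq)
qed

lemma val_pow: "x \<in> Kx \<Longrightarrow> val M x [^]\<^bsub>value_group M\<^esub> (n :: nat) = val M (x [^] n)"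
proof (induction n)
  case 0
  have "\<one>\<^bsub>value_group M\<^esub> = val M \<one>"
    by (auto simp: value_group_def Units_val_ring val_eq image_iff)
  then show ?case by simp
next
  case (Suc n)
  then show ?case using val_mult[of "x [^] n" x] by simp
qed

lemma value_le_iff: "x \<in> Kx \<Longrightarrow> y \<in> Kx \<Longrightarrow> value_le M (val M x) (val M y) \<longleftrightarrow> x \<preceq> y"
proof
  assume xy: "x \<in> Kx" "y \<in> Kx"
  have m: "u \<otimes> z \<asymp> z" if "u \<in> vunits" "z \<in> Kx" for u z
    using eqv_mult_iff[of z u \<one>] that by (simp add: vunits_def)
  assume "value_le M (val M x) (val M y)"
  then obtain u v where u: "u \<in> vunits" "v \<in> vunits" "vle M (u \<otimes> x) (v \<otimes> y)"
    by (auto simp: value_le_def val_eq)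
  then have "u \<otimes> x \<preceq> v \<otimes> y" using xy by (simp add: le univ)
  then show "x \<preceq> y" using m[OF u(1) xy(1)] m[OF u(2) xy(2)] by (blast intro: le_trans dest: eqv_le eqv_sym)
next
  assume xy: "x \<in> Kx" "y \<in> Kx" "x \<preceq> y"
  have "\<one> \<otimes> x \<in> val M x" "\<one> \<otimes> y \<in> val M y" unfolding val_eq by (rule imageI, simp)+
  then show "value_le M (val M x) (val M y)" using xy unfolding value_le_def by (auto simp: le)
qed

text \<open>An order-preserving \<open>s\<close> respects \<open>\<asymp>\<close> and induces a map
  on \<Gamma>, whatever representatives are chosen. Reflection of the order gives injectivity, and
  the graph pulled back to the field is s(x) \<asymp> y.\<close>

lemma gamma_hypI:
  assumes "value_group_no_exotic E M"
  shows gamma_hyp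
  unfolding gamma_hyp_def
proof (intro allI impI, elim conjE)
  fix s assume s: "dhom s" and ord: "\<forall>x\<in>Kx. \<forall>y\<in>Kx. x \<preceq> y \<longleftrightarrow> s x \<preceq> s y"
    and surj: "\<forall>y\<in>Kx. \<exists>x\<in>Kx. s x \<asymp> y"
  note h = dhomD[OF s]
  have eqv: "s x \<asymp> s y \<longleftrightarrow> x \<asymp> y" if "x \<in> Kx" "y \<in> Kx" for x y
    using ord that unfolding eqv_def by blast
  define \<alpha> where "\<alpha> \<gamma> = val M (s (SOME x. x \<in> Kx \<and> \<gamma> = val M x))" for \<gamma>
  have \<alpha>: "\<alpha> (val M x) = val M (s x)" if x: "x \<in> Kx" for x
  proof -
    define y where "y = (SOME y. y \<in> Kx \<and> val M x = val M y)"
    have y: "y \<in> Kx \<and> val M x = val M y" unfolding y_def by (rule someI[of _ x]) (use x in simp)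
    then have "x \<asymp> y" using val_eq_iff x by blast
    then have "val M (s x) = val M (s y)" using val_eq_iff[of "s x" "s y"] h(2) eqv x y by blast
    then show ?thesis by (simp add: \<alpha>_def y_def)
  qed
  have iso: "\<alpha> \<in> iso (value_group M) (value_group M)"
    unfolding iso_def hom_def
  proof (intro CollectI conjI ballI)
    show "\<alpha> \<in> carrier (value_group M) \<rightarrow> carrier (value_group M)"
      using \<alpha> h(2) by (auto simp: carrier_value_group)
    fix \<gamma> \<delta> assume "\<gamma> \<in> carrier (value_group M)" "\<delta> \<in> carrier (value_group M)"
    then obtain x y where "x \<in> Kx" "y \<in> Kx" "\<gamma> = val M x" "\<delta> = val M y" by (auto simp: carrier_value_group)
    then show "\<alpha> (\<gamma> \<otimes>\<^bsub>value_group M\<^esub> \<delta>) = \<alpha> \<gamma> \<otimes>\<^bsub>value_group M\<^esub> \<alpha> \<delta>"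
      using h(2,3) by (simp add: val_mult \<alpha>)
  next
    show "bij_betw \<alpha> (carrier (value_group M)) (carrier (value_group M))"
      unfolding bij_betw_def
    proof
      show "inj_on \<alpha> (carrier (value_group M))"
        unfolding inj_on_def carrier_value_group using \<alpha> val_eq_iff eqv h(2) by auto
      show "\<alpha> ` carrier (value_group M) = carrier (value_group M)"
      proof (intro equalityI subsetI)
        fix \<gamma> assume "\<gamma> \<in> carrier (value_group M)"
        then obtain y where y: "y \<in> Kx" "\<gamma> = val M y" by (auto simp: carrier_value_group)
        obtain x where x: "x \<in> Kx" "s x \<asymp> y" using surj y(1) by blast
        then have "\<gamma> = \<alpha> (val M x)" using \<alpha> y val_eq_iff h(2) eqv_sym[OF x(2)] by simp
        then show "\<gamma> \<in> \<alpha> ` carrier (value_group M)" using x(1) by (auto simp: carrier_value_group)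
      qed (use \<alpha> h(2) in \<open>auto simp: carrier_value_group\<close>)
    qed
  qed
  have mono: "\<forall>\<gamma>\<in>carrier (value_group M). \<forall>\<delta>\<in>carrier (value_group M).
      value_le M \<gamma> \<delta> \<longleftrightarrow> value_le M (\<alpha> \<gamma>) (\<alpha> \<delta>)"
    using ord h(2) by (auto simp: carrier_value_group \<alpha> value_le_iff)
  have def: "definable (vf_language E) M 2
      {[x, y] |x y. x \<in> Units (vfield M) \<and> y \<in> Units (vfield M) \<and> \<alpha> (val M x) = val M y}"
  proof -
    have "Df (\<lambda>e. e 0 \<in> Kx \<and> e 1 \<in> Kx \<and> s (e 0) \<asymp> e 1)" by (intro df Dt_fun1[OF h(1)])
    from definable2[OF this] have "definable (vf_language E) M 2
      {[x, y] |x y. x \<in> K \<and> y \<in> K \<and> x \<in> Kx \<and> y \<in> Kx \<and> s x \<asymp> y}" .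
    moreover have "{[x, y] |x y. x \<in> K \<and> y \<in> K \<and> x \<in> Kx \<and> y \<in> Kx \<and> s x \<asymp> y} =
      {[x, y] |x y. x \<in> Units (vfield M) \<and> y \<in> Units (vfield M) \<and> \<alpha> (val M x) = val M y}"
      unfolding R[symmetric] Units_Kx using \<alpha> val_eq_iff h(2) by auto
    ultimately show ?thesis by simp
  qed
  obtain p q :: nat where q: "p > 0" "q > 0"
    "\<forall>\<gamma>\<in>carrier (value_group M). \<alpha> \<gamma> [^]\<^bsub>value_group M\<^esub> q = \<gamma> [^]\<^bsub>value_group M\<^esub> p"
    using assms[unfolded value_group_no_exotic_def, THEN bspec, OF iso] mono def by auto
  have "s x [^] q \<asymp> x [^] p" if x: "x \<in> Kx" for x
  proof -
    have "val M (s x [^] q) = val M (x [^] p)"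
      using q(3) x by (simp add: carrier_value_group \<alpha> val_pow h(2))
    then show ?thesis using val_eq_iff[of "s x [^] q" "x [^] p"] x h(2) by simp
  qed
  then show "\<exists>(p::nat) (q::nat). p > 0 \<and> q > 0 \<and> (\<forall>x\<in>Kx. s x [^] q \<asymp> x [^] p)" using q(1,2) by blast
qed

subsection \<open>The residue field\<close>

lemma cring_val_ring: "cring (val_ring M)"
proof -
  have "subcring vring R" using subcringI'[OF val_subring] by (simp add: vring_def)
  moreover have "vring \<subseteq> K" by auto
  ultimately show ?thesis unfolding val_ring using subcring_iff[of vring] by blast
qed

lemma vring_uminus: "x \<in> vring \<Longrightarrow> \<ominus>\<^bsub>val_ring M\<^esub> x = \<ominus> x"
proof -
  assume x: "x \<in> vring"
  interpret V: cring "val_ring M" by (rule cring_val_ring)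
  have "\<ominus> x \<oplus>\<^bsub>val_ring M\<^esub> x = \<zero>\<^bsub>val_ring M\<^esub>" using x by (simp add: val_ring l_neg)
  then show ?thesis using x by (intro V.minus_equality) (auto simp: val_ring)
qed

lemma max_ideal_ideal: "ideal (max_ideal M) (val_ring M)"
proof (rule idealI)
  interpret V: cring "val_ring M" by (rule cring_val_ring)
  show "ring (val_ring M)" by (rule V.ring_axioms)
  have I: "x \<in> max_ideal M \<longleftrightarrow> x \<in> K \<and> \<one> \<prec> x" for x
    by (auto simp: max_ideal req_def a_minus_def vring_def dest: lt_imp_le)
  have IV: "x \<in> vring" if "x \<in> max_ideal M" for x using that by (simp add: max_ideal)
  show "subgroup (max_ideal M) (add_monoid (val_ring M))"
  proof (rule V.add.subgroupI)
    show "max_ideal M \<subseteq> carrier (val_ring M)" using IV by (auto simp: val_ring)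
    show "max_ideal M \<noteq> {}" using lt_zero[of \<one>] I[of \<zero>] by auto
    show "\<ominus>\<^bsub>val_ring M\<^esub> x \<in> max_ideal M" if "x \<in> max_ideal M" for x
      using that req_sym[of x \<zero>] IV[OF that] vring_uminus[of x] by (simp add: I) (simp add: max_ideal req_def a_minus_def)?
    show "x \<oplus>\<^bsub>val_ring M\<^esub> y \<in> max_ideal M" if "x \<in> max_ideal M" "y \<in> max_ideal M" for x y
      using that lt_add[of \<one> x y] by (simp add: I val_ring)
  qed
  have m: "a \<otimes> x \<in> max_ideal M" if "a \<in> max_ideal M" "x \<in> vring" for a x
    using that req_mult[of a \<zero> x] by (simp add: max_ideal)
  show "a \<otimes>\<^bsub>val_ring M\<^esub> x \<in> max_ideal M" if "a \<in> max_ideal M" "x \<in> carrier (val_ring M)" for a x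
    using m that by (simp add: val_ring)
  show "x \<otimes>\<^bsub>val_ring M\<^esub> a \<in> max_ideal M" if "a \<in> max_ideal M" "x \<in> carrier (val_ring M)" for a x
    using m[OF that(1), of x] that m_comm[of a x] IV[OF that(1)] by (simp add: val_ring)
qed

abbreviation k where "k \<equiv> residue_field M"

lemma res_eq_iff: "x \<in> vring \<Longrightarrow> y \<in> vring \<Longrightarrow> res M x = res M y \<longleftrightarrow> x \<approx> y"
proof -
  assume xy: "x \<in> vring" "y \<in> vring"
  interpret V: cring "val_ring M" by (rule cring_val_ring)
  have "res M x = res M y \<longleftrightarrow> x \<ominus>\<^bsub>val_ring M\<^esub> y \<in> max_ideal M"
    using V.quotient_eq_iff_same_a_r_cos[OF max_ideal_ideal, of x y] xy by (simp add: res_def val_ring)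
  also have "x \<ominus>\<^bsub>val_ring M\<^esub> y = x \<ominus> y"
    unfolding a_minus_def vring_uminus[OF xy(2)] by (simp add: val_ring)
  also have "x \<ominus> y \<in> max_ideal M \<longleftrightarrow> x \<approx> y"
    using xy vring_diff[OF xy] by (auto simp: max_ideal req_def) (simp add: a_minus_def)?
  finally show ?thesis .
qed

lemma res_hom:
  "x \<in> vring \<Longrightarrow> res M x \<in> carrier k"
  "x \<in> vring \<Longrightarrow> y \<in> vring \<Longrightarrow> res M (x \<otimes> y) = res M x \<otimes>\<^bsub>k\<^esub> res M y"
  "x \<in> vring \<Longrightarrow> y \<in> vring \<Longrightarrow> res M (x \<oplus> y) = res M x \<oplus>\<^bsub>k\<^esub> res M y"
  "res M \<one> = \<one>\<^bsub>k\<^esub>"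
proof -
  have "res M = (+>\<^bsub>val_ring M\<^esub>) (max_ideal M)" by (auto simp: res_def)
  then have "res M \<in> ring_hom (val_ring M) k"
    using ideal.rcos_ring_hom[OF max_ideal_ideal] by (simp add: residue_field_def)
  note h = ring_hom_memE[OF this]
  show "x \<in> vring \<Longrightarrow> res M x \<in> carrier k" "res M \<one> = \<one>\<^bsub>k\<^esub>"
    "x \<in> vring \<Longrightarrow> y \<in> vring \<Longrightarrow> res M (x \<otimes> y) = res M x \<otimes>\<^bsub>k\<^esub> res M y"
    "x \<in> vring \<Longrightarrow> y \<in> vring \<Longrightarrow> res M (x \<oplus> y) = res M x \<oplus>\<^bsub>k\<^esub> res M y"
    using h(1)[of x] h(2)[of x y] h(3)[of x y] h(4) by (simp_all add: val_ring)
qed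

lemma carrier_residue_field: "carrier k = res M ` vring"
  by (auto simp: residue_field_def FactRing_def A_RCOSETS_def' res_def val_ring)

lemma cring_residue_field: "cring k"
  unfolding residue_field_def by (rule ideal.quotient_is_cring[OF max_ideal_ideal cring_val_ring])

lemma res_zero: "res M \<zero> = \<zero>\<^bsub>k\<^esub>"
proof -
  interpret k: cring k by (rule cring_residue_field)
  have "res M \<zero> = res M \<zero> \<oplus>\<^bsub>k\<^esub> res M \<zero>" using res_hom(3)[of \<zero> \<zero>] by simp
  then show ?thesis using res_hom(1)[OF zero_vring] k.add.l_cancel_one' by metis
qed

lemma res_pow: "x \<in> vring \<Longrightarrow> res M (x [^] (n :: nat)) = res M x [^]\<^bsub>k\<^esub> n"
  by (induction n) (simp_all add: res_hom vring_pow)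

lemma res_unit: "x \<in> vring \<Longrightarrow> res M x \<noteq> \<zero>\<^bsub>k\<^esub> \<longleftrightarrow> x \<in> vunits"
  using res_eq_iff[of x \<zero>] vring_not_unit[of x] by (auto simp: res_zero)

lemma field_residue_field: "field k"
proof -
  interpret k: cring k by (rule cring_residue_field)
  show ?thesis
  proof (rule k.cring_fieldI2)
    show "\<zero>\<^bsub>k\<^esub> \<noteq> \<one>\<^bsub>k\<^esub>" using res_unit[of \<one>] by (simp add: res_hom(4))
    fix a assume "a \<in> carrier k" "a \<noteq> \<zero>\<^bsub>k\<^esub>"
    then obtain x where x0: "x \<in> vring" "a = res M x" by (auto simp: carrier_residue_field)
    then have x: "x \<in> vunits" "a = res M x" using res_unit[of x] \<open>a \<noteq> \<zero>\<^bsub>k\<^esub>\<close> by auto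
    have "a \<otimes>\<^bsub>k\<^esub> res M (inv x) = \<one>\<^bsub>k\<^esub>" using x res_hom(2)[of x "inv x"] res_hom(4) by simp
    then show "\<exists>b\<in>carrier k. a \<otimes>\<^bsub>k\<^esub> b = \<one>\<^bsub>k\<^esub>" using x res_hom(1)[of "inv x"] by auto
  qed
qed

lemma Units_residue_field: "Units k = res M ` vunits"
proof -
  have "Units k = res M ` vring - {\<zero>\<^bsub>k\<^esub>}"
    using field.field_Units[OF field_residue_field] by (simp add: carrier_residue_field)
  also have "\<dots> = res M ` vunits"
  proof (intro equalityI subsetI)
    fix a assume a: "a \<in> res M ` vring - {\<zero>\<^bsub>k\<^esub>}"
    then obtain x where "x \<in> vring" "a = res M x" by blast
    then show "a \<in> res M ` vunits" using res_unit[of x] a by blast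
  next
    fix a assume "a \<in> res M ` vunits"
    then obtain x where "x \<in> vunits" "a = res M x" by blast
    then show "a \<in> res M ` vring - {\<zero>\<^bsub>k\<^esub>}" using res_unit[of x] vunits_vring[of x] by blast
  qed
  finally show ?thesis .
qed

lemma res_eval:
  assumes "set p \<subseteq> vring" "x \<in> vring"
  shows "eval p x \<in> vring \<and> ring.eval k (map (res M) p) (res M x) = res M (eval p x)"
proof -
  interpret k: field k by (rule field_residue_field)
  show ?thesis using assms
    by (induction p) (simp_all add: res_hom res_pow res_zero vring_pow)
qed

text \<open>A monic polynomial over k lifts to the valuation ring, where its root is integral by
  \<open>root_vring\<close>. If k were countable, saturation would yield an element whose residue
  differs from every member of an enumeration.\<close>

lemma big_acf_residue_field: "big_acf k"
proof -
  interpret k: field k by (rule field_residue_field)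
  show ?thesis
  proof
    show "\<exists>x\<in>carrier k. k.eval (\<one>\<^bsub>k\<^esub> # p) x = \<zero>\<^bsub>k\<^esub>" if p: "set p \<subseteq> carrier k" "p \<noteq> []" for p
    proof -
      have "\<forall>a\<in>set p. \<exists>x. x \<in> vring \<and> a = res M x" using p(1) by (auto simp: carrier_residue_field)
      from bchoice[OF this] obtain g where g: "\<forall>a\<in>set p. g a \<in> vring \<and> a = res M (g a)" by blast
      define q where "q = map g p"
      have q: "set q \<subseteq> vring" "map (res M) q = p" "q \<noteq> []"
        using g p(2) by (auto simp: q_def intro!: map_idI)
      have "set q \<subseteq> K" using q(1) by auto
      then obtain x where x: "x \<in> K" "eval (\<one> # q) x = \<zero>" using root[OF _ q(3)] by blast
      have xv: "x \<in> vring" using root_vring[OF q(1) x] .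
      have "set (\<one> # q) \<subseteq> vring" using q(1) by auto
      from res_eval[OF this xv] have "k.eval (map (res M) (\<one> # q)) (res M x) = \<zero>\<^bsub>k\<^esub>" using x(2) res_zero by simp
      moreover have "map (res M) (\<one> # q) = \<one>\<^bsub>k\<^esub> # p" using q(2) res_hom(4) by simp
      ultimately show ?thesis using res_hom(1)[OF xv] by metis
    qed
    show "uncountable (carrier k)"
    proof
      assume cnt: "countable (carrier k)"
      have ne: "carrier k \<noteq> {}" using k.zero_closed by blast
      define c where "c = from_nat_into (carrier k)"
      have c: "range c = carrier k" unfolding c_def by (rule range_from_nat_into[OF ne cnt])
      have "\<exists>w. w \<in> vring \<and> c n = res M w" for n
      proof -
        have "c n \<in> res M ` vring" using c rangeI[of c n] carrier_residue_field by simp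
        then show ?thesis by blast
      qed
      then have "\<forall>n. \<exists>w. w \<in> vring \<and> c n = res M w" by blast
      from choice[OF this] obtain w where "\<forall>n. w n \<in> vring \<and> c n = res M (w n)" by (rule exE)
      then have w: "\<And>n. w n \<in> vring" "\<And>n. c n = res M (w n)" by simp_all
      have "\<exists>x\<in>K. \<forall>i. x \<in> vring \<and> \<not> x \<approx> w i"
      proof (rule saturation)
        show "Df (\<lambda>e. e 0 \<in> vring \<and> \<not> e 0 \<approx> w n)" for n using w(1)[of n] by (intro df) simp_all
        show "\<exists>x\<in>K. \<forall>i<n. x \<in> vring \<and> \<not> x \<approx> w i" for n
        proof -
          have "finite (w ` {..<n})" "w ` {..<n} \<subseteq> vring" using w(1) by auto
          from residue_infinite[OF this] obtain u where u: "u \<in> vunits" "\<forall>a\<in>w ` {..<n}. \<not> u \<approx> a" by blast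
          then show ?thesis by (intro bexI[of _ u]) simp_all
        qed
      qed
      then obtain x where x: "x \<in> vring" "\<And>i. \<not> x \<approx> w i" by blast
      have "res M x \<in> range c" using res_hom(1)[OF x(1)] c by simp
      then obtain n where "res M x = res M (w n)" using w(2) by auto
      then show False using x(2)[of n] res_eq_iff[OF x(1) w(1)] by simp
    qed
  qed
qed

end

section \<open>Roots of unity and n-th roots in fields\<close>

lemma card_set_mset: "card (set_mset A) \<le> size A"
  by (induction A) (auto simp: card_insert_if)

lemma (in field) card_roots_of_unity:
  assumes "n > 0"
  shows "finite {x \<in> carrier R. x [^] n = \<one>} \<and> card {x \<in> carrier R. x [^] n = \<one>} \<le> (n :: nat)"
proof -
  define p where "p = \<one> # replicate (n - 1) \<zero> @ [\<ominus> \<one>]"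
  have p: "p \<in> carrier (poly_ring R)"
    unfolding univ_poly_carrier[symmetric] polynomial_def p_def by auto
  have "eval (replicate m \<zero> @ [\<ominus> \<one>]) x = \<ominus> \<one>" if "x \<in> carrier R" for m x
    using that by (induction m) simp_all
  then have "eval p x = x [^] n \<ominus> \<one>" if "x \<in> carrier R" for x
    using that assms unfolding p_def by (simp add: a_minus_def)
  then have sub: "{x \<in> carrier R. x [^] n = \<one>} \<subseteq> set_mset (roots p)"
    using roots_mem_iff_is_root[OF p] by (auto simp: is_root_def p_def)
  have "card (set_mset (roots p)) \<le> n"
    using card_set_mset[of "roots p"] size_roots_le_degree[OF p] assms by (simp add: p_def)
  then show ?thesis using card_mono[OF _ sub] finite_subset[OF sub] by auto
qed

lemma (in big_acf) units_nth_root: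
  assumes "a \<in> Units R" "n > 0"
  shows "\<exists>b\<in>Units R. b [^] (n :: nat) = a"
proof -
  have a: "a \<in> carrier R" "a \<noteq> \<zero>" using assms(1) field_Units by auto
  have "set (replicate (n - 1) \<zero> @ [\<ominus> a]) \<subseteq> carrier R" using a by auto
  from root[OF this] obtain x where x: "x \<in> carrier R" "eval (\<one> # replicate (n - 1) \<zero> @ [\<ominus> a]) x = \<zero>" by blast
  have "eval (replicate m \<zero> @ [\<ominus> a]) x = \<ominus> a" for m
    using x(1) a by (induction m) simp_all
  then have "x [^] n \<ominus> a = \<zero>" using x assms(2) a by (simp add: a_minus_def)
  then have "x [^] n = a" using x(1) a by simp
  moreover then have "x \<noteq> \<zero>" using a(2) assms(2) by (metis nat_pow_zero gr_implies_not0)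
  ultimately show ?thesis using x(1) field_Units by blast
qed

context vf_model
begin

text \<open>The kernel of the map induced by \<open>r\<close> on \<open>k\<^sup>\<times>\<close> is finite, so it is the group of \<open>n\<close>-th roots of
  unity for some \<open>n\<close>, and the map is an automorphism \<open>\<alpha>\<close> composed with the \<open>n\<close>-th power.\<close>

lemma residue_hypI:
  assumes "residue_no_exotic E M"
  shows residue_hyp
  unfolding residue_hyp_def
proof (intro allI impI, elim conjE exE)
  fix r Q assume r: "dhom r" and r1: "\<forall>u\<in>vunits. u \<approx> \<one> \<longrightarrow> r u \<approx> \<one>"
    and surj: "\<forall>w\<in>vunits. \<exists>u\<in>vunits. r u \<approx> w"
    and Q: "finite Q" and ker: "\<forall>u\<in>vunits. r u \<approx> \<one> \<longrightarrow> (\<exists>q\<in>Q. u \<approx> q)"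
  note h = dhomD[OF r]
  have ru: "r u \<in> vunits" if "u \<in> vunits" for u by (rule dhom_units[OF r that])
  interpret k: big_acf k by (rule big_acf_residue_field)
  have kc: "a \<in> carrier k" if "a \<in> Units k" for a using that by (rule k.Units_closed)
  have resU: "res M u \<in> Units k" if "u \<in> vunits" for u using that by (simp add: Units_residue_field)
  have unit_rep: "\<exists>u\<in>vunits. a = res M u" if "a \<in> Units k" for a using that unfolding Units_residue_field by blast
  \<comment> \<open>The map induced by \<open>r\<close> on k^\<times>; the chosen representative is
    immaterial because \<open>r\<close> sends units of residue 1 to units of residue 1.\<close>
  define \<rho> where "\<rho> a = res M (r (SOME u. u \<in> vunits \<and> a = res M u))" for a
  have \<rho>: "\<rho> (res M u) = res M (r u)" if u: "u \<in> vunits" for u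
  proof -
    define v where "v = (SOME v. v \<in> vunits \<and> res M u = res M v)"
    have v: "v \<in> vunits \<and> res M u = res M v" unfolding v_def by (rule someI[of _ u]) (use u in simp)
    then have "v \<approx> u" using res_eq_iff[of u v] u req_sym[of u v] by simp
    from req_mult[OF this, of "inv u"] have "v \<otimes> inv u \<approx> \<one>" using u by simp
    then have "r (v \<otimes> inv u) \<approx> \<one>" using r1 u v by simp
    from req_mult[OF this, of "r u"] have "r (v \<otimes> inv u) \<otimes> r u \<approx> r u" using ru[OF u] by simp
    moreover have "r (v \<otimes> inv u) \<otimes> r u = r v"
    proof -
      have "r (v \<otimes> inv u) \<otimes> r u = r (v \<otimes> inv u \<otimes> u)" using h(3)[of "v \<otimes> inv u" u] u v by simp
      also have "v \<otimes> inv u \<otimes> u = v" using u v by (simp add: m_assoc)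
      finally show ?thesis .
    qed
    ultimately have "res M (r v) = res M (r u)" using res_eq_iff[of "r v" "r u"] ru u v by simp
    then show ?thesis by (simp add: \<rho>_def v_def)
  qed
  have \<rho>U: "\<rho> a \<in> Units k" if "a \<in> Units k" for a
    using unit_rep[OF that] \<rho> resU[OF ru] by auto
  have \<rho>m: "\<rho> (a \<otimes>\<^bsub>k\<^esub> b) = \<rho> a \<otimes>\<^bsub>k\<^esub> \<rho> b" if ab: "a \<in> Units k" "b \<in> Units k" for a b
  proof -
    obtain u v where uv: "u \<in> vunits" "a = res M u" "v \<in> vunits" "b = res M v" using unit_rep[OF ab(1)] unit_rep[OF ab(2)] by blast
    then have "a \<otimes>\<^bsub>k\<^esub> b = res M (u \<otimes> v)" using res_hom(2)[of u v] by simp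
    moreover have "r (u \<otimes> v) = r u \<otimes> r v" using h(3)[of u v] uv by simp
    ultimately show ?thesis using uv \<rho> res_hom(2)[of "r u" "r v"] ru by simp
  qed
  define N where "N = {a \<in> Units k. \<rho> a = \<one>\<^bsub>k\<^esub>}"
  have one: "\<one>\<^bsub>k\<^esub> \<in> N"
  proof -
    have "\<rho> \<one>\<^bsub>k\<^esub> = \<one>\<^bsub>k\<^esub>" using \<rho>[of \<one>] dhom_one[OF r] res_hom(4) by simp
    then show ?thesis by (simp add: N_def)
  qed
  have invN: "inv\<^bsub>k\<^esub> a \<in> N" if a: "a \<in> N" for a
  proof -
    have u: "a \<in> Units k" "\<rho> a = \<one>\<^bsub>k\<^esub>" using a by (auto simp: N_def)
    have "\<rho> a \<otimes>\<^bsub>k\<^esub> \<rho> (inv\<^bsub>k\<^esub> a) = \<rho> \<one>\<^bsub>k\<^esub>" using \<rho>m[OF u(1), of "inv\<^bsub>k\<^esub> a"] u(1) by simp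
    then have "\<rho> (inv\<^bsub>k\<^esub> a) = \<one>\<^bsub>k\<^esub>" using u kc[OF \<rho>U[of "inv\<^bsub>k\<^esub> a"]] one by (simp add: N_def)
    then show ?thesis using u(1) by (simp add: N_def)
  qed
  have finN: "finite N"
  proof (rule finite_subset)
    show "N \<subseteq> res M ` Q"
    proof
      fix a assume a: "a \<in> N"
      then obtain u where u: "u \<in> vunits" "a = res M u" using unit_rep by (auto simp: N_def)
      then have "res M (r u) = res M \<one>" using a \<rho> res_hom(4) by (simp add: N_def)
      then have "r u \<approx> \<one>" using res_eq_iff[of "r u" \<one>] ru[OF u(1)] by simp
      then obtain q where q: "q \<in> Q" "u \<approx> q" using ker u(1) by blast
      have "q \<in> vunits" using req_unit[OF q(2) u(1)] .
      then have "a = res M q" using res_eq_iff[of u q] u q(2) by simp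
      then show "a \<in> res M ` Q" using q(1) by blast
    qed
  qed (use Q in simp)
  define n where "n = card N"
  have n: "n > 0" using one finN by (auto simp: n_def card_gt_0_iff)
  interpret G: comm_group "units_of k" by (rule k.units_comm_group)
  have sub: "subgroup N (units_of k)"
  proof (rule G.subgroupI)
    show "N \<subseteq> carrier (units_of k)" by (auto simp: N_def units_of_carrier)
    show "N \<noteq> {}" using one by blast
    show "inv\<^bsub>units_of k\<^esub> a \<in> N" if "a \<in> N" for a
      using invN[OF that] k.units_of_inv[of a] that by (simp add: N_def)
    show "a \<otimes>\<^bsub>units_of k\<^esub> b \<in> N" if "a \<in> N" "b \<in> N" for a b
      using that \<rho>m by (simp add: N_def units_of_mult)
  qed
  have powN: "a [^]\<^bsub>k\<^esub> n = \<one>\<^bsub>k\<^esub>" if a: "a \<in> N" for a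
  proof -
    interpret H: group "units_of k\<lparr>carrier := N\<rparr>" by (rule subgroup.subgroup_is_group[OF sub G.group_axioms])
    have "a [^]\<^bsub>units_of k\<lparr>carrier := N\<rparr>\<^esub> n = \<one>\<^bsub>k\<^esub>"
      using H.pow_order_eq_1[of a] a by (simp add: order_def n_def units_of_one)
    then show ?thesis using G.nat_pow_consistent[of a n N] k.units_of_pow[of a n] a by (simp add: N_def)
  qed
  \<comment> \<open>The kernel has n elements, all of them n-th roots of unity, and there are at
    most n of those.\<close>
  have N: "N = {a \<in> carrier k. a [^]\<^bsub>k\<^esub> n = \<one>\<^bsub>k\<^esub>}"
  proof (rule card_seteq)
    show "finite {a \<in> carrier k. a [^]\<^bsub>k\<^esub> n = \<one>\<^bsub>k\<^esub>}" "card {a \<in> carrier k. a [^]\<^bsub>k\<^esub> n = \<one>\<^bsub>k\<^esub>} \<le> card N"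
      using k.card_roots_of_unity[OF n] by (simp_all add: n_def)
    show "N \<subseteq> {a \<in> carrier k. a [^]\<^bsub>k\<^esub> n = \<one>\<^bsub>k\<^esub>}" using powN kc by (auto simp: N_def)
  qed
  \<comment> \<open>The fibres of \<rho> are those of the n-th power, so \<rho> factors through it,
    and the other factor \<alpha> is injective.\<close>
  have same: "\<rho> a = \<rho> b \<longleftrightarrow> a [^]\<^bsub>k\<^esub> n = b [^]\<^bsub>k\<^esub> n" if ab: "a \<in> Units k" "b \<in> Units k" for a b
  proof -
    define c where "c = a \<otimes>\<^bsub>k\<^esub> inv\<^bsub>k\<^esub> b"
    have c: "c \<in> Units k" using ab by (simp add: c_def)
    have a: "a = b \<otimes>\<^bsub>k\<^esub> c" using ab kc by (simp add: c_def k.m_lcomm[of b a])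
    have "\<rho> a = \<rho> b \<otimes>\<^bsub>k\<^esub> \<rho> c" using \<rho>m[OF ab(2) c] a by simp
    then have "\<rho> a = \<rho> b \<longleftrightarrow> \<rho> c = \<one>\<^bsub>k\<^esub>"
      using k.Units_l_cancel[OF \<rho>U[OF ab(2)], of "\<rho> c" "\<one>\<^bsub>k\<^esub>"] kc[OF \<rho>U[OF c]] kc[OF \<rho>U[OF ab(2)]] by simp
    also have "\<dots> \<longleftrightarrow> c \<in> N" using c by (simp add: N_def)
    also have "\<dots> \<longleftrightarrow> c [^]\<^bsub>k\<^esub> n = \<one>\<^bsub>k\<^esub>" unfolding N using kc[OF c] by simp
    also have "\<dots> \<longleftrightarrow> b [^]\<^bsub>k\<^esub> n \<otimes>\<^bsub>k\<^esub> c [^]\<^bsub>k\<^esub> n = b [^]\<^bsub>k\<^esub> n"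
      using k.Units_l_cancel[OF k.Units_pow_closed[OF ab(2), of n], of "c [^]\<^bsub>k\<^esub> n" "\<one>\<^bsub>k\<^esub>"] kc[OF c] kc[OF ab(2)] by simp
    also have "b [^]\<^bsub>k\<^esub> n \<otimes>\<^bsub>k\<^esub> c [^]\<^bsub>k\<^esub> n = a [^]\<^bsub>k\<^esub> n"
      unfolding a using k.nat_pow_distrib[OF kc[OF ab(2)] kc[OF c]] by simp
    finally show ?thesis .
  qed
  define \<alpha> where "\<alpha> a = \<rho> (SOME b. b \<in> Units k \<and> b [^]\<^bsub>k\<^esub> n = a)" for a
  have \<alpha>: "\<alpha> (b [^]\<^bsub>k\<^esub> n) = \<rho> b" if b: "b \<in> Units k" for b
  proof -
    define c where "c = (SOME c. c \<in> Units k \<and> c [^]\<^bsub>k\<^esub> n = b [^]\<^bsub>k\<^esub> n)"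
    have "c \<in> Units k \<and> c [^]\<^bsub>k\<^esub> n = b [^]\<^bsub>k\<^esub> n" unfolding c_def by (rule someI[of _ b]) (use b in simp)
    then have "\<rho> c = \<rho> b" using same b by blast
    then show ?thesis by (simp add: \<alpha>_def c_def)
  qed
  have nth: "\<exists>b\<in>Units k. a = b [^]\<^bsub>k\<^esub> n" if "a \<in> Units k" for a
    using k.units_nth_root[OF that n] by blast
  have \<alpha>U: "\<alpha> a \<in> Units k" if "a \<in> Units k" for a using nth[OF that] \<alpha> \<rho>U by auto
  have \<alpha>m: "\<alpha> (a \<otimes>\<^bsub>k\<^esub> b) = \<alpha> a \<otimes>\<^bsub>k\<^esub> \<alpha> b" if ab: "a \<in> Units k" "b \<in> Units k" for a b
  proof -
    obtain c d where cd: "c \<in> Units k" "a = c [^]\<^bsub>k\<^esub> n" "d \<in> Units k" "b = d [^]\<^bsub>k\<^esub> n"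
      using nth[OF ab(1)] nth[OF ab(2)] by blast
    then have "a \<otimes>\<^bsub>k\<^esub> b = (c \<otimes>\<^bsub>k\<^esub> d) [^]\<^bsub>k\<^esub> n" using k.nat_pow_distrib[OF kc kc] by simp
    then show ?thesis using cd \<alpha> \<rho>m by simp
  qed
  have "\<alpha> \<in> iso (units_of k) (units_of k)"
    unfolding iso_def hom_def units_of_carrier units_of_mult
  proof (intro CollectI conjI ballI)
    show "\<alpha> \<in> Units k \<rightarrow> Units k" using \<alpha>U by blast
    show "\<alpha> (a \<otimes>\<^bsub>k\<^esub> b) = \<alpha> a \<otimes>\<^bsub>k\<^esub> \<alpha> b" if "a \<in> Units k" "b \<in> Units k" for a b by (rule \<alpha>m[OF that])
    show "bij_betw \<alpha> (Units k) (Units k)"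
      unfolding bij_betw_def
    proof
      show "inj_on \<alpha> (Units k)"
      proof (rule inj_onI)
        fix a b assume ab: "a \<in> Units k" "b \<in> Units k" "\<alpha> a = \<alpha> b"
        obtain c d where cd: "c \<in> Units k" "a = c [^]\<^bsub>k\<^esub> n" "d \<in> Units k" "b = d [^]\<^bsub>k\<^esub> n"
          using nth[OF ab(1)] nth[OF ab(2)] by blast
        then show "a = b" using ab(3) \<alpha> same by simp
      qed
      show "\<alpha> ` Units k = Units k"
      proof (intro equalityI subsetI)
        fix b assume b: "b \<in> Units k"
        obtain w where w: "w \<in> vunits" "b = res M w" using unit_rep[OF b] by blast
        obtain u where u: "u \<in> vunits" "r u \<approx> w" using surj w(1) by blast
        have "b = \<rho> (res M u)" using \<rho>[OF u(1)] w u(2) res_eq_iff[of "r u" w] ru[OF u(1)] by simp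
        then have "b = \<alpha> (res M u [^]\<^bsub>k\<^esub> n)" using \<alpha>[OF resU[OF u(1)]] by simp
        then show "b \<in> \<alpha> ` Units k" using k.Units_pow_closed[OF resU[OF u(1)]] by blast
      qed (use \<alpha>U in blast)
    qed
  qed
  moreover have "definable (vf_language E) M 2
      {[x, y] |x y. x \<in> Units (val_ring M) \<and> y \<in> Units (val_ring M) \<and> \<alpha> (res M x) = res M y}"
  proof -
    \<comment> \<open>The graph of \<alpha>, pulled back to the field, is parametrised by a lift z
      of an n-th root: z^n has the residue of x, and r(z) that of y.\<close>
    have iff: "\<alpha> (res M x) = res M y \<longleftrightarrow> (\<exists>z\<in>vunits. z [^] n \<approx> x \<and> r z \<approx> y)" if xy: "x \<in> vunits" "y \<in> vunits" for x y
    proof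
      assume a: "\<alpha> (res M x) = res M y"
      obtain b where b: "b \<in> Units k" "res M x = b [^]\<^bsub>k\<^esub> n" using nth[OF resU[OF xy(1)]] by blast
      obtain z where z: "z \<in> vunits" "b = res M z" using unit_rep[OF b(1)] by blast
      have "res M (z [^] n) = res M x" using b z res_pow[of z n] by simp
      then have "z [^] n \<approx> x" using res_eq_iff[of "z [^] n" x] z(1) xy(1) vring_pow by simp
      moreover have "res M (r z) = res M y" using a b z \<alpha> \<rho> by simp
      then have "r z \<approx> y" using res_eq_iff[of "r z" y] ru[OF z(1)] xy(2) by simp
      ultimately show "\<exists>z\<in>vunits. z [^] n \<approx> x \<and> r z \<approx> y" using z(1) by blast
    next
      assume "\<exists>z\<in>vunits. z [^] n \<approx> x \<and> r z \<approx> y"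
      then obtain z where z: "z \<in> vunits" "z [^] n \<approx> x" "r z \<approx> y" by blast
      have "res M (z [^] n) = res M x" using res_eq_iff[of "z [^] n" x] z xy(1) vring_pow by simp
      then have "res M x = res M z [^]\<^bsub>k\<^esub> n" using res_pow[of z n] z(1) by simp
      moreover have "res M (r z) = res M y" using res_eq_iff[of "r z" y] ru[OF z(1)] xy(2) z(3) by simp
      ultimately show "\<alpha> (res M x) = res M y" using \<alpha>[OF resU[OF z(1)]] \<rho>[OF z(1)] by simp
    qed
    have eq: "{[x, y] |x y. x \<in> Units (val_ring M) \<and> y \<in> Units (val_ring M) \<and> \<alpha> (res M x) = res M y} =
      {[x, y] |x y. x \<in> K \<and> y \<in> K \<and> x \<in> vunits \<and> y \<in> vunits \<and> (\<exists>z\<in>vunits. z [^] n \<approx> x \<and> r z \<approx> y)}"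
      unfolding Units_val_ring
    proof (rule Collect_cong, rule ex_cong1, rule ex_cong1)
      fix l x y
      show "(l = [x, y] \<and> x \<in> vunits \<and> y \<in> vunits \<and> \<alpha> (res M x) = res M y) \<longleftrightarrow>
        (l = [x, y] \<and> x \<in> K \<and> y \<in> K \<and> x \<in> vunits \<and> y \<in> vunits \<and> (\<exists>z\<in>vunits. z [^] n \<approx> x \<and> r z \<approx> y))"
        using iff[of x y] vunits_K[of x] vunits_K[of y] by blast
    qed
    have "Df (\<lambda>e. e 0 \<in> vunits \<and> e 1 \<in> vunits \<and> (\<exists>z\<in>vunits. z [^] n \<approx> e 0 \<and> r z \<approx> e 1))"
      by (intro df Dt_fun1[OF h(1)])
    from definable2[OF this] show ?thesis unfolding eq .
  qed
  ultimately have "definable ring_language (ring_structure k) 2 {[a, \<alpha> a] |a. a \<in> Units k}"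
    using assms unfolding residue_no_exotic_def by blast
  from k.definable_multiplicative_map[OF \<alpha>U \<alpha>m this]
  obtain i m j :: nat where j: "j > 0" "\<forall>a\<in>Units k. \<alpha> a [^]\<^bsub>k\<^esub> j \<otimes>\<^bsub>k\<^esub> a [^]\<^bsub>k\<^esub> i = a [^]\<^bsub>k\<^esub> m" by blast
  \<comment> \<open>At the n-th power of the residue of u, \<alpha> takes the residue of r(u); this
    multiplies the exponents by n. Moving u^(n i) to the other side makes the exponent an
    integer.\<close>
  have "r u [^] j \<approx> pw (int (n * m) - int (n * i)) u" if u: "u \<in> vunits" for u
  proof -
    have V: "u \<in> vring" "r u \<in> vring" using u ru[OF u] by auto
    have "\<alpha> (res M u [^]\<^bsub>k\<^esub> n) [^]\<^bsub>k\<^esub> j \<otimes>\<^bsub>k\<^esub> (res M u [^]\<^bsub>k\<^esub> n) [^]\<^bsub>k\<^esub> i = (res M u [^]\<^bsub>k\<^esub> n) [^]\<^bsub>k\<^esub> m"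
      using j(2) k.Units_pow_closed[OF resU[OF u]] by blast
    then have "res M (r u) [^]\<^bsub>k\<^esub> j \<otimes>\<^bsub>k\<^esub> res M u [^]\<^bsub>k\<^esub> (n * i) = res M u [^]\<^bsub>k\<^esub> (n * m)"
      unfolding \<alpha>[OF resU[OF u]] \<rho>[OF u] using k.nat_pow_pow[OF kc[OF resU[OF u]]] by simp
    then have "res M (r u [^] j \<otimes> u [^] (n * i)) = res M (u [^] (n * m))"
      using res_hom(2)[OF vring_pow[OF V(2)] vring_pow[OF V(1)]] res_pow V by simp
    then have "r u [^] j \<otimes> u [^] (n * i) \<approx> u [^] (n * m)"
      using res_eq_iff[OF vring_mult[OF vring_pow[OF V(2)] vring_pow[OF V(1)]] vring_pow[OF V(1)]] by blast
    then have "r u [^] j \<otimes> pw (int (n * i)) u \<approx> pw (int (n * m)) u" using u by (simp only: pw_nat vunits_Kx)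
    from req_mult[OF this, of "pw (- int (n * i)) u"]
    have "r u [^] j \<otimes> pw (int (n * i)) u \<otimes> pw (- int (n * i)) u \<approx> pw (int (n * m)) u \<otimes> pw (- int (n * i)) u"
      using pw_vunits[OF u] by simp
    moreover have "r u [^] j \<otimes> pw (int (n * i)) u \<otimes> pw (- int (n * i)) u = r u [^] j"
    proof -
      have "r u [^] j \<in> K" using V by simp
      then show ?thesis using m_assoc[of "r u [^] j" "pw (int (n * i)) u" "pw (- int (n * i)) u"] pw_minus[OF vunits_Kx[OF u], of "int (n * i)"]
        by (metis pw_K r_one)
    qed
    moreover have "pw (int (n * m)) u \<otimes> pw (- int (n * i)) u = pw (int (n * m) - int (n * i)) u"
      using pw_add[OF vunits_Kx[OF u], of "int (n * m)" "- int (n * i)"] by (simp only: diff_conv_add_uminus)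
    ultimately show ?thesis by metis
  qed
  then show "\<exists>(i :: int) (j :: nat). j > 0 \<and> (\<forall>u\<in>vunits. r u [^] j \<approx> pw i u)" using j(1) by blast
qed

subsection \<open>The valuation topology\<close>

lemma closed_ball_open: "r \<in> Kx \<Longrightarrow> openin (val_topology M) {x \<in> K. r \<preceq> x}"
proof -
  assume r: "r \<in> Kx"
  have "is_ball M {x. r \<preceq> x \<ominus> \<zero> \<and> x \<in> K}"
    unfolding is_ball by (rule bexI[of _ \<zero>], rule bexI[of _ r]) (use r in auto)
  moreover have "{x. r \<preceq> x \<ominus> \<zero> \<and> x \<in> K} = {x \<in> K. r \<preceq> x}" by (auto simp: a_minus_def)
  ultimately show ?thesis unfolding val_topology_def by (auto intro: topology_generated_by_Basis)
qed

text \<open>The generators are balls with arbitrary centre; by the ultrametric inequality one that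
  contains \<open>\<zero>\<close> is also centred at \<open>\<zero>\<close>.\<close>

lemma open_contains_ball:
  assumes "openin (val_topology M) W" "\<zero> \<in> W"
  shows "\<exists>r\<in>Kx. \<forall>x\<in>K. r \<preceq> x \<longrightarrow> x \<in> W"
proof -
  have "generate_topology_on {B. is_ball M B} W"
    using assms(1) openin_topology_generated_by unfolding val_topology_def by blast
  then show ?thesis using assms(2)
  proof (induction W rule: generate_topology_on.induct)
    case Empty
    then show ?case by simp
  next
    case (Int A B)
    then obtain r s where r: "r \<in> Kx" "\<forall>x\<in>K. r \<preceq> x \<longrightarrow> x \<in> A" and s: "s \<in> Kx" "\<forall>x\<in>K. s \<preceq> x \<longrightarrow> x \<in> B"
      by blast
    have "r \<preceq> s \<or> s \<preceq> r" using le_total[of r s] r(1) s(1) by simp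
    then show ?case
    proof
      assume "r \<preceq> s"
      then show ?thesis using r s le_trans[OF \<open>r \<preceq> s\<close>] by (intro bexI[of _ s]) auto
    next
      assume "s \<preceq> r"
      then show ?thesis using r s le_trans[OF \<open>s \<preceq> r\<close>] by (intro bexI[of _ r]) auto
    qed
  next
    case (UN \<K>)
    then obtain A where A: "A \<in> \<K>" "\<zero> \<in> A" by blast
    then obtain r where "r \<in> Kx" "\<forall>x\<in>K. r \<preceq> x \<longrightarrow> x \<in> A" using UN by blast
    then show ?case using A(1) by blast
  next
    case (Basis B)
    then obtain a r where a: "a \<in> K" "r \<in> K - {\<zero>}"
      and B: "B = {x. r \<preceq> x \<ominus> a \<and> x \<in> K} \<or> B = {x. r \<prec> x \<ominus> a \<and> x \<in> K}"
      by (auto simp: is_ball)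
    have rx: "r \<in> Kx" using a(2) by auto
    from B show ?case
    proof
      assume B: "B = {x. r \<preceq> x \<ominus> a \<and> x \<in> K}"
      have za: "r \<preceq> \<zero> \<ominus> a" using Basis B by blast
      have "r \<preceq> x \<ominus> a" if "x \<in> K" "r \<preceq> x" for x
        using le_diff_trans[of r x \<zero> a] za that a by (simp add: a_minus_def)
      then show ?thesis using rx B by (intro bexI[of _ r]) auto
    next
      assume B: "B = {x. r \<prec> x \<ominus> a \<and> x \<in> K}"
      have za: "r \<prec> \<zero> \<ominus> a" using Basis B by blast
      \<comment> \<open>The neighbourhood wanted is given by a non-strict inequality, so inside an
        open ball a strictly finer radius is taken.\<close>
      obtain e where e: "e \<in> Kx" "r \<prec> e" using above_exists[OF rx] .
      have "r \<prec> x \<ominus> a" if x: "x \<in> K" "e \<preceq> x" for x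
      proof -
        have "r \<prec> x \<ominus> \<zero>" using lt_le_trans[OF e(2) x(2)] x(1) by (simp add: a_minus_def)
        then show ?thesis using lt_diff_trans[of r x \<zero> a] za x a by simp
      qed
      then show ?thesis using e(1) B by (intro bexI[of _ e]) auto
    qed
  qed
qed

lemma limitin_if_lim:
  assumes l: "lim \<phi> \<zero>" and \<phi>: "\<And>x. x \<in> Kx \<Longrightarrow> \<phi> x \<in> K" and eq: "\<And>x. x \<in> D \<Longrightarrow> x \<in> Kx \<Longrightarrow> \<psi> x = \<phi> x"
  shows "limitin (val_topology M) \<psi> \<zero> (atin_within (val_topology M) \<zero> D)"
  unfolding limitin_def
proof (intro conjI allI impI)
  show "\<zero> \<in> topspace (val_topology M)"
    using openin_subset[OF closed_ball_open[OF one_Kx]] le_zero[of \<one>] by auto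
  fix W assume "openin (val_topology M) W \<and> \<zero> \<in> W"
  then obtain r where r: "r \<in> Kx" "\<forall>x\<in>K. r \<preceq> x \<longrightarrow> x \<in> W" using open_contains_ball by blast
  obtain d where d: "d \<in> Kx" "\<forall>x\<in>Kx. d \<preceq> x \<longrightarrow> r \<preceq> \<phi> x \<ominus> \<zero>" using limD[OF l r(1)] unfolding ev_def by blast
  have "\<psi> x \<in> W" if "x \<in> {x \<in> K. d \<preceq> x}" "x \<in> D" "x \<noteq> \<zero>" for x
  proof -
    have x: "x \<in> Kx" "d \<preceq> x" using that by auto
    then have "r \<preceq> \<phi> x \<ominus> \<zero>" using d(2) by blast
    then have "r \<preceq> \<phi> x" using \<phi>[OF x(1)] by (simp add: a_minus_def)
    then show ?thesis using r(2) \<phi>[OF x(1)] eq[OF that(2) x(1)] by simp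
  qed
  then show "eventually (\<lambda>x. \<psi> x \<in> W) (atin_within (val_topology M) \<zero> D)"
    unfolding eventually_atin_within using closed_ball_open[OF d(1)] d(1) le_zero[of d]
    by (intro disjI2 exI[of _ "{x \<in> K. d \<preceq> x}"]) auto
qed

text \<open>The calculus works with total functions; the domain \<open>D\<close> is definable as the
  projection of the graph.\<close>

lemma definable_fun_extend:
  assumes "definable_fun (vf_language E) M D f"
  shows "deffun (\<lambda>x. if x \<in> D then f x else \<zero>)"
proof -
  have D: "D \<subseteq> K" "f ` D \<subseteq> K" and gr: "definable (vf_language E) M 2 {[x, f x] |x. x \<in> D}"
    using assms by (auto simp: definable_fun_def univ)
  define G where "G x y \<longleftrightarrow> x \<in> D \<and> y = f x" for x y
  have "Df (\<lambda>e. map e [0..<2] \<in> {[x, f x] |x. x \<in> D})"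
    using definable_imp_dfpred[OF gr] unfolding Df_eq .
  then have dG: "Df (\<lambda>e. G (e 0) (e 1))"
    by (rule Df_cong) (auto simp: G_def upt_rec numeral_2_eq_2)
  have "Df (\<lambda>e. G (e 1) (e 0) \<or> (\<not> (\<exists>y\<in>K. G (e 1) y) \<and> e 0 = \<zero>))"
    by (intro df Df_comp2[OF dG]) simp_all
  then have "Df (\<lambda>e. e 0 = (if e 1 \<in> D then f (e 1) else \<zero>))"
    by (rule Df_cong) (use D in \<open>auto simp: G_def image_subset_iff\<close>)
  then show ?thesis unfolding deffun_def using D(2) by (auto simp: image_subset_iff)
qed

text \<open>The recursion numbers the monomials from 0 and the statement from 1, hence the shift by
  \<open>n - 1\<close>; for nonzero x the total power \<open>pw\<close> is the power of the
  field.\<close>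

lemma definable_expansion:
  assumes exotic: "residue_no_exotic E M \<or> value_group_no_exotic E M"
    and f: "definable_fun (vf_language E) M D f"
  shows "\<exists>(m :: nat \<Rightarrow> int) (c :: nat \<Rightarrow> 'a). strict_mono_on {1..} m \<and> (\<forall>n\<ge>1. c n \<in> K) \<and>
     (\<forall>l\<ge>1. limitin (val_topology M)
        (\<lambda>x. (f x \<ominus> (\<Oplus>n\<in>{1..l}. c n \<otimes> x [^] m n)) \<otimes> inv (x [^] m l))
        \<zero> (atin_within (val_topology M) \<zero> D))"
proof -
  define g where "g x = (if x \<in> D then f x else \<zero>)" for x
  have g: "deffun g" unfolding g_def by (rule definable_fun_extend[OF f])
  have gK: "g x \<in> K" if "x \<in> K" for x using deffun_closed[OF g that] .
  have "gamma_hyp \<or> residue_hyp" using exotic gamma_hypI residue_hypI by blast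
  from asymptotic_expansion[OF this g] obtain m :: "nat \<Rightarrow> int" and c :: "nat \<Rightarrow> 'a" where
    m: "strict_mono m" and c: "\<And>n. c n \<in> K" and
    l: "\<And>l. lim (\<lambda>x. (g x \<ominus> (\<Oplus>n\<in>{..l}. c n \<otimes> pw (m n) x)) \<oslash> pw (m l) x) \<zero>" by blast
  have "strict_mono_on {1..} (\<lambda>n. m (n - 1))"
    using m by (auto simp: strict_mono_on_def strict_mono_def)
  moreover have "limitin (val_topology M)
      (\<lambda>x. (f x \<ominus> (\<Oplus>n\<in>{1..l}. c (n - 1) \<otimes> x [^] m (n - 1))) \<otimes> inv (x [^] m (l - 1)))
      \<zero> (atin_within (val_topology M) \<zero> D)" if l1: "l \<ge> 1" for l
  proof (rule limitin_if_lim[OF l[of "l - 1"]])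
    fix x assume x: "x \<in> Kx"
    have sum: "(\<Oplus>n\<in>{..l - 1}. c n \<otimes> pw (m n) x) \<in> K" using c by (intro finsum_closed) auto
    then show "(g x \<ominus> (\<Oplus>n\<in>{..l - 1}. c n \<otimes> pw (m n) x)) \<oslash> pw (m (l - 1)) x \<in> K"
      using gK[of x] x by (simp add: div_Kx_eq[OF pw_closed])
    assume D: "x \<in> D"
    have "{1..l} = Suc ` {..l - 1}" using l1 by (auto simp: image_Suc_atMost)
    then have "(\<Oplus>n\<in>{1..l}. c (n - 1) \<otimes> x [^] m (n - 1)) = (\<Oplus>n\<in>{..l - 1}. c (Suc n - 1) \<otimes> x [^] m (Suc n - 1))"
      using finsum_reindex[of "\<lambda>n. c (n - 1) \<otimes> x [^] m (n - 1)" Suc "{..l - 1}"] c pw_K[of _ x] x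
      by (auto simp: pw_def)
    also have "\<dots> = (\<Oplus>n\<in>{..l - 1}. c n \<otimes> pw (m n) x)" using x by (simp add: pw_def)
    finally show "(f x \<ominus> (\<Oplus>n\<in>{1..l}. c (n - 1) \<otimes> x [^] m (n - 1))) \<otimes> inv (x [^] m (l - 1)) =
      (g x \<ominus> (\<Oplus>n\<in>{..l - 1}. c n \<otimes> pw (m n) x)) \<oslash> pw (m (l - 1)) x"
      using x D unfolding div_Kx_eq[OF pw_closed] by (simp add: g_def pw_def)
  qed
  ultimately show ?thesis using c
    by (intro exI[of _ "\<lambda>n. m (n - 1)"] exI[of _ "\<lambda>n. c (n - 1)"]) auto
qed

end

theorem theorem7p7:
  fixes E :: "('f, 'r) language"
    and T :: "('f vf_fun, 'r vf_rel) fo_form set"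
    and M :: "('f, 'r, 'a) vf_structure"
    and \<kappa> :: "'k rel"
    and t :: 'f
    and D :: "'a set"
    and f :: "'a \<Rightarrow> 'a"
  assumes "complete_theory TYPE('a) (vf_language E) T"
    and "C_minimal_expansion TYPE('a) E T"
    and "monster_model \<kappa> (vf_language E) T M"
    and "fun_ar E t = Some 0"
    and "vless M \<one>\<^bsub>vfield M\<^esub> (fun_int M (FunE t) [])"
    and "definably_complete E M"
    and "char_0 (vfield M)"
    and "residue_no_exotic E M \<or> value_group_no_exotic E M"
    and "punctured_nbhd_0 M D"
    and "definable_fun (vf_language E) M D f"
  shows "\<exists>(m :: nat \<Rightarrow> int) (c :: nat \<Rightarrow> 'a).
     strict_mono_on {1..} m \<and> (\<forall>n\<ge>1. c n \<in> univ M) \<and>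
     (\<forall>l\<ge>1. limitin (val_topology M)
        (\<lambda>x. (f x \<ominus>\<^bsub>vfield M\<^esub>
               (\<Oplus>\<^bsub>vfield M\<^esub>n\<in>{1..l}. c n \<otimes>\<^bsub>vfield M\<^esub> x [^]\<^bsub>vfield M\<^esub> m n))
             \<otimes>\<^bsub>vfield M\<^esub> inv\<^bsub>vfield M\<^esub> (x [^]\<^bsub>vfield M\<^esub> m l))
        \<zero>\<^bsub>vfield M\<^esub>
        (atin_within (val_topology M) \<zero>\<^bsub>vfield M\<^esub> D))"
proof -
  define le where "le x y \<longleftrightarrow> x \<in> univ M \<and> y \<in> univ M \<and> vle M x y" for x y
  have model: "is_model (vf_language E) T M" using assms(3) by (simp add: monster_model_def)
  then have acvf: "acvf M" and cmin: "\<forall>S \<subseteq> univ M. definable (vf_language E) M 1 {[x] |x. x \<in> S} \<longrightarrow>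
      S \<in> bool_combs (univ M) ({B. is_ball M B} \<union> {{a} |a. a \<in> univ M})"
    using assms(2) unfolding C_minimal_expansion_def by blast+
  have "field (vfield M)" using acvf by (simp add: acvf_def algebraically_closed_def)
  then have am: "acvf_model (vfield M) M le"
    using acvf by (simp add: acvf_model_def acvf_model_axioms_def le_def)
  have "cmin_field (vfield M) le (dfpred (vf_language E) M)"
    by (rule acvf_model.cmin_fieldI[OF am cmin assms(3,6,7)])
  then have "vf_model (vfield M) le (dfpred (vf_language E) M) M E"
    using am by (simp add: vf_model_def vf_model_axioms_def)
  from vf_model.definable_expansion[OF this assms(8,10)] show ?thesis
    by (simp add: vfield_def)
qed

end
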